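(* For any $r\in[0,\infty)$, there exists a probability measure $\mathbf Q_{\infty,r}$ on $\mathcal M$ such that, for any $\mu\in\mathcal M^o$, $\mathbf Q^\mu_{t,r}$ converges weakly to $\mathbf Q_{\infty,r}$ as $t\to\infty$.
   Context: Setting. $E$ is a Polish space. For a metric space $F$, $b\mathcal B(F)$, $p\mathcal B(F)$, $bp\mathcal B(F)$ denote the bounded, the non-negative, and the bounded non-negative Borel functions on $F$. $\mathbb R_+=[0,\infty)$. $(\xi_t)_{t\in[0,\zeta)}$ is an $E$-valued Borel right process with (possibly sub-Markovian) transition semigroup $(P_t)_{t\ge0}$ and lifetime $\zeta$; $\Pi_x$ is its law started from $x\in E$. The branching mechanism is $$\psi(x,z)=-\beta(x)z+\sigma(x)^2z^2+\int_{(0,\infty)}(e^{-zu}-1+zu)\,\pi(x,du),\quad x\in E,\ z\ge0,$$ with $\beta,\sigma\in b\mathcal B(E)$ and $\pi$ a kernel from $E$ to $(0,\infty)$ with $\sup_{x\in E}\int_{(0,\infty)}(u\wedge u^2)\pi(x,du)<\infty$. For $f\in bp\mathcal B(E)$, $(t,x)\mapsto V_tf(x)$ is the unique non-negative Borel function on $\mathbb R_+\times E$ that is bounded on $[0,t_0]\times E$ for every $t_0\ge 0$ and satisfies $V_tf(x)+\int_0^t ds\int_E\psi(y,V_{t-s}f(y))P_s(x,dy)=P_tf(x)$ for all $t\ge0,x\in E$. $\mathcal M$ is the Polish space of finite Borel measures on $E$ with the topology of weak convergence, $\mathbf 0$ is the null measure, $\mathcal M^o=\mathcal M\setminus\{\mathbf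 0\}$, and $\gamma(f)=\int f\,d\gamma$. The $(\xi,\psi)$-superprocess $X=(X_t)_{t\ge0}$ is the $\mathcal M$-valued conservative right process with transition semigroup $(Q_t)_{t\ge0}$ determined by $\int_{\mathcal M}e^{-\eta(f)}Q_t(\mu,d\eta)=e^{-\mu(V_tf)}$ for $\mu\in\mathcal M$, $t\ge0$, $f\in bp\mathcal B(E)$. It is realized as the coordinate process on the space $\Omega$ of $\mathcal M$-valued right-continuous functions on $\mathbb R_+$; $\mathcal F_t=\sigma(X_s:s\le t)$, $\mathcal F=\sigma(X_s:s\ge0)$; $\mathrm P_\mu$ is the law (and expectation) of $X$ with $X_0=\mu$. The mean semigroup is $T_tf(x)=\Pi_x[e^{\int_0^t\beta(\xi_s)ds}f(\xi_t)\mathbf 1_{\{t<\zeta\}}]$, and $L_1^+(\nu)$ is the set of $f\in p\mathcal B(E)$ with $\nu(f)<\infty$. Standing assumptions: (i) There are $\lambda\in\mathbb R$, a bounded strictly positive Borel function $\phi$ on $E$ and a probability measure $\nu$ with full support on $E$ such that $\nu(\phi)=1$ and, for all $t\ge0$, $T_t\phi=e^{\lambda t}\phi$ and $\nu T_t=e^{\lambda t}\nu$. (ii) There is a map $(t,x,f)\mapsto H_tf(x)$ from $(0,\infty)\times E\times L_1^+(\nu)$ to $\mathbb R$ with $T_tf(x)=e^{\lambda t}\phi(x)\nu(f)(1+H_tf(x))$ for all $t>0$, $x\in E$, $f\in L_1^+(\nu)$; $\sup_{x\in E,f\in L_1^+(\nu)}|H_tf(x)|<\infty$ for every $t>0$;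 and $\lim_{t\to\infty}\sup_{x\in E,f\in L_1^+(\nu)}|H_tf(x)|=0$. (iii) $\lambda<0$ (subcriticality). (iv) $\mathrm P_\nu(X_t=\mathbf 0)>0$ for all $t>0$. For $\mu\in\mathcal M^o$ and $t,r\ge0$, $\mathbf Q^\mu_{t,r}(A):=\mathrm P_\mu(X_t\in A\mid X_{t+r}\ne\mathbf 0)$ for Borel $A\subset\mathcal M$. *)

theory Defs
  imports "HOL-Probability.Probability"
begin

subsection \<open>Function classes and finite measures\<close>

definition bB :: "('a::topological_space \<Rightarrow> real) set" where
  "bB = {f \<in> borel_measurable borel. bounded (range f)}"

definition bpB :: "('a::topological_space \<Rightarrow> real) set" where
  "bpB = {f \<in> bB. \<forall>x. 0 \<le> f x}"

definition L1_plus :: "'a::topological_space measure \<Rightarrow> ('a \<Rightarrow> real) set" where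
  "L1_plus \<nu> = {f \<in> borel_measurable borel. (\<forall>x. 0 \<le> f x) \<and> (\<integral>\<^sup>+x. ennreal (f x) \<partial>\<nu>) < \<infinity>}"

typedef (overloaded) 'a fin_measure =
  "{m :: 'a::topological_space measure. sets m = sets borel \<and> finite_measure m}"
  morphisms fm_measure Fin_Measure
  by (rule exI[of _ "null_measure borel"]) (auto intro: finite_measureI)

instantiation fin_measure :: (topological_space) zero
begin

definition zero_fin_measure :: "'a fin_measure" where
  "0 = Fin_Measure (null_measure borel)"

instance ..

end

text \<open>The topology of weak convergence: the coarsest one that makes
  \<open>\<mu> \<mapsto> \<integral>f d\<mu>\<close> continuous for every bounded continuous \<open>f\<close>.\<close>

instantiation fin_measure :: (topological_space) topological_space
begin

definition open_fin_measure :: "'a fin_measure set \<Rightarrow> bool" where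
  "open_fin_measure = generate_topology
     {{\<mu>. (\<integral>x. f x \<partial>fm_measure \<mu>) \<in> U} | (f :: 'a \<Rightarrow> real) U.
        continuous_on UNIV f \<and> bounded (range f) \<and> open U}"

instance
proof
  show "open (UNIV :: 'a fin_measure set)"
    unfolding open_fin_measure_def by (rule generate_topology.UNIV)
  show "open (S \<inter> T)" if "open S" "open T" for S T :: "'a fin_measure set"
    using that unfolding open_fin_measure_def by (rule generate_topology.Int)
  show "open (\<Union>K)" if "\<forall>S\<in>K. open S" for K :: "'a fin_measure set set"
    using that unfolding open_fin_measure_def by (blast intro: generate_topology.UN)
qed

end

definition converges_weakly ::
  "('t \<Rightarrow> 'a::topological_space measure) \<Rightarrow> 'a measure \<Rightarrow> 't filter \<Rightarrow> bool" where
  "converges_weakly N L F \<longleftrightarrow>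
     (\<forall>g :: 'a \<Rightarrow> real. continuous_on UNIV g \<and> bounded (range g) \<longrightarrow>
        ((\<lambda>t. \<integral>x. g x \<partial>N t) \<longlongrightarrow> (\<integral>x. g x \<partial>L)) F)"

subsection \<open>Borel right processes\<close>

text \<open>Time is \<open>real\<close>, and only times \<open>t \<ge> 0\<close> are constrained.  The cemetery state is
  implicit: \<open>\<xi> t \<omega>\<close> is meaningful only while \<open>t < \<zeta> \<omega>\<close>, and the sub-Markovian
  defect of \<open>P t x\<close> is the probability of \<open>\<zeta> \<le> t\<close>.\<close>

definition transition_semigroup ::
  "(real \<Rightarrow> 'a::topological_space \<Rightarrow> 'a measure) \<Rightarrow> bool" where
  "transition_semigroup P \<longleftrightarrow>
     (\<forall>t\<ge>0. P t \<in> borel \<rightarrow>\<^sub>M subprob_algebra borel) \<and>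
     (\<forall>x. P 0 x = return borel x) \<and>
     (\<forall>s\<ge>0. \<forall>t\<ge>0. \<forall>x. P (s + t) x = P s x \<bind> P t)"

definition universally_measurable :: "('a::topological_space \<Rightarrow> ennreal) \<Rightarrow> bool" where
  "universally_measurable f \<longleftrightarrow>
     (\<forall>m. sets m = sets borel \<and> finite_measure m \<longrightarrow> f \<in> borel_measurable (completion m))"

text \<open>Excessive functions are a priori only universally measurable, hence the completions.\<close>

definition excessive ::
  "(real \<Rightarrow> 'a::topological_space \<Rightarrow> 'a measure) \<Rightarrow> real \<Rightarrow> ('a \<Rightarrow> ennreal) \<Rightarrow> bool" where
  "excessive P \<alpha> f \<longleftrightarrow>
     universally_measurable f \<and>
     (\<forall>t\<ge>0. \<forall>x. ennreal (exp (- \<alpha> * t)) * (\<integral>\<^sup>+y. f y \<partial>completion (P t x)) \<le> f x) \<and>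
     (\<forall>x. ((\<lambda>t. ennreal (exp (- \<alpha> * t)) * (\<integral>\<^sup>+y. f y \<partial>completion (P t x))) \<longlongrightarrow> f x) (at_right 0))"

definition natural_filtration ::
  "'w measure \<Rightarrow> (real \<Rightarrow> 'w \<Rightarrow> 'a::topological_space) \<Rightarrow> ('w \<Rightarrow> ereal) \<Rightarrow> real \<Rightarrow> 'w measure" where
  "natural_filtration M \<xi> \<zeta> t =
     sigma (space M) {{\<omega> \<in> space M. ereal s < \<zeta> \<omega> \<and> \<xi> s \<omega> \<in> A} | s A.
       0 \<le> s \<and> s \<le> t \<and> A \<in> sets borel}"

text \<open>\<open>law x\<close> is the law of the process started from \<open>x\<close>, on the measurable space \<open>M\<close>.
  The last assumption is the defining property of right processes beyond the simple Markov
  property (it yields the strong Markov property); functions vanish at the cemetery.\<close>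

locale borel_right_process =
  fixes P :: "real \<Rightarrow> 'a::topological_space \<Rightarrow> 'a measure"
    and M :: "'w measure"
    and law :: "'a \<Rightarrow> 'w measure"
    and \<xi> :: "real \<Rightarrow> 'w \<Rightarrow> 'a"
    and \<zeta> :: "'w \<Rightarrow> ereal"
  assumes semigroup: "transition_semigroup P"
    and sets_law: "\<And>x. sets (law x) = sets M"
    and prob_law: "\<And>x. prob_space (law x)"
    and measurable_process: "\<And>t A. 0 \<le> t \<Longrightarrow> A \<in> sets borel \<Longrightarrow>
          {\<omega> \<in> space M. ereal t < \<zeta> \<omega> \<and> \<xi> t \<omega> \<in> A} \<in> sets M"
    and right_continuous: "\<And>\<omega> t. \<omega> \<in> space M \<Longrightarrow> 0 \<le> t \<Longrightarrow> ereal t < \<zeta> \<omega> \<Longrightarrow>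
          ((\<lambda>s. \<xi> s \<omega>) \<longlongrightarrow> \<xi> t \<omega>) (at_right t)"
    and normal: "\<And>x. AE \<omega> in law x. 0 < \<zeta> \<omega> \<and> \<xi> 0 \<omega> = x"
    and Markov: "\<And>x s t A. 0 \<le> s \<Longrightarrow> 0 \<le> t \<Longrightarrow> A \<in> sets borel \<Longrightarrow>
          AE \<omega> in law x.
            nn_cond_exp (law x) (natural_filtration M \<xi> \<zeta> t)
              (indicator {\<omega>' \<in> space M. ereal (t + s) < \<zeta> \<omega>' \<and> \<xi> (t + s) \<omega>' \<in> A}) \<omega>
            = (if ereal t < \<zeta> \<omega> then emeasure (P s (\<xi> t \<omega>)) A else 0)"
    and excessive_right_continuous: "\<And>x \<alpha> f. 0 < \<alpha> \<Longrightarrow> excessive P \<alpha> f \<Longrightarrow>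
          AE \<omega> in law x. \<forall>t\<ge>0.
            ((\<lambda>s. if ereal s < \<zeta> \<omega> then f (\<xi> s \<omega>) else 0)
               \<longlongrightarrow> (if ereal t < \<zeta> \<omega> then f (\<xi> t \<omega>) else 0)) (at_right t)"

definition mean_semigroup ::
  "('a \<Rightarrow> 'w measure) \<Rightarrow> (real \<Rightarrow> 'w \<Rightarrow> 'a) \<Rightarrow> ('w \<Rightarrow> ereal) \<Rightarrow> ('a \<Rightarrow> real) \<Rightarrow>
   real \<Rightarrow> ('a \<Rightarrow> real) \<Rightarrow> 'a \<Rightarrow> ennreal" where
  "mean_semigroup law \<xi> \<zeta> \<beta> t f x =
     (\<integral>\<^sup>+\<omega>. ennreal (exp (LINT s:{0..t}|lborel. \<beta> (\<xi> s \<omega>)) * f (\<xi> t \<omega>))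
            * indicator {\<omega>'. ereal t < \<zeta> \<omega>'} \<omega> \<partial>law x)"

subsection \<open>Branching mechanism and superprocess\<close>

definition branching_kernel :: "('a::topological_space \<Rightarrow> real measure) \<Rightarrow> bool" where
  "branching_kernel \<pi> \<longleftrightarrow>
     (\<forall>x. sets (\<pi> x) = sets (restrict_space borel {0<..})) \<and>
     (\<forall>B \<in> sets (restrict_space borel {0<..}). (\<lambda>x. emeasure (\<pi> x) B) \<in> borel_measurable borel) \<and>
     (SUP x. \<integral>\<^sup>+u. ennreal (min u (u\<^sup>2)) \<partial>\<pi> x) < \<infinity>"

definition branching_mechanism ::
  "('a \<Rightarrow> real) \<Rightarrow> ('a \<Rightarrow> real) \<Rightarrow> ('a \<Rightarrow> real measure) \<Rightarrow> 'a \<Rightarrow> real \<Rightarrow> real" where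
  "branching_mechanism \<beta> \<sigma> \<pi> x z =
     - \<beta> x * z + (\<sigma> x)\<^sup>2 * z\<^sup>2 + (\<integral>u. (exp (- z * u) - 1 + z * u) \<partial>\<pi> x)"

text \<open>\<open>u t x\<close> plays the role of \<open>V\<^sub>t f(x)\<close>.  For \<open>f \<in> bpB\<close> the conditions below determine \<open>u\<close>
  uniquely on \<open>t \<ge> 0\<close>, so assuming them characterises \<open>V\<close>.\<close>

definition cumulant_solution ::
  "(real \<Rightarrow> 'a::topological_space \<Rightarrow> 'a measure) \<Rightarrow> ('a \<Rightarrow> real \<Rightarrow> real) \<Rightarrow>
   ('a \<Rightarrow> real) \<Rightarrow> (real \<Rightarrow> 'a \<Rightarrow> real) \<Rightarrow> bool" where
  "cumulant_solution P \<psi> f u \<longleftrightarrow>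
     (\<lambda>(t, x). u t x) \<in> borel_measurable (restrict_space borel ({0..} \<times> UNIV)) \<and>
     (\<forall>t\<ge>0. \<forall>x. 0 \<le> u t x) \<and>
     (\<forall>t0\<ge>0. bounded ((\<lambda>(t, x). u t x) ` ({0..t0} \<times> UNIV))) \<and>
     (\<forall>t\<ge>0. \<forall>x. u t x + (LINT s:{0..t}|lborel. \<integral>y. \<psi> y (u (t - s) y) \<partial>P s x)
                = (\<integral>y. f y \<partial>P t x))"

text \<open>Right-continuous functions on \<open>[0, \<infinity>)\<close> (extensional, i.e. \<open>undefined\<close> at negative times)
  with the \<open>\<sigma>\<close>-algebra generated by the coordinates.\<close>

definition path_space :: "(real \<Rightarrow> 'a::topological_space) measure" where
  "path_space = restrict_space (\<Pi>\<^sub>M t\<in>{0..}. borel)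
     {w. \<forall>t\<ge>0. (w \<longlongrightarrow> w t) (at_right t)}"

text \<open>\<open>Pr \<mu>\<close> is the law on path space of the superprocess started from \<open>\<mu>\<close>; it is conservative,
  i.e. has infinite lifetime.\<close>

locale superprocess =
  borel_right_process Q path_space Pr "\<lambda>t w. w t" "\<lambda>_. \<infinity>"
  for Q :: "real \<Rightarrow> 'a::topological_space fin_measure \<Rightarrow> 'a fin_measure measure"
    and Pr :: "'a fin_measure \<Rightarrow> (real \<Rightarrow> 'a fin_measure) measure" +
  fixes V :: "real \<Rightarrow> ('a \<Rightarrow> real) \<Rightarrow> 'a \<Rightarrow> real"
  assumes Laplace_functional: "\<And>\<mu> t f. 0 \<le> t \<Longrightarrow> f \<in> bpB \<Longrightarrow>
      (\<integral>\<eta>. exp (- (\<integral>x. f x \<partial>fm_measure \<eta>)) \<partial>Q t \<mu>) = exp (- (\<integral>x. V t f x \<partial>fm_measure \<mu>))"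

text \<open>\<open>conditional_law Pr \<mu> t r A = Pr \<mu> (X\<^sub>t \<in> A | X\<^sub>t\<^sub>+\<^sub>r \<noteq> 0)\<close>.\<close>

definition conditional_law ::
  "('a::topological_space fin_measure \<Rightarrow> (real \<Rightarrow> 'a fin_measure) measure) \<Rightarrow>
   'a fin_measure \<Rightarrow> real \<Rightarrow> real \<Rightarrow> 'a fin_measure measure" where
  "conditional_law Pr \<mu> t r =
     distr (uniform_measure (Pr \<mu>) {w \<in> space (Pr \<mu>). w (t + r) \<noteq> 0}) borel (\<lambda>w. w t)"

end

theory Submission
  imports Defs
begin

text \<open>
  Write \<open>\<nu>(f)\<close> for the integral of \<open>f\<close> against \<open>\<nu>\<close>.  The Laplace functionals of the superprocess are given by
  the cumulants \<open>V\<^sub>t f\<close>, which form a flow, increase with \<open>f\<close>, satisfy \<open>c V\<^sub>t f \<le> V\<^sub>t (c f)\<close> for \<open>0 \<le> c \<le> 1\<close>, and have a finite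
  limit \<open>v\<^sub>t\<close> (\<open>ext t\<close> below) as \<open>f\<close> increases to infinity, because extinction has positive probability;
  \<open>exp (- \<mu>(v\<^sub>t))\<close> is the extinction probability.  By the Markov property, for \<open>r > 0\<close>, the Laplace functional of
  the conditional law is
  \<open>(exp (- \<mu>(V\<^sub>t f)) - exp (- \<mu>(V\<^sub>t (f + v\<^sub>r)))) / (1 - exp (- \<mu>(v\<^sub>t\<^sub>+\<^sub>r)))\<close>, with \<open>v\<^sub>t\<close> in place of
  \<open>V\<^sub>t (f + v\<^sub>r)\<close> if \<open>r = 0\<close>.  All exponents tend to \<open>0\<close>, so only their ratios matter.

  These ratios are controlled by writing the cumulant equation in mean form (\<open>mean_equation\<close>,
  \<open>V_mean_equation\<close>): \<open>V\<^sub>t f\<close> is the mean semigroup applied to \<open>f\<close>, minus the accumulated effect of the nonlinear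
  part \<open>\<psi>\<^sub>0\<close> of the branching mechanism.  At large times the cumulants are bounded by small multiples
  of \<open>\<phi>\<close>, where \<open>\<psi>\<^sub>0\<close> is negligible in mean (\<open>\<psi>\<^sub>0_small\<close>).  Together with the ergodicity of the mean semigroup
  this shows that, uniformly in \<open>f\<close>, \<open>V\<^sub>t f\<close> is asymptotic to \<open>\<nu>(V\<^sub>t f) \<phi>\<close> and \<open>\<nu>(V\<^sub>t\<^sub>+\<^sub>s f)\<close> to
  \<open>exp (lam s) \<nu>(V\<^sub>t f)\<close> (\<open>V_upper_asymp\<close>, \<open>V_lower_asymp\<close>, \<open>mean_decay\<close>).  By the concavity under scaling the ratio
  \<open>\<nu>(V\<^sub>t f) / \<nu>(v\<^sub>t)\<close> is then almost nondecreasing in \<open>t\<close>, so it converges to a limit \<open>G f\<close> (\<open>G_tendsto\<close>).  The Laplace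
  functionals converge to \<open>exp (- lam r) (G (f + v\<^sub>r) - G f)\<close>, or to \<open>1 - G f\<close> if \<open>r = 0\<close>, whatever the initial
  measure (\<open>conditional_limit\<close>).

  Convergence of Laplace functionals gives weak convergence of the laws once the limit is known to be the
  Laplace functional of a random measure.  This is so because \<open>G f\<close> is small when \<open>\<nu>(f)\<close> is small (\<open>G_small\<close>):
  a continuity theorem for random finite measures on a Polish space (\<open>fm_laplace_weak_convergence\<close>) asks for
  convergence on all bounded Borel functions and for this absolute continuity with respect to \<open>\<nu>\<close>.  Its proof
  codes finite measures by numbers in \<open>[0, 1]\<close>, where Skorohod's theorem is available, and shows that almost
  every limit code is the code of a measure.
\<close>

section \<open>Finite measures and kernels\<close>

lemmas bochner_nonneg = Bochner_Integration.integral_nonneg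
lemmas bochner_cong = Bochner_Integration.integral_cong

lemma fm_measure_prop: "sets (fm_measure (\<mu>::'a::topological_space fin_measure)) = sets borel"
    "finite_measure (fm_measure \<mu>)"
  using fm_measure[of \<mu>] by auto

lemma sets_fm_measure [measurable_cong, simp]: "sets (fm_measure (\<mu>::'a::topological_space fin_measure)) = sets borel"
  by (rule fm_measure_prop)

lemma space_fm_measure [simp]: "space (fm_measure (\<mu>::'a::topological_space fin_measure)) = UNIV"
  using sets_eq_imp_space_eq[OF sets_fm_measure] by simp

lemma finite_fm_measure [simp]: "finite_measure (fm_measure (\<mu>::'a::topological_space fin_measure))"
  by (rule fm_measure_prop)

lemma fm_measure_Fin_Measure:
  assumes "sets m = sets borel" "finite_measure m"
  shows "fm_measure (Fin_Measure m) = m"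
  using assms by (intro Fin_Measure_inverse) auto

lemma fm_measure_zero [simp]: "fm_measure (0::'a::topological_space fin_measure) = null_measure borel"
  unfolding zero_fin_measure_def by (rule fm_measure_Fin_Measure) (auto intro: finite_measureI)

lemma bpB_measurable [measurable_dest]: "f \<in> bpB \<Longrightarrow> f \<in> borel_measurable borel"
  by (auto simp: bpB_def bB_def)

lemma bpB_nonneg: "f \<in> bpB \<Longrightarrow> 0 \<le> f x"
  by (auto simp: bpB_def)

lemma bpB_boundE:
  assumes "f \<in> bpB" obtains B where "0 < B" "\<And>x. f x \<le> B"
proof -
  obtain B where "\<And>x. \<bar>f x\<bar> \<le> B" using assms unfolding bpB_def bB_def bounded_iff by force
  then have "f x \<le> max B 1" for x by (meson abs_le_D1 max.coboundedI1)
  then show ?thesis by (intro that[of "max B 1"]) auto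
qed

lemma bpBI:
  assumes "f \<in> borel_measurable borel" "\<And>x. 0 \<le> f x" "\<And>x. f x \<le> B"
  shows "f \<in> bpB"
  using assms by (auto simp: bpB_def bB_def bounded_iff intro!: exI[of _ B])

lemma integrable_fm:
  fixes f :: "'a::topological_space \<Rightarrow> real"
  assumes "f \<in> borel_measurable borel" "\<And>x. \<bar>f x\<bar> \<le> B"
  shows "integrable (fm_measure \<mu>) f"
proof -
  interpret finite_measure "fm_measure \<mu>" by simp
  show ?thesis using assms by (intro integrable_const_bound[of _ B]) auto
qed

lemma integrable_fm_bpB: "f \<in> bpB \<Longrightarrow> integrable (fm_measure \<mu>) f"
  by (metis abs_of_nonneg bpB_boundE bpB_measurable bpB_nonneg integrable_fm)

text \<open>The Laplace functional of the unit mass at \<open>\<eta>\<close>; its expectation under a law on finite measures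
  is the Laplace functional of that law.\<close>

definition laplace :: "('a::topological_space \<Rightarrow> real) \<Rightarrow> 'a fin_measure \<Rightarrow> real" where
  "laplace f \<eta> = exp (- (\<integral>x. f x \<partial>fm_measure \<eta>))"

text \<open>A family of finite measures is a measurable kernel as soon as it is measurable on a
  generating \<open>\<pi>\<close>-system.\<close>

lemma kernel_measurable:
  fixes N :: "'z \<Rightarrow> 'a measure"
  assumes G: "G \<subseteq> Pow \<Omega>" "Int_stable G"
    and N: "\<And>z. z \<in> space M \<Longrightarrow> sets (N z) = sigma_sets \<Omega> G"
    and fin: "\<And>z. z \<in> space M \<Longrightarrow> finite_measure (N z)"
    and gen: "\<And>A. A \<in> G \<Longrightarrow> (\<lambda>z. measure (N z) A) \<in> borel_measurable M"
    and total: "(\<lambda>z. measure (N z) \<Omega>) \<in> borel_measurable M"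
    and A: "A \<in> sigma_sets \<Omega> G"
  shows "(\<lambda>z. measure (N z) A) \<in> borel_measurable M"
  using A
proof (induction rule: sigma_sets_induct_disjoint[OF G(2) G(1), consumes 1, case_names basic empty compl union])
  case (basic A) then show ?case by (rule gen)
next
  case empty then show ?case by simp
next
  case (compl A)
  have "(\<lambda>z. measure (N z) \<Omega> - measure (N z) A) \<in> borel_measurable M"
    using compl total by simp
  moreover have "measure (N z) (\<Omega> - A) = measure (N z) \<Omega> - measure (N z) A" if z: "z \<in> space M" for z
  proof -
    interpret finite_measure "N z" by (rule fin[OF z])
    have "space (N z) \<in> sigma_sets \<Omega> G" "\<Omega> \<in> sets (N z)"
      using N[OF z] sets.top[of "N z"] sigma_sets_top[of \<Omega> G] by auto
    then have sp: "space (N z) = \<Omega>"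
      using sigma_sets_into_sp[OF G(1)] sets.sets_into_space[of \<Omega> "N z"] by auto
    show ?thesis using compl N[OF z] sp by (metis finite_measure_compl)
  qed
  ultimately show ?case by (simp cong: measurable_cong)
next
  case (union A)
  have "(\<lambda>z. \<Sum>i. measure (N z) (A i)) \<in> borel_measurable M"
    using union by (intro borel_measurable_suminf) auto
  moreover have "measure (N z) (\<Union>i. A i) = (\<Sum>i. measure (N z) (A i))" if z: "z \<in> space M" for z
  proof -
    interpret finite_measure "N z" by (rule fin[OF z])
    show ?thesis using union N[OF z] by (intro sums_unique finite_measure_UNION) auto
  qed
  ultimately show ?case by (simp cong: measurable_cong)
qed

lemma kernel_nn_integral_measurable:
  fixes N :: "'z \<Rightarrow> 'a measure" and f :: "'a \<Rightarrow> ennreal"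
  assumes N: "\<And>z. z \<in> space M \<Longrightarrow> sets (N z) = sets S"
    and meas: "\<And>A. A \<in> sets S \<Longrightarrow> (\<lambda>z. emeasure (N z) A) \<in> borel_measurable M"
    and f: "f \<in> borel_measurable S"
  shows "(\<lambda>z. \<integral>\<^sup>+x. f x \<partial>N z) \<in> borel_measurable M"
  using f
proof (induction rule: borel_measurable_induct)
  case (cong f g)
  have "(\<integral>\<^sup>+x. f x \<partial>N z) = (\<integral>\<^sup>+x. g x \<partial>N z)" if "z \<in> space M" for z
    using cong(3) sets_eq_imp_space_eq[OF N[OF that]] by (intro nn_integral_cong) auto
  then show ?case using cong by (simp cong: measurable_cong)
next
  case (set A)
  have "(\<integral>\<^sup>+x. indicator A x \<partial>N z) = emeasure (N z) A" if "z \<in> space M" for z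
    using set N[OF that] by simp
  then show ?case using meas[OF set] by (simp cong: measurable_cong)
next
  case (mult u c)
  have "(\<integral>\<^sup>+x. c * u x \<partial>N z) = c * (\<integral>\<^sup>+x. u x \<partial>N z)" if "z \<in> space M" for z
    using mult(2) N[OF that] by (intro nn_integral_cmult) (simp cong: measurable_cong_sets)
  then show ?case using mult by (simp cong: measurable_cong)
next
  case (add u v)
  have "(\<integral>\<^sup>+x. u x + v x \<partial>N z) = (\<integral>\<^sup>+x. u x \<partial>N z) + (\<integral>\<^sup>+x. v x \<partial>N z)" if "z \<in> space M" for z
    using add N[OF that] by (intro nn_integral_add) (simp_all cong: measurable_cong_sets)
  then show ?case using add by (simp add: add.commute[of "v _"] cong: measurable_cong)
next
  case (seq U)
  have "(\<integral>\<^sup>+x. (SUP i. U i) x \<partial>N z) = (SUP i. \<integral>\<^sup>+x. U i x \<partial>N z)" if "z \<in> space M" for z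
    unfolding SUP_apply image_image
    using seq N[OF that] by (intro nn_integral_monotone_convergence_SUP) (simp_all cong: measurable_cong_sets)
  then show ?case using seq by (simp cong: measurable_cong)
qed

lemma borel_sigma_sets_open: "sets borel = sigma_sets UNIV {S::'a::topological_space set. open S}"
  by (simp add: borel_def)

lemma Int_stable_open: "Int_stable {S::'a::topological_space set. open S}"
  by (auto simp: Int_stable_def)

text \<open>Indicators of open sets in a metric space are limits of continuous functions with values in \<open>[0, 1]\<close>:
  the distance to the complement is magnified and truncated at \<open>1\<close>.\<close>

definition open_approx :: "'a::metric_space set \<Rightarrow> nat \<Rightarrow> 'a \<Rightarrow> real" where
  "open_approx G k x = (if G = UNIV then 1 else min 1 (real k * infdist x (- G)))"

lemma open_approx_continuous: "continuous_on S (open_approx G k)"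
  by (cases "G = UNIV") (auto simp: open_approx_def[abs_def] intro!: continuous_intros)

lemma open_approx_measurable [measurable]: "open_approx (G::'a::metric_space set) k \<in> borel_measurable borel"
  by (rule borel_measurable_continuous_onI[OF open_approx_continuous])

lemma open_approx_bounds: "0 \<le> open_approx G k x" "open_approx G k x \<le> 1"
  by (auto simp: open_approx_def infdist_nonneg)

lemma open_approx_abs [simp]: "\<bar>open_approx G k x\<bar> \<le> 1"
  using open_approx_bounds[of G k x] by simp

lemma open_approx_bounded: "bounded (range (open_approx G k))"
  using open_approx_bounds[of G k] by (auto simp: bounded_iff intro!: exI[of _ 1])

lemma open_approx_bpB: "open_approx G k \<in> bpB"
  using open_approx_bounds by (intro bpBI[where B=1]) auto

lemma open_approx_le: "open_approx G k x \<le> indicator G x"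
  by (cases "x \<in> G") (auto simp: open_approx_def)

lemma open_approx_tendsto:
  assumes "open G"
  shows "(\<lambda>k. open_approx G k x) \<longlonglongrightarrow> indicator G x"
proof (cases "x \<in> G \<and> G \<noteq> UNIV")
  case True
  then have "0 < infdist x (- G)"
    using assms in_closed_iff_infdist_zero[of "- G" x] infdist_nonneg[of x "- G"] by (auto simp: less_le closed_def)
  then obtain n :: nat where n: "1 < real n * infdist x (- G)"
    using reals_Archimedean3 by blast
  have "open_approx G k x = indicator G x" if "n \<le> k" for k
  proof -
    have "real n * infdist x (- G) \<le> real k * infdist x (- G)"
      using that by (intro mult_right_mono infdist_nonneg) auto
    with n show ?thesis using True by (auto simp: open_approx_def min_def)
  qed
  then show ?thesis by (intro tendsto_eventually) (auto simp: eventually_sequentially)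
next
  case False
  then have "open_approx G k x = indicator G x" for k by (auto simp: open_approx_def)
  then show ?thesis by simp
qed

lemma fm_continuous_integral:
  assumes "continuous_on UNIV (f::'a::topological_space \<Rightarrow> real)" "bounded (range f)"
  shows "continuous_on UNIV (\<lambda>\<eta>. \<integral>x. f x \<partial>fm_measure \<eta>)"
proof -
  have "open ((\<lambda>\<eta>. \<integral>x. f x \<partial>fm_measure \<eta>) -` B)" if "open B" for B
    unfolding open_fin_measure_def vimage_def
    by (rule generate_topology.Basis, rule CollectI, rule exI[of _ f], rule exI[of _ B])
      (intro conjI refl assms that)
  then show ?thesis by (simp add: continuous_on_open_vimage)
qed

lemma fm_tendstoI:
  assumes conv: "\<And>f::'a::topological_space \<Rightarrow> real. continuous_on UNIV f \<Longrightarrow> bounded (range f) \<Longrightarrow>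
     ((\<lambda>n. \<integral>x. f x \<partial>fm_measure (\<eta> n)) \<longlongrightarrow> (\<integral>x. f x \<partial>fm_measure \<eta>0)) F"
  shows "(\<eta> \<longlongrightarrow> \<eta>0) F"
proof (rule topological_tendstoI)
  fix S assume S: "open S" "\<eta>0 \<in> S"
  from S(1)[unfolded open_fin_measure_def] S(2) show "eventually (\<lambda>n. \<eta> n \<in> S) F"
  proof (induction rule: generate_topology.induct)
    case (Basis S)
    from Basis(1) show ?case
    proof (elim CollectE exE conjE)
      fix f :: "'a \<Rightarrow> real" and U assume S: "S = {\<mu>. (\<integral>x. f x \<partial>fm_measure \<mu>) \<in> U}"
        and f: "continuous_on UNIV f" "bounded (range f)" and U: "open U"
      from Basis(2) S have "(\<integral>x. f x \<partial>fm_measure \<eta>0) \<in> U" by simp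
      then have "eventually (\<lambda>n. (\<integral>x. f x \<partial>fm_measure (\<eta> n)) \<in> U) F"
        by (rule topological_tendstoD[OF conv[OF f] U])
      then show ?case by (simp add: S)
    qed
  next
    case (UN K)
    from UN.prems obtain S where S: "S \<in> K" "\<eta>0 \<in> S" by blast
    from UN.IH[OF S] have "eventually (\<lambda>n. \<eta> n \<in> S) F" .
    then show ?case by (rule eventually_mono) (use S(1) in blast)
  next
    case (Int a b)
    then have "eventually (\<lambda>n. \<eta> n \<in> a) F" "eventually (\<lambda>n. \<eta> n \<in> b) F" by blast+
    then show ?case by eventually_elim simp
  qed simp
qed

lemma fm_measure_measurable [measurable]:
  assumes A: "A \<in> sets (borel :: 'a::metric_space measure)"
  shows "(\<lambda>\<eta>. measure (fm_measure \<eta>) A) \<in> borel_measurable borel"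
proof (rule kernel_measurable[OF _ Int_stable_open])
  have open_meas: "(\<lambda>\<eta>. measure (fm_measure \<eta>) G) \<in> borel_measurable borel" if G: "open G" for G :: "'a set"
  proof (rule borel_measurable_LIMSEQ_real)
    show "(\<lambda>\<eta>. \<integral>x. open_approx G k x \<partial>fm_measure \<eta>) \<in> borel_measurable borel" for k
      by (intro borel_measurable_continuous_onI fm_continuous_integral open_approx_continuous open_approx_bounded)
    fix \<eta> :: "'a fin_measure"
    interpret finite_measure "fm_measure \<eta>" by simp
    have "(\<lambda>k. \<integral>x. open_approx G k x \<partial>fm_measure \<eta>) \<longlonglongrightarrow> (\<integral>x. indicator G x \<partial>fm_measure \<eta>)"
      using G
      by (intro integral_dominated_convergence[where w="\<lambda>_. 1"])
        (auto intro!: open_approx_tendsto intro: borel_measurable_indicator)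
    then show "(\<lambda>k. \<integral>x. open_approx G k x \<partial>fm_measure \<eta>) \<longlonglongrightarrow> measure (fm_measure \<eta>) G"
      using G by simp
  qed
  then show "(\<lambda>\<eta>. measure (fm_measure \<eta>) G) \<in> borel_measurable borel" if "G \<in> {S. open S}" for G :: "'a set"
    using that by auto
  show "(\<lambda>\<eta>. measure (fm_measure \<eta>) (UNIV::'a set)) \<in> borel_measurable borel"
    by (rule open_meas) simp
  show "A \<in> sigma_sets UNIV {S. open S}" using A by (simp add: borel_sigma_sets_open)
qed (auto simp: borel_sigma_sets_open)

lemma fm_emeasure_measurable [measurable]:
  assumes A: "A \<in> sets (borel :: 'a::metric_space measure)"
  shows "(\<lambda>\<eta>. emeasure (fm_measure \<eta>) A) \<in> borel_measurable borel"
proof -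
  have "emeasure (fm_measure \<eta>) A = ennreal (measure (fm_measure \<eta>) A)" for \<eta> :: "'a fin_measure"
    by (rule finite_measure.emeasure_eq_measure) simp
  then show ?thesis using A by simp
qed

lemma fm_nn_integral_measurable [measurable]:
  assumes "f \<in> borel_measurable (borel :: 'a::metric_space measure)"
  shows "(\<lambda>\<eta>. \<integral>\<^sup>+x. f x \<partial>fm_measure \<eta>) \<in> borel_measurable borel"
  by (rule kernel_nn_integral_measurable[where S=borel]) (use assms in auto)

lemma fm_integral_measurable:
  assumes f: "f \<in> bpB"
  shows "(\<lambda>\<eta>. \<integral>x. f x \<partial>fm_measure (\<eta> :: 'a::metric_space fin_measure)) \<in> borel_measurable borel"
proof -
  have "(\<integral>x. f x \<partial>fm_measure \<eta>) = enn2real (\<integral>\<^sup>+x. ennreal (f x) \<partial>fm_measure \<eta>)" for \<eta> :: "'a fin_measure"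
    using f by (intro integral_eq_nn_integral) (auto simp: bpB_nonneg bpB_measurable)
  then show ?thesis using f by (simp add: bpB_measurable)
qed

lemma zero_fin_measure_iff: "\<eta> = 0 \<longleftrightarrow> measure (fm_measure \<eta>) UNIV = 0"
  for \<eta> :: "'a::topological_space fin_measure"
proof
  assume *: "measure (fm_measure \<eta>) UNIV = 0"
  interpret finite_measure "fm_measure \<eta>" by simp
  have "fm_measure \<eta> = null_measure borel"
  proof (rule measure_eqI)
    fix A assume "A \<in> sets (fm_measure \<eta>)"
    have "measure (fm_measure \<eta>) A \<le> measure (fm_measure \<eta>) UNIV"
      by (rule finite_measure_mono) auto
    then show "emeasure (fm_measure \<eta>) A = emeasure (null_measure borel) A"
      using * measure_nonneg[of "fm_measure \<eta>" A] by (simp add: emeasure_eq_measure)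
  qed simp
  then show "\<eta> = 0" by (metis fm_measure_inject fm_measure_zero)
qed simp

lemma sets_zero_fm [measurable]: "{0 :: 'a::metric_space fin_measure} \<in> sets borel"
proof -
  have "{0 :: 'a fin_measure} = {\<eta>\<in>space borel. measure (fm_measure \<eta>) UNIV = 0}" by (auto simp: zero_fin_measure_iff)
  also have "\<dots> \<in> sets borel" by measurable
  finally show ?thesis .
qed

section \<open>Weak convergence tested on a countable family of sets\<close>

text \<open>By inclusion and exclusion, convergence on an intersection-stable family extends to finite unions.\<close>

lemma pi_system_union_tendsto:
  fixes N :: "nat \<Rightarrow> 'a measure"
  assumes sets_N: "\<And>n. sets (N n) = S" "sets N0 = S"
    and fin: "\<And>n. finite_measure (N n)" "finite_measure N0"
    and P: "P \<subseteq> S" and Int: "\<And>A B. A \<in> P \<Longrightarrow> B \<in> P \<Longrightarrow> A \<inter> B \<in> P"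
    and conv: "\<And>A. A \<in> P \<Longrightarrow> (\<lambda>n. measure (N n) A) \<longlonglongrightarrow> measure N0 A"
  shows "set xs \<subseteq> P \<Longrightarrow> (\<lambda>n. measure (N n) (\<Union>(set xs))) \<longlonglongrightarrow> measure N0 (\<Union>(set xs))"
proof (induction "length xs" arbitrary: xs)
  case 0
  then show ?case by simp
next
  case (Suc k)
  then obtain A ys where xs: "xs = A # ys" "length ys = k" by (cases xs) auto
  have A: "A \<in> P" "set ys \<subseteq> P" using Suc.prems xs by auto
  have *: "measure m (\<Union>(set xs)) = measure m A + measure m (\<Union>(set ys)) - measure m (\<Union>(set (map ((\<inter>) A) ys)))"
    if m: "sets m = S" "finite_measure m" for m
  proof -
    interpret finite_measure m by (rule m)
    have "A \<in> fmeasurable m" "\<Union>(set ys) \<in> fmeasurable m"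
      using A P m unfolding fmeasurable_eq_sets by (auto intro!: sets.finite_Union)
    from measure_Un3[OF this] show ?thesis
      by (simp add: xs Int_Union image_def)
  qed
  have "(\<lambda>n. measure (N n) (\<Union>(set ys))) \<longlonglongrightarrow> measure N0 (\<Union>(set ys))"
    using Suc.hyps(1)[of ys] xs A by auto
  moreover have "(\<lambda>n. measure (N n) (\<Union>(set (map ((\<inter>) A) ys)))) \<longlonglongrightarrow> measure N0 (\<Union>(set (map ((\<inter>) A) ys)))"
    using Suc.hyps(1)[of "map ((\<inter>) A) ys"] xs A Int by auto
  ultimately show ?case
    using conv[OF A(1)] by (simp only: *[OF sets_N(1) fin(1)] *[OF sets_N(2) fin(2)]) (intro tendsto_intros)
qed

text \<open>A bounded function is approximated from below, up to \<open>1 / K\<close>, by the average of the indicators of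
  its \<open>K\<close> upper level sets; this is the counting estimate behind it.\<close>

lemma card_less_bounds:
  fixes y :: real and K :: nat
  assumes "0 \<le> y" "y \<le> K"
  shows "real (card {j\<in>{1..K}. real j < y}) \<le> y" "y - 1 \<le> real (card {j\<in>{1..K}. real j < y})"
proof -
  have "{j\<in>{1..K}. real j < y} \<subseteq> {1..nat \<lfloor>y\<rfloor>}" by (auto simp: le_nat_iff le_floor_iff)
  then have "card {j\<in>{1..K}. real j < y} \<le> nat \<lfloor>y\<rfloor>" using card_mono[of "{1..nat \<lfloor>y\<rfloor>}"] by fastforce
  then show "real (card {j\<in>{1..K}. real j < y}) \<le> y" using assms by linarith
  have "{1..nat (\<lceil>y\<rceil> - 1)} \<subseteq> {j\<in>{1..K}. real j < y}"
  proof
    fix j assume "j \<in> {1..nat (\<lceil>y\<rceil> - 1)}"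
    then have "1 \<le> j" "int j \<le> \<lceil>y\<rceil> - 1" by auto
    then have "real j < y" by linarith
    with \<open>1 \<le> j\<close> assms show "j \<in> {j\<in>{1..K}. real j < y}" by auto
  qed
  then have "nat (\<lceil>y\<rceil> - 1) \<le> card {j\<in>{1..K}. real j < y}"
    using card_mono[of "{j\<in>{1..K}. real j < y}" "{1..nat (\<lceil>y\<rceil> - 1)}"] by simp
  then show "y - 1 \<le> real (card {j\<in>{1..K}. real j < y})" using le_of_int_ceiling[of y] by linarith
qed

text \<open>If every open set is a countable union of members of an intersection-stable family, then convergence
  on the family and of the total masses gives weak convergence: the masses of open sets are lower
  semicontinuous, hence so are integrals of functions with values in \<open>[0, 1]\<close>, and \<open>1 - g\<close> gives the
  other inequality.  The limit \<open>N0\<close> is prescribed, so no tightness is needed.\<close>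

lemma portmanteau_pi_system:
  fixes N :: "nat \<Rightarrow> 'a::topological_space measure" and f :: "'a \<Rightarrow> real"
  assumes sets_N: "\<And>n. sets (N n) = sets borel" "sets N0 = sets borel"
    and fin: "\<And>n. finite_measure (N n)" "finite_measure N0"
    and P: "P \<subseteq> sets borel" and Int: "\<And>A B. A \<in> P \<Longrightarrow> B \<in> P \<Longrightarrow> A \<inter> B \<in> P"
    and cover: "\<And>G. open G \<Longrightarrow> \<exists>C\<subseteq>P. countable C \<and> \<Union>C = G"
    and conv: "\<And>A. A \<in> P \<Longrightarrow> (\<lambda>n. measure (N n) A) \<longlonglongrightarrow> measure N0 A"
    and total: "(\<lambda>n. measure (N n) UNIV) \<longlonglongrightarrow> measure N0 UNIV"
    and f: "continuous_on UNIV f" "bounded (range f)"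
  shows "(\<lambda>n. \<integral>x. f x \<partial>N n) \<longlonglongrightarrow> (\<integral>x. f x \<partial>N0)"
proof -
  have sp: "space (N n) = UNIV" "space N0 = UNIV" for n
    using sets_eq_imp_space_eq[OF sets_N(1)] sets_eq_imp_space_eq[OF sets_N(2)] by auto
  have lower_open: "eventually (\<lambda>n. a < measure (N n) G) sequentially" if G: "open G" and a: "a < measure N0 G" for a G
  proof -
    obtain C where C: "C \<subseteq> P" "countable C" "\<Union>C = G" using cover[OF G] by blast
    show ?thesis
    proof (cases "C = {}")
      case True
      then show ?thesis using a C by auto
    next
      case False
      define U where "U k = \<Union>(set (map (from_nat_into C) [0..<k]))" for k
      have CP: "from_nat_into C i \<in> P" for i using from_nat_into[OF False] C by blast
      have "(\<Union>k. U k) = (\<Union>i. from_nat_into C i)"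
        by (auto simp: U_def) (metis atLeastLessThan_iff lessI zero_le)
      also have "\<dots> = G" using range_from_nat_into[OF False C(2)] C(3) by auto
      finally have UG: "(\<Union>k. U k) = G" .
      have Um: "U k \<in> sets borel" for k unfolding U_def using CP P by (auto intro!: sets.finite_Union)
      have Uinc: "incseq U" unfolding incseq_def
      proof (intro allI impI subsetI)
        fix m n x assume "m \<le> n" "x \<in> U m"
        then obtain i where "i < m" "x \<in> from_nat_into C i" by (auto simp: U_def)
        then show "x \<in> U n" using \<open>m \<le> n\<close> by (auto simp: U_def intro!: bexI[of _ i])
      qed
      have "(\<lambda>k. measure N0 (U k)) \<longlonglongrightarrow> measure N0 (\<Union>k. U k)"
        by (rule finite_measure.finite_Lim_measure_incseq[OF fin(2)])
          (use Um sets_N Uinc in auto)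
      then have "eventually (\<lambda>k. a < measure N0 (U k)) sequentially" using a UG by (auto intro: order_tendstoD)
      then obtain k where k: "a < measure N0 (U k)" by (auto simp: eventually_sequentially)
      have "(\<lambda>n. measure (N n) (U k)) \<longlonglongrightarrow> measure N0 (U k)"
        unfolding U_def by (rule pi_system_union_tendsto[OF sets_N fin P Int conv]) (use CP in auto)
      then have "eventually (\<lambda>n. a < measure (N n) (U k)) sequentially" using k by (auto intro: order_tendstoD)
      then show ?thesis
      proof eventually_elim
        case (elim n)
        have "measure (N n) (U k) \<le> measure (N n) G"
          by (rule finite_measure.finite_measure_mono[OF fin(1)]) (use UG G sets_N in auto)
        with elim show ?case by simp
      qed
    qed
  qed
  have lower: "eventually (\<lambda>n. a < (\<integral>x. g x \<partial>N n)) sequentially"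
    if g: "continuous_on UNIV g" "\<And>x. 0 \<le> g x" "\<And>x. g x \<le> 1" and a: "a < (\<integral>x. g x \<partial>N0)" for g :: "'a \<Rightarrow> real" and a
  proof -
    have gm[measurable]: "g \<in> borel_measurable borel" by (rule borel_measurable_continuous_onI[OF g(1)])
    define d where "d = ((\<integral>x. g x \<partial>N0) - a) / 2"
    have d: "0 < d" using a by (simp add: d_def)
    obtain K :: nat where K: "measure N0 UNIV / d < K" using reals_Archimedean2 by blast
    have K0: "0 < K" using K d by (metis divide_nonneg_pos measure_nonneg not_less of_nat_0 of_nat_0_less_iff order_le_less_trans)
    have Kd: "measure N0 UNIV / K < d" using K K0 d by (simp add: field_simps)
    define G where "G j = {x. real j / K < g x}" for j :: nat
    have G: "open (G j)" for j
      unfolding G_def using open_Collect_less[of "\<lambda>_. real j / K" g] g(1) by auto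
    have Gm: "G j \<in> sets borel" for j using G by auto
    define h where "h x = (\<Sum>j=1..K. indicator (G j) x) / real K" for x
    have h_card: "h x = real (card {j\<in>{1..K}. real j < K * g x}) / K" for x
    proof -
      have "(\<Sum>j=1..K. indicator (G j) x) = (\<Sum>j\<in>{1..K}. if real j < K * g x then 1 else 0 :: real)"
        using K0 by (intro sum.cong) (auto simp: G_def indicator_def field_simps)
      also have "\<dots> = real (card {j\<in>{1..K}. real j < K * g x})"
        by (subst sum.inter_filter[symmetric]) auto
      finally show ?thesis by (simp add: h_def)
    qed
    have h: "h x \<le> g x" "g x - 1 / K \<le> h x" for x
    proof -
      have "0 \<le> K * g x" "K * g x \<le> K" using g(2,3)[of x] by (auto simp: mult_left_le)
      from divide_right_mono[OF card_less_bounds(1)[OF this], of K] divide_right_mono[OF card_less_bounds(2)[OF this], of K]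
      show "h x \<le> g x" "g x - 1 / K \<le> h x" using K0 by (auto simp: h_card diff_divide_distrib)
    qed
    have int: "integrable m g" "integrable m h" "(\<integral>x. h x \<partial>m) = (\<Sum>j=1..K. measure m (G j)) / K"
      if m: "sets m = sets borel" "finite_measure m" for m
    proof -
      interpret finite_measure m by fact
      note m(1)[measurable_cong]
      show "integrable m g" using g by (intro integrable_const_bound[of _ 1]) auto
      have ig: "integrable m (indicator (G j) :: 'a \<Rightarrow> real)" for j
        using Gm m by (intro integrable_const_bound[of _ 1]) auto
      then show "integrable m h" unfolding h_def by (intro integrable_divide Bochner_Integration.integrable_sum) auto
      show "(\<integral>x. h x \<partial>m) = (\<Sum>j=1..K. measure m (G j)) / K"
        unfolding h_def using ig sets_eq_imp_space_eq[OF m(1)] Gm m(1) by (simp add: Bochner_Integration.integral_sum)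
    qed
    have "(\<integral>x. g x \<partial>N0) - measure N0 UNIV / K = (\<integral>x. g x - 1 / K \<partial>N0)"
      using int(1)[OF sets_N(2) fin(2)] sp(2) finite_measure.integrable_const[OF fin(2)]
      by (subst Bochner_Integration.integral_diff) auto
    also have "\<dots> \<le> (\<integral>x. h x \<partial>N0)"
      using int(1,2)[OF sets_N(2) fin(2)] h finite_measure.integrable_const[OF fin(2)]
      by (intro integral_mono Bochner_Integration.integrable_diff) auto
    finally have h0: "a + d < (\<Sum>j=1..K. measure N0 (G j)) / K"
      using Kd int(3)[OF sets_N(2) fin(2)] by (simp add: d_def field_simps)
    have "eventually (\<lambda>n. \<forall>j\<in>{1..K}. measure N0 (G j) - d < measure (N n) (G j)) sequentially"
      using d by (intro eventually_ball_finite ballI lower_open[OF G]) auto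
    then show ?thesis
    proof eventually_elim
      case (elim n)
      have "(\<Sum>j=1..K. measure N0 (G j)) - K * d = (\<Sum>j=1..K. measure N0 (G j) - d)" by (simp add: sum_subtractf)
      also have "\<dots> \<le> (\<Sum>j=1..K. measure (N n) (G j))" using elim by (intro sum_mono less_imp_le) blast
      finally have "((\<Sum>j=1..K. measure N0 (G j)) - K * d) / K \<le> (\<Sum>j=1..K. measure (N n) (G j)) / K"
        by (rule divide_right_mono) simp
      then have "(\<Sum>j=1..K. measure N0 (G j)) / K - d \<le> (\<Sum>j=1..K. measure (N n) (G j)) / K"
        using K0 by (simp add: diff_divide_distrib)
      also have "\<dots> = (\<integral>x. h x \<partial>N n)" using int(3)[OF sets_N(1) fin(1)] by simp
      also have "\<dots> \<le> (\<integral>x. g x \<partial>N n)"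
        using int(1,2)[OF sets_N(1) fin(1)] h by (intro integral_mono) auto
      finally show ?case using h0 by simp
    qed
  qed
  obtain B0 where B0: "\<And>x. \<bar>f x\<bar> \<le> B0" using f(2) by (auto simp: bounded_iff)
  define B where "B = max B0 1"
  have B: "0 < B" "\<And>x. \<bar>f x\<bar> \<le> B" using B0 by (auto simp: B_def intro: max.coboundedI1)
  define g where "g x = (f x + B) / (2 * B)" for x
  have fm[measurable]: "f \<in> borel_measurable borel" by (rule borel_measurable_continuous_onI[OF f(1)])
  have g: "continuous_on UNIV g" "0 \<le> g x" "g x \<le> 1" for x
    using B(2)[of x] B(1) f(1) by (auto simp: g_def abs_le_iff field_simps intro!: continuous_intros)
  have g': "continuous_on UNIV (\<lambda>x. 1 - g x)" using g(1) by (intro continuous_intros)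
  have int: "integrable m f" "integrable m g" "(\<integral>x. 1 - g x \<partial>m) = measure m UNIV - (\<integral>x. g x \<partial>m)"
     "(\<integral>x. f x \<partial>m) = 2 * B * (\<integral>x. g x \<partial>m) - B * measure m UNIV"
    if m: "sets m = sets borel" "finite_measure m" for m
  proof -
    interpret finite_measure m by fact
    note m(1)[measurable_cong]
    have spm: "space m = UNIV" using sets_eq_imp_space_eq[OF m(1)] by simp
    show i: "integrable m f" using B by (intro integrable_const_bound[of _ B]) auto
    then show ig: "integrable m g" unfolding g_def by auto
    show "(\<integral>x. 1 - g x \<partial>m) = measure m UNIV - (\<integral>x. g x \<partial>m)" using ig spm by simp
    have "(\<integral>x. g x \<partial>m) = ((\<integral>x. f x \<partial>m) + B * measure m UNIV) / (2 * B)"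
      unfolding g_def using i spm by (simp add: mult.commute)
    then show "(\<integral>x. f x \<partial>m) = 2 * B * (\<integral>x. g x \<partial>m) - B * measure m UNIV" using B(1) by simp
  qed
  have "(\<lambda>n. \<integral>x. g x \<partial>N n) \<longlonglongrightarrow> (\<integral>x. g x \<partial>N0)"
  proof (rule order_tendstoI)
    fix a assume "a < (\<integral>x. g x \<partial>N0)"
    then show "eventually (\<lambda>n. a < (\<integral>x. g x \<partial>N n)) sequentially" by (rule lower[OF g])
  next
    fix a assume a: "(\<integral>x. g x \<partial>N0) < a"
    define e where "e = a - (\<integral>x. g x \<partial>N0)"
    have e: "0 < e" using a by (simp add: e_def)
    have "eventually (\<lambda>n. (\<integral>x. 1 - g x \<partial>N0) - e/2 < (\<integral>x. 1 - g x \<partial>N n)) sequentially"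
      by (rule lower[OF g']) (use g e in auto)
    moreover have "eventually (\<lambda>n. measure (N n) UNIV < measure N0 UNIV + e/2) sequentially"
      using e by (intro order_tendstoD[OF total]) auto
    ultimately show "eventually (\<lambda>n. (\<integral>x. g x \<partial>N n) < a) sequentially"
      by eventually_elim (simp add: int(3)[OF sets_N(1) fin(1)] int(3)[OF sets_N(2) fin(2)] e_def field_simps)
  qed
  then show ?thesis
    unfolding int(4)[OF sets_N(1) fin(1)] int(4)[OF sets_N(2) fin(2)] using total by (intro tendsto_intros)
qed

section \<open>Coding a Polish space in the line\<close>

text \<open>A sequence of bits is coded by the point of the Cantor set whose ternary digits are twice the bits.
  The clamp is a continuous function equal to the first bit on codes, and it extends to all reals; the
  bits are therefore continuous functions of the code.\<close>

definition ternary_clamp :: "real \<Rightarrow> real" where "ternary_clamp z = max 0 (min 1 (3 * z - 1))"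

fun ternary_digit :: "nat \<Rightarrow> real \<Rightarrow> real" where
  "ternary_digit 0 z = ternary_clamp z"
| "ternary_digit (Suc n) z = ternary_digit n (3 * z - 2 * ternary_clamp z)"

definition cantor_code :: "(nat \<Rightarrow> bool) \<Rightarrow> real" where
  "cantor_code b = (\<Sum>n. 2 * of_bool (b n) / 3 ^ Suc n)"

lemma continuous_ternary_clamp: "continuous_on S ternary_clamp"
  unfolding ternary_clamp_def[abs_def] by (intro continuous_intros)

lemma continuous_ternary_digit: "continuous_on UNIV (ternary_digit n)"
proof (induction n)
  case 0
  then show ?case using continuous_ternary_clamp[of UNIV] by (simp add: fun_eq_iff cong: continuous_on_cong)
next
  case (Suc n)
  have "continuous_on UNIV (\<lambda>z. ternary_digit n (3 * z - 2 * ternary_clamp z))"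
    by (rule continuous_on_compose2[OF Suc]) (auto intro!: continuous_intros continuous_ternary_clamp)
  then show ?case by simp
qed

lemma ternary_digit_bounds: "0 \<le> ternary_digit n z" "ternary_digit n z \<le> 1"
  by (induction n arbitrary: z) (auto simp: ternary_clamp_def)

lemma cantor_code_summable: "summable (\<lambda>n. 2 * of_bool (b n) / 3 ^ Suc n :: real)"
proof (rule summable_comparison_test'[of "\<lambda>n. 2 / 3 * (1 / 3) ^ n" 0])
  show "summable (\<lambda>n. 2 / 3 * (1 / 3) ^ n :: real)" by (intro summable_mult summable_geometric) auto
qed (auto simp: field_simps)

lemma cantor_code_bounds: "0 \<le> cantor_code b" "cantor_code b \<le> 1"
proof -
  show "0 \<le> cantor_code b" unfolding cantor_code_def by (intro suminf_nonneg cantor_code_summable) auto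
  have "cantor_code b \<le> (\<Sum>n. 2 / 3 * (1 / 3) ^ n)" unfolding cantor_code_def
    by (intro suminf_le cantor_code_summable summable_mult summable_geometric) (auto simp: field_simps)
  also have "\<dots> = 1" by (subst suminf_mult) (auto simp: suminf_geometric summable_geometric)
  finally show "cantor_code b \<le> 1" .
qed

lemma cantor_code_rec: "3 * cantor_code b = 2 * of_bool (b 0) + cantor_code (\<lambda>n. b (Suc n))"
proof -
  have "cantor_code b = 2 * of_bool (b 0) / 3 + (\<Sum>n. 2 * of_bool (b (Suc n)) / 3 ^ Suc (Suc n))"
    unfolding cantor_code_def by (subst suminf_split_head[OF cantor_code_summable]) simp
  also have "(\<Sum>n. 2 * of_bool (b (Suc n)) / 3 ^ Suc (Suc n)) = (\<Sum>n. 1 / 3 * (2 * of_bool (b (Suc n)) / 3 ^ Suc n) :: real)"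
    by (intro suminf_cong) simp
  also have "\<dots> = 1 / 3 * cantor_code (\<lambda>n. b (Suc n))"
    unfolding cantor_code_def by (rule suminf_mult[OF cantor_code_summable])
  finally show ?thesis by simp
qed

lemma ternary_digit_code: "ternary_digit n (cantor_code b) = of_bool (b n)"
proof (induction n arbitrary: b)
  case 0
  show ?case using cantor_code_rec[of b] cantor_code_bounds[of "\<lambda>n. b (Suc n)"]
    by (auto simp: ternary_clamp_def)
next
  case (Suc n)
  have "ternary_clamp (cantor_code b) = of_bool (b 0)"
    using cantor_code_rec[of b] cantor_code_bounds[of "\<lambda>n. b (Suc n)"] by (auto simp: ternary_clamp_def)
  then show ?case using cantor_code_rec[of b] Suc[of "\<lambda>n. b (Suc n)"] by simp
qed

lemma cantor_code_measurable:
  assumes "\<And>n. Measurable.pred M (\<lambda>x. b x n)"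
  shows "(\<lambda>x. cantor_code (b x)) \<in> borel_measurable M"
proof -
  have "(\<lambda>x. 2 * of_bool (b x n) / 3 ^ Suc n :: real) \<in> borel_measurable M" for n
    using assms[of n] unfolding of_bool_def by measurable
  then show ?thesis unfolding cantor_code_def by (intro borel_measurable_suminf)
qed

text \<open>The binary digits of a number in \<open>[0, 1)\<close>, starting with the digit of \<open>1 / 2\<close>.\<close>

definition binary_digit :: "real \<Rightarrow> nat \<Rightarrow> bool" where
  "binary_digit y n \<longleftrightarrow> odd \<lfloor>2 ^ Suc n * y\<rfloor>"

lemma floor_double: "\<lfloor>2 * x\<rfloor> = 2 * \<lfloor>x\<rfloor> + of_bool (odd \<lfloor>2 * x\<rfloor>)" for x :: real
proof -
  have "\<lfloor>2 * x\<rfloor> = 2 * \<lfloor>x\<rfloor> \<or> \<lfloor>2 * x\<rfloor> = 2 * \<lfloor>x\<rfloor> + 1" by linarith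
  then show ?thesis by auto
qed

lemma binary_digits_partial:
  assumes "0 \<le> y" "y < 1"
  shows "(\<Sum>j<n. of_bool (binary_digit y j) / 2 ^ Suc j) = real_of_int \<lfloor>2 ^ n * y\<rfloor> / 2 ^ n"
proof (induction n)
  case 0
  have "\<lfloor>y\<rfloor> = 0" using assms by linarith
  then show ?case by simp
next
  case (Suc n)
  have "\<lfloor>2 ^ Suc n * y\<rfloor> = 2 * \<lfloor>2 ^ n * y\<rfloor> + of_bool (binary_digit y n)"
    using floor_double[of "2 ^ n * y"] by (simp add: binary_digit_def mult.assoc)
  then have "real_of_int \<lfloor>2 ^ Suc n * y\<rfloor> / 2 ^ Suc n
      = real_of_int \<lfloor>2 ^ n * y\<rfloor> / 2 ^ n + of_bool (binary_digit y n) / 2 ^ Suc n"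
    by (simp add: add_divide_distrib)
  then show ?case using Suc by simp
qed

lemma binary_digits_sums:
  assumes "0 \<le> y" "y < 1"
  shows "(\<lambda>j. of_bool (binary_digit y j) / 2 ^ Suc j) sums y"
  unfolding sums_def binary_digits_partial[OF assms]
proof (rule tendsto_sandwich[OF always_eventually always_eventually])
  show "\<forall>n. y - (1/2) ^ n \<le> real_of_int \<lfloor>2 ^ n * y\<rfloor> / 2 ^ n"
  proof
    fix n
    have "2 ^ n * y - 1 \<le> real_of_int \<lfloor>2 ^ n * y\<rfloor>" by linarith
    then have "(2 ^ n * y - 1) / 2 ^ n \<le> real_of_int \<lfloor>2 ^ n * y\<rfloor> / 2 ^ n" by (intro divide_right_mono) auto
    then show "y - (1/2) ^ n \<le> real_of_int \<lfloor>2 ^ n * y\<rfloor> / 2 ^ n" by (simp add: diff_divide_distrib power_divide)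
  qed
  show "\<forall>n. real_of_int \<lfloor>2 ^ n * y\<rfloor> / 2 ^ n \<le> y"
  proof
    fix n show "real_of_int \<lfloor>2 ^ n * y\<rfloor> / 2 ^ n \<le> y"
      using of_int_floor_le[of "2 ^ n * y"] by (simp add: field_simps)
  qed
  have "(\<lambda>n. y - (1/2) ^ n) \<longlonglongrightarrow> y - 0" by (intro tendsto_intros LIMSEQ_power_zero) auto
  then show "(\<lambda>n. y - (1/2) ^ n) \<longlonglongrightarrow> y" by simp
qed simp

text \<open>A countable family of numbers in \<open>[0, 1)\<close> is coded by the single number whose ternary
  expansion interleaves their binary expansions.  Decoding is continuous, coding only Borel.\<close>

definition family_code :: "('i::countable \<Rightarrow> real) \<Rightarrow> real" where
  "family_code y = cantor_code (\<lambda>n. case from_nat n of (i, j) \<Rightarrow> binary_digit (y i) j)"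

definition family_decode :: "'i::countable \<Rightarrow> real \<Rightarrow> real" where
  "family_decode i z = (\<Sum>j. ternary_digit (to_nat (i, j)) z / 2 ^ Suc j)"

lemma half_power_summable: "summable (\<lambda>j. 1 / 2 ^ Suc j :: real)"
  using sums_summable[OF power_half_series] by (simp add: power_divide)

lemma half_power_suminf: "(\<Sum>j. 1 / 2 ^ Suc j :: real) = 1"
  using sums_unique[OF power_half_series] by (simp add: power_divide)

lemma family_decode_summable: "summable (\<lambda>j. ternary_digit (to_nat (i::'i::countable, j)) z / 2 ^ Suc j)"
  by (rule summable_comparison_test'[OF half_power_summable, of 0])
    (use ternary_digit_bounds in \<open>auto intro!: divide_right_mono simp: abs_of_nonneg\<close>)

lemma continuous_family_decode: "continuous_on UNIV (family_decode (i::'i::countable))"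
proof -
  have "uniform_limit UNIV (\<lambda>n z. \<Sum>j<n. ternary_digit (to_nat (i, j)) z / 2 ^ Suc j) (family_decode i) sequentially"
    unfolding family_decode_def[abs_def]
    by (rule Weierstrass_m_test[OF _ half_power_summable])
      (use ternary_digit_bounds in \<open>auto intro!: divide_right_mono simp: abs_of_nonneg\<close>)
  then show ?thesis
    by (rule uniform_limit_theorem[rotated])
      (auto intro!: always_eventually continuous_intros continuous_on_divide continuous_ternary_digit)
qed

lemma family_decode_bounds: "0 \<le> family_decode (i::'i::countable) z" "family_decode i z \<le> 1"
proof -
  show "0 \<le> family_decode i z" unfolding family_decode_def
    by (intro suminf_nonneg family_decode_summable) (simp add: ternary_digit_bounds)
  have "family_decode i z \<le> (\<Sum>j. 1 / 2 ^ Suc j)" unfolding family_decode_def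
    by (intro suminf_le family_decode_summable half_power_summable divide_right_mono) (auto simp: ternary_digit_bounds)
  then show "family_decode i z \<le> 1" by (simp only: half_power_suminf)
qed

lemma family_decode_code:
  assumes "0 \<le> y i" "y i < 1"
  shows "family_decode (i::'i::countable) (family_code y) = y i"
proof -
  have "family_decode i (family_code y) = (\<Sum>j. of_bool (binary_digit (y i) j) / 2 ^ Suc j)"
    unfolding family_decode_def family_code_def by (simp add: ternary_digit_code)
  then show ?thesis using sums_unique[OF binary_digits_sums[OF assms]] by simp
qed

lemma family_code_bounds: "0 \<le> family_code y" "family_code y \<le> 1"
  unfolding family_code_def by (rule cantor_code_bounds)+

lemma family_code_measurable:
  assumes y: "\<And>i::'i::countable. (\<lambda>x. y x i) \<in> borel_measurable M"
  shows "(\<lambda>x. family_code (y x)) \<in> borel_measurable M"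
  unfolding family_code_def
proof (rule cantor_code_measurable)
  fix n
  obtain i :: 'i and j :: nat where ij: "from_nat n = (i, j)" by (cases "from_nat n :: 'i \<times> nat")
  note y[of i, measurable]
  have "Measurable.pred M (\<lambda>x. odd \<lfloor>2 ^ Suc j * y x i\<rfloor>)" by measurable
  then show "Measurable.pred M (\<lambda>x. case from_nat n of (i, j) \<Rightarrow> binary_digit (y x i) j)"
    by (simp add: ij binary_digit_def)
qed

text \<open>A second countable space is embedded into the line by coding, for each point, which members of
  a countable basis contain it.\<close>

definition basis_seq :: "nat \<Rightarrow> 'a::second_countable_topology set" where
  "basis_seq = from_nat_into (SOME B. countable B \<and> topological_basis B)"

definition line_code :: "'a::second_countable_topology \<Rightarrow> real" where
  "line_code x = cantor_code (\<lambda>n. x \<in> basis_seq n)"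

lemma basis_seq:
  shows "open (basis_seq n :: 'a::second_countable_topology set)"
    and "open G \<Longrightarrow> \<exists>J. G = (\<Union>n\<in>J. basis_seq n :: 'a set)"
proof -
  define B :: "'a set set" where "B = (SOME B. countable B \<and> topological_basis B)"
  have B: "countable B" "topological_basis B"
    using someI_ex[OF ex_countable_basis] by (auto simp: B_def)
  have tb: "\<exists>B'. B' \<subseteq> B \<and> \<Union>B' = U" if "open U" for U
    using B(2) that by (simp add: topological_basis_def)
  have "B \<noteq> {}" using tb[OF open_UNIV] by auto
  then have r: "range basis_seq = B" using B(1) by (simp add: basis_seq_def B_def[symmetric] range_from_nat_into)
  show "open (basis_seq n :: 'a set)" using topological_basis_open[OF B(2)] r by (metis rangeI)
  assume "open G"
  then obtain B' where "B' \<subseteq> B" "\<Union>B' = G" using tb by metis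
  then show "\<exists>J. G = (\<Union>n\<in>J. basis_seq n :: 'a set)"
    by (intro exI[of _ "{n. basis_seq n \<in> B'}"]) (use r in \<open>auto 4 3\<close>)
qed

lemma line_code_bounds: "0 \<le> line_code x" "line_code x \<le> 1"
  unfolding line_code_def by (rule cantor_code_bounds)+

lemma line_code_measurable [measurable]: "line_code \<in> borel_measurable borel"
  unfolding line_code_def[abs_def]
  by (rule cantor_code_measurable) (simp add: pred_def borel_open[OF basis_seq(1)])

lemma line_code_open:
  assumes "open (G :: 'a::second_countable_topology set)"
  obtains W where "open W" "G = line_code -` W"
proof -
  obtain J where J: "G = (\<Union>n\<in>J. basis_seq n)" using basis_seq(2)[OF assms] by blast
  define W where "W = (\<Union>n\<in>J. {z. 1/2 < ternary_digit n z})"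
  have "open W" unfolding W_def
    by (intro open_UN ballI open_Collect_less continuous_ternary_digit continuous_on_const)
  moreover have "1/2 < ternary_digit n (line_code x) \<longleftrightarrow> x \<in> basis_seq n" for n and x :: 'a
    unfolding line_code_def ternary_digit_code by simp
  then have "G = line_code -` W" unfolding W_def J by auto
  ultimately show ?thesis by (rule that)
qed

text \<open>The coding has a Borel left inverse.  Every point is the limit of those points of a dense sequence
  that are first to be close to it, and this search can be carried out on the code; codes on which it
  does not converge are sent to an arbitrary point.\<close>

lemma line_decode_exists:
  "\<exists>\<rho>::real \<Rightarrow> 'a::polish_space. \<rho> \<in> borel_measurable borel \<and> (\<forall>x. \<rho> (line_code x) = x)"
proof -
  obtain D :: "'a set" where D: "countable D" "\<And>X. open X \<Longrightarrow> X \<noteq> {} \<Longrightarrow> \<exists>d\<in>D. d \<in> X"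
    using countable_dense_exists[where 'a='a] by metis
  have "D \<noteq> {}" using D(2)[of UNIV] by auto
  define x where "x = from_nat_into D"
  have xD: "range x = D" using D(1) \<open>D \<noteq> {}\<close> by (simp add: x_def range_from_nat_into)
  have "\<exists>W. open W \<and> ball (x k) (1 / 2 ^ m) = line_code -` W" for k m :: nat
    using line_code_open[of "ball (x k) (1 / 2 ^ m)"] by (metis open_ball)
  then obtain W where W: "\<And>k m. open (W k m)" "\<And>k m. ball (x k) (1 / 2 ^ m) = line_code -` W k m" by metis
  define k where "k m z = (LEAST k. z \<in> W k m)" for m z
  have Wm[measurable]: "W i m \<in> sets borel" for i m using W(1) by auto
  have k_meas[measurable]: "k m \<in> borel \<rightarrow>\<^sub>M count_space UNIV" for m
    unfolding k_def[abs_def] by measurable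
  have f[measurable]: "(\<lambda>z. x (k m z)) \<in> borel \<rightarrow>\<^sub>M borel" for m
    by (rule measurable_compose[OF k_meas]) simp
  define C where "C z \<longleftrightarrow> (\<forall>e::nat. \<exists>N. \<forall>m\<ge>N. \<forall>n\<ge>N. dist (x (k m z)) (x (k n z)) < 1 / Suc e)" for z
  have C: "C z \<longleftrightarrow> Cauchy (\<lambda>m. x (k m z))" for z
    unfolding C_def metric_Cauchy_iff2 by (simp add: inverse_eq_divide)
  have [measurable]: "Measurable.pred borel C"
    unfolding C_def[abs_def] by measurable
  define g where "g m z = (if C z then x (k m z) else x 0)" for m z
  have g[measurable]: "g m \<in> borel \<rightarrow>\<^sub>M borel" for m unfolding g_def[abs_def] by measurable
  have "convergent (\<lambda>m. g m z)" for z
    by (cases "C z") (auto simp: g_def C Cauchy_convergent_iff convergent_const)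
  then have lim: "(\<lambda>m. g m z) \<longlonglongrightarrow> lim (\<lambda>m. g m z)" for z
    by (simp add: convergent_LIMSEQ_iff)
  have "(\<lambda>z. lim (\<lambda>m. g m z)) \<in> borel_measurable borel"
    by (rule borel_measurable_LIMSEQ_metric[OF g]) (rule lim)
  moreover have "lim (\<lambda>m. g m (line_code y)) = y" for y
  proof -
    have d: "dist (x (k m (line_code y))) y < (1/2) ^ m" for m
    proof -
      have "\<exists>i. y \<in> ball (x i) (1 / 2 ^ m)"
      proof -
        have "ball y (1 / 2 ^ m) \<noteq> {}" using centre_in_ball[of y "1 / 2 ^ m"] by force
        then obtain d where "d \<in> D" "d \<in> ball y (1 / 2 ^ m)" using D(2)[of "ball y (1 / 2 ^ m)"] by auto
        then show ?thesis using xD by (auto simp: dist_commute)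
      qed
      then have "\<exists>i. line_code y \<in> W i m" using W(2) by auto
      then have "line_code y \<in> W (k m (line_code y)) m" unfolding k_def by (rule LeastI_ex)
      then have "y \<in> ball (x (k m (line_code y))) (1 / 2 ^ m)" using W(2) by auto
      then show ?thesis by (simp add: power_divide)
    qed
    have l: "(\<lambda>m. x (k m (line_code y))) \<longlonglongrightarrow> y"
      by (rule metric_tendsto_imp_tendsto[OF LIMSEQ_power_zero[of "1/2::real"]])
        (auto intro!: always_eventually less_imp_le[OF d] simp: abs_of_nonneg)
    then have "Cauchy (\<lambda>m. x (k m (line_code y)))" by (rule LIMSEQ_imp_Cauchy)
    then have "(\<lambda>m. g m (line_code y)) = (\<lambda>m. x (k m (line_code y)))" by (auto simp: g_def C)
    then show ?thesis using l by (simp add: limI)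
  qed
  ultimately show ?thesis by (intro exI[of _ "\<lambda>z. lim (\<lambda>m. g m z)"]) auto
qed

definition line_decode :: "real \<Rightarrow> 'a::polish_space" where
  "line_decode = (SOME \<rho>. \<rho> \<in> borel_measurable borel \<and> (\<forall>x. \<rho> (line_code x) = x))"

lemma line_decode_measurable [measurable]: "(line_decode :: real \<Rightarrow> 'a::polish_space) \<in> borel_measurable borel"
  and line_decode_code [simp]: "line_decode (line_code x) = (x::'a::polish_space)"
proof -
  have "(line_decode :: real \<Rightarrow> 'a) \<in> borel_measurable borel \<and> (\<forall>x::'a. line_decode (line_code x) = x)"
    by (rule someI_ex[OF line_decode_exists, folded line_decode_def])
  then show "(line_decode :: real \<Rightarrow> 'a) \<in> borel_measurable borel" "line_decode (line_code x) = x" by blast+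
qed

section \<open>The Borel structure of the space of finite measures\<close>

text \<open>The distribution function, at rational points, of the image of a measure on the line.\<close>

definition coded_cdf :: "'a::polish_space fin_measure \<Rightarrow> rat \<Rightarrow> real" where
  "coded_cdf \<eta> q = measure (fm_measure \<eta>) {x. line_code x \<le> of_rat q}"

lemma sets_line_code_le [measurable]: "{x::'a::second_countable_topology. line_code x \<le> c} \<in> sets borel"
proof -
  have "line_code -` {..c} \<inter> space (borel :: 'a measure) \<in> sets borel"
    by (rule measurable_sets[OF line_code_measurable]) simp
  then show ?thesis by (simp add: vimage_def)
qed

lemma coded_cdf_measurable [measurable]: "(\<lambda>\<eta>. coded_cdf \<eta> q) \<in> borel_measurable borel"
  unfolding coded_cdf_def by (rule fm_measure_measurable[OF sets_line_code_le])

lemma coded_cdf_nonneg: "0 \<le> coded_cdf \<eta> q"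
  by (simp add: coded_cdf_def)

lemma coded_cdf_ge_1:
  fixes \<eta> :: "'a::polish_space fin_measure"
  assumes "1 \<le> q"
  shows "coded_cdf \<eta> q = measure (fm_measure \<eta>) UNIV"
proof -
  from assms have "(1::real) \<le> of_rat q" by simp
  then have "line_code x \<le> of_rat q" for x :: 'a using line_code_bounds(2)[of x] by linarith
  then have "{x::'a. line_code x \<le> of_rat q} = UNIV" by auto
  then show ?thesis by (simp add: coded_cdf_def)
qed

lemma open_real_rational_intervals:
  assumes "open (W :: real set)"
  shows "W = (\<Union>(p, q)\<in>{(p::rat, q::rat). {of_rat p<..of_rat q} \<subseteq> W}. {of_rat p<..of_rat q})"
proof (intro equalityI subsetI)
  fix z assume "z \<in> W"
  then obtain e where e: "0 < e" "ball z e \<subseteq> W" using openE[OF assms] by metis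
  obtain p where p: "z - e < of_rat p" "of_rat p < z" using of_rat_dense[of "z - e" z] e(1) by auto
  obtain q where q: "z < of_rat q" "of_rat q < z + e" using of_rat_dense[of z "z + e"] e(1) by auto
  have "{of_rat p<..of_rat q} \<subseteq> ball z e" using p q by (auto simp: dist_real_def abs_if)
  then show "z \<in> (\<Union>(p, q)\<in>{(p::rat, q::rat). {of_rat p<..of_rat q} \<subseteq> W}. {of_rat p<..of_rat q})"
    using e(2) p(2) q(1) by (intro UN_I[of "(p, q)"]) auto
qed auto

text \<open>Here \<open>c\<close> is any Borel map whose preimages of open sets give all open sets, such as \<open>line_code\<close>.
  Convergence of the image distribution functions at every rational point, without exception for
  atoms, is much stronger than weak convergence on the line.  This is what makes up for \<open>c\<close> not being
  continuous.\<close>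

lemma cdf_tendsto_imp_weak:
  fixes N :: "nat \<Rightarrow> 'a::topological_space measure" and c :: "'a \<Rightarrow> real" and f :: "'a \<Rightarrow> real"
  assumes sets_N: "\<And>n. sets (N n) = sets borel" "sets N0 = sets borel"
    and fin: "\<And>n. finite_measure (N n)" "finite_measure N0"
    and c: "c \<in> borel_measurable borel" "\<And>G. open G \<Longrightarrow> \<exists>W. open W \<and> G = c -` W"
    and conv: "\<And>q::rat. (\<lambda>n. measure (N n) {x. c x \<le> of_rat q}) \<longlonglongrightarrow> measure N0 {x. c x \<le> of_rat q}"
    and total: "(\<lambda>n. measure (N n) UNIV) \<longlonglongrightarrow> measure N0 UNIV"
    and f: "continuous_on UNIV f" "bounded (range f)"
  shows "(\<lambda>n. \<integral>x. f x \<partial>N n) \<longlonglongrightarrow> (\<integral>x. f x \<partial>N0)"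
proof -
  define I where "I p q = c -` {of_rat p<..of_rat q}" for p q :: rat
  define P where "P = {I p q | p q. True}"
  have Iq: "I p q = {x. c x \<le> of_rat q} - {x. c x \<le> of_rat p}" for p q by (auto simp: I_def)
  have cm[measurable]: "{x. c x \<le> b} \<in> sets borel" for b
  proof -
    have "c -` {..b} \<inter> space borel \<in> sets borel"
      by (rule measurable_sets[OF c(1)]) simp
    then show ?thesis by (simp add: vimage_def)
  qed
  show ?thesis
  proof (rule portmanteau_pi_system[OF sets_N fin, of P])
    show "P \<subseteq> sets borel" by (auto simp: P_def Iq)
    show "A \<inter> B \<in> P" if AB: "A \<in> P" "B \<in> P" for A B
    proof -
      obtain p q p' q' where "A = I p q" "B = I p' q'" using AB unfolding P_def by blast
      moreover have "of_rat (max p p') = max (of_rat p) (of_rat p' :: real)" "of_rat (min q q') = min (of_rat q) (of_rat q' :: real)"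
        by (simp_all add: max_def min_def of_rat_less_eq)
      ultimately have "A \<inter> B = I (max p p') (min q q')" by (auto simp: I_def)
      then show ?thesis by (auto simp: P_def)
    qed
    show "\<exists>C\<subseteq>P. countable C \<and> \<Union>C = G" if G: "open G" for G
    proof -
      obtain W where W: "open W" "G = c -` W" using c(2)[OF G] by metis
      let ?C = "(\<lambda>(p, q). I p q) ` {(p::rat, q::rat). {of_rat p<..of_rat q} \<subseteq> W}"
      have "\<Union>?C = c -` (\<Union>(p, q)\<in>{(p::rat, q::rat). {of_rat p<..of_rat q} \<subseteq> W}. {of_rat p<..of_rat q})"
        by (auto simp: I_def)
      also have "\<dots> = G" using open_real_rational_intervals[OF W(1)] W(2) by simp
      finally have "\<Union>?C = G" .
      then show ?thesis by (intro exI[of _ ?C]) (auto simp: P_def)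
    qed
    show "(\<lambda>n. measure (N n) A) \<longlonglongrightarrow> measure N0 A" if A: "A \<in> P" for A
    proof -
      obtain p q where pq: "A = I p q" using A by (auto simp: P_def)
      have d: "measure m A = (if p \<le> q then measure m {x. c x \<le> of_rat q} - measure m {x. c x \<le> of_rat p} else 0)"
        if m: "sets m = sets borel" "finite_measure m" for m
      proof (cases "p \<le> q")
        case True
        then have "{x. c x \<le> of_rat p} \<subseteq> {x. c x \<le> of_rat q}" using of_rat_less_eq order_trans by blast
        then show ?thesis using True unfolding pq Iq
          by (simp add: finite_measure.finite_measure_Diff[OF m(2)] m(1))
      next
        case False
        then have "A = {}" unfolding pq I_def using of_rat_less[of q p, where 'a=real] by (auto simp: not_le)
        then show ?thesis using False by simp
      qed
      show ?thesis unfolding d[OF sets_N(1) fin(1)] d[OF sets_N(2) fin(2)]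
        by (auto intro!: tendsto_intros conv)
    qed
  qed (use total f in auto)
qed

lemma coded_cdf_tendsto_imp:
  assumes "\<And>q. (\<lambda>n. coded_cdf (\<eta> n) q) \<longlonglongrightarrow> coded_cdf \<eta>0 q"
  shows "(\<eta> :: nat \<Rightarrow> 'a::polish_space fin_measure) \<longlonglongrightarrow> \<eta>0"
proof (rule fm_tendstoI)
  fix f :: "'a \<Rightarrow> real" assume f: "continuous_on UNIV f" "bounded (range f)"
  show "(\<lambda>n. \<integral>x. f x \<partial>fm_measure (\<eta> n)) \<longlonglongrightarrow> (\<integral>x. f x \<partial>fm_measure \<eta>0)"
  proof (rule cdf_tendsto_imp_weak[where c=line_code])
    show "\<exists>W. open W \<and> G = line_code -` W" if "open G" for G :: "'a set" using line_code_open[OF that] by metis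
    show "(\<lambda>n. measure (fm_measure (\<eta> n)) UNIV) \<longlonglongrightarrow> measure (fm_measure \<eta>0) UNIV"
      using assms[of 1] by (simp add: coded_cdf_ge_1)
  qed (use f assms in \<open>auto simp: coded_cdf_def\<close>)
qed

lemma fun_tendsto_component:
  fixes g :: "'b \<Rightarrow> 'i::countable \<Rightarrow> real"
  assumes "(g \<longlongrightarrow> h) F"
  shows "((\<lambda>n. g n i) \<longlongrightarrow> h i) F"
proof -
  have "continuous_on UNIV (\<lambda>x::'i \<Rightarrow> real. x i)"
    by (rule continuous_on_product_then_coordinatewise) (rule continuous_on_id)
  then have "isCont (\<lambda>x::'i \<Rightarrow> real. x i) h"
    using continuous_on_eq_continuous_at[OF open_UNIV] by blast
  from isCont_tendsto_compose[OF this assms] show ?thesis .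
qed

text \<open>The weak topology is coarser than the topology of pointwise convergence of coded distribution
  functions.  Hence measurability of a map into the space of measures can be checked on the latter.\<close>

lemma fm_open_coded:
  assumes V: "open (V :: 'a::polish_space fin_measure set)"
  shows "\<exists>G. open G \<and> V = coded_cdf -` G"
proof -
  define G where "G = \<Union>{G. open G \<and> coded_cdf -` G \<subseteq> V}"
  have "V \<subseteq> coded_cdf -` G"
  proof
    fix \<eta>0 assume \<eta>0: "\<eta>0 \<in> V"
    have "\<exists>k. coded_cdf -` ball (coded_cdf \<eta>0) (1 / Suc k) \<subseteq> V"
    proof (rule ccontr)
      assume neg: "\<not> ?thesis"
      have "\<exists>\<eta>. dist (coded_cdf \<eta>0) (coded_cdf \<eta>) < 1 / Suc k \<and> \<eta> \<notin> V" for k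
      proof -
        have "\<not> coded_cdf -` ball (coded_cdf \<eta>0) (1 / Suc k) \<subseteq> V" using neg by blast
        then show ?thesis by (auto simp: subset_eq)
      qed
      then obtain \<eta> where \<eta>: "\<And>k. dist (coded_cdf \<eta>0) (coded_cdf (\<eta> k)) < 1 / Suc k" "\<And>k. \<eta> k \<notin> V" by metis
      have "(\<lambda>k. coded_cdf (\<eta> k)) \<longlonglongrightarrow> coded_cdf \<eta>0"
        by (rule metric_tendsto_imp_tendsto[OF LIMSEQ_inverse_real_of_nat])
          (use \<eta>(1) in \<open>auto intro!: always_eventually less_imp_le simp: dist_commute inverse_eq_divide simp del: of_nat_Suc\<close>)
      then have "\<eta> \<longlonglongrightarrow> \<eta>0" by (intro coded_cdf_tendsto_imp fun_tendsto_component)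
      from topological_tendstoD[OF this V \<eta>0] \<eta>(2) show False by (simp add: eventually_sequentially)
    qed
    then obtain k where "coded_cdf -` ball (coded_cdf \<eta>0) (1 / Suc k) \<subseteq> V" by blast
    moreover have "coded_cdf \<eta>0 \<in> ball (coded_cdf \<eta>0) (1 / Suc k)" by simp
    ultimately show "\<eta>0 \<in> coded_cdf -` G" unfolding G_def by blast
  qed
  then show ?thesis by (intro exI[of _ G]) (auto simp: G_def)
qed

lemma fm_measurableI:
  assumes "\<And>q. (\<lambda>z. coded_cdf (\<Phi> z) q) \<in> borel_measurable M"
  shows "\<Phi> \<in> M \<rightarrow>\<^sub>M (borel :: 'a::polish_space fin_measure measure)"
proof (rule borel_measurableI)
  fix S :: "'a fin_measure set" assume "open S"
  then obtain G where G: "open G" "S = coded_cdf -` G" using fm_open_coded by blast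
  have "(\<lambda>z. coded_cdf (\<Phi> z)) \<in> borel_measurable M"
    by (rule measurable_coordinatewise_then_product) (rule assms)
  then have "(\<lambda>z. coded_cdf (\<Phi> z)) -` G \<inter> space M \<in> sets M" using G(1) by (auto intro: measurable_sets)
  then show "\<Phi> -` S \<inter> space M \<in> sets M" by (simp add: G(2) vimage_def)
qed

text \<open>Finite measures agree when they assign the same integrals to bounded continuous functions.\<close>

lemma finite_measure_eqI_continuous:
  fixes N N0 :: "'a::metric_space measure"
  assumes sets_N: "sets N = sets borel" "sets N0 = sets borel"
    and fin: "finite_measure N" "finite_measure N0"
    and eq: "\<And>f::'a \<Rightarrow> real. continuous_on UNIV f \<Longrightarrow> bounded (range f) \<Longrightarrow> (\<integral>x. f x \<partial>N) = (\<integral>x. f x \<partial>N0)"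
  shows "N = N0"
proof (rule measure_eqI_generator_eq[OF Int_stable_open, of UNIV])
  show "emeasure N G = emeasure N0 G" if "G \<in> {S. open S}" for G
  proof -
    have G: "open G" using that by simp
    have lim: "(\<lambda>k. \<integral>x. open_approx G k x \<partial>m) \<longlonglongrightarrow> measure m G"
      if m: "sets m = sets borel" "finite_measure m" for m
    proof -
      interpret finite_measure m by (rule m(2))
      note m(1)[measurable_cong]
      have "(\<lambda>k. \<integral>x. open_approx G k x \<partial>m) \<longlonglongrightarrow> (\<integral>x. indicator G x \<partial>m)"
        using G m(1) by (intro integral_dominated_convergence[where w="\<lambda>_. 1"])
          (auto intro!: open_approx_tendsto intro: borel_measurable_indicator)
      then show ?thesis using G m(1) sets_eq_imp_space_eq[OF m(1)] by simp
    qed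
    from lim[OF sets_N(1) fin(1)] lim[OF sets_N(2) fin(2)] have "measure N G = measure N0 G"
      by (simp add: eq[OF open_approx_continuous open_approx_bounded] LIMSEQ_unique)
    then show ?thesis by (simp add: finite_measure.emeasure_eq_measure[OF fin(1)] finite_measure.emeasure_eq_measure[OF fin(2)])
  qed
  show "range (\<lambda>_::nat. UNIV) \<subseteq> {S::'a set. open S}" by auto
  show "emeasure N UNIV \<noteq> \<infinity>" for i :: nat by (simp add: finite_measure.emeasure_eq_measure[OF fin(1)])
qed (auto simp: borel_sigma_sets_open sets_N)

lemma finite_measure_eq_cdf:
  fixes N N0 :: "'a::metric_space measure" and c :: "'a \<Rightarrow> real"
  assumes sets_N: "sets N = sets borel" "sets N0 = sets borel"
    and fin: "finite_measure N" "finite_measure N0"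
    and c: "c \<in> borel_measurable borel" "\<And>G. open G \<Longrightarrow> \<exists>W. open W \<and> G = c -` W"
    and cdf: "\<And>q::rat. measure N {x. c x \<le> of_rat q} = measure N0 {x. c x \<le> of_rat q}"
    and total: "measure N UNIV = measure N0 UNIV"
  shows "N = N0"
proof (rule finite_measure_eqI_continuous[OF sets_N fin])
  show "(\<integral>x. f x \<partial>N) = (\<integral>x. f x \<partial>N0)"
    if f: "continuous_on UNIV f" "bounded (range f)" for f :: "'a \<Rightarrow> real"
  proof -
    have "(\<lambda>n::nat. \<integral>x. f x \<partial>N) \<longlonglongrightarrow> (\<integral>x. f x \<partial>N0)"
      by (rule cdf_tendsto_imp_weak[OF sets_N fin c _ _ f]) (simp_all add: cdf total)
    then show ?thesis by (simp add: LIMSEQ_const_iff)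
  qed
qed

section \<open>Decoding finite measures\<close>

text \<open>A code \<open>z\<close> of a finite measure determines the numbers \<open>1 - exp (- F q)\<close>, where \<open>F\<close> is the
  coded distribution function.  The measure is recovered from the codes that satisfy the
  constraints which these numbers obey.\<close>

definition fm_code :: "'a::polish_space fin_measure \<Rightarrow> real" where
  "fm_code \<eta> = family_code (\<lambda>q::rat. 1 - exp (- coded_cdf \<eta> q))"

definition consistent_code :: "real \<Rightarrow> bool" where
  "consistent_code z \<longleftrightarrow>
     (\<forall>q::rat. family_decode q z < 1) \<and>
     (\<forall>p q::rat. p \<le> q \<longrightarrow> family_decode p z \<le> family_decode q z) \<and>
     (\<forall>q::rat. q < 0 \<longrightarrow> family_decode q z = 0) \<and>
     (\<forall>q::rat. 1 \<le> q \<longrightarrow> family_decode q z = family_decode (1::rat) z) \<and>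
     (\<forall>q::rat. \<forall>n::nat. \<exists>p>q. family_decode p z < family_decode q z + 1 / Suc n)"

definition decoded_inf :: "real \<Rightarrow> real \<Rightarrow> real" where
  "decoded_inf z x = (INF q\<in>{q::rat. x < of_rat q}. family_decode q z)"

definition decoded_cdf :: "real \<Rightarrow> real \<Rightarrow> real" where
  "decoded_cdf z x = - ln (1 - decoded_inf z x)"

definition line_measure :: "real \<Rightarrow> real measure" where
  "line_measure z =
     (if consistent_code z then interval_measure (decoded_cdf z) else null_measure borel)"

definition fm_decode :: "real \<Rightarrow> 'a::polish_space fin_measure" where
  "fm_decode z = Fin_Measure (distr (line_measure z) borel line_decode)"

lemma fm_code_measurable [measurable]: "fm_code \<in> borel_measurable borel"
  unfolding fm_code_def[abs_def] by (rule family_code_measurable) simp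

lemma family_decode_fm_code: "family_decode q (fm_code \<eta>) = 1 - exp (- coded_cdf \<eta> (q::rat))"
  unfolding fm_code_def by (rule family_decode_code) (auto simp: coded_cdf_nonneg)

lemma family_decode_measurable [measurable]: "family_decode (i::'i::countable) \<in> borel_measurable borel"
  by (rule borel_measurable_continuous_onI[OF continuous_family_decode])

lemma consistent_code_measurable [measurable]: "Measurable.pred borel consistent_code"
  unfolding consistent_code_def[abs_def] by measurable

lemma coded_cdf_mono:
  assumes "p \<le> q"
  shows "coded_cdf (\<eta>::'a::polish_space fin_measure) p \<le> coded_cdf \<eta> q"
proof -
  have "(of_rat p :: real) \<le> of_rat q" using assms by (simp add: of_rat_less_eq)
  then have "{x::'a. line_code x \<le> of_rat p} \<subseteq> {x. line_code x \<le> of_rat q}" by auto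
  then show ?thesis unfolding coded_cdf_def
    by (intro finite_measure.finite_measure_mono[OF finite_fm_measure]) simp_all
qed

lemma rat_above_seq: "\<exists>p. (\<forall>n. x < of_rat (p n)) \<and> decseq p \<and> (\<lambda>n. of_rat (p n)) \<longlonglongrightarrow> (x::real)"
proof -
  have ex: "\<exists>q. x < of_rat q \<and> of_rat q < x + e" if "0 < e" for e
    using of_rat_dense[of x "x + e"] that by auto
  define p where "p = rec_nat (SOME q. x < of_rat q \<and> of_rat q < x + 1)
    (\<lambda>n p. SOME q. x < of_rat q \<and> of_rat q < min (of_rat p) (x + 1 / Suc (Suc n)))"
  have p: "x < of_rat (p n) \<and> of_rat (p n) < x + 1 / Suc n \<and> (0 < n \<longrightarrow> of_rat (p n) < (of_rat (p (n - 1)) :: real))" for n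
  proof (induction n)
    case 0
    show ?case using someI_ex[OF ex[of 1]] by (simp add: p_def)
  next
    case (Suc n)
    have "\<exists>q. x < of_rat q \<and> of_rat q < min (of_rat (p n)) (x + 1 / Suc (Suc n))"
      using of_rat_dense[of x "min (of_rat (p n)) (x + 1 / Suc (Suc n))"] Suc by auto
    from someI_ex[OF this] show ?case by (simp add: p_def)
  qed
  have "decseq p" unfolding decseq_Suc_iff
  proof
    fix n show "p (Suc n) \<le> p n" using p[of "Suc n"] by (simp add: of_rat_less)
  qed
  moreover have "(\<lambda>n. of_rat (p n)) \<longlonglongrightarrow> x"
  proof (rule tendsto_sandwich[of "\<lambda>_. x" _ _ "\<lambda>n. x + 1 / Suc n"])
    have "(\<lambda>n. x + inverse (real (Suc n))) \<longlonglongrightarrow> x + 0"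
      by (intro tendsto_intros LIMSEQ_inverse_real_of_nat)
    then show "(\<lambda>n. x + 1 / real (Suc n)) \<longlonglongrightarrow> x" by (simp add: inverse_eq_divide)
  qed (use p in \<open>auto intro!: always_eventually less_imp_le simp del: of_nat_Suc\<close>)
  ultimately show ?thesis using p by blast
qed

lemma coded_cdf_right_continuous:
  fixes \<eta> :: "'a::polish_space fin_measure"
  assumes "0 < e"
  shows "\<exists>p::rat. q < p \<and> coded_cdf \<eta> p < coded_cdf \<eta> q + e"
proof -
  interpret finite_measure "fm_measure \<eta>" by simp
  obtain p where p: "\<And>n. of_rat q < (of_rat (p n) :: real)" "decseq p" "(\<lambda>n. of_rat (p n)) \<longlonglongrightarrow> (of_rat q :: real)"
    using rat_above_seq[of "of_rat q"] by blast
  have "(\<lambda>n. measure (fm_measure \<eta>) {x. line_code x \<le> of_rat (p n)}) \<longlonglongrightarrow>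
      measure (fm_measure \<eta>) (\<Inter>n. {x. line_code x \<le> of_rat (p n)})"
  proof (rule finite_Lim_measure_decseq)
    show "decseq (\<lambda>n. {x::'a. line_code x \<le> of_rat (p n)})"
    proof (rule decseq_SucI)
      fix n
      have "(of_rat (p (Suc n)) :: real) \<le> of_rat (p n)" using p(2) by (simp add: of_rat_less_eq decseq_Suc_iff)
      then show "{x::'a. line_code x \<le> of_rat (p (Suc n))} \<subseteq> {x. line_code x \<le> of_rat (p n)}" by auto
    qed
  qed auto
  also have "(\<Inter>n. {x::'a. line_code x \<le> of_rat (p n)}) = {x. line_code x \<le> of_rat q}"
  proof (intro equalityI subsetI)
    fix x :: 'a assume "x \<in> (\<Inter>n. {x. line_code x \<le> of_rat (p n)})"
    then show "x \<in> {x. line_code x \<le> of_rat q}"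
      using LIMSEQ_le_const[OF p(3), of "line_code x"] by auto
  next
    fix x :: 'a assume "x \<in> {x. line_code x \<le> of_rat q}"
    then show "x \<in> (\<Inter>n. {x. line_code x \<le> of_rat (p n)})" using p(1) by (auto intro!: order_trans[OF _ less_imp_le[OF p(1)]])
  qed
  finally have "(\<lambda>n. coded_cdf \<eta> (p n)) \<longlonglongrightarrow> coded_cdf \<eta> q" by (simp add: coded_cdf_def)
  then have "eventually (\<lambda>n. coded_cdf \<eta> (p n) < coded_cdf \<eta> q + e) sequentially"
    using assms by (intro order_tendstoD) auto
  then obtain n where "coded_cdf \<eta> (p n) < coded_cdf \<eta> q + e" by (auto simp: eventually_sequentially)
  then show ?thesis using p(1)[of n] by (auto simp: of_rat_less intro!: exI[of _ "p n"])
qed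

lemma coded_cdf_neg: "q < 0 \<Longrightarrow> coded_cdf (\<eta>::'a::polish_space fin_measure) q = 0"
proof -
  assume "q < 0"
  then have "(of_rat q :: real) < 0" by simp
  then have "\<not> line_code x \<le> of_rat q" for x :: 'a using line_code_bounds(1)[of x] by linarith
  then show ?thesis by (simp add: coded_cdf_def)
qed

lemma consistent_fm_code: "consistent_code (fm_code (\<eta>::'a::polish_space fin_measure))"
proof -
  have "\<exists>p>q. family_decode p (fm_code \<eta>) < family_decode q (fm_code \<eta>) + 1 / Suc n" for q :: rat and n :: nat
  proof -
    have "0 < - ln (1 - 1 / real (Suc (Suc n)))" by (simp add: field_simps)
    from coded_cdf_right_continuous[OF this, of q \<eta>] obtain p where p: "q < p"
      "coded_cdf \<eta> p < coded_cdf \<eta> q - ln (1 - 1 / real (Suc (Suc n)))" by auto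
    have "1 - 1 / real (Suc (Suc n)) > 0" by simp
    then have "exp (- coded_cdf \<eta> q) * (1 - 1 / real (Suc (Suc n))) = exp (- coded_cdf \<eta> q + ln (1 - 1 / real (Suc (Suc n))))"
      by (simp only: exp_add exp_ln)
    also have "\<dots> < exp (- coded_cdf \<eta> p)" using p by simp
    finally have "exp (- coded_cdf \<eta> q) - exp (- coded_cdf \<eta> p) < exp (- coded_cdf \<eta> q) * (1 / real (Suc (Suc n)))"
      by (simp add: algebra_simps)
    also have "\<dots> \<le> 1 * (1 / real (Suc n))"
      by (intro mult_mono) (auto simp: coded_cdf_nonneg field_simps)
    finally show ?thesis using p(1) by (auto simp: family_decode_fm_code intro!: exI[of _ p])
  qed
  then show ?thesis
    unfolding consistent_code_def
    by (auto simp: family_decode_fm_code coded_cdf_mono coded_cdf_ge_1 coded_cdf_neg)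
qed

text \<open>On consistent codes the right-continuous extension of the decoded values to the line is a
  distribution function with the prescribed values at rational points.\<close>

context
  fixes z :: real
  assumes z: "consistent_code z"
begin

lemma family_decode_lt_1: "family_decode (q::rat) z < 1"
  using z by (simp add: consistent_code_def)

lemma family_decode_mono: "p \<le> q \<Longrightarrow> family_decode (p::rat) z \<le> family_decode q z"
  using z by (simp add: consistent_code_def)

lemma rats_above_nonempty: "{q::rat. x < (of_rat q :: real)} \<noteq> {}"
  using of_rat_dense[of x "x + 1"] by auto

lemma bdd_family_decode: "bdd_below ((\<lambda>q::rat. family_decode q z) ` A)"
  by (intro bdd_belowI[of _ 0]) (auto simp: family_decode_bounds)

lemma decoded_inf_less_iff: "decoded_inf z x < c \<longleftrightarrow> (\<exists>q::rat. x < of_rat q \<and> family_decode q z < c)"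
  unfolding decoded_inf_def by (subst cINF_less_iff[OF rats_above_nonempty bdd_family_decode]) auto

lemma decoded_inf_le: "x < of_rat q \<Longrightarrow> decoded_inf z x \<le> family_decode q z"
  unfolding decoded_inf_def by (intro cINF_lower bdd_family_decode) auto

lemma decoded_inf_nonneg: "0 \<le> decoded_inf z x"
  unfolding decoded_inf_def by (intro cINF_greatest rats_above_nonempty family_decode_bounds)

lemma decoded_inf_lt_1: "decoded_inf z x < 1"
  using rats_above_nonempty[of x] family_decode_lt_1 by (auto simp: decoded_inf_less_iff)

lemma decoded_inf_mono: "x \<le> y \<Longrightarrow> decoded_inf z x \<le> decoded_inf z y"
  unfolding decoded_inf_def by (intro cINF_superset_mono rats_above_nonempty bdd_family_decode) auto

lemma decoded_inf_rat: "decoded_inf z (of_rat q) = family_decode q z"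
proof (rule antisym)
  show "decoded_inf z (of_rat q) \<le> family_decode q z"
  proof (rule field_le_epsilon)
    fix e :: real assume "0 < e"
    then obtain n where n: "inverse (real (Suc n)) < e" using reals_Archimedean by blast
    obtain p where "q < p" "family_decode p z < family_decode q z + 1 / Suc n"
      using z unfolding consistent_code_def by metis
    then show "decoded_inf z (of_rat q) \<le> family_decode q z + e"
      using decoded_inf_le[of "of_rat q" p] n by (simp add: of_rat_less inverse_eq_divide)
  qed
  show "family_decode q z \<le> decoded_inf z (of_rat q)"
    unfolding decoded_inf_def
    by (intro cINF_greatest rats_above_nonempty family_decode_mono) (auto simp: of_rat_less)
qed

lemma decoded_cdf_mono: "x \<le> y \<Longrightarrow> decoded_cdf z x \<le> decoded_cdf z y"
  using decoded_inf_mono[of x y] decoded_inf_lt_1[of x] decoded_inf_lt_1[of y] by (simp add: decoded_cdf_def)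

lemma decoded_cdf_right_continuous: "continuous (at_right x) (decoded_cdf z)"
proof -
  have "((decoded_inf z) \<longlongrightarrow> decoded_inf z x) (at_right x)"
  proof (rule order_tendstoI)
    fix a assume "a < decoded_inf z x"
    then show "eventually (\<lambda>y. a < decoded_inf z y) (at_right x)"
      unfolding eventually_at_right_field using decoded_inf_mono[of x]
      by (intro exI[of _ "x + 1"]) (auto intro!: less_le_trans[of a "decoded_inf z x"])
  next
    fix a assume "decoded_inf z x < a"
    then obtain q :: rat where q: "x < of_rat q" "family_decode q z < a" by (auto simp: decoded_inf_less_iff)
    then show "eventually (\<lambda>y. decoded_inf z y < a) (at_right x)"
      unfolding eventually_at_right_field
      by (intro exI[of _ "of_rat q"]) (auto intro: le_less_trans[OF decoded_inf_le])
  qed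
  then have "((\<lambda>y. - ln (1 - decoded_inf z y)) \<longlongrightarrow> - ln (1 - decoded_inf z x)) (at_right x)"
    using decoded_inf_lt_1[of x] by (intro tendsto_intros) auto
  then show ?thesis by (simp add: continuous_within decoded_cdf_def[abs_def])
qed

lemma decoded_cdf_rat: "decoded_cdf z (of_rat q) = - ln (1 - family_decode q z)"
  by (simp add: decoded_cdf_def decoded_inf_rat)

lemma decoded_cdf_neg: "x < 0 \<Longrightarrow> decoded_cdf z x = 0"
proof -
  assume "x < 0"
  then obtain q where "x < of_rat q" "(of_rat q :: real) < 0" using of_rat_dense by blast
  then have "decoded_inf z x \<le> 0" using decoded_inf_le[of x q] z by (auto simp: consistent_code_def)
  then show ?thesis using decoded_inf_nonneg[of x] by (simp add: decoded_cdf_def)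
qed

lemma decoded_cdf_ge_1: "1 \<le> x \<Longrightarrow> decoded_cdf z x = decoded_cdf z 1"
proof -
  have *: "decoded_inf z x = family_decode (1::rat) z" if "1 \<le> x" for x
  proof -
    have "family_decode q z = family_decode (1::rat) z" if "x < of_rat q" for q :: rat
    proof -
      have "(of_rat 1 :: real) \<le> of_rat q" using that \<open>1 \<le> x\<close> unfolding of_rat_1 by linarith
      then have "1 \<le> q" by (simp only: of_rat_less_eq)
      then show ?thesis using z unfolding consistent_code_def by blast
    qed
    then have "decoded_inf z x = (INF q\<in>{q::rat. x < of_rat q}. family_decode (1::rat) z)"
      unfolding decoded_inf_def by (intro INF_cong) auto
    then show ?thesis using rats_above_nonempty by simp
  qed
  show "1 \<le> x \<Longrightarrow> decoded_cdf z x = decoded_cdf z 1" by (simp add: decoded_cdf_def *)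
qed

lemma decoded_cdf_at_bot: "(decoded_cdf z \<longlongrightarrow> 0) at_bot"
  unfolding tendsto_def eventually_at_bot_dense
  by (auto simp: decoded_cdf_neg intro!: exI[of _ 0])

lemma decoded_cdf_at_top: "(decoded_cdf z \<longlongrightarrow> decoded_cdf z 1) at_top"
  by (rule tendsto_eventually, rule eventually_mono[OF eventually_ge_at_top[of 1]]) (rule decoded_cdf_ge_1)

lemma decoded_cdf_nonneg: "0 \<le> decoded_cdf z x"
  using decoded_inf_nonneg[of x] decoded_inf_lt_1[of x] by (simp add: decoded_cdf_def)

lemma line_measure_consistent:
  shows "finite_measure (line_measure z)"
    and "measure (line_measure z) {..x} = decoded_cdf z x"
    and "measure (line_measure z) UNIV = decoded_cdf z 1"
proof -
  note F = decoded_cdf_mono decoded_cdf_right_continuous decoded_cdf_at_bot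
  have N: "line_measure z = interval_measure (decoded_cdf z)" using z by (simp add: line_measure_def)
  have U: "emeasure (line_measure z) UNIV = decoded_cdf z 1"
    unfolding N by (rule interval_measure_UNIV[OF F decoded_cdf_at_top decoded_cdf_nonneg])
  show "finite_measure (line_measure z)" by (rule finite_measureI) (use U N in auto)
  show "measure (line_measure z) {..x} = decoded_cdf z x"
    unfolding N by (rule measure_interval_measure_Iic[OF F])
  show "measure (line_measure z) UNIV = decoded_cdf z 1"
    using U decoded_cdf_nonneg by (simp add: measure_def)
qed

end

lemma sets_line_measure [simp, measurable_cong]: "sets (line_measure z) = sets borel"
  by (simp add: line_measure_def)

lemma space_line_measure [simp]: "space (line_measure z) = UNIV"
  using sets_eq_imp_space_eq[OF sets_line_measure] by simp

lemma finite_line_measure [simp]: "finite_measure (line_measure z)"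
proof (cases "consistent_code z")
  case False
  then show ?thesis by (auto simp: line_measure_def intro: finite_measureI)
qed (rule line_measure_consistent)

lemma line_measure_measurable:
  assumes "B \<in> sets borel"
  shows "(\<lambda>z. measure (line_measure z) B) \<in> borel_measurable borel"
proof (rule kernel_measurable[where G="range (\<lambda>a. {..a::real})" and \<Omega>=UNIV])
  show "Int_stable (range (\<lambda>a. {..a::real}))" by (auto simp: Int_stable_def Int_atMost)
  have borel: "sets borel = sigma_sets UNIV (range (\<lambda>a. {..a::real}))"
    by (subst borel_eq_atMost) simp
  then show "sets (line_measure z) = sigma_sets UNIV (range (\<lambda>a. {..a}))" for z by simp
  show "B \<in> sigma_sets UNIV (range (\<lambda>a. {..a}))" using assms borel by simp
  have cdf: "(\<lambda>z. if consistent_code z then decoded_cdf z x else 0) \<in> borel_measurable borel" for x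
  proof -
    have "(\<lambda>z. if consistent_code z then decoded_inf z x else 0) \<in> borel_measurable borel"
    proof (subst borel_measurable_iff_less, rule allI)
      fix a
      have "{z \<in> space borel. (if consistent_code z then decoded_inf z x else 0) < a} =
        {z \<in> space borel. if consistent_code z then (\<exists>q\<in>{q::rat. x < of_rat q}. family_decode q z < a) else 0 < a}"
        by (auto simp: decoded_inf_less_iff)
      also have "\<dots> \<in> sets borel" by measurable
      finally show "{z \<in> space borel. (if consistent_code z then decoded_inf z x else 0) < a} \<in> sets borel" .
    qed
    then have "(\<lambda>z. - ln (1 - (if consistent_code z then decoded_inf z x else 0))) \<in> borel_measurable borel"
      by measurable
    also have "(\<lambda>z. - ln (1 - (if consistent_code z then decoded_inf z x else 0))) =
      (\<lambda>z. if consistent_code z then decoded_cdf z x else 0)"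
      by (auto simp: decoded_cdf_def)
    finally show ?thesis .
  qed
  have "measure (line_measure z) {..x} = (if consistent_code z then decoded_cdf z x else 0)" for z x
    using line_measure_consistent(2)[of z x] by (auto simp: line_measure_def)
  then show "(\<lambda>z. measure (line_measure z) A) \<in> borel_measurable borel" if "A \<in> range (\<lambda>a. {..a})" for A
    using that cdf by auto
  have "measure (line_measure z) UNIV = (if consistent_code z then decoded_cdf z 1 else 0)" for z
    using line_measure_consistent(3)[of z] by (auto simp: line_measure_def)
  then show "(\<lambda>z. measure (line_measure z) UNIV) \<in> borel_measurable borel" using cdf by simp
qed auto

lemma fm_measure_fm_decode: "fm_measure (fm_decode z) = distr (line_measure z) borel line_decode"
  unfolding fm_decode_def
  by (rule fm_measure_Fin_Measure) (auto intro!: finite_measure.finite_measure_distr)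

lemma coded_cdf_fm_decode:
  "coded_cdf (fm_decode z :: 'a::polish_space fin_measure) q =
     measure (line_measure z) {w. line_code (line_decode w :: 'a) \<le> of_rat q}"
  by (simp add: coded_cdf_def fm_measure_fm_decode measure_distr vimage_def)

lemma fm_decode_measurable [measurable]: "fm_decode \<in> borel \<rightarrow>\<^sub>M (borel :: 'a::polish_space fin_measure measure)"
proof (rule fm_measurableI)
  fix q
  have "{w\<in>space borel. line_code (line_decode w :: 'a) \<le> of_rat q} \<in> sets borel" by measurable
  then show "(\<lambda>z. coded_cdf (fm_decode z :: 'a fin_measure) q) \<in> borel_measurable borel"
    unfolding coded_cdf_fm_decode by (intro line_measure_measurable) simp
qed

lemma line_measure_fm_code:
  "line_measure (fm_code \<eta>) = distr (fm_measure (\<eta>::'a::polish_space fin_measure)) borel line_code"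
proof (rule finite_measure_eq_cdf[where c="\<lambda>x. x"])
  note z = consistent_fm_code[of \<eta>]
  have d: "decoded_cdf (fm_code \<eta>) (of_rat q) = coded_cdf \<eta> q" for q
    using decoded_cdf_rat[OF z] by (simp add: family_decode_fm_code)
  show "measure (line_measure (fm_code \<eta>)) {x. x \<le> of_rat q} = measure (distr (fm_measure \<eta>) borel line_code) {x. x \<le> of_rat q}" for q
  proof -
    have "measure (line_measure (fm_code \<eta>)) {x. x \<le> of_rat q} = coded_cdf \<eta> q"
      using line_measure_consistent(2)[OF z, of "of_rat q"] d by (simp add: atMost_def)
    then show ?thesis by (simp add: measure_distr vimage_def coded_cdf_def)
  qed
  show "measure (line_measure (fm_code \<eta>)) UNIV = measure (distr (fm_measure \<eta>) borel line_code) UNIV"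
    using line_measure_consistent(3)[OF z] d[of 1] coded_cdf_ge_1[of 1 \<eta>] by (simp add: measure_distr)
  show "finite_measure (distr (fm_measure \<eta>) borel line_code)" by (auto intro!: finite_measure.finite_measure_distr)
qed auto

lemma fm_decode_code [simp]: "fm_decode (fm_code \<eta>) = (\<eta> :: 'a::polish_space fin_measure)"
proof -
  have "fm_measure (fm_decode (fm_code \<eta>)) = distr (fm_measure \<eta>) borel (line_decode \<circ> line_code)"
    unfolding fm_measure_fm_decode line_measure_fm_code by (subst distr_distr) auto
  also have "line_decode \<circ> line_code = (\<lambda>x::'a. x)" by auto
  also have "distr (fm_measure \<eta>) borel (\<lambda>x. x) = fm_measure \<eta>" by (rule distr_id2) simp
  finally show ?thesis by (simp add: fm_measure_inject)
qed

section \<open>A continuity theorem for random measures\<close>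

lemma decoded_integral_measurable:
  assumes f: "f \<in> bpB"
  shows "(\<lambda>z. \<integral>x. f x \<partial>line_measure z) \<in> borel_measurable borel"
proof -
  have fm: "f \<in> borel_measurable borel" using f by (rule bpB_measurable)
  have "(\<lambda>z. emeasure (line_measure z) A) \<in> borel_measurable borel" if "A \<in> sets borel" for A
    using line_measure_measurable[OF that]
    by (simp add: finite_measure.emeasure_eq_measure)
  then have "(\<lambda>z. \<integral>\<^sup>+x. ennreal (f x) \<partial>line_measure z) \<in> borel_measurable borel"
    by (intro kernel_nn_integral_measurable[where S=borel]) (use fm in auto)
  moreover have "(\<integral>x. f x \<partial>line_measure z) = enn2real (\<integral>\<^sup>+x. ennreal (f x) \<partial>line_measure z)" for z
    using f fm by (intro integral_eq_nn_integral) (auto simp: bpB_nonneg cong: measurable_cong_sets)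
  ultimately show ?thesis by simp
qed

lemma indicator_line_code_bpB: "indicator {x::'a::polish_space. line_code x \<le> c} \<in> bpB"
  by (rule bpBI[where B=1]) (auto intro!: borel_measurable_indicator)

text \<open>Step functions of the code: their integrals are the sums of coded distribution functions.\<close>

abbreviation line_steps :: "rat list \<Rightarrow> 'a::polish_space \<Rightarrow> real" where
  "line_steps qs x \<equiv> \<Sum>q\<leftarrow>qs. indicator {x. line_code x \<le> of_rat q} x"

lemma sum_indicator_bpB:
  "(\<lambda>x::'a::polish_space. line_steps qs x) \<in> bpB"
proof (rule bpBI[where B="real (length qs)"])
  show "(\<lambda>x::'a. line_steps qs x) \<in> borel_measurable borel"
  proof (induction qs)
    case (Cons q qs)
    then show ?case using bpB_measurable[OF indicator_line_code_bpB[of "of_rat q", where 'a='a]]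
      by (simp add: borel_measurable_add)
  qed simp
  show "0 \<le> (line_steps qs (x::'a))" for x by (induction qs) auto
  show "(line_steps qs (x::'a)) \<le> real (length qs)" for x
    by (induction qs) (auto simp: indicator_def)
qed

lemma integral_sum_indicator:
  fixes \<eta> :: "'a::polish_space fin_measure"
  shows "(\<integral>x. (line_steps qs x) \<partial>fm_measure \<eta>) = (\<Sum>q\<leftarrow>qs. coded_cdf \<eta> q)"
proof (induction qs)
  case (Cons q qs)
  have "(\<integral>x. (\<Sum>q\<leftarrow>q # qs. indicator {x. line_code x \<le> of_rat q} x :: real) \<partial>fm_measure \<eta>) =
    (\<integral>x. indicator {x. line_code x \<le> of_rat q} x \<partial>fm_measure \<eta> :: real) +
    (\<integral>x. (line_steps qs x) \<partial>fm_measure \<eta>)"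
    unfolding list.map sum_list.Cons
    by (intro Bochner_Integration.integral_add integrable_fm_bpB indicator_line_code_bpB sum_indicator_bpB)
  then show ?case using Cons by (simp add: coded_cdf_def)
qed simp

lemma one_le_epsilon: "(\<And>e. 0 < e \<Longrightarrow> 1 - e \<le> x) \<Longrightarrow> 1 \<le> (x::real)"
  by (rule field_le_epsilon) (simp add: algebra_simps)

lemma le_zero_epsilon: "(\<And>e. 0 < e \<Longrightarrow> x \<le> e) \<Longrightarrow> x \<le> (0::real)"
  by (rule field_le_epsilon) simp

lemma exp_neg_diff_le: "0 \<le> (a::real) \<Longrightarrow> a \<le> b \<Longrightarrow> exp (- a) - exp (- b) \<le> 1 - exp (- (b - a))"
proof -
  assume "0 \<le> a" "a \<le> b"
  have "exp (- a) - exp (- b) = exp (- a) * (1 - exp (- (b - a)))" by (simp add: algebra_simps flip: exp_add)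
  also have "\<dots> \<le> 1 * (1 - exp (- (b - a)))" using \<open>0 \<le> a\<close> \<open>a \<le> b\<close> by (intro mult_right_mono) auto
  finally show ?thesis by simp
qed

text \<open>Compactness part of the continuity theorem.  The laws are coded as laws on \<open>[0, 1]\<close>, where a
  subsequence converges and is realised by almost surely convergent variables \<open>Yn\<close> with limit \<open>Y\<close>.
  The coded distribution functions depend continuously on the code, and so converge almost surely.
  The assumption \<open>ac\<close> on the limit functional excludes the three ways in which the limit could fail to
  be the distribution function of a measure on the original space: infinite mass, loss of right
  continuity, and mass outside the image of the space.  The last one uses outer regularity of the
  image of \<open>\<nu>\<close>.\<close>

proposition fm_laplace_continuity:
  fixes N :: "nat \<Rightarrow> 'a::polish_space fin_measure measure" and L :: "('a \<Rightarrow> real) \<Rightarrow> real" and \<nu> :: "'a fin_measure"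
  assumes N: "\<And>n. prob_space (N n)" "\<And>n. sets (N n) = sets borel"
    and conv: "\<And>f. f \<in> bpB \<Longrightarrow> (\<lambda>n. \<integral>\<eta>. exp (- (\<integral>x. f x \<partial>fm_measure \<eta>)) \<partial>N n) \<longlonglongrightarrow> L f"
    and ac: "\<And>e. 0 < e \<Longrightarrow> \<exists>d>0. \<forall>f\<in>bpB. (\<forall>x. f x \<le> 1) \<longrightarrow> (\<integral>x. f x \<partial>fm_measure \<nu>) < d \<longrightarrow> 1 - L f < e"
  obtains r Q where "strict_mono r" "prob_space Q" "sets Q = sets (borel :: 'a fin_measure measure)"
    "\<And>g::'a fin_measure \<Rightarrow> real. continuous_on UNIV g \<Longrightarrow> bounded (range g) \<Longrightarrow>
       (\<lambda>n. \<integral>\<eta>. g \<eta> \<partial>N (r n)) \<longlonglongrightarrow> (\<integral>\<eta>. g \<eta> \<partial>Q)"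
    "\<And>qs. (\<integral>\<eta>. exp (- (\<Sum>q\<leftarrow>qs. coded_cdf \<eta> q)) \<partial>Q) = L (\<lambda>x. line_steps qs x)"
proof -
  note N(2)[measurable_cong]
  define m where "m n = distr (N n) borel fm_code" for n
  have Zm[measurable]: "fm_code \<in> borel_measurable (N n)" for n by measurable
  have rd: "real_distribution (m n)" for n
    unfolding m_def by (rule prob_space.real_distribution_distr[OF N(1) Zm])
  have "tight m" unfolding tight_def
  proof (intro conjI allI impI rd)
    fix e :: real assume "0 < e"
    have "measure (m n) {-1<..1} = 1" for n
    proof -
      have "fm_code -` {-1<..1} \<inter> space (N n) = space (N n)"
        using family_code_bounds by (fastforce simp: fm_code_def intro: less_le_trans[of "-1" 0])
      then show ?thesis by (simp add: m_def measure_distr prob_space.prob_space[OF N(1)])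
    qed
    then show "\<exists>a b. a < b \<and> (\<forall>n. 1 - e < measure (m n) {a<..b})" using \<open>0 < e\<close> by (intro exI[of _ "-1"] exI[of _ 1]) auto
  qed
  then obtain r M0 where r: "strict_mono r" and M0: "real_distribution M0" "weak_conv_m (m \<circ> id \<circ> r) M0"
    using tight_imp_convergent_subsubsequence[of m id] by (auto simp: strict_mono_id)
  have wc: "weak_conv_m (\<lambda>n. m (r n)) M0" using M0(2) by (simp add: comp_def)
  from Skorohod[OF rd M0(1) wc] obtain S :: "real measure" and Yn Y where S: "prob_space S"
    and Yn': "\<forall>n. Yn n \<in> borel_measurable S" "\<forall>n. distr S borel (Yn n) = m (r n)"
    and Y': "Y \<in> measurable S lborel" and lim': "\<forall>w\<in>space S. (\<lambda>n. Yn n w) \<longlonglongrightarrow> Y w"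
    by blast
  have Yn: "Yn n \<in> borel_measurable S" and dYn: "distr S borel (Yn n) = m (r n)" for n using Yn' by auto
  have Y: "Y \<in> borel_measurable S" using Y' by simp
  have lim: "(\<lambda>n. Yn n w) \<longlonglongrightarrow> Y w" if "w \<in> space S" for w using lim' that by auto
  note [measurable] = Yn Y
  interpret S: prob_space S by fact
  let ?D = "\<lambda>(q::rat) z. family_decode q z"
  have int: "(\<integral>w. h (Yn n w) \<partial>S) = (\<integral>\<eta>. h (fm_code \<eta>) \<partial>N (r n))" if [measurable]: "h \<in> borel_measurable borel" for h :: "real \<Rightarrow> real" and n
  proof -
    have "(\<integral>w. h (Yn n w) \<partial>S) = (\<integral>z. h z \<partial>distr S borel (Yn n))" by (subst integral_distr) auto
    also have "\<dots> = (\<integral>\<eta>. h (fm_code \<eta>) \<partial>N (r n))" unfolding dYn m_def by (subst integral_distr) auto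
    finally show ?thesis .
  qed
  have aeYn: "AE w in S. R (Yn n w)" if [measurable]: "Measurable.pred borel R" and "\<And>\<eta>::'a fin_measure. R (fm_code \<eta>)" for R n
  proof -
    have "AE z in distr S borel (Yn n). R z" unfolding dYn m_def using that by (subst AE_distr_iff) auto
    then show ?thesis by (subst (asm) AE_distr_iff) auto
  qed
  have dct: "(\<lambda>n. \<integral>w. h (Yn n w) \<partial>S) \<longlonglongrightarrow> (\<integral>w. h (Y w) \<partial>S)"
    if [measurable]: "h \<in> borel_measurable borel" and "AE w in S. (\<lambda>n. h (Yn n w)) \<longlonglongrightarrow> h (Y w)" "\<And>z. \<bar>h z\<bar> \<le> 1" for h :: "real \<Rightarrow> real"
    using that by (intro integral_dominated_convergence[where w="\<lambda>_. 1"]) auto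
  have D_lim: "(\<lambda>n. ?D q (Yn n w)) \<longlonglongrightarrow> ?D q (Y w)" if "w \<in> space S" for q w
    using continuous_on_tendsto_compose[OF continuous_family_decode lim[OF that]] by auto
  have D_abs: "\<bar>?D q z\<bar> \<le> 1" for q z using family_decode_bounds[of q z] by auto
  have aeYn_cons: "AE w in S. \<forall>n. consistent_code (Yn n w)"
    unfolding AE_all_countable by (auto intro!: aeYn consistent_fm_code)

  text \<open>Joint Laplace transforms of the limit.\<close>
  have laplace: "(\<integral>w. (\<Prod>q\<leftarrow>qs. 1 - ?D q (Y w)) \<partial>S) = L (\<lambda>x. line_steps qs x)" for qs
  proof -
    let ?S = "\<lambda>z. \<Prod>q\<leftarrow>qs. 1 - ?D q z"
    have Sm: "?S \<in> borel_measurable borel" by (induction qs) (auto intro!: borel_measurable_times borel_measurable_diff)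
    have Sb: "0 \<le> ?S z \<and> ?S z \<le> 1" for z
      by (induction qs) (auto simp: family_decode_bounds intro!: mult_le_one)
    have Sl: "(\<lambda>n. ?S (Yn n w)) \<longlonglongrightarrow> ?S (Y w)" if "w \<in> space S" for w
      by (induction qs) (auto intro!: tendsto_intros D_lim that)
    have SZ: "?S (fm_code \<eta>) = exp (- (\<integral>x. (line_steps qs x) \<partial>fm_measure \<eta>))" for \<eta> :: "'a fin_measure"
      unfolding integral_sum_indicator by (induction qs) (auto simp: family_decode_fm_code exp_add[symmetric])
    have "(\<lambda>n. \<integral>w. ?S (Yn n w) \<partial>S) \<longlonglongrightarrow> (\<integral>w. ?S (Y w) \<partial>S)"
      by (intro dct Sm AE_I2 Sl) (use Sb in \<open>auto simp: abs_of_nonneg\<close>)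
    moreover have "(\<lambda>n. \<integral>w. ?S (Yn n w) \<partial>S) \<longlonglongrightarrow> L (\<lambda>x. line_steps qs x)"
      unfolding int[OF Sm] SZ using LIMSEQ_subseq_LIMSEQ[OF conv[OF sum_indicator_bpB] r] by (simp add: comp_def)
    ultimately show ?thesis by (rule LIMSEQ_unique)
  qed

  text \<open>The limit of the codes is almost surely consistent.\<close>
  have lt1: "AE w in S. ?D 1 (Y w) < 1"
  proof -
    have "1 - e \<le> S.prob {w\<in>space S. ?D 1 (Y w) < 1}" if e: "0 < e" for e
    proof -
      obtain d where d: "0 < d" "\<And>f. f \<in> bpB \<Longrightarrow> (\<And>x. f x \<le> 1) \<Longrightarrow> (\<integral>x. f x \<partial>fm_measure \<nu>) < d \<Longrightarrow> 1 - L f < e"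
        using ac[OF e] by metis
      define b where "b = measure (fm_measure \<nu>) UNIV + 1"
      define c where "c = min 1 (d / (2 * b))"
      have mpos: "0 < b" using measure_nonneg[of "fm_measure \<nu>" UNIV] unfolding b_def by linarith
      have c: "0 < c" "c \<le> 1" using d(1) mpos by (auto simp: c_def)
      have "c * b \<le> d / (2 * b) * b"
        using mpos by (intro mult_right_mono) (auto simp: c_def)
      also have "\<dots> = d / 2" using mpos by simp
      finally have cd: "c * measure (fm_measure \<nu>) UNIV < d" using c d(1) by (simp add: algebra_simps b_def)
      have cB: "(\<lambda>_::'a. c) \<in> bpB" using c by (intro bpBI[where B=c]) auto
      have "1 - L (\<lambda>_. c) < e" using c cd by (intro d(2)[OF cB]) (auto simp: mult.commute)
      moreover have "(\<integral>w. (1 - ?D 1 (Y w)) powr c \<partial>S) = L (\<lambda>_. c)"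
      proof (rule LIMSEQ_unique)
        show "(\<lambda>n. \<integral>w. (1 - ?D 1 (Yn n w)) powr c \<partial>S) \<longlonglongrightarrow> (\<integral>w. (1 - ?D 1 (Y w)) powr c \<partial>S)"
        proof (rule dct)
          show "\<bar>(1 - ?D 1 z) powr c\<bar> \<le> 1" for z
            using powr_mono2[of c "1 - ?D 1 z" 1] c family_decode_bounds[of "1::rat" z] by auto
          show "AE w in S. (\<lambda>n. (1 - ?D 1 (Yn n w)) powr c) \<longlonglongrightarrow> (1 - ?D 1 (Y w)) powr c"
            using c by (intro AE_I2 tendsto_powr' tendsto_intros D_lim) (auto simp: family_decode_bounds)
        qed measurable
        have hm: "(\<lambda>z. (1 - ?D 1 z) powr c) \<in> borel_measurable borel" by measurable
        have "(1 - ?D 1 (fm_code \<eta>)) powr c = exp (- (\<integral>x. c \<partial>fm_measure \<eta>))" for \<eta> :: "'a fin_measure"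
          by (simp add: family_decode_fm_code coded_cdf_ge_1 powr_def)
        then show "(\<lambda>n. \<integral>w. (1 - ?D 1 (Yn n w)) powr c \<partial>S) \<longlonglongrightarrow> L (\<lambda>_. c)"
          unfolding int[OF hm] using LIMSEQ_subseq_LIMSEQ[OF conv[OF cB] r] by (simp add: comp_def)
      qed
      moreover have "(\<integral>w. (1 - ?D 1 (Y w)) powr c \<partial>S) \<le> (\<integral>w. indicator {w\<in>space S. ?D 1 (Y w) < 1} w \<partial>S)"
      proof (rule integral_mono)
        have b: "\<bar>(1 - ?D 1 z) powr c\<bar> \<le> 1" for z
          using powr_mono2[of c "1 - ?D 1 z" 1] c family_decode_bounds[of "1::rat" z] by auto
        then show "integrable S (\<lambda>w. (1 - ?D 1 (Y w)) powr c)" by (intro S.integrable_const_bound[of _ 1]) auto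
        show "integrable S (\<lambda>w. indicator {w\<in>space S. ?D 1 (Y w) < 1} w :: real)"
          by (intro S.integrable_const_bound[of _ 1]) auto
        fix w assume "w \<in> space S"
        then show "(1 - ?D 1 (Y w)) powr c \<le> indicator {w\<in>space S. ?D 1 (Y w) < 1} w"
          using b[of "Y w"] family_decode_bounds[of "1::rat" "Y w"] by (auto simp: indicator_def)
      qed
      ultimately show ?thesis by simp
    qed
    then have "1 \<le> S.prob {w\<in>space S. ?D 1 (Y w) < 1}" by (rule one_le_epsilon)
    then have "S.prob {w\<in>space S. ?D 1 (Y w) < 1} = 1" using S.prob_le_1 by (intro antisym) auto
    then show ?thesis by (subst (asm) S.prob_Collect_eq_1) auto
  qed
  have mono_lim: "AE w in S. (\<forall>p q. p \<le> q \<longrightarrow> ?D p (Y w) \<le> ?D q (Y w)) \<and> (\<forall>q<0. ?D q (Y w) = 0) \<and> (\<forall>q\<ge>1. ?D q (Y w) = ?D 1 (Y w))"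
    using aeYn_cons AE_space
  proof eventually_elim
    case (elim w)
    have c: "\<And>n p q. p \<le> q \<Longrightarrow> ?D p (Yn n w) \<le> ?D q (Yn n w)" "\<And>n q. q < 0 \<Longrightarrow> ?D q (Yn n w) = 0"
      "\<And>n q. 1 \<le> q \<Longrightarrow> ?D q (Yn n w) = ?D 1 (Yn n w)"
      using elim(1) unfolding consistent_code_def by blast+
    show ?case
    proof (intro conjI allI impI)
      show "?D p (Y w) \<le> ?D q (Y w)" if "p \<le> q" for p q
        by (rule LIMSEQ_le[OF D_lim D_lim]) (use elim(2) c(1)[OF that] in auto)
      show "?D q (Y w) = 0" if "q < 0" for q
        using D_lim[OF elim(2), of q] c(2)[OF that] by (simp add: LIMSEQ_const_iff)
      show "?D q (Y w) = ?D 1 (Y w)" if "1 \<le> q" for q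
        using LIMSEQ_unique[OF D_lim[OF elim(2), of q]] D_lim[OF elim(2), of 1] c(3)[OF that] by simp
    qed
  qed
  have rc: "AE w in S. \<exists>p>q. ?D p (Y w) < ?D q (Y w) + 1 / Suc n" for q :: rat and n :: nat
  proof -
    define B where "B = {w\<in>space S. \<forall>p\<in>{p. q < p}. ?D q (Y w) + 1 / Suc n \<le> ?D p (Y w)}"
    have B[measurable]: "B \<in> sets S" unfolding B_def by measurable
    have "S.prob B / Suc n \<le> e" if e: "0 < e" for e
    proof -
      obtain d where d: "0 < d" "\<And>f. f \<in> bpB \<Longrightarrow> (\<And>x. f x \<le> 1) \<Longrightarrow> (\<integral>x. f x \<partial>fm_measure \<nu>) < d \<Longrightarrow> 1 - L f < e"
        using ac[OF e] by metis
      obtain p where p: "q < p" "coded_cdf \<nu> p < coded_cdf \<nu> q + d" using coded_cdf_right_continuous[OF d(1)] by blast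
      have pq: "(of_rat q :: real) \<le> of_rat p" using p(1) by (simp add: of_rat_less_eq)
      define f where "f x = (indicator {x::'a. line_code x \<le> of_rat p} x - indicator {x. line_code x \<le> of_rat q} x :: real)" for x
      have fb: "0 \<le> f x" "f x \<le> 1" for x using pq by (auto simp: f_def indicator_def)
      have fB: "f \<in> bpB" by (rule bpBI[OF _ fb]) (auto simp: f_def[abs_def] intro!: borel_measurable_indicator borel_measurable_diff)
      have fi: "(\<integral>x. f x \<partial>fm_measure \<eta>) = coded_cdf \<eta> p - coded_cdf \<eta> q" for \<eta>
        unfolding f_def coded_cdf_def
        by (subst Bochner_Integration.integral_diff) (auto intro!: integrable_fm_bpB indicator_line_code_bpB)
      have Lf: "1 - L f < e" by (rule d(2)[OF fB fb(2)]) (use fi[of \<nu>] p(2) in simp)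
      have hm: "(\<lambda>z. ?D p z - ?D q z) \<in> borel_measurable borel" by measurable
      have hb: "\<bar>?D p z - ?D q z\<bar> \<le> 1" for z using family_decode_bounds[of p z] family_decode_bounds[of q z] by auto
      have "(\<integral>w. ?D p (Y w) - ?D q (Y w) \<partial>S) \<le> 1 - L f"
      proof (rule LIMSEQ_le)
        show "(\<lambda>n. \<integral>w. ?D p (Yn n w) - ?D q (Yn n w) \<partial>S) \<longlonglongrightarrow> (\<integral>w. ?D p (Y w) - ?D q (Y w) \<partial>S)"
          by (rule dct[OF hm _ hb]) (intro AE_I2 tendsto_intros D_lim)
        show "(\<lambda>n. 1 - (\<integral>\<eta>. exp (- (\<integral>x. f x \<partial>fm_measure \<eta>)) \<partial>N (r n))) \<longlonglongrightarrow> 1 - L f"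
          using LIMSEQ_subseq_LIMSEQ[OF conv[OF fB] r] by (intro tendsto_intros) (simp add: comp_def)
        have "(\<integral>w. ?D p (Yn n w) - ?D q (Yn n w) \<partial>S) \<le> 1 - (\<integral>\<eta>. exp (- (\<integral>x. f x \<partial>fm_measure \<eta>)) \<partial>N (r n))" for n
        proof -
          interpret Nr: prob_space "N (r n)" by (rule N)
          have [measurable]: "(\<lambda>\<eta>. \<integral>x. f x \<partial>fm_measure \<eta>) \<in> borel_measurable borel" by (rule fm_integral_measurable[OF fB])
          have "0 \<le> (\<integral>x. f x \<partial>fm_measure \<eta>)" for \<eta> by (rule bochner_nonneg) (simp add: fb)
          then have ie: "integrable (N (r n)) (\<lambda>\<eta>. exp (- (\<integral>x. f x \<partial>fm_measure \<eta>)))"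
            by (intro Nr.integrable_const_bound[of _ 1]) auto
          have "(\<integral>w. ?D p (Yn n w) - ?D q (Yn n w) \<partial>S) = (\<integral>\<eta>. ?D p (fm_code \<eta>) - ?D q (fm_code \<eta>) \<partial>N (r n))"
            by (rule int[OF hm])
          also have "\<dots> \<le> (\<integral>\<eta>. 1 - exp (- (\<integral>x. f x \<partial>fm_measure \<eta>)) \<partial>N (r n))"
          proof (rule integral_mono)
            show "integrable (N (r n)) (\<lambda>\<eta>. ?D p (fm_code \<eta>) - ?D q (fm_code \<eta>))"
              using hb by (intro Nr.integrable_const_bound[of _ 1]) auto
            show "integrable (N (r n)) (\<lambda>\<eta>. 1 - exp (- (\<integral>x. f x \<partial>fm_measure \<eta>)))" using ie by auto
            show "?D p (fm_code \<eta>) - ?D q (fm_code \<eta>) \<le> 1 - exp (- (\<integral>x. f x \<partial>fm_measure \<eta>))" for \<eta> :: "'a fin_measure"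
              unfolding fi family_decode_fm_code
              using exp_neg_diff_le[of "coded_cdf \<eta> q" "coded_cdf \<eta> p"] coded_cdf_mono[of q p \<eta>] p(1) by (simp add: coded_cdf_nonneg)
          qed
          also have "\<dots> = 1 - (\<integral>\<eta>. exp (- (\<integral>x. f x \<partial>fm_measure \<eta>)) \<partial>N (r n))" using ie by (simp add: Nr.prob_space)
          finally show ?thesis .
        qed
        then show "\<exists>k. \<forall>n\<ge>k. (\<integral>w. ?D p (Yn n w) - ?D q (Yn n w) \<partial>S) \<le> 1 - (\<integral>\<eta>. exp (- (\<integral>x. f x \<partial>fm_measure \<eta>)) \<partial>N (r n))" by auto
      qed
      moreover have "(\<integral>w. indicator B w / Suc n \<partial>S) \<le> (\<integral>w. ?D p (Y w) - ?D q (Y w) \<partial>S)"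
      proof (rule integral_mono_AE)
        show "integrable S (\<lambda>w. indicator B w / real (Suc n))"
          by (intro integrable_divide S.integrable_const_bound[of _ 1]) auto
        show "integrable S (\<lambda>w. ?D p (Y w) - ?D q (Y w))" using hb by (intro S.integrable_const_bound[of _ 1]) auto
        show "AE w in S. indicator B w / Suc n \<le> ?D p (Y w) - ?D q (Y w)"
          using mono_lim
        proof eventually_elim
          case (elim w)
          then have "?D q (Y w) \<le> ?D p (Y w)" using p(1) by auto
          moreover have "?D q (Y w) + 1 / Suc n \<le> ?D p (Y w)" if "w \<in> B" using that p(1) by (auto simp: B_def)
          ultimately show ?case by (auto simp: indicator_def)
        qed
      qed
      ultimately show ?thesis using Lf by simp
    qed
    then have "S.prob B / Suc n \<le> 0" by (rule le_zero_epsilon)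
    then have "S.prob B = 0" using measure_nonneg[of S B] by (simp add: divide_le_0_iff del: of_nat_Suc)
    then have "AE w in S. w \<notin> B" by (intro AE_not_in) (simp add: null_sets_def S.emeasure_eq_measure)
    then show ?thesis using AE_space by eventually_elim (auto simp: B_def not_le)
  qed
  have aeY_cons: "AE w in S. consistent_code (Y w)"
  proof -
    have "AE w in S. \<forall>q n. \<exists>p>q. ?D p (Y w) < ?D q (Y w) + 1 / Suc n"
      unfolding AE_all_countable using rc by auto
    from this mono_lim lt1 show ?thesis
    proof eventually_elim
      case (elim w)
      have "?D q (Y w) < 1" for q
      proof (cases "1 \<le> q")
        case True then show ?thesis using elim(2,3) by metis
      next
        case False then have "?D q (Y w) \<le> ?D 1 (Y w)" using elim(2) by (metis linear)
        then show ?thesis using elim(3) by simp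
      qed
      then have "\<forall>q::rat. ?D q (Y w) < 1" by blast
      with elim(1,2) show ?case unfolding consistent_code_def by (intro conjI) (elim conjE; assumption)+
    qed
  qed

  text \<open>The decoded measure is carried by the image of the state space.\<close>
  let ?K = line_measure
  have K_lim: "AE w in S. \<forall>h. continuous_on UNIV h \<longrightarrow> bounded (range h) \<longrightarrow>
      (\<lambda>n. \<integral>y. h y \<partial>?K (Yn n w)) \<longlonglongrightarrow> (\<integral>y. h y \<partial>?K (Y w) :: real)"
    using aeYn_cons aeY_cons AE_space
  proof eventually_elim
    case (elim w)
    have c: "(\<lambda>n. decoded_cdf (Yn n w) (of_rat q)) \<longlonglongrightarrow> decoded_cdf (Y w) (of_rat q)" for q
      using D_lim[OF elim(3)] family_decode_lt_1[OF elim(2), of q] elim(1,2)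
      by (auto simp: decoded_cdf_rat intro!: tendsto_intros)
    show ?case
    proof (intro allI impI)
      fix h :: "real \<Rightarrow> real" assume h: "continuous_on UNIV h" "bounded (range h)"
      show "(\<lambda>n. \<integral>y. h y \<partial>?K (Yn n w)) \<longlonglongrightarrow> (\<integral>y. h y \<partial>?K (Y w))"
      proof (rule cdf_tendsto_imp_weak[where c="\<lambda>x. x", OF _ _ _ _ _ _ _ _ h])
        show "(\<lambda>n. measure (?K (Yn n w)) {x. x \<le> of_rat q}) \<longlonglongrightarrow> measure (?K (Y w)) {x. x \<le> of_rat q}" for q
          using c[of q] elim by (simp add: line_measure_consistent(2) flip: atMost_def)
        show "(\<lambda>n. measure (?K (Yn n w)) UNIV) \<longlonglongrightarrow> measure (?K (Y w)) UNIV"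
          using c[of 1] elim by (simp add: line_measure_consistent(3))
      qed auto
    qed
  qed
  have K_laplace: "(\<integral>w. exp (- (\<integral>y. h y \<partial>?K (Y w))) \<partial>S) = L (\<lambda>x. h (line_code x))"
    if h: "continuous_on UNIV h" "\<And>y. 0 \<le> h y" "\<And>y. h y \<le> 1" for h :: "real \<Rightarrow> real"
  proof (rule LIMSEQ_unique)
    have hm[measurable]: "h \<in> borel_measurable borel" by (rule borel_measurable_continuous_onI[OF h(1)])
    have hB: "h \<in> bpB" by (rule bpBI[OF hm h(2,3)])
    have hB': "(\<lambda>x::'a. h (line_code x)) \<in> bpB" by (rule bpBI[where B=1]) (use h in auto)
    have hbd: "bounded (range h)" using h by (auto simp: bounded_iff abs_of_nonneg intro!: exI[of _ 1])
    have gm: "(\<lambda>z. exp (- (\<integral>y. h y \<partial>?K z))) \<in> borel_measurable borel"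
      using decoded_integral_measurable[OF hB] by simp
    show "(\<lambda>n. \<integral>w. exp (- (\<integral>y. h y \<partial>?K (Yn n w))) \<partial>S) \<longlonglongrightarrow> (\<integral>w. exp (- (\<integral>y. h y \<partial>?K (Y w))) \<partial>S)"
    proof (rule dct[OF gm])
      show "AE w in S. (\<lambda>n. exp (- (\<integral>y. h y \<partial>?K (Yn n w)))) \<longlonglongrightarrow> exp (- (\<integral>y. h y \<partial>?K (Y w)))"
        using K_lim by eventually_elim (use h(1) hbd in \<open>auto intro!: tendsto_intros\<close>)
      show "\<bar>exp (- (\<integral>y. h y \<partial>?K z))\<bar> \<le> 1" for z
        using bochner_nonneg[of "?K z" h] h(2) by auto
    qed
    have "exp (- (\<integral>y. h y \<partial>?K (fm_code \<eta>))) = exp (- (\<integral>x. h (line_code x) \<partial>fm_measure \<eta>))" for \<eta> :: "'a fin_measure"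
      unfolding line_measure_fm_code by (subst integral_distr) auto
    then show "(\<lambda>n. \<integral>w. exp (- (\<integral>y. h y \<partial>?K (Yn n w))) \<partial>S) \<longlonglongrightarrow> L (\<lambda>x. h (line_code x))"
      unfolding int[OF gm] using LIMSEQ_subseq_LIMSEQ[OF conv[OF hB'] r] by (simp add: comp_def)
  qed
  define A where "A = {y. line_code (line_decode y :: 'a) \<noteq> y}"
  have A[measurable]: "A \<in> sets borel"
  proof -
    have "{y\<in>space borel. line_code (line_decode y :: 'a) \<noteq> y} \<in> sets borel" by measurable
    then show ?thesis by (simp add: A_def)
  qed
  have KA: "AE w in S. measure (?K (Y w)) A = 0"
  proof -
    have Km[measurable]: "(\<lambda>w. measure (?K (Y w)) B) \<in> borel_measurable S" if "B \<in> sets borel" for B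
      by (rule measurable_compose[OF Y line_measure_measurable[OF that]])
    have iK: "integrable S (\<lambda>w. exp (- measure (?K (Y w)) B))" if "B \<in> sets borel" for B
      by (intro S.integrable_const_bound[of _ 1]) (use that in auto)
    have "1 - e \<le> (\<integral>w. exp (- measure (?K (Y w)) A) \<partial>S)" if e: "0 < e" for e
    proof -
      obtain d where d: "0 < d" "\<And>f. f \<in> bpB \<Longrightarrow> (\<And>x. f x \<le> 1) \<Longrightarrow> (\<integral>x. f x \<partial>fm_measure \<nu>) < d \<Longrightarrow> 1 - L f < e"
        using ac[OF e] by metis
      let ?\<nu> = "distr (fm_measure \<nu>) borel (line_code :: 'a \<Rightarrow> real)"
      interpret \<nu>: finite_measure "fm_measure \<nu>" by simp
      interpret \<nu>': finite_measure ?\<nu> by (rule \<nu>.finite_measure_distr) simp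
      have "emeasure ?\<nu> A = 0" by (simp add: emeasure_distr A_def)
      moreover have "emeasure ?\<nu> A = (INF U\<in>{U. A \<subseteq> U \<and> open U}. emeasure ?\<nu> U)"
        by (rule outer_regular) (auto simp: \<nu>'.emeasure_eq_measure)
      ultimately have "(INF U\<in>{U. A \<subseteq> U \<and> open U}. emeasure ?\<nu> U) < ennreal d" using d by simp
      then obtain U where U: "A \<subseteq> U" "open U" "emeasure ?\<nu> U < ennreal d" unfolding INF_less_iff by auto
      have U'[measurable]: "U \<in> sets borel" using U by auto
      have \<nu>U: "measure ?\<nu> U < d" using U(3) by (simp add: \<nu>'.emeasure_eq_measure ennreal_less_iff)
      have "1 - e \<le> (\<integral>w. exp (- (\<integral>y. open_approx U k y \<partial>?K (Y w))) \<partial>S)" for k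
      proof -
        have B: "(\<lambda>x::'a. open_approx U k (line_code x)) \<in> bpB" by (rule bpBI[where B=1]) (auto simp: open_approx_bounds)
        have "(\<integral>x. open_approx U k (line_code x) \<partial>fm_measure \<nu>) \<le> (\<integral>x. indicator U (line_code x) \<partial>fm_measure \<nu>)"
          by (intro integral_mono integrable_fm_bpB[OF B] \<nu>.integrable_const_bound[of _ 1]) (auto simp: open_approx_le)
        also have "\<dots> = (\<integral>y. indicator U y \<partial>?\<nu>)" by (subst integral_distr) auto
        also have "\<dots> < d" using \<nu>U by simp
        finally have "1 - L (\<lambda>x. open_approx U k (line_code x)) < e" by (intro d(2)[OF B]) (auto simp: open_approx_bounds)
        then show ?thesis by (subst K_laplace) (auto simp: open_approx_bounds open_approx_continuous)
      qed
      moreover have "(\<lambda>k. \<integral>w. exp (- (\<integral>y. open_approx U k y \<partial>?K (Y w))) \<partial>S) \<longlonglongrightarrow> (\<integral>w. exp (- measure (?K (Y w)) U) \<partial>S)"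
      proof (rule integral_dominated_convergence[where w="\<lambda>_. 1"])
        show "(\<lambda>w. exp (- measure (?K (Y w)) U)) \<in> borel_measurable S" by measurable
        show "(\<lambda>w. exp (- (\<integral>y. open_approx U k y \<partial>?K (Y w)))) \<in> borel_measurable S" for k
          using measurable_compose[OF Y decoded_integral_measurable[OF open_approx_bpB]] by simp
        show "AE w in S. norm (exp (- (\<integral>y. open_approx U k y \<partial>?K (Y w)))) \<le> 1" for k
          by (auto intro!: AE_I2 bochner_nonneg simp: open_approx_bounds)
        show "AE w in S. (\<lambda>k. exp (- (\<integral>y. open_approx U k y \<partial>?K (Y w)))) \<longlonglongrightarrow> exp (- measure (?K (Y w)) U)"
        proof (intro AE_I2 tendsto_intros)
          fix w
          interpret K: finite_measure "?K (Y w)" by simp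
          have "(\<lambda>k. \<integral>y. open_approx U k y \<partial>?K (Y w)) \<longlonglongrightarrow> (\<integral>y. indicator U y \<partial>?K (Y w))"
            using U(2) by (intro integral_dominated_convergence[where w="\<lambda>_. 1"]) (auto intro!: open_approx_tendsto)
          then show "(\<lambda>k. \<integral>y. open_approx U k y \<partial>?K (Y w)) \<longlonglongrightarrow> measure (?K (Y w)) U" by simp
        qed
      qed auto
      ultimately have "1 - e \<le> (\<integral>w. exp (- measure (?K (Y w)) U) \<partial>S)" by (intro LIMSEQ_le_const) auto
      also have "\<dots> \<le> (\<integral>w. exp (- measure (?K (Y w)) A) \<partial>S)"
        using U by (intro integral_mono iK) (auto intro!: finite_measure.finite_measure_mono)
      finally show ?thesis .
    qed
    then have "1 \<le> (\<integral>w. exp (- measure (?K (Y w)) A) \<partial>S)" by (rule one_le_epsilon)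
    then have "(\<integral>w. 1 - exp (- measure (?K (Y w)) A) \<partial>S) \<le> 0" using iK[OF A] by (simp add: S.prob_space)
    moreover have "0 \<le> (\<integral>w. 1 - exp (- measure (?K (Y w)) A) \<partial>S)" by (intro bochner_nonneg) auto
    ultimately have "(\<integral>w. 1 - exp (- measure (?K (Y w)) A) \<partial>S) = 0" by simp
    then have "AE w in S. 1 - exp (- measure (?K (Y w)) A) = 0"
      using iK[OF A] by (subst (asm) integral_nonneg_eq_0_iff_AE) auto
    then show ?thesis by eventually_elim simp
  qed
  have cdfY: "AE w in S. \<forall>q. coded_cdf (fm_decode (Y w) :: 'a fin_measure) q = - ln (1 - ?D q (Y w))"
    using KA aeY_cons
  proof eventually_elim
    case (elim w)
    interpret K: finite_measure "?K (Y w)" by simp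
    have "emeasure (?K (Y w)) A = 0" using elim by (simp add: K.emeasure_eq_measure)
    then have ae: "AE y in ?K (Y w). y \<notin> A" by (intro AE_not_in) (auto simp: null_sets_def)
    show ?case
    proof
      fix q
      have [measurable]: "{y. line_code (line_decode y :: 'a) \<le> of_rat q} \<in> sets borel"
      proof -
        have "{y\<in>space borel. line_code (line_decode y :: 'a) \<le> of_rat q} \<in> sets borel" by measurable
        then show ?thesis by simp
      qed
      have "coded_cdf (fm_decode (Y w) :: 'a fin_measure) q = measure (?K (Y w)) {..of_rat q}"
        unfolding coded_cdf_fm_decode by (rule measure_eq_AE) (use ae in \<open>auto simp: A_def\<close>)
      also have "\<dots> = - ln (1 - ?D q (Y w))"
        using elim by (simp add: line_measure_consistent(2) decoded_cdf_rat)
      finally show "coded_cdf (fm_decode (Y w) :: 'a fin_measure) q = - ln (1 - ?D q (Y w))" .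
    qed
  qed
  have cdfYn: "AE w in S. \<forall>n q. coded_cdf (fm_decode (Yn n w) :: 'a fin_measure) q = - ln (1 - ?D q (Yn n w))"
    unfolding AE_all_countable by (intro allI aeYn) (auto simp: family_decode_fm_code)
  have conv_ae: "AE w in S. (\<lambda>n. fm_decode (Yn n w) :: 'a fin_measure) \<longlonglongrightarrow> fm_decode (Y w)"
    using cdfY cdfYn aeY_cons AE_space
  proof eventually_elim
    case (elim w)
    show ?case
    proof (rule coded_cdf_tendsto_imp)
      fix q
      show "(\<lambda>n. coded_cdf (fm_decode (Yn n w) :: 'a fin_measure) q) \<longlonglongrightarrow> coded_cdf (fm_decode (Y w) :: 'a fin_measure) q"
        using elim D_lim[of w q] family_decode_lt_1[of "Y w" q] by (auto intro!: tendsto_intros)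
    qed
  qed
  define Q where "Q = distr S borel (\<lambda>w. fm_decode (Y w) :: 'a fin_measure)"
  show thesis
  proof (rule that[OF r, of Q])
    show "prob_space Q" unfolding Q_def by (rule S.prob_space_distr) simp
    show "sets Q = sets borel" by (simp add: Q_def)
    show "(\<lambda>n. \<integral>\<eta>. g \<eta> \<partial>N (r n)) \<longlonglongrightarrow> (\<integral>\<eta>. g \<eta> \<partial>Q)" if g: "continuous_on UNIV g" "bounded (range g)" for g :: "'a fin_measure \<Rightarrow> real"
    proof -
      have gm[measurable]: "g \<in> borel_measurable borel" by (rule borel_measurable_continuous_onI[OF g(1)])
      obtain B where B: "\<And>x. \<bar>g x\<bar> \<le> B" using g(2) by (auto simp: bounded_iff)
      have "(\<lambda>n. \<integral>w. g (fm_decode (Yn n w)) \<partial>S) \<longlonglongrightarrow> (\<integral>w. g (fm_decode (Y w)) \<partial>S)"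
      proof (rule integral_dominated_convergence[where w="\<lambda>_. B"])
        show "AE w in S. (\<lambda>n. g (fm_decode (Yn n w))) \<longlonglongrightarrow> g (fm_decode (Y w))"
          using conv_ae by eventually_elim (rule continuous_on_tendsto_compose[OF g(1)], auto)
      qed (use B in auto)
      moreover have "(\<integral>w. g (fm_decode (Yn n w)) \<partial>S) = (\<integral>\<eta>. g \<eta> \<partial>N (r n))" for n
        by (subst int) auto
      moreover have "(\<integral>\<eta>. g \<eta> \<partial>Q) = (\<integral>w. g (fm_decode (Y w)) \<partial>S)" unfolding Q_def by (subst integral_distr) auto
      ultimately show ?thesis by simp
    qed
    show "(\<integral>\<eta>. exp (- (\<Sum>q\<leftarrow>qs. coded_cdf \<eta> q)) \<partial>Q) = L (\<lambda>x. line_steps qs x)" for qs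
    proof -
      have em: "(\<lambda>\<eta>::'a fin_measure. exp (- (\<Sum>q\<leftarrow>qs. coded_cdf \<eta> q))) \<in> borel_measurable borel"
      proof -
        have "(\<lambda>\<eta>::'a fin_measure. \<Sum>q\<leftarrow>qs. coded_cdf \<eta> q) \<in> borel_measurable borel"
          by (induction qs) (auto intro!: borel_measurable_add)
        then show ?thesis by simp
      qed
      have "(\<integral>\<eta>. exp (- (\<Sum>q\<leftarrow>qs. coded_cdf \<eta> q)) \<partial>Q) = (\<integral>w. exp (- (\<Sum>q\<leftarrow>qs. coded_cdf (fm_decode (Y w) :: 'a fin_measure) q)) \<partial>S)"
        unfolding Q_def by (subst integral_distr) (use em in auto)
      also have "\<dots> = (\<integral>w. (\<Prod>q\<leftarrow>qs. 1 - ?D q (Y w)) \<partial>S)"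
      proof (rule integral_cong_AE)
        show "(\<lambda>w. exp (- (\<Sum>q\<leftarrow>qs. coded_cdf (fm_decode (Y w) :: 'a fin_measure) q))) \<in> borel_measurable S"
          by (rule measurable_compose[OF _ em]) simp
        show "(\<lambda>w. \<Prod>q\<leftarrow>qs. 1 - ?D q (Y w)) \<in> borel_measurable S"
          by (induction qs) (auto intro!: borel_measurable_times borel_measurable_diff)
        show "AE w in S. exp (- (\<Sum>q\<leftarrow>qs. coded_cdf (fm_decode (Y w) :: 'a fin_measure) q)) = (\<Prod>q\<leftarrow>qs. 1 - ?D q (Y w))"
          using cdfY aeY_cons
        proof eventually_elim
          case (elim w)
          have "exp (ln (1 - ?D q (Y w))) = 1 - ?D q (Y w)" for q using family_decode_lt_1[OF elim(2), of q] by simp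
          then show ?case using elim(1) by (induction qs) (auto simp: exp_diff exp_minus divide_inverse)
        qed
      qed
      finally show ?thesis unfolding laplace .
    qed
  qed
qed

section \<open>Uniqueness of the law of a random measure\<close>

lemma moments_determine_measure:
  fixes M N :: "real measure"
  assumes sets_MN: "sets M = sets borel" "sets N = sets borel"
    and fin: "finite_measure M" "finite_measure N"
    and supp: "AE x in M. x \<in> {0..1}" "AE x in N. x \<in> {0..1}"
    and moments: "\<And>k. (\<integral>x. x ^ k \<partial>M) = (\<integral>x. x ^ k \<partial>N)"
  shows "M = N"
proof -
  note sets_MN[measurable_cong]
  have pow_int: "integrable m (\<lambda>x. x ^ k)" if m: "sets m = sets borel" "finite_measure m" "AE x in m. x \<in> {0..1}" for m :: "real measure" and k
  proof -
    interpret finite_measure m by (rule m)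
    note m(1)[measurable_cong]
    show ?thesis
    proof (rule integrable_const_bound[of _ 1])
      show "AE x in m. norm (x ^ k) \<le> 1" using m(3) by eventually_elim (auto simp: power_le_one)
    qed simp
  qed
  have poly: "integrable M p \<and> integrable N p \<and> (\<integral>x. p x \<partial>M) = (\<integral>x. p x \<partial>N)" if pp: "real_polynomial_function p" for p
  proof -
    obtain a n where "p = (\<lambda>x. \<Sum>i\<le>n. a i * x ^ i)" using real_polynomial_function_imp_sum[OF pp] by metis
    then show ?thesis
      using pow_int[OF sets_MN(1) fin(1) supp(1)] pow_int[OF sets_MN(2) fin(2) supp(2)] moments
      by (simp add: Bochner_Integration.integral_sum Bochner_Integration.integrable_sum)
  qed
  have cont: "(\<integral>x. f x \<partial>M) = (\<integral>x. f x \<partial>N)" if f: "continuous_on UNIV f" "bounded (range f)" for f :: "real \<Rightarrow> real"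
  proof -
    have fm[measurable]: "f \<in> borel_measurable borel" by (rule borel_measurable_continuous_onI[OF f(1)])
    obtain B where B: "\<And>x. \<bar>f x\<bar> \<le> B" using f(2) by (auto simp: bounded_iff)
    have approx: "\<bar>(\<integral>x. f x \<partial>m) - (\<integral>x. p x \<partial>m)\<bar> \<le> e * measure m UNIV"
      if m: "sets m = sets borel" "finite_measure m" "AE x in m. x \<in> {0..1}" and p: "integrable m p"
        and e: "\<And>x. x \<in> {0..1} \<Longrightarrow> \<bar>f x - p x\<bar> < e" for m :: "real measure" and p and e :: real
    proof -
      interpret finite_measure m by (rule m)
      note m(1)[measurable_cong]
      have fi: "integrable m f" using B by (intro integrable_const_bound[of _ B]) auto
      have "\<bar>(\<integral>x. f x \<partial>m) - (\<integral>x. p x \<partial>m)\<bar> = \<bar>\<integral>x. f x - p x \<partial>m\<bar>" using fi p by simp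
      also have "\<dots> \<le> (\<integral>x. \<bar>f x - p x\<bar> \<partial>m)" by (rule integral_abs_bound)
      also have "\<dots> \<le> (\<integral>x. e \<partial>m)"
      proof (rule integral_mono_AE)
        show "AE x in m. \<bar>f x - p x\<bar> \<le> e" using m(3) by eventually_elim (use e in \<open>auto intro: less_imp_le\<close>)
      qed (use fi p in auto)
      finally show ?thesis using sets_eq_imp_space_eq[OF m(1)] by (simp add: mult.commute)
    qed
    have "\<bar>(\<integral>x. f x \<partial>M) - (\<integral>x. f x \<partial>N)\<bar> \<le> e" if e: "0 < e" for e
    proof -
      define C where "C = measure M UNIV + measure N UNIV + 1"
      have C: "0 < C" using measure_nonneg[of M UNIV] measure_nonneg[of N UNIV] unfolding C_def by linarith
      have "0 < e / C" using e C by simp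
      then obtain p where p: "real_polynomial_function p" "\<And>x. x \<in> {0..1} \<Longrightarrow> \<bar>f x - p x\<bar> < e / C"
        using Stone_Weierstrass_real_polynomial_function[of "{0..1::real}" f "e / C"] f(1) continuous_on_subset by blast
      have "\<bar>(\<integral>x. f x \<partial>M) - (\<integral>x. f x \<partial>N)\<bar> \<le> e / C * measure M UNIV + e / C * measure N UNIV"
        using approx[OF sets_MN(1) fin(1) supp(1) _ p(2)] approx[OF sets_MN(2) fin(2) supp(2) _ p(2)] poly[OF p(1)] by auto
      also have "\<dots> = e / C * (measure M UNIV + measure N UNIV)" by (simp add: algebra_simps)
      also have "\<dots> \<le> e / C * C" using e C by (intro mult_left_mono) (auto simp: C_def)
      finally show ?thesis using C by simp
    qed
    then have "\<bar>(\<integral>x. f x \<partial>M) - (\<integral>x. f x \<partial>N)\<bar> \<le> 0" by (rule le_zero_epsilon)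
    then show ?thesis by simp
  qed
  show ?thesis by (rule finite_measure_eqI_continuous[OF sets_MN fin cont])
qed

text \<open>The law of a random measure is determined by the joint Laplace transforms of its coded
  distribution function.  The moments are turned one at a time into distribution functions, which
  works because the remaining factors form a nonnegative weight.\<close>

lemma coded_laplace_determines_law:
  fixes Q Q' :: "'a::polish_space fin_measure measure"
  assumes Q: "prob_space Q" "sets Q = sets borel" and Q': "prob_space Q'" "sets Q' = sets borel"
    and eq: "\<And>qs. (\<integral>\<eta>. exp (- (\<Sum>q\<leftarrow>qs. coded_cdf \<eta> q)) \<partial>Q) = (\<integral>\<eta>. exp (- (\<Sum>q\<leftarrow>qs. coded_cdf \<eta> q)) \<partial>Q')"
  shows "Q = Q'"
proof -
  note [measurable_cong] = Q(2) Q'(2)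
  let ?y = "\<lambda>q (\<eta>::'a fin_measure). exp (- coded_cdf \<eta> q)"
  define W where "W ps qs \<eta> = (\<Prod>(q, a)\<leftarrow>ps. indicator {..a::real} (?y q \<eta>)) * (\<Prod>q\<leftarrow>qs. ?y q \<eta>)"
    for ps qs and \<eta> :: "'a fin_measure"
  have W_meas[measurable]: "W ps qs \<in> borel_measurable borel" for ps qs
  proof -
    have 1: "(\<lambda>\<eta>. \<Prod>(q, a)\<leftarrow>ps. indicator {..a::real} (?y q \<eta>) :: real) \<in> borel_measurable borel"
    proof (induction ps)
      case (Cons x ps)
      obtain q a where "x = (q, a)" by (cases x)
      then show ?case using Cons by simp
    qed simp
    have 2: "(\<lambda>\<eta>. \<Prod>q\<leftarrow>qs. ?y q \<eta>) \<in> borel_measurable borel" by (induction qs) auto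
    show ?thesis unfolding W_def[abs_def] using 1 2 by (rule borel_measurable_times)
  qed
  have W_bounds: "0 \<le> W ps qs \<eta>" "W ps qs \<eta> \<le> 1" for ps qs \<eta>
  proof -
    have 1: "0 \<le> (\<Prod>(q, a)\<leftarrow>ps. indicator {..a::real} (?y q \<eta>) :: real) \<and> (\<Prod>(q, a)\<leftarrow>ps. indicator {..a::real} (?y q \<eta>)) \<le> (1::real)"
      by (induction ps) (auto intro!: mult_le_one)
    have 2: "0 \<le> (\<Prod>q\<leftarrow>qs. ?y q \<eta>) \<and> (\<Prod>q\<leftarrow>qs. ?y q \<eta>) \<le> 1"
      by (induction qs) (auto intro!: mult_le_one simp: coded_cdf_nonneg)
    show "0 \<le> W ps qs \<eta>" "W ps qs \<eta> \<le> 1" unfolding W_def using 1 2 by (auto intro!: mult_le_one)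
  qed
  have main: "(\<integral>\<eta>. W ps qs \<eta> \<partial>Q) = (\<integral>\<eta>. W ps qs \<eta> \<partial>Q')" for ps qs
  proof (induction ps arbitrary: qs)
    case Nil
    have "W [] qs \<eta> = exp (- (\<Sum>q\<leftarrow>qs. coded_cdf \<eta> q))" for \<eta>
      unfolding W_def by (induction qs) (auto simp: exp_diff exp_minus divide_inverse)
    then show ?case using eq by simp
  next
    case (Cons x ps)
    obtain q a where x: "x = (q, a)" by (cases x)
    define D where "D R = distr (density R (\<lambda>\<eta>. ennreal (W ps qs \<eta>))) borel (?y q)" for R :: "'a fin_measure measure"
    have D: "sets (D R) = sets borel" "finite_measure (D R)" "AE z in D R. z \<in> {0..1}"
      "h \<in> borel_measurable borel \<Longrightarrow> (\<integral>z. h z \<partial>D R) = (\<integral>\<eta>. W ps qs \<eta> * h (?y q \<eta>) \<partial>R)"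
      if R: "prob_space R" "sets R = sets borel" for R and h :: "real \<Rightarrow> real"
    proof -
      interpret prob_space R by (rule R)
      note R(2)[measurable_cong]
      show "sets (D R) = sets borel" by (simp add: D_def)
      have "emeasure (density R (\<lambda>\<eta>. ennreal (W ps qs \<eta>))) (space (density R (\<lambda>\<eta>. ennreal (W ps qs \<eta>)))) = (\<integral>\<^sup>+\<eta>. ennreal (W ps qs \<eta>) \<partial>R)"
        by (subst emeasure_density) (auto intro!: nn_integral_cong)
      also have "\<dots> \<le> (\<integral>\<^sup>+\<eta>. 1 \<partial>R)" using W_bounds by (intro nn_integral_mono) auto
      also have "\<dots> = 1" by (simp add: emeasure_space_1)
      finally have "finite_measure (density R (\<lambda>\<eta>. ennreal (W ps qs \<eta>)))"
        by (intro finite_measureI) (auto simp: top_unique)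
      then show "finite_measure (D R)" unfolding D_def by (rule finite_measure.finite_measure_distr) measurable
      show "AE z in D R. z \<in> {0..1}" unfolding D_def
        by (subst AE_distr_iff) (auto simp: coded_cdf_nonneg)
      show "(\<integral>z. h z \<partial>D R) = (\<integral>\<eta>. W ps qs \<eta> * h (?y q \<eta>) \<partial>R)" if [measurable]: "h \<in> borel_measurable borel"
        unfolding D_def using W_bounds by (subst integral_distr) (auto simp: integral_real_density)
    qed
    have "D Q = D Q'"
    proof (rule moments_determine_measure[OF D(1)[OF Q] D(1)[OF Q'] D(2)[OF Q] D(2)[OF Q'] D(3)[OF Q] D(3)[OF Q']])
      fix k
      have "W ps qs \<eta> * ?y q \<eta> ^ k = W ps (replicate k q @ qs) \<eta>" for \<eta>
        by (induction k) (auto simp: W_def)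
      then show "(\<integral>x. x ^ k \<partial>D Q) = (\<integral>x. x ^ k \<partial>D Q')"
        using Cons.IH[of "replicate k q @ qs"] by (simp add: D(4)[OF Q] D(4)[OF Q'])
    qed
    moreover have "W ps qs \<eta> * indicator {..a} (?y q \<eta>) = W (x # ps) qs \<eta>" for \<eta>
      by (simp add: W_def x)
    then have "(\<integral>\<eta>. W (x # ps) qs \<eta> \<partial>R) = (\<integral>z. indicator {..a} z \<partial>D R)"
      if R: "prob_space R" "sets R = sets borel" for R
      by (subst D(4)[OF R]) auto
    from this[OF Q] this[OF Q'] calculation show ?case by (simp only:)
  qed
  define G where "G = {{\<eta>::'a fin_measure. \<forall>(q, a)\<in>set ps. ?y q \<eta> \<le> a} | ps. True}"
  have G_meas: "A \<in> sets borel" if "A \<in> G" for A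
  proof -
    obtain ps where ps: "A = {\<eta>. \<forall>(q, a)\<in>set ps. ?y q \<eta> \<le> a}" using \<open>A \<in> G\<close> unfolding G_def by blast
    have "{\<eta>\<in>space borel. \<forall>x\<in>set ps. ?y (fst x) \<eta> \<le> snd x} \<in> sets borel" by measurable
    then show ?thesis by (simp add: ps case_prod_beta)
  qed
  have G_borel: "sets (borel :: 'a fin_measure measure) = sigma_sets UNIV G"
  proof
    show "sigma_sets UNIV G \<subseteq> sets (borel :: 'a fin_measure measure)"
      using G_meas sets.sigma_sets_subset[of G borel] by auto
    let ?S = "sigma UNIV G :: 'a fin_measure measure"
    have "(\<lambda>\<eta>. \<eta>) \<in> ?S \<rightarrow>\<^sub>M borel"
    proof (rule fm_measurableI)
      fix q
      have "(\<lambda>\<eta>. ?y q \<eta>) \<in> borel_measurable ?S"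
      proof (subst borel_measurable_iff_le, rule allI)
        fix a
        have "{\<eta>. \<forall>(q, a)\<in>set [(q, a)]. ?y q \<eta> \<le> a} \<in> G" unfolding G_def by blast
        then show "{\<eta> \<in> space ?S. ?y q \<eta> \<le> a} \<in> sets ?S" by (simp add: sets_measure_of)
      qed
      then have "(\<lambda>\<eta>. - ln (?y q \<eta>)) \<in> borel_measurable ?S" by measurable
      then show "(\<lambda>\<eta>. coded_cdf \<eta> q) \<in> borel_measurable ?S" by simp
    qed
    then have "sets (borel :: 'a fin_measure measure) \<subseteq> sets ?S"
      by (auto dest: measurable_sets)
    then show "sets (borel :: 'a fin_measure measure) \<subseteq> sigma_sets UNIV G" by (simp add: sets_measure_of)
  qed
  show ?thesis
  proof (rule measure_eqI_generator_eq[of G UNIV Q Q' "\<lambda>_. UNIV"])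
    show "Int_stable G" unfolding Int_stable_def
    proof (intro ballI)
      fix A B assume "A \<in> G" "B \<in> G"
      then obtain ps ps' where "A = {\<eta>. \<forall>(q, a)\<in>set ps. ?y q \<eta> \<le> a}" "B = {\<eta>. \<forall>(q, a)\<in>set ps'. ?y q \<eta> \<le> a}"
        unfolding G_def by blast
      then have "A \<inter> B = {\<eta>. \<forall>(q, a)\<in>set (ps @ ps'). ?y q \<eta> \<le> a}" by auto
      then show "A \<inter> B \<in> G" unfolding G_def by blast
    qed
    show "emeasure Q A = emeasure Q' A" if A: "A \<in> G" for A
    proof -
      obtain ps where ps: "A = {\<eta>. \<forall>(q, a)\<in>set ps. ?y q \<eta> \<le> a}" using A unfolding G_def by blast
      have "W ps [] \<eta> = indicator A \<eta>" for \<eta>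
        unfolding W_def ps by (induction ps) (auto simp: indicator_def)
      then have "(\<integral>\<eta>. indicator A \<eta> \<partial>Q) = (\<integral>\<eta>. indicator A \<eta> \<partial>Q' :: real)" using main[of ps "[]"] by simp
      then have "measure Q A = measure Q' A"
        using G_meas[OF A] Q(2) Q'(2) sets_eq_imp_space_eq[OF Q(2)] sets_eq_imp_space_eq[OF Q'(2)] by simp
      then show ?thesis using Q(1) Q'(1) by (simp add: finite_measure.emeasure_eq_measure prob_space_def)
    qed
    have "{\<eta>. \<forall>(q, a)\<in>set []. ?y q \<eta> \<le> a} \<in> G" unfolding G_def by blast
    then show "range (\<lambda>_::nat. UNIV) \<subseteq> G" by auto
    show "emeasure Q UNIV \<noteq> \<infinity>" for i :: nat
      using Q(1) by (simp add: finite_measure.emeasure_eq_measure prob_space_def)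
  qed (use Q Q' G_borel in auto)
qed

text \<open>Continuity theorem: convergence of Laplace functionals, for all bounded Borel test functions,
  to a functional that is absolutely continuous with respect to a fixed finite measure implies weak
  convergence of the laws, and the limit depends only on the functional.\<close>

theorem fm_laplace_weak_convergence:
  fixes L :: "('a::polish_space \<Rightarrow> real) \<Rightarrow> real" and \<nu> :: "'a fin_measure"
  assumes ac: "\<And>e. 0 < e \<Longrightarrow> \<exists>d>0. \<forall>f\<in>bpB. (\<forall>x. f x \<le> 1) \<longrightarrow> (\<integral>x. f x \<partial>fm_measure \<nu>) < d \<longrightarrow> 1 - L f < e"
    and N0: "\<And>n::nat. prob_space (N0 n)" "\<And>n. sets (N0 n) = sets (borel :: 'a fin_measure measure)"
      "\<And>f. f \<in> bpB \<Longrightarrow> (\<lambda>n. \<integral>\<eta>. laplace f \<eta> \<partial>N0 n) \<longlonglongrightarrow> L f"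
  obtains Q :: "'a fin_measure measure" where "prob_space Q" "sets Q = sets borel"
    "\<And>N :: real \<Rightarrow> 'a fin_measure measure.
      eventually (\<lambda>t. prob_space (N t) \<and> sets (N t) = sets borel) at_top \<Longrightarrow>
      (\<And>f. f \<in> bpB \<Longrightarrow> ((\<lambda>t. \<integral>\<eta>. laplace f \<eta> \<partial>N t) \<longlongrightarrow> L f) at_top) \<Longrightarrow>
      converges_weakly N Q at_top"
proof -
  obtain r0 Q where Q: "prob_space Q" "sets Q = sets (borel :: 'a fin_measure measure)"
    and QL: "\<And>qs. (\<integral>\<eta>. exp (- (\<Sum>q\<leftarrow>qs. coded_cdf \<eta> q)) \<partial>Q) = L (\<lambda>x. line_steps qs x)"
    using fm_laplace_continuity[OF N0[unfolded laplace_def[abs_def]] ac] by metis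
  have weak: "converges_weakly N Q at_top"
    if ev: "eventually (\<lambda>t. prob_space (N t) \<and> sets (N t) = sets borel) at_top"
      and conv: "\<And>f. f \<in> bpB \<Longrightarrow> ((\<lambda>t. \<integral>\<eta>. laplace f \<eta> \<partial>N t) \<longlongrightarrow> L f) at_top"
    for N :: "real \<Rightarrow> 'a fin_measure measure"
    unfolding converges_weakly_def
  proof (intro allI impI, elim conjE)
    fix g :: "'a fin_measure \<Rightarrow> real" assume g: "continuous_on UNIV g" "bounded (range g)"
    show "((\<lambda>t. \<integral>x. g x \<partial>N t) \<longlongrightarrow> (\<integral>x. g x \<partial>Q)) at_top"
    proof (rule ccontr)
      assume "\<not> ?thesis"
      then obtain e where e: "0 < e" "\<not> eventually (\<lambda>t. dist (\<integral>x. g x \<partial>N t) (\<integral>x. g x \<partial>Q) < e) at_top"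
        by (auto simp: tendsto_iff)
      obtain t0 where t0: "\<And>t. t0 \<le> t \<Longrightarrow> prob_space (N t) \<and> sets (N t) = sets borel"
        using ev by (auto simp: eventually_at_top_linorder)
      have "\<exists>t\<ge>max t0 (real n). \<not> dist (\<integral>x. g x \<partial>N t) (\<integral>x. g x \<partial>Q) < e" for n :: nat
        using e(2) unfolding eventually_at_top_linorder by blast
      then obtain t where t: "\<And>n. max t0 (real n) \<le> t n" "\<And>n. \<not> dist (\<integral>x. g x \<partial>N (t n)) (\<integral>x. g x \<partial>Q) < e" by metis
      have tt: "filterlim t at_top sequentially"
        by (rule filterlim_at_top_mono[OF filterlim_real_sequentially]) (use t(1) in auto)
      have Nt: "prob_space (N (t n))" "sets (N (t n)) = sets borel" for n using t0[of "t n"] t(1)[of n] by auto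
      have convt: "(\<lambda>n. \<integral>\<eta>. exp (- (\<integral>x. f x \<partial>fm_measure \<eta>)) \<partial>N (t n)) \<longlonglongrightarrow> L f" if "f \<in> bpB" for f
        using filterlim_compose[OF conv[OF that, unfolded laplace_def[abs_def]] tt] .
      obtain r Q' where r: "strict_mono r" and Q': "prob_space Q'" "sets Q' = sets (borel :: 'a fin_measure measure)"
        and lim: "\<And>g::'a fin_measure \<Rightarrow> real. continuous_on UNIV g \<Longrightarrow> bounded (range g) \<Longrightarrow>
           (\<lambda>n. \<integral>\<eta>. g \<eta> \<partial>N (t (r n))) \<longlonglongrightarrow> (\<integral>\<eta>. g \<eta> \<partial>Q')"
        and QL': "\<And>qs. (\<integral>\<eta>. exp (- (\<Sum>q\<leftarrow>qs. coded_cdf \<eta> q)) \<partial>Q') = L (\<lambda>x. line_steps qs x)"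
        using fm_laplace_continuity[of "\<lambda>n. N (t n)", OF Nt convt ac] by metis
      have "Q' = Q" by (rule coded_laplace_determines_law[OF Q' Q]) (simp add: QL QL')
      then have "(\<lambda>n. \<integral>\<eta>. g \<eta> \<partial>N (t (r n))) \<longlonglongrightarrow> (\<integral>\<eta>. g \<eta> \<partial>Q)" using lim[OF g] by simp
      from tendstoD[OF this e(1)] t(2) show False by (simp add: eventually_sequentially)
    qed
  qed
  show thesis by (rule that[OF Q weak])
qed

section \<open>The Markov property for path functionals\<close>

context borel_right_process
begin

text \<open>Up to its lifetime the process is \<open>\<xi>\<close>; afterwards its state is set to \<open>undefined\<close>, so that \<open>state t\<close> is
  measurable.  The laws are only known to depend measurably on the starting point on the
  \<open>\<sigma>\<close>-algebra \<open>paths\<close> that is generated by the process; \<open>past t\<close> is its natural filtration.\<close>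

definition alive :: "real \<Rightarrow> 'w \<Rightarrow> bool" where
  "alive t w \<longleftrightarrow> 0 \<le> t \<and> ereal t < \<zeta> w"

definition state :: "real \<Rightarrow> 'w \<Rightarrow> 'a" where
  "state t w = (if alive t w then \<xi> t w else undefined)"

definition event :: "real \<Rightarrow> 'a set \<Rightarrow> 'w set" where
  "event s A = {w \<in> space M. ereal s < \<zeta> w \<and> \<xi> s w \<in> A}"

abbreviation past :: "real \<Rightarrow> 'w measure" where "past \<equiv> natural_filtration M \<xi> \<zeta>"

definition paths :: "'w measure" where
  "paths = sigma (space M) {event s A | s A. 0 \<le> s \<and> A \<in> sets borel}"

lemma event_Pow: "{event s A | s A. Q s A} \<subseteq> Pow (space M)"
  by (auto simp: event_def)

lemma natural_filtration_eq:
  "past t = sigma (space M) {event s A | s A. 0 \<le> s \<and> s \<le> t \<and> A \<in> sets borel}"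
  by (simp add: natural_filtration_def event_def)

lemma space_path_algebra [simp]: "space paths = space M"
  by (simp add: paths_def space_measure_of_conv)

lemma space_natural_filtration [simp]: "space (past t) = space M"
  by (simp add: natural_filtration_eq space_measure_of_conv)

lemma event_path_algebra: "0 \<le> s \<Longrightarrow> A \<in> sets borel \<Longrightarrow> event s A \<in> sets paths"
  unfolding paths_def by (subst sets_measure_of[OF event_Pow]) (rule sigma_sets.Basic, blast)

lemma event_natural_filtration:
  "0 \<le> s \<Longrightarrow> s \<le> t \<Longrightarrow> A \<in> sets borel \<Longrightarrow> event s A \<in> sets (past t)"
  unfolding natural_filtration_eq by (subst sets_measure_of[OF event_Pow]) (rule sigma_sets.Basic, blast)

lemma sets_path_algebra_subset: "sets paths \<subseteq> sets M"
  unfolding paths_def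
  by (subst sets_measure_of[OF event_Pow], rule sets.sigma_sets_subset)
    (use measurable_process in \<open>auto simp: event_def\<close>)

lemma sets_natural_filtration_subset: "sets (past t) \<subseteq> sets paths"
  unfolding natural_filtration_eq
proof (subst sets_measure_of[OF event_Pow])
  have "sigma_sets (space paths) {event s A |s A. 0 \<le> s \<and> s \<le> t \<and> A \<in> sets borel} \<subseteq> sets paths"
    by (rule sets.sigma_sets_subset) (auto intro: event_path_algebra)
  then show "sigma_sets (space M) {event s A |s A. 0 \<le> s \<and> s \<le> t \<and> A \<in> sets borel} \<subseteq> sets paths" by simp
qed

lemma space_law [simp]: "space (law x) = space M"
  by (rule sets_eq_imp_space_eq[OF sets_law])

lemma subalgebra_path: "subalgebra (law x) paths"
  using sets_path_algebra_subset by (simp add: subalgebra_def sets_law)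

lemma subalgebra_natural: "subalgebra (law x) (past t)"
  using sets_path_algebra_subset sets_natural_filtration_subset[of t] by (auto simp: subalgebra_def sets_law)

lemma natural_measurable_path:
  "f \<in> measurable (past t) N \<Longrightarrow> f \<in> measurable paths N"
  using sets_natural_filtration_subset[of t] by (auto simp: measurable_def)

lemma path_measurable_law: "f \<in> measurable paths N \<Longrightarrow> f \<in> measurable (law x) N"
  using sets_path_algebra_subset by (auto simp: measurable_def sets_law)

lemma alive_natural: "s \<le> t \<Longrightarrow> Measurable.pred (past t) (alive s)"
proof (cases "0 \<le> s")
  case True
  assume "s \<le> t"
  have "{w \<in> space (past t). alive s w} = event s UNIV" using True by (auto simp: alive_def event_def)
  then show ?thesis using event_natural_filtration[OF True \<open>s \<le> t\<close>, of UNIV] by (simp add: pred_def)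
qed (simp add: alive_def[abs_def])

lemma state_natural: "s \<le> t \<Longrightarrow> state s \<in> past t \<rightarrow>\<^sub>M borel"
proof (cases "0 \<le> s")
  case True
  assume st: "s \<le> t"
  note [measurable] = alive_natural[OF st]
  show ?thesis
  proof (rule measurableI)
    fix A :: "'a set" assume A: "A \<in> sets borel"
    have "state s -` A \<inter> space (past t) =
        event s A \<union> (if undefined \<in> A then {w\<in>space (past t). \<not> alive s w} else {})"
      using True by (auto simp: state_def alive_def event_def split: if_splits)
    also have "{w\<in>space (past t). \<not> alive s w} \<in> sets (past t)" by measurable
    then have "event s A \<union> (if undefined \<in> A then {w\<in>space (past t). \<not> alive s w} else {})
        \<in> sets (past t)"
      using event_natural_filtration[OF True st A] by auto
    finally show "state s -` A \<inter> space (past t) \<in> sets (past t)" .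
  qed simp
next
  case False
  then have "state s = (\<lambda>_. undefined)" by (auto simp: state_def alive_def)
  then show ?thesis by simp
qed

lemmas alive_path = natural_measurable_path[OF alive_natural[OF order_refl]]
lemmas state_path = natural_measurable_path[OF state_natural[OF order_refl]]

lemma P_measurable: "0 \<le> s \<Longrightarrow> P s \<in> borel \<rightarrow>\<^sub>M subprob_algebra borel"
  using semigroup by (simp add: transition_semigroup_def)

lemma sets_P [simp]: "0 \<le> s \<Longrightarrow> sets (P s x) = sets borel"
  by (rule sets_kernel[OF P_measurable]) auto

lemma subprob_P: "0 \<le> s \<Longrightarrow> subprob_space (P s x)"
  by (rule subprob_space_kernel[OF P_measurable]) auto

lemma P_integral_measurable: "0 \<le> s \<Longrightarrow> f \<in> borel_measurable borel \<Longrightarrow> (\<lambda>x. \<integral>\<^sup>+y. f y \<partial>P s x) \<in> borel_measurable borel"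
  by (rule measurable_compose[OF P_measurable nn_integral_measurable_subprob_algebra])

text \<open>The Markov property as an identity of integrals, for nonnegative functions that vanish at the cemetery.\<close>

lemma markov_nn_integral:
  assumes st: "0 \<le> s" "0 \<le> t"
    and G: "G \<in> borel_measurable (past t)"
    and f: "f \<in> borel_measurable borel"
  shows "(\<integral>\<^sup>+w. G w * (if alive (t + s) w then f (state (t + s) w) else 0) \<partial>law x) =
    (\<integral>\<^sup>+w. G w * (if alive t w then \<integral>\<^sup>+y. f y \<partial>P s (state t w) else 0) \<partial>law x)"
proof -
  have Gm[measurable]: "G \<in> borel_measurable (law x)" by (rule path_measurable_law[OF natural_measurable_path[OF G]])
  have m[measurable]: "Measurable.pred (law x) (alive u)" "state u \<in> law x \<rightarrow>\<^sub>M borel" for u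
    by (rule path_measurable_law[OF alive_path], rule path_measurable_law[OF state_path])
  have Pm[measurable]: "(\<lambda>w. \<integral>\<^sup>+y. f y \<partial>P s (state t w)) \<in> borel_measurable (law x)" if "f \<in> borel_measurable borel" for f
    by (rule measurable_compose[OF m(2) P_integral_measurable[OF st(1) that]])
  show ?thesis
    using f
  proof (induction rule: borel_measurable_induct)
    case (cong f g)
    then have "f = g" by auto
    with cong show ?case by (simp cong: if_cong)
  next
    case (set A)
    interpret prob_space "law x" by (rule prob_law)
    interpret C: finite_measure_subalgebra "law x" "past t"
      by unfold_locales (rule subalgebra_natural)
    have "(\<integral>\<^sup>+w. G w * (if alive (t + s) w then indicator A (state (t + s) w) else 0) \<partial>law x) =
      (\<integral>\<^sup>+w. G w * indicator (event (t + s) A) w \<partial>law x)"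
      using st by (intro nn_integral_cong) (auto simp: alive_def state_def event_def indicator_def)
    also have "\<dots> = (\<integral>\<^sup>+w. G w * nn_cond_exp (law x) (past t) (indicator (event (t + s) A)) w \<partial>law x)"
    proof (rule C.nn_cond_exp_intg[symmetric, OF G])
      have "event (t + s) A \<in> sets (law x)" using measurable_process[of "t + s" A] st set by (simp add: event_def sets_law)
      then show "indicator (event (t + s) A) \<in> borel_measurable (law x)" by simp
    qed
    also have "\<dots> = (\<integral>\<^sup>+w. G w * (if alive t w then emeasure (P s (state t w)) A else 0) \<partial>law x)"
    proof (rule nn_integral_cong_AE)
      show "AE w in law x. G w * nn_cond_exp (law x) (past t) (indicator (event (t + s) A)) w =
        G w * (if alive t w then emeasure (P s (state t w)) A else 0)"
        using Markov[OF st set, of x] unfolding event_def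
        by eventually_elim (use st in \<open>simp add: alive_def state_def\<close>)
    qed
    finally show ?case using st set by (simp cong: if_cong)
  next
    case (mult u c)
    note mult(2)[measurable]
    have "(\<integral>\<^sup>+w. G w * (if alive (t + s) w then c * u (state (t + s) w) else 0) \<partial>law x)
      = (\<integral>\<^sup>+w. c * (G w * (if alive (t + s) w then u (state (t + s) w) else 0)) \<partial>law x)"
      by (intro nn_integral_cong) (auto simp: ac_simps)
    also have "\<dots> = c * (\<integral>\<^sup>+w. G w * (if alive (t + s) w then u (state (t + s) w) else 0) \<partial>law x)"
      using mult by (intro nn_integral_cmult) measurable
    also have "\<dots> = c * (\<integral>\<^sup>+w. G w * (if alive t w then \<integral>\<^sup>+y. u y \<partial>P s (state t w) else 0) \<partial>law x)"
      by (simp only: mult)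
    also have "\<dots> = (\<integral>\<^sup>+w. c * (G w * (if alive t w then \<integral>\<^sup>+y. u y \<partial>P s (state t w) else 0)) \<partial>law x)"
      using mult by (intro nn_integral_cmult[symmetric]) measurable
    also have "\<dots> = (\<integral>\<^sup>+w. G w * (if alive t w then \<integral>\<^sup>+y. c * u y \<partial>P s (state t w) else 0) \<partial>law x)"
      using mult st by (intro nn_integral_cong) (auto simp: ac_simps nn_integral_cmult cong: measurable_cong_sets)
    finally show ?case .
  next
    case (add u v)
    note add(1,3)[measurable]
    have "(\<integral>\<^sup>+w. G w * (if alive (t + s) w then v (state (t + s) w) + u (state (t + s) w) else 0) \<partial>law x)
      = (\<integral>\<^sup>+w. G w * (if alive (t + s) w then v (state (t + s) w) else 0) + G w * (if alive (t + s) w then u (state (t + s) w) else 0) \<partial>law x)"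
      by (intro nn_integral_cong) (auto simp: algebra_simps)
    also have "\<dots> = (\<integral>\<^sup>+w. G w * (if alive (t + s) w then v (state (t + s) w) else 0) \<partial>law x) + (\<integral>\<^sup>+w. G w * (if alive (t + s) w then u (state (t + s) w) else 0) \<partial>law x)"
      using add by (intro nn_integral_add) measurable
    also have "\<dots> = (\<integral>\<^sup>+w. G w * (if alive t w then \<integral>\<^sup>+y. v y \<partial>P s (state t w) else 0) \<partial>law x) + (\<integral>\<^sup>+w. G w * (if alive t w then \<integral>\<^sup>+y. u y \<partial>P s (state t w) else 0) \<partial>law x)"
      by (simp only: add)
    also have "\<dots> = (\<integral>\<^sup>+w. G w * (if alive t w then \<integral>\<^sup>+y. v y \<partial>P s (state t w) else 0) + G w * (if alive t w then \<integral>\<^sup>+y. u y \<partial>P s (state t w) else 0) \<partial>law x)"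
      using add by (intro nn_integral_add[symmetric]) measurable
    also have "\<dots> = (\<integral>\<^sup>+w. G w * (if alive t w then \<integral>\<^sup>+y. v y + u y \<partial>P s (state t w) else 0) \<partial>law x)"
      using add st by (intro nn_integral_cong) (auto simp: algebra_simps nn_integral_add cong: measurable_cong_sets)
    finally show ?case .
  next
    case (seq U)
    note seq(1)[measurable]
    have "(\<integral>\<^sup>+w. G w * (if alive (t + s) w then (SUP i. U i) (state (t + s) w) else 0) \<partial>law x)
      = (\<integral>\<^sup>+w. (SUP i. G w * (if alive (t + s) w then U i (state (t + s) w) else 0)) \<partial>law x)"
      by (intro nn_integral_cong) (auto simp: SUP_apply image_image SUP_mult_left_ennreal)
    also have "\<dots> = (SUP i. \<integral>\<^sup>+w. G w * (if alive (t + s) w then U i (state (t + s) w) else 0) \<partial>law x)"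
    proof (rule nn_integral_monotone_convergence_SUP)
      show "incseq (\<lambda>i w. G w * (if alive (t + s) w then U i (state (t + s) w) else 0))"
        using seq(3) by (auto simp: incseq_def le_fun_def intro!: mult_left_mono)
    qed (use seq in measurable)
    also have "\<dots> = (SUP i. \<integral>\<^sup>+w. G w * (if alive t w then \<integral>\<^sup>+y. U i y \<partial>P s (state t w) else 0) \<partial>law x)"
      by (simp only: seq)
    also have "\<dots> = (\<integral>\<^sup>+w. (SUP i. G w * (if alive t w then \<integral>\<^sup>+y. U i y \<partial>P s (state t w) else 0)) \<partial>law x)"
    proof (rule nn_integral_monotone_convergence_SUP[symmetric])
      show "incseq (\<lambda>i w. G w * (if alive t w then \<integral>\<^sup>+y. U i y \<partial>P s (state t w) else 0))"
        using seq(3) by (auto simp: incseq_def le_fun_def intro!: mult_left_mono nn_integral_mono)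
    qed (use seq in measurable)
    also have "\<dots> = (\<integral>\<^sup>+w. G w * (if alive t w then \<integral>\<^sup>+y. (SUP i. U i) y \<partial>P s (state t w) else 0) \<partial>law x)"
    proof (intro nn_integral_cong)
      fix w
      have "(\<integral>\<^sup>+y. (SUP i. U i) y \<partial>P s (state t w)) = (SUP i. \<integral>\<^sup>+y. U i y \<partial>P s (state t w))"
        unfolding SUP_apply image_image using seq st
        by (intro nn_integral_monotone_convergence_SUP) (simp_all cong: measurable_cong_sets)
      then show "(SUP i. G w * (if alive t w then \<integral>\<^sup>+y. U i y \<partial>P s (state t w) else 0)) =
          G w * (if alive t w then \<integral>\<^sup>+y. (SUP i. U i) y \<partial>P s (state t w) else 0)"
        by (auto simp: SUP_mult_left_ennreal)
    qed
    finally show ?case .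
  qed
qed

lemma P_0: "P 0 x = return borel x"
  using semigroup by (simp add: transition_semigroup_def)

lemma law_state_nn_integral:
  assumes t: "0 \<le> t" and f: "f \<in> borel_measurable borel"
  shows "(\<integral>\<^sup>+w. (if alive t w then f (state t w) else 0) \<partial>law x) = (\<integral>\<^sup>+y. f y \<partial>P t x)"
proof -
  interpret prob_space "law x" by (rule prob_law)
  have "(\<integral>\<^sup>+w. (if alive t w then f (state t w) else 0) \<partial>law x) =
    (\<integral>\<^sup>+w. (if alive 0 w then \<integral>\<^sup>+y. f y \<partial>P t (state 0 w) else 0) \<partial>law x)"
    using markov_nn_integral[OF t order_refl, of "\<lambda>_. 1" f x] f by (simp cong: if_cong)
  also have "\<dots> = (\<integral>\<^sup>+w. (\<integral>\<^sup>+y. f y \<partial>P t x) \<partial>law x)"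
  proof (rule nn_integral_cong_AE)
    show "AE w in law x. (if alive 0 w then \<integral>\<^sup>+y. f y \<partial>P t (state 0 w) else 0) = (\<integral>\<^sup>+y. f y \<partial>P t x)"
      using normal[of x] by eventually_elim (simp add: alive_def state_def zero_ereal_def)
  qed
  finally show ?thesis using emeasure_space_1 by simp
qed

text \<open>Cylinder sets form a generating \<open>\<pi>\<close>-system of \<open>paths\<close>.  By the Markov property, applied to the
  latest time first, their probabilities are measurable in the starting point.\<close>

definition cylinder :: "(real \<times> 'a set) list \<Rightarrow> 'w set" where
  "cylinder l = {w \<in> space M. \<forall>(s, A) \<in> set l. w \<in> event s A}"

lemma cylinder_Cons: "cylinder ((s, A) # l) = event s A \<inter> cylinder l"
  by (auto simp: cylinder_def event_def)

lemma cylinder_natural: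
  "\<forall>(s, A) \<in> set l. 0 \<le> s \<and> s \<le> t \<and> A \<in> sets borel \<Longrightarrow> cylinder l \<in> sets (past t)"
proof (induction l)
  case Nil
  then show ?case using sets.top[of "past t"] by (simp add: cylinder_def)
next
  case (Cons x l)
  then show ?case by (cases x) (auto simp: cylinder_Cons event_natural_filtration)
qed

lemma cylinder_law_measurable:
  assumes "sorted_wrt (\<lambda>a b. fst b \<le> fst a) l" "0 \<le> t" "\<forall>(s, A) \<in> set l. 0 \<le> s \<and> s \<le> t \<and> A \<in> sets borel"
    and "f \<in> borel_measurable borel"
  shows "(\<lambda>x. \<integral>\<^sup>+w. indicator (cylinder l) w * (if alive t w then f (state t w) else 0) \<partial>law x) \<in> borel_measurable borel"
  using assms
proof (induction l arbitrary: t f)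
  case Nil
  have "(\<integral>\<^sup>+w. indicator (cylinder []) w * (if alive t w then f (state t w) else 0) \<partial>law x) = (\<integral>\<^sup>+y. f y \<partial>P t x)" for x
    unfolding law_state_nn_integral[OF Nil(2,4), symmetric] by (intro nn_integral_cong) (auto simp: cylinder_def)
  then show ?case using P_integral_measurable[OF Nil(2,4)] by simp
next
  case (Cons z l)
  obtain s A where z: "z = (s, A)" by (cases z)
  have s: "0 \<le> s" "s \<le> t" "A \<in> sets borel" using Cons.prems(3) z by auto
  have l: "\<forall>(u, B) \<in> set l. 0 \<le> u \<and> u \<le> s \<and> B \<in> sets borel" using Cons.prems(1,3) z by auto
  note fm = Cons.prems(4)
  define g where "g y = indicator A y * (\<integral>\<^sup>+v. f v \<partial>P (t - s) y)" for y
  have g: "g \<in> borel_measurable borel"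
    unfolding g_def[abs_def] using s P_integral_measurable[of "t - s" f] fm by (intro borel_measurable_times_ennreal) auto
  have "(\<integral>\<^sup>+w. indicator (cylinder (z # l)) w * (if alive t w then f (state t w) else 0) \<partial>law x) =
    (\<integral>\<^sup>+w. indicator (cylinder l) w * (if alive s w then g (state s w) else 0) \<partial>law x)" for x
  proof -
    have "(\<integral>\<^sup>+w. indicator (cylinder (z # l)) w * (if alive (s + (t - s)) w then f (state (s + (t - s)) w) else 0) \<partial>law x)
      = (\<integral>\<^sup>+w. indicator (cylinder (z # l)) w * (if alive s w then \<integral>\<^sup>+y. f y \<partial>P (t - s) (state s w) else 0) \<partial>law x)"
      by (rule markov_nn_integral) (use s l z fm in \<open>auto intro!: borel_measurable_indicator cylinder_natural\<close>)
    also have "\<dots> = (\<integral>\<^sup>+w. indicator (cylinder l) w * (if alive s w then g (state s w) else 0) \<partial>law x)"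
      by (intro nn_integral_cong) (auto simp: z cylinder_Cons indicator_def g_def event_def state_def alive_def)
    finally show ?thesis by (simp cong: if_cong)
  qed
  then show ?case using Cons.IH[OF _ s(1) l g] Cons.prems(1) by simp
qed

text \<open>The law of the process, restricted to the events that it generates: a probability kernel.\<close>

definition path_law :: "'a \<Rightarrow> 'w measure" where
  "path_law x = restr_to_subalg (law x) paths"

lemma sets_path_law [simp, measurable_cong]: "sets (path_law x) = sets paths"
  unfolding path_law_def by (rule sets_restr_to_subalg[OF subalgebra_path])

lemma space_path_law [simp]: "space (path_law x) = space M"
  by (simp add: path_law_def space_restr_to_subalg)

lemma emeasure_path_law: "A \<in> sets paths \<Longrightarrow> emeasure (path_law x) A = emeasure (law x) A"
  unfolding path_law_def by (rule emeasure_restr_to_subalg[OF subalgebra_path])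

lemma nn_integral_path_law: "f \<in> borel_measurable paths \<Longrightarrow> (\<integral>\<^sup>+w. f w \<partial>path_law x) = (\<integral>\<^sup>+w. f w \<partial>law x)"
  unfolding path_law_def by (rule nn_integral_subalgebra2[OF subalgebra_path])

lemma prob_path_law: "prob_space (path_law x)"
  unfolding path_law_def by (rule prob_space_restr_to_subalg[OF subalgebra_path prob_law])

lemma path_law_measurable [measurable]: "path_law \<in> borel \<rightarrow>\<^sub>M subprob_algebra paths"
proof (rule measurable_subprob_algebra_generated)
  define G where "G = {cylinder l | l. \<forall>(s, A) \<in> set l. 0 \<le> s \<and> A \<in> sets borel}"
  have cyl: "cylinder l \<in> sets paths" if "\<forall>(s, A) \<in> set l. 0 \<le> s \<and> A \<in> sets borel" for l :: "(real \<times> 'a set) list"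
    using that
  proof (induction l)
    case Nil
    then show ?case using sets.top[of paths] by (simp add: cylinder_def)
  next
    case (Cons x l)
    then show ?case by (cases x) (auto simp: cylinder_Cons event_path_algebra)
  qed
  show "sets paths = sigma_sets (space M) G"
  proof
    have "{event s A | s A. 0 \<le> s \<and> A \<in> sets borel} \<subseteq> G"
    proof clarify
      fix s :: real and A :: "'a set" assume "0 \<le> s" "A \<in> sets borel"
      moreover have "event s A = cylinder [(s, A)]" by (auto simp: cylinder_def event_def)
      ultimately show "event s A \<in> G" unfolding G_def by (intro CollectI exI[of _ "[(s, A)]"]) auto
    qed
    then show "sets paths \<subseteq> sigma_sets (space M) G"
      unfolding paths_def by (subst sets_measure_of[OF event_Pow]) (rule sigma_sets_mono')
    have "sigma_sets (space paths) G \<subseteq> sets paths"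
      by (rule sets.sigma_sets_subset) (auto simp: G_def cyl)
    then show "sigma_sets (space M) G \<subseteq> sets paths" by simp
  qed
  show "Int_stable G" unfolding Int_stable_def
  proof (intro ballI)
    fix A B assume "A \<in> G" "B \<in> G"
    then obtain l l' where l: "A = cylinder l" "\<forall>(s, A) \<in> set l. 0 \<le> s \<and> A \<in> sets borel"
      "B = cylinder l'" "\<forall>(s, A) \<in> set l'. 0 \<le> s \<and> A \<in> sets borel" unfolding G_def by blast
    then have "A \<inter> B = cylinder (l @ l')" by (auto simp: cylinder_def)
    then show "A \<inter> B \<in> G" unfolding G_def using l by (intro CollectI exI[of _ "l @ l'"]) auto
  qed
  show "G \<subseteq> Pow (space M)" by (auto simp: G_def cylinder_def)
  show "subprob_space (path_law x)" for x by (rule prob_space_imp_subprob_space[OF prob_path_law])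
  show "(\<lambda>x. emeasure (path_law x) (space M)) \<in> borel_measurable borel"
    using prob_space.emeasure_space_1[OF prob_path_law] by simp
  show "(\<lambda>x. emeasure (path_law x) C) \<in> borel_measurable borel" if "C \<in> G" for C
  proof -
    obtain l where l: "C = cylinder l" "\<forall>(s, A) \<in> set l. 0 \<le> s \<and> A \<in> sets borel" using \<open>C \<in> G\<close> unfolding G_def by blast
    define l' where "l' = rev (sort_key fst l)"
    have l': "set l' = set l" by (simp add: l'_def)
    have sorted: "sorted_wrt (\<lambda>a b. fst b \<le> fst a) l'"
      unfolding l'_def sorted_wrt_rev using sorted_sort_key[of fst l] by (simp add: sorted_map)
    have C: "C = cylinder l'" using l(1) l' by (simp add: cylinder_def)
    have C_meas: "C \<in> sets paths" using cyl[OF l(2)] l(1) by simp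
    show ?thesis
    proof (cases l')
      case Nil
      then have "C = space (path_law x)" for x by (simp add: C cylinder_def)
      then show ?thesis using prob_space.emeasure_space_1[OF prob_path_law] by simp
    next
      case (Cons z k)
      obtain s A where z: "z = (s, A)" by (cases z)
      have sl: "\<forall>(u, B) \<in> insert (s, A) (set k). 0 \<le> u \<and> B \<in> sets borel"
        using l(2) unfolding l'[symmetric] Cons z by simp
      have sk: "(\<forall>y\<in>set k. fst y \<le> s) \<and> sorted_wrt (\<lambda>a b. fst b \<le> fst a) k"
        using sorted unfolding Cons z by simp
      have s: "0 \<le> s" "A \<in> sets borel" using sl by auto
      have k: "\<forall>(u, B) \<in> set k. 0 \<le> u \<and> u \<le> s \<and> B \<in> sets borel" "sorted_wrt (\<lambda>a b. fst b \<le> fst a) k"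
        using sl sk by auto
      have "emeasure (path_law x) C = (\<integral>\<^sup>+w. indicator (cylinder k) w * (if alive s w then indicator A (state s w) else 0) \<partial>law x)" for x
      proof -
        have "C \<in> sets (law x)" using C_meas sets_path_algebra_subset by (auto simp: sets_law)
        then have "emeasure (path_law x) C = (\<integral>\<^sup>+w. indicator C w \<partial>law x)" using C_meas by (simp add: emeasure_path_law)
        also have "\<dots> = (\<integral>\<^sup>+w. indicator (cylinder k) w * (if alive s w then indicator A (state s w) else 0) \<partial>law x)"
          using s by (intro nn_integral_cong) (auto simp: C Cons z cylinder_Cons indicator_def event_def state_def alive_def)
        finally show ?thesis .
      qed
      then show ?thesis using cylinder_law_measurable[OF k(2) s(1) k(1), of "indicator A"] s by simp
    qed
  qed
qed simp

end

section \<open>Exponential identities\<close>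

lemma exp_diff_bounds:
  fixes x y :: real
  shows "exp y * (x - y) \<le> exp x - exp y" "exp x - exp y \<le> exp x * (x - y)"
proof -
  have "exp y * (1 + (x - y)) \<le> exp y * exp (x - y)" by (intro mult_left_mono exp_ge_add_one_self) auto
  then show "exp y * (x - y) \<le> exp x - exp y" by (simp add: algebra_simps flip: exp_add)
  have "exp x * (1 + (y - x)) \<le> exp x * exp (y - x)" by (intro mult_left_mono exp_ge_add_one_self) auto
  then show "exp x - exp y \<le> exp x * (x - y)" by (simp add: algebra_simps flip: exp_add)
qed

lemma exp_lipschitz:
  fixes x y R :: real
  assumes "x \<le> R" "y \<le> R"
  shows "\<bar>exp x - exp y\<bar> \<le> exp R * \<bar>x - y\<bar>"
proof -
  have "exp x * (x - y) \<le> exp R * \<bar>x - y\<bar>" "exp y * (y - x) \<le> exp R * \<bar>x - y\<bar>"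
  proof -
    have "exp x * (x - y) \<le> exp x * \<bar>x - y\<bar>" "exp y * (y - x) \<le> exp y * \<bar>x - y\<bar>" by (intro mult_left_mono; simp)+
    moreover have "exp x * \<bar>x - y\<bar> \<le> exp R * \<bar>x - y\<bar>" "exp y * \<bar>x - y\<bar> \<le> exp R * \<bar>x - y\<bar>"
      using assms by (intro mult_right_mono; simp)+
    ultimately show "exp x * (x - y) \<le> exp R * \<bar>x - y\<bar>" "exp y * (y - x) \<le> exp R * \<bar>x - y\<bar>" by linarith+
  qed
  then show ?thesis using exp_diff_bounds(2)[of x y] exp_diff_bounds(2)[of y x] by (auto simp: abs_le_iff)
qed

lemma exp_taylor_bound:
  fixes x y R :: real
  assumes "x \<le> R" "y \<le> R"
  shows "\<bar>exp x - exp y - exp y * (x - y)\<bar> \<le> exp R * \<bar>x - y\<bar>\<^sup>2"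
proof -
  have "exp x - exp y - exp y * (x - y) \<le> (exp x - exp y) * (x - y)"
    using exp_diff_bounds(2)[of x y] by (simp add: algebra_simps)
  also have "\<dots> \<le> \<bar>exp x - exp y\<bar> * \<bar>x - y\<bar>" by (metis abs_ge_self abs_mult)
  also have "\<dots> \<le> exp R * \<bar>x - y\<bar> * \<bar>x - y\<bar>" using exp_lipschitz[OF assms] by (intro mult_right_mono) auto
  finally have "exp x - exp y - exp y * (x - y) \<le> exp R * \<bar>x - y\<bar>\<^sup>2" by (simp add: power2_eq_square)
  moreover have "0 \<le> exp x - exp y - exp y * (x - y)" using exp_diff_bounds(1)[of y x] by simp
  ultimately show ?thesis by simp
qed

text \<open>Splitting the interval into \<open>n\<close> pieces bounds the total increment by \<open>K t\<^sup>2 / n\<close>.\<close>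

lemma quadratic_increments_constant:
  fixes D :: "real \<Rightarrow> real"
  assumes t: "0 \<le> t" and D: "\<And>r s. 0 \<le> r \<Longrightarrow> r \<le> s \<Longrightarrow> s \<le> t \<Longrightarrow> \<bar>D s - D r\<bar> \<le> K * (s - r)\<^sup>2"
  shows "D t = D 0"
proof -
  have bound: "\<bar>D t - D 0\<bar> \<le> K * t\<^sup>2 * inverse (real (Suc n))" for n
  proof -
    let ?p = "\<lambda>k. real k * t / real (Suc n)"
    have "D t - D 0 = D (?p (Suc n)) - D (?p 0)" by simp
    also have "\<dots> = (\<Sum>k<Suc n. D (?p (Suc k)) - D (?p k))" by (rule sum_lessThan_telescope[symmetric])
    finally have "\<bar>D t - D 0\<bar> \<le> (\<Sum>k<Suc n. \<bar>D (?p (Suc k)) - D (?p k)\<bar>)" by (simp only: sum_abs)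
    also have "\<dots> \<le> (\<Sum>k<Suc n. K * (t / real (Suc n))\<^sup>2)"
    proof (rule sum_mono)
      fix k assume "k \<in> {..<Suc n}"
      then have k: "real (Suc k) \<le> real (Suc n)" by simp
      have 1: "0 \<le> ?p k" using t by simp
      have 2: "?p k \<le> ?p (Suc k)" using t by (intro divide_right_mono mult_right_mono) auto
      have "?p (Suc k) \<le> real (Suc n) * t / real (Suc n)" using t k by (intro divide_right_mono mult_right_mono) auto
      then have 3: "?p (Suc k) \<le> t" by simp
      have "?p (Suc k) - ?p k = t / real (Suc n)" by (simp add: diff_divide_distrib[symmetric] algebra_simps)
      with D[OF 1 2 3] show "\<bar>D (?p (Suc k)) - D (?p k)\<bar> \<le> K * (t / real (Suc n))\<^sup>2" by simp
    qed
    also have "\<dots> = K * t\<^sup>2 * inverse (real (Suc n))" by (simp add: power2_eq_square divide_inverse)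
    finally show ?thesis .
  qed
  have "(\<lambda>n. K * t\<^sup>2 * inverse (real (Suc n))) \<longlonglongrightarrow> K * t\<^sup>2 * 0"
    by (intro tendsto_intros LIMSEQ_inverse_real_of_nat)
  then have "\<bar>D t - D 0\<bar> \<le> 0" using LIMSEQ_le_const[of _ _ "\<bar>D t - D 0\<bar>"] bound by fastforce
  then show ?thesis by simp
qed

text \<open>The fundamental theorem for \<open>exp (\<integral> b)\<close> with a bounded Borel rate \<open>b\<close>.  The difference of the two
  sides has increments of quadratic size in the length of the time interval, hence is constant.\<close>

lemma exp_integral_identity:
  fixes b :: "real \<Rightarrow> real"
  assumes bm[measurable]: "b \<in> borel_measurable borel" and B: "\<And>u. \<bar>b u\<bar> \<le> B" and t: "0 \<le> t"
  shows "(LINT s:{0..t}|lborel. b s * exp (LINT u:{0..s}|lborel. b u)) = exp (LINT u:{0..t}|lborel. b u) - 1"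
proof -
  define I where "I s = (LINT u:{0..s}|lborel. b u)" for s
  have B0: "0 \<le> B" using B[of 0] by (meson abs_ge_zero order_trans)
  have si: "set_integrable lborel {r..s} h" if "h \<in> borel_measurable borel" "\<And>u. u \<in> {r..s} \<Longrightarrow> \<bar>h u\<bar> \<le> C" for r s C and h :: "real \<Rightarrow> real"
    unfolding set_integrable_def
  proof (rule integrableI_bounded_set[where A="{r..s}" and B=C])
    show "AE x\<in>{r..s} in lborel. norm (indicator {r..s} x *\<^sub>R h x) \<le> C" using that(2) by (intro AE_I2) auto
  qed (use that in \<open>auto simp: emeasure_lborel_Icc_eq\<close>)
  have bnd: "\<bar>LINT u:{r..s}|lborel. h u\<bar> \<le> C * (s - r)" if h: "h \<in> borel_measurable borel" "\<And>u. u \<in> {r..s} \<Longrightarrow> \<bar>h u\<bar> \<le> C" and "r \<le> s" for r s C and h :: "real \<Rightarrow> real"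
  proof -
    have "\<bar>LINT u:{r..s}|lborel. h u\<bar> \<le> (LINT u:{r..s}|lborel. \<bar>h u\<bar>)"
      unfolding set_lebesgue_integral_def by (rule order_trans[OF integral_abs_bound]) (simp add: abs_mult)
    also have "\<dots> \<le> (LINT u:{r..s}|lborel. C)"
      by (intro set_integral_mono set_integrable_abs si[OF h] si[where h="\<lambda>_. C" and C="\<bar>C\<bar>"]) (use h(2) in auto)
    also have "\<dots> = C * (s - r)" using \<open>r \<le> s\<close> by (simp add: set_lebesgue_integral_def)
    finally show ?thesis .
  qed
  have split: "(LINT u:{0..s}|lborel. h u) = (LINT u:{0..r}|lborel. h u) + (LINT u:{r..s}|lborel. h u)"
    if h: "h \<in> borel_measurable borel" "\<And>u. u \<in> {0..s} \<Longrightarrow> \<bar>h u\<bar> \<le> C" and rs: "0 \<le> r" "r \<le> s" for r s C and h :: "real \<Rightarrow> real"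
  proof -
    have "(LINT u:{0..s}|lborel. h u) = (\<integral>u. indicator {0..r} u *\<^sub>R h u + indicator {r..s} u *\<^sub>R h u \<partial>lborel)"
      unfolding set_lebesgue_integral_def
    proof (rule integral_cong_AE)
      show "AE u in lborel. indicator {0..s} u *\<^sub>R h u = indicator {0..r} u *\<^sub>R h u + indicator {r..s} u *\<^sub>R h u"
        using AE_lborel_singleton[of r] by eventually_elim (use rs in \<open>auto simp: indicator_def\<close>)
    qed (use h in auto)
    also have "\<dots> = (LINT u:{0..r}|lborel. h u) + (LINT u:{r..s}|lborel. h u)"
      unfolding set_lebesgue_integral_def
      by (rule Bochner_Integration.integral_add)
        (use si[OF h(1), of 0 r C] si[OF h(1), of r s C] h(2) rs in \<open>auto simp: set_integrable_def\<close>)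
    finally show ?thesis .
  qed
  have Im[measurable]: "I \<in> borel_measurable borel"
  proof -
    have "(\<lambda>s. \<integral>u. indicator {0..s} u *\<^sub>R b u \<partial>lborel) \<in> borel_measurable borel"
    proof (rule lborel.borel_measurable_lebesgue_integral)
      have "(\<lambda>(s, u). (if 0 \<le> u \<and> u \<le> s then b u else 0)) \<in> borel_measurable (borel \<Otimes>\<^sub>M lborel)" by measurable
      also have "(\<lambda>(s, u). (if 0 \<le> u \<and> u \<le> s then b u else 0)) = (\<lambda>(s, u). indicator {0..s} u *\<^sub>R b u)" by (auto simp: indicator_def)
      finally show "(\<lambda>(s, u). indicator {0..s} u *\<^sub>R b u) \<in> borel_measurable (borel \<Otimes>\<^sub>M lborel)" .
    qed
    then show ?thesis by (simp add: I_def[abs_def] set_lebesgue_integral_def)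
  qed
  have I_diff: "\<bar>I s - I r\<bar> \<le> B * (s - r)" if "0 \<le> r" "r \<le> s" for r s
    using split[OF bm B that] bnd[OF bm B that(2)] by (simp add: I_def)
  have I_0: "I 0 = 0"
  proof -
    have "(\<integral>u. indicator {0..0} u *\<^sub>R b u \<partial>lborel) = (\<integral>u. 0 \<partial>(lborel :: real measure))"
    proof (rule integral_cong_AE)
      show "AE u in lborel. indicator {0..0} u *\<^sub>R b u = 0"
        using AE_lborel_singleton[of "0::real"] by eventually_elim (simp add: indicator_def)
    qed measurable
    then show ?thesis by (simp add: I_def set_lebesgue_integral_def)
  qed
  have I_bound: "I s \<le> B * t" if "0 \<le> s" "s \<le> t" for s
    using I_diff[of 0 s] that I_0 mult_left_mono[OF that(2) B0] by auto
  define J where "J s = (LINT u:{0..s}|lborel. b u * exp (I u))" for s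
  define D where "D s = exp (I s) - J s" for s
  define h where "h u = (if u \<in> {0..t} then b u * exp (I u) else 0)" for u
  have hm[measurable]: "h \<in> borel_measurable borel" unfolding h_def[abs_def] by measurable
  have hb: "\<bar>h u\<bar> \<le> B * exp (B * t)" for u
    using B[of u] I_bound[of u] B0 by (auto simp: h_def abs_mult intro!: mult_mono')
  have Jh: "J s = (LINT u:{0..s}|lborel. h u)" if "s \<le> t" for s
    unfolding J_def set_lebesgue_integral_def using that by (intro bochner_cong) (auto simp: h_def indicator_def)
  have "D t = D 0"
  proof (rule quadratic_increments_constant[OF t, where K="2 * exp (B * t) * B\<^sup>2"])
    fix r s assume rs: "0 \<le> r" "r \<le> s" "s \<le> t"
    define d where "d = s - r"
    have d: "0 \<le> d" using rs by (simp add: d_def)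
    have "J s - J r = (LINT u:{r..s}|lborel. h u)" using split[OF hm hb rs(1,2)] Jh rs by simp
    also have "\<dots> = (LINT u:{r..s}|lborel. b u * exp (I r) + (h u - b u * exp (I r)))" by simp
    also have "\<dots> = (LINT u:{r..s}|lborel. b u * exp (I r)) + (LINT u:{r..s}|lborel. h u - b u * exp (I r))"
    proof (rule set_integral_add)
      show "set_integrable lborel {r..s} (\<lambda>u. b u * exp (I r))"
        by (rule si[where C="B * exp (I r)"]) (use B in \<open>auto simp: abs_mult\<close>)
      show "set_integrable lborel {r..s} (\<lambda>u. h u - b u * exp (I r))"
      proof (rule si[where C="B * exp (B * t) + B * exp (I r)"])
        fix u show "\<bar>h u - b u * exp (I r)\<bar> \<le> B * exp (B * t) + B * exp (I r)"
          using B by (intro order_trans[OF abs_triangle_ineq4] add_mono hb) (auto simp: abs_mult intro: mult_right_mono)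
      qed measurable
    qed
    also have "(LINT u:{r..s}|lborel. b u * exp (I r)) = (I s - I r) * exp (I r)"
      using split[OF bm B rs(1,2)] by (simp add: I_def)
    finally have J: "J s - J r = (I s - I r) * exp (I r) + (LINT u:{r..s}|lborel. h u - b u * exp (I r))" .
    have 1: "\<bar>LINT u:{r..s}|lborel. h u - b u * exp (I r)\<bar> \<le> (exp (B * t) * B\<^sup>2 * d) * (s - r)"
    proof (rule bnd[OF _ _ rs(2)])
      fix u assume u: "u \<in> {r..s}"
      have "\<bar>h u - b u * exp (I r)\<bar> = \<bar>b u\<bar> * \<bar>exp (I u) - exp (I r)\<bar>" using u rs by (simp add: h_def abs_mult flip: right_diff_distrib)
      also have "\<dots> \<le> B * (exp (B * t) * \<bar>I u - I r\<bar>)"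
        using u rs B[of u] by (intro mult_mono exp_lipschitz I_bound) auto
      also have "\<dots> \<le> B * (exp (B * t) * (B * (u - r)))"
        using u rs I_diff[of r u] B0 by (intro mult_left_mono) auto
      also have "\<dots> \<le> B * (exp (B * t) * (B * d))" using u B0 by (intro mult_left_mono) (auto simp: d_def)
      finally show "\<bar>h u - b u * exp (I r)\<bar> \<le> exp (B * t) * B\<^sup>2 * d" by (simp add: power2_eq_square mult_ac)
    qed measurable
    have 2: "\<bar>exp (I s) - exp (I r) - exp (I r) * (I s - I r)\<bar> \<le> exp (B * t) * (B * d)\<^sup>2"
    proof -
      have "\<bar>exp (I s) - exp (I r) - exp (I r) * (I s - I r)\<bar> \<le> exp (B * t) * \<bar>I s - I r\<bar>\<^sup>2"
        using rs by (intro exp_taylor_bound I_bound) auto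
      also have "\<dots> \<le> exp (B * t) * (B * d)\<^sup>2"
        using I_diff[OF rs(1,2)] by (intro mult_left_mono power_mono) (auto simp: d_def)
      finally show ?thesis .
    qed
    have "D s - D r = (exp (I s) - exp (I r) - exp (I r) * (I s - I r)) - (LINT u:{r..s}|lborel. h u - b u * exp (I r))"
      using J by (simp add: D_def algebra_simps)
    then have "\<bar>D s - D r\<bar> \<le> exp (B * t) * (B * d)\<^sup>2 + (exp (B * t) * B\<^sup>2 * d) * (s - r)"
      using 1 2 by linarith
    also have "\<dots> = 2 * exp (B * t) * B\<^sup>2 * (s - r)\<^sup>2" by (simp add: d_def power2_eq_square algebra_simps)
    finally show "\<bar>D s - D r\<bar> \<le> 2 * exp (B * t) * B\<^sup>2 * (s - r)\<^sup>2" .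
  qed
  moreover have "J 0 = 0"
  proof -
    have "(\<integral>u. indicator {0..0} u *\<^sub>R (b u * exp (I u)) \<partial>lborel) = (\<integral>u. 0 \<partial>(lborel :: real measure))"
    proof (rule integral_cong_AE)
      show "AE u in lborel. indicator {0..0} u *\<^sub>R (b u * exp (I u)) = 0"
        using AE_lborel_singleton[of "0::real"] by eventually_elim (simp add: indicator_def)
    qed measurable
    then show ?thesis by (simp add: J_def set_lebesgue_integral_def)
  qed
  ultimately show ?thesis using I_0 by (simp add: D_def J_def I_def)
qed

lemma bounded_Fubini:
  fixes f :: "'x \<Rightarrow> 'y \<Rightarrow> real"
  assumes "finite_measure A" "finite_measure B"
    and f: "(\<lambda>(x, y). f x y) \<in> borel_measurable (A \<Otimes>\<^sub>M B)" and C: "\<And>x y. x \<in> space A \<Longrightarrow> y \<in> space B \<Longrightarrow> \<bar>f x y\<bar> \<le> C"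
  shows "(\<integral>y. (\<integral>x. f x y \<partial>A) \<partial>B) = (\<integral>x. (\<integral>y. f x y \<partial>B) \<partial>A)"
    and "(\<lambda>x. \<integral>y. f x y \<partial>B) \<in> borel_measurable A"
    and "integrable A (\<lambda>x. \<integral>y. f x y \<partial>B)"
proof -
  interpret A: finite_measure A by fact
  interpret B: finite_measure B by fact
  interpret pair_sigma_finite A B ..
  interpret AB: finite_measure "A \<Otimes>\<^sub>M B" by (rule finite_measure_pair_measure[OF B.finite_measure_axioms A.finite_measure_axioms])
  have i: "integrable (A \<Otimes>\<^sub>M B) (\<lambda>(x, y). f x y)"
    using f C by (intro AB.integrable_const_bound[of _ C] AE_I2) (auto simp: space_pair_measure)
  then show "(\<integral>y. (\<integral>x. f x y \<partial>A) \<partial>B) = (\<integral>x. (\<integral>y. f x y \<partial>B) \<partial>A)" by (rule Fubini_integral)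
  show "integrable A (\<lambda>x. \<integral>y. f x y \<partial>B)" using integrable_fst'[OF i] by simp
  show "(\<lambda>x. \<integral>y. f x y \<partial>B) \<in> borel_measurable A" using f by (rule B.borel_measurable_lebesgue_integral)
qed

section \<open>Joint measurability and Feynman--Kac weights\<close>

lemma kernel_integral_measurable:
  fixes f :: "'x \<Rightarrow> 'y \<Rightarrow> real"
  assumes f[measurable]: "(\<lambda>(x, y). f x y) \<in> borel_measurable (X \<Otimes>\<^sub>M Y)" and C: "\<And>x y. \<bar>f x y\<bar> \<le> C"
    and L: "L \<in> X \<rightarrow>\<^sub>M subprob_algebra Y"
    and prob: "\<And>x. x \<in> space X \<Longrightarrow> prob_space (L x)"
  shows "(\<lambda>x. \<integral>y. f x y \<partial>L x) \<in> borel_measurable X"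
proof -
  have "(\<lambda>(x, y). ennreal (f x y + C)) \<in> borel_measurable (X \<Otimes>\<^sub>M Y)" by measurable
  then have "(\<lambda>x. \<integral>\<^sup>+y. ennreal (f x y + C) \<partial>L x) \<in> borel_measurable X"
    by (rule nn_integral_measurable_subprob_algebra2[OF _ L])
  then have "(\<lambda>x. enn2real (\<integral>\<^sup>+y. ennreal (f x y + C) \<partial>L x) - C) \<in> borel_measurable X" by measurable
  moreover have "(\<integral>y. f x y \<partial>L x) = enn2real (\<integral>\<^sup>+y. ennreal (f x y + C) \<partial>L x) - C" if x: "x \<in> space X" for x
  proof -
    interpret prob_space "L x" by (rule prob[OF x])
    have s: "sets (L x) = sets Y" by (rule sets_kernel[OF L x])
    have fx: "f x \<in> borel_measurable (L x)"
      using measurable_compose[OF measurable_Pair1'[OF x] f] by (simp cong: measurable_cong_sets[OF s refl])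
    have fi: "integrable (L x) (f x)" using fx C by (intro integrable_const_bound[of _ C]) auto
    have fp: "0 \<le> f x y + C" for y using C[of x y] by (simp add: abs_le_iff)
    have "(\<integral>y. f x y \<partial>L x) + C = (\<integral>y. f x y + C \<partial>L x)" using fi by (simp add: prob_space)
    also have "\<dots> = enn2real (\<integral>\<^sup>+y. ennreal (f x y + C) \<partial>L x)"
      using fx fp by (intro integral_eq_nn_integral) auto
    finally show ?thesis by simp
  qed
  ultimately show ?thesis by (simp cong: measurable_cong)
qed

text \<open>Approximation of a time from the right by a grid of mesh \<open>1 / (n + 1)\<close>.  Right-continuous functions are
  limits of their values at these times, which gives joint measurability.\<close>

definition right_approx :: "nat \<Rightarrow> real \<Rightarrow> real" where
  "right_approx n c = (of_int \<lfloor>real (Suc n) * c\<rfloor> + 1) / real (Suc n)"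

lemma right_approx_bounds: "c < right_approx n c" "right_approx n c \<le> c + inverse (real (Suc n))"
proof -
  have "real (Suc n) * c < of_int \<lfloor>real (Suc n) * c\<rfloor> + 1" by linarith
  then show "c < right_approx n c" unfolding right_approx_def by (subst pos_less_divide_eq) (auto simp: mult.commute)
  have "of_int \<lfloor>real (Suc n) * c\<rfloor> + 1 \<le> real (Suc n) * c + 1" by linarith
  then have "right_approx n c \<le> (real (Suc n) * c + 1) / real (Suc n)" unfolding right_approx_def by (intro divide_right_mono) auto
  then show "right_approx n c \<le> c + inverse (real (Suc n))" by (simp add: add_divide_distrib inverse_eq_divide)
qed

lemma right_approx_tendsto: "(\<lambda>n. right_approx n c) \<longlonglongrightarrow> c"
proof (rule tendsto_sandwich[of "\<lambda>_. c"])
  have "(\<lambda>n. c + inverse (real (Suc n))) \<longlonglongrightarrow> c + 0" by (intro tendsto_intros LIMSEQ_inverse_real_of_nat)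
  then show "(\<lambda>n. c + inverse (real (Suc n))) \<longlonglongrightarrow> c" by simp
qed (use right_approx_bounds in \<open>auto intro!: always_eventually less_imp_le\<close>)

lemma right_approx_compose_measurable:
  assumes g: "\<And>i::int. (\<lambda>x. g ((of_int i + 1) / real (Suc n)) x) \<in> X \<rightarrow>\<^sub>M Y" and h: "h \<in> borel_measurable X"
  shows "(\<lambda>x. g (right_approx n (h x)) x) \<in> X \<rightarrow>\<^sub>M Y"
  unfolding right_approx_def
  by (rule measurable_compose_countable[OF g]) (use h in measurable)

locale polish_right_process = borel_right_process P M law \<xi> \<zeta>
  for P :: "real \<Rightarrow> 'a::polish_space \<Rightarrow> 'a measure"
    and M :: "'w measure"
    and law :: "'a \<Rightarrow> 'w measure"
    and \<xi> :: "real \<Rightarrow> 'w \<Rightarrow> 'a"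
    and \<zeta> :: "'w \<Rightarrow> ereal"
begin

lemma right_limit:
  assumes w: "w \<in> space M" "alive s w" and u: "\<And>n. s \<le> u n" "u \<longlonglongrightarrow> s"
  shows "(\<lambda>n. \<xi> (u n) w) \<longlonglongrightarrow> \<xi> s w"
proof (rule topological_tendstoI)
  fix S assume S: "open S" "\<xi> s w \<in> S"
  have "((\<lambda>r. \<xi> r w) \<longlongrightarrow> \<xi> s w) (at_right s)" using right_continuous[OF w(1)] w(2) by (simp add: alive_def)
  from topological_tendstoD[OF this S] obtain b where b: "s < b" "\<And>r. s < r \<Longrightarrow> r < b \<Longrightarrow> \<xi> r w \<in> S"
    unfolding eventually_at_right_field by blast
  have "eventually (\<lambda>n. u n < b) sequentially" using u(2) b(1) by (rule order_tendstoD)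
  then show "eventually (\<lambda>n. \<xi> (u n) w \<in> S) sequentially"
  proof eventually_elim
    case (elim n)
    then show ?case using b(2)[of "u n"] u(1)[of n] S(2) by (cases "u n = s") auto
  qed
qed

lemma state_joint: "(\<lambda>(s, w). state s w) \<in> borel_measurable (borel \<Otimes>\<^sub>M paths)"
proof (rule borel_measurable_LIMSEQ_metric)
  fix n
  have "(\<lambda>z. state (right_approx n (fst z)) (snd z)) \<in> borel_measurable (borel \<Otimes>\<^sub>M paths)"
    by (rule right_approx_compose_measurable[where g="\<lambda>c z. state c (snd z)"])
      (auto intro: measurable_compose[OF measurable_snd state_path])
  then show "(\<lambda>(s, w). if 0 \<le> s then state (right_approx n s) w else undefined) \<in> borel_measurable (borel \<Otimes>\<^sub>M paths)"
    unfolding case_prod_beta by measurable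
next
  fix z assume z: "z \<in> space (borel \<Otimes>\<^sub>M paths :: (real \<times> 'w) measure)"
  obtain s w where zs: "z = (s, w)" by (cases z)
  have w: "w \<in> space M" using z by (simp add: zs space_pair_measure)
  have "(\<lambda>n. if 0 \<le> s then state (right_approx n s) w else undefined) \<longlonglongrightarrow> state s w"
  proof (cases "alive s w")
    case True
    then have s: "0 \<le> s" "ereal s < \<zeta> w" by (auto simp: alive_def)
    obtain b where b: "ereal s < ereal b" "ereal b < \<zeta> w" using ereal_dense2[OF s(2)] by auto
    have "eventually (\<lambda>n. right_approx n s < b) sequentially"
      using right_approx_tendsto b(1) by (intro order_tendstoD) auto
    then have "eventually (\<lambda>n. \<xi> (right_approx n s) w = (if 0 \<le> s then state (right_approx n s) w else undefined)) sequentially"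
    proof eventually_elim
      case (elim n)
      have "ereal (right_approx n s) < \<zeta> w" using elim b(2) by (metis ereal_less_eq(3) le_less_trans less_imp_le)
      then show ?case using s(1) right_approx_bounds(1)[of s n] by (simp add: state_def alive_def)
    qed
    moreover have "(\<lambda>n. \<xi> (right_approx n s) w) \<longlonglongrightarrow> state s w"
      using right_limit[OF w True _ right_approx_tendsto] right_approx_bounds(1) True by (simp add: state_def less_imp_le)
    ultimately show ?thesis using tendsto_cong by fast
  next
    case False
    have "(if 0 \<le> s then state (right_approx n s) w else undefined) = state s w" for n
    proof (cases "0 \<le> s")
      case True
      then have "\<zeta> w \<le> ereal s" using False by (simp add: alive_def not_less)
      also have "\<dots> < ereal (right_approx n s)" using right_approx_bounds(1) by simp
      finally have "\<not> alive (right_approx n s) w" by (simp add: alive_def not_less less_imp_le)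
      then show ?thesis using False by (simp add: state_def)
    qed (simp add: state_def alive_def)
    then show ?thesis by simp
  qed
  then show "(\<lambda>n. case z of (s, w) \<Rightarrow> if 0 \<le> s then state (right_approx n s) w else undefined) \<longlonglongrightarrow> (case z of (s, w) \<Rightarrow> state s w)"
    by (simp add: zs)
qed

lemma alive_joint: "Measurable.pred (borel \<Otimes>\<^sub>M paths) (\<lambda>z. alive (fst z) (snd z))"
proof -
  have eq: "alive s w \<longleftrightarrow> 0 \<le> s \<and> (\<exists>q::rat. s < of_rat q \<and> alive (of_rat q) w)" for s w
  proof
    assume a: "alive s w"
    then obtain b where b: "ereal s < ereal b" "ereal b < \<zeta> w" using ereal_dense2[of "ereal s" "\<zeta> w"] by (auto simp: alive_def)
    obtain q where q: "s < of_rat q" "of_rat q < b" using of_rat_dense[of s b] b by auto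
    have "ereal (of_rat q) < \<zeta> w" using q(2) b(2) by (metis ereal_less_eq(3) le_less_trans less_imp_le)
    moreover have "0 \<le> s" using a by (simp add: alive_def)
    moreover from this have "0 \<le> (of_rat q :: real)" using q(1) by linarith
    ultimately show "0 \<le> s \<and> (\<exists>q::rat. s < of_rat q \<and> alive (of_rat q) w)"
      using q(1) unfolding alive_def by blast
  next
    assume "0 \<le> s \<and> (\<exists>q::rat. s < of_rat q \<and> alive (of_rat q) w)"
    then obtain q :: rat where "0 \<le> s" "s < of_rat q" "ereal (of_rat q) < \<zeta> w" by (auto simp: alive_def)
    then show "alive s w" by (auto simp: alive_def intro: less_trans[of _ "ereal (of_rat q)"])
  qed
  have [measurable]: "Measurable.pred ((borel :: real measure) \<Otimes>\<^sub>M paths) (\<lambda>z. alive (of_rat q) (snd z))" for q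
    by (rule measurable_compose[OF measurable_snd alive_path])
  have m: "Measurable.pred (borel \<Otimes>\<^sub>M paths) (\<lambda>z. 0 \<le> (fst z :: real) \<and> (\<exists>q::rat. fst z < of_rat q \<and> alive (of_rat q) (snd z)))"
    by measurable
  have "(\<lambda>z. alive (fst z) (snd z)) = (\<lambda>z. 0 \<le> (fst z :: real) \<and> (\<exists>q::rat. fst z < of_rat q \<and> alive (of_rat q) (snd z)))"
    by (rule ext) (rule eq)
  then show ?thesis by (simp only: m)
qed

text \<open>On the event that the process survives up to time \<open>t\<close>, the path before \<open>t\<close> is jointly measurable with
  respect to the natural filtration at time \<open>t\<close>; grid times beyond \<open>t\<close> are replaced by \<open>t\<close>.\<close>

lemma adapted_joint:
  "(\<lambda>(u, w). if alive t w then \<xi> (max 0 (min t u)) w else undefined) \<in> borel_measurable (borel \<Otimes>\<^sub>M past t)"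
proof (rule borel_measurable_LIMSEQ_metric)
  fix n
  let ?F = "past t"
  have [measurable]: "Measurable.pred (borel \<Otimes>\<^sub>M ?F) (\<lambda>z. alive t (snd z))"
    by (rule measurable_compose[OF measurable_snd alive_natural]) simp
  have [measurable]: "(\<lambda>z. state (min t (right_approx n (max 0 (min t (fst z))))) (snd z)) \<in> borel_measurable (borel \<Otimes>\<^sub>M ?F)"
    by (rule right_approx_compose_measurable[where g="\<lambda>c z. state (min t c) (snd z)"])
      (auto intro!: measurable_compose[OF measurable_snd state_natural])
  show "(\<lambda>(u, w). if alive t w then state (min t (right_approx n (max 0 (min t u)))) w else undefined) \<in> borel_measurable (borel \<Otimes>\<^sub>M ?F)"
    unfolding case_prod_beta by measurable
next
  fix z assume z: "z \<in> space (borel \<Otimes>\<^sub>M past t :: (real \<times> 'w) measure)"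
  obtain u w where zu: "z = (u, w)" by (cases z)
  have w: "w \<in> space M" using z by (simp add: zu space_pair_measure)
  have "(\<lambda>n. if alive t w then state (min t (right_approx n (max 0 (min t u)))) w else undefined) \<longlonglongrightarrow>
      (if alive t w then \<xi> (max 0 (min t u)) w else undefined)"
  proof (cases "alive t w")
    case True
    define c where "c = max 0 (min t u)"
    have c: "0 \<le> c" "c \<le> t" using True by (auto simp: c_def alive_def)
    have below: "alive r w" if "0 \<le> r" "r \<le> t" for r
      using True that by (auto simp: alive_def intro: le_less_trans[of _ "ereal t"])
    have cl: "c \<le> min t (right_approx n c)" for n using c right_approx_bounds(1)[of c n] by simp
    have "(\<lambda>n. min t (right_approx n c)) \<longlonglongrightarrow> min t c" by (intro tendsto_min tendsto_const right_approx_tendsto)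
    moreover have "min t c = c" using c by simp
    ultimately have "(\<lambda>n. min t (right_approx n c)) \<longlonglongrightarrow> c" by simp
    then have "(\<lambda>n. \<xi> (min t (right_approx n c)) w) \<longlonglongrightarrow> \<xi> c w"
      using c by (intro right_limit w below cl)
    moreover have "state (min t (right_approx n c)) w = \<xi> (min t (right_approx n c)) w" for n
      using below[of "min t (right_approx n c)"] c(1) cl[of n] by (simp add: state_def)
    ultimately show ?thesis using True by (simp add: c_def)
  qed simp
  then show "(\<lambda>n. case z of (u, w) \<Rightarrow> if alive t w then state (min t (right_approx n (max 0 (min t u)))) w else undefined) \<longlonglongrightarrow>
      (case z of (u, w) \<Rightarrow> if alive t w then \<xi> (max 0 (min t u)) w else undefined)"
    by (simp add: zu)
qed

end

text \<open>The mean semigroup \<open>FK\<close> is the Feynman--Kac semigroup with bounded rate \<open>\<beta>\<close>; \<open>fk s h\<close> is the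
  functional of the path whose expectation it is.\<close>

locale feynman_kac = polish_right_process P M law \<xi> \<zeta>
  for P :: "real \<Rightarrow> 'a::polish_space \<Rightarrow> 'a measure" and M :: "'w measure" and law \<xi> \<zeta> +
  fixes \<beta> :: "'a \<Rightarrow> real" and b0 :: real
  assumes \<beta>_measurable [measurable]: "\<beta> \<in> borel_measurable borel"
    and \<beta>_bound: "\<And>x. \<bar>\<beta> x\<bar> \<le> b0"
begin

definition weight :: "real \<Rightarrow> 'w \<Rightarrow> real" where
  "weight s w = (LINT u:{0..s}|lborel. \<beta> (state u w))"

definition fk :: "real \<Rightarrow> ('a \<Rightarrow> real) \<Rightarrow> 'w \<Rightarrow> real" where
  "fk s h w = (if alive s w then exp (weight s w) * h (state s w) else 0)"

definition FK :: "real \<Rightarrow> ('a \<Rightarrow> real) \<Rightarrow> 'a \<Rightarrow> real" where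
  "FK s h x = (\<integral>w. fk s h w \<partial>path_law x)"

lemma b0_nonneg: "0 \<le> b0" using \<beta>_bound[of undefined] by (meson abs_ge_zero order_trans)

lemma weight_bound: "0 \<le> s \<Longrightarrow> \<bar>weight s w\<bar> \<le> b0 * s"
proof -
  assume s: "0 \<le> s"
  have "\<bar>weight s w\<bar> \<le> (\<integral>u. \<bar>indicator {0..s} u *\<^sub>R \<beta> (state u w)\<bar> \<partial>lborel)"
    unfolding weight_def set_lebesgue_integral_def by (rule integral_abs_bound)
  also have "\<dots> \<le> (\<integral>u. indicator {0..s} u * b0 \<partial>lborel)"
  proof (rule integral_mono')
    show "integrable lborel (\<lambda>u. indicator {0..s} u * b0 :: real)" by (simp add: emeasure_lborel_Icc_eq)
  qed (auto simp: indicator_def \<beta>_bound b0_nonneg)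
  also have "\<dots> = b0 * s" using s by simp
  finally show ?thesis .
qed

lemma weight_joint: "(\<lambda>(s, w). weight s w) \<in> borel_measurable (borel \<Otimes>\<^sub>M paths)"
proof -
  note [measurable] = state_joint
  have "(\<lambda>(z, u). if 0 \<le> u \<and> u \<le> fst z then \<beta> (state u (snd z)) else 0) \<in> borel_measurable ((borel \<Otimes>\<^sub>M paths) \<Otimes>\<^sub>M lborel)"
  proof -
    have "(\<lambda>q. state (snd q) (snd (fst q))) \<in> borel_measurable ((borel \<Otimes>\<^sub>M paths) \<Otimes>\<^sub>M lborel :: ((real \<times> 'w) \<times> real) measure)"
      using measurable_compose[OF _ state_joint, of "\<lambda>q. (snd q, snd (fst q))" "(borel \<Otimes>\<^sub>M paths) \<Otimes>\<^sub>M lborel"] by simp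
    then show ?thesis unfolding case_prod_beta by measurable
  qed
  from lborel.borel_measurable_lebesgue_integral[OF this]
  have "(\<lambda>z. \<integral>u. (if 0 \<le> u \<and> u \<le> fst z then \<beta> (state u (snd z)) else 0) \<partial>lborel) \<in> borel_measurable (borel \<Otimes>\<^sub>M paths)" .
  moreover have "(\<integral>u. (if 0 \<le> u \<and> u \<le> s then \<beta> (state u w) else 0) \<partial>lborel) = weight s w" for s w
    unfolding weight_def set_lebesgue_integral_def by (intro bochner_cong) (auto simp: indicator_def)
  ultimately show ?thesis by (simp add: case_prod_beta)
qed

lemma fk_joint:
  assumes h: "(\<lambda>(s, y). h s y) \<in> borel_measurable (borel \<Otimes>\<^sub>M borel)"
  shows "(\<lambda>(s, w). fk s (h s) w) \<in> borel_measurable (borel \<Otimes>\<^sub>M paths)"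
proof -
  note [measurable] = alive_joint
  have [measurable]: "(\<lambda>z. weight (fst z) (snd z)) \<in> borel_measurable (borel \<Otimes>\<^sub>M paths)"
    using weight_joint by (simp add: case_prod_beta)
  have "(\<lambda>z. (fst z, state (fst z) (snd z))) \<in> borel \<Otimes>\<^sub>M paths \<rightarrow>\<^sub>M borel \<Otimes>\<^sub>M borel"
    using state_joint by (intro measurable_Pair) (auto simp: case_prod_beta)
  from measurable_compose[OF this h]
  have [measurable]: "(\<lambda>z. h (fst z) (state (fst z) (snd z))) \<in> borel_measurable (borel \<Otimes>\<^sub>M paths)" by simp
  show ?thesis unfolding fk_def case_prod_beta by measurable
qed

lemma fk_measurable: "h \<in> borel_measurable borel \<Longrightarrow> fk s h \<in> borel_measurable paths"
proof -
  assume "h \<in> borel_measurable borel"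
  then have "(\<lambda>(s::real, y). h y) \<in> borel_measurable (borel \<Otimes>\<^sub>M borel)" by measurable
  from measurable_compose[OF measurable_Pair1' fk_joint[OF this], of s]
  show ?thesis by simp
qed

lemma fk_bound: "0 \<le> s \<Longrightarrow> (\<And>y. \<bar>h y\<bar> \<le> C) \<Longrightarrow> \<bar>fk s h w\<bar> \<le> exp (b0 * s) * C"
proof -
  assume s: "0 \<le> s" and C: "\<And>y. \<bar>h y\<bar> \<le> C"
  have "0 \<le> C" using C[of undefined] by (meson abs_ge_zero order_trans)
  moreover have "weight s w \<le> b0 * s" using weight_bound[OF s, of w] by simp
  ultimately show ?thesis by (auto simp: fk_def abs_mult intro!: mult_mono C)
qed

lemma fk_neg: "s < 0 \<Longrightarrow> fk s h w = 0" by (simp add: fk_def alive_def)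

lemma fk_integrable:
  assumes "0 \<le> s" "h \<in> borel_measurable borel" "\<And>y. \<bar>h y\<bar> \<le> C"
  shows "integrable (path_law x) (fk s h)"
proof -
  interpret prob_space "path_law x" by (rule prob_path_law)
  show ?thesis using fk_measurable[OF assms(2)] fk_bound[OF assms(1,3)]
    by (intro integrable_const_bound[of _ "exp (b0 * s) * C"]) auto
qed

lemma fk_adapted:
  assumes h: "h \<in> borel_measurable borel"
  shows "fk s h \<in> borel_measurable (past s)"
proof (cases "0 \<le> s")
  case True
  let ?F = "past s"
  let ?X = "\<lambda>u w. if alive s w then \<xi> (max 0 (min s u)) w else undefined"
  note [measurable] = alive_natural[OF order_refl[of s]] state_natural[OF order_refl[of s]] h
  have X: "(\<lambda>z. ?X (snd z) (fst z)) \<in> borel_measurable (?F \<Otimes>\<^sub>M lborel)"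
    using measurable_compose[OF _ adapted_joint[of s], of "\<lambda>z. (snd z, fst z)" "?F \<Otimes>\<^sub>M lborel"] by simp
  have "(\<lambda>(w, u). indicator {0..s} u *\<^sub>R \<beta> (?X u w)) \<in> borel_measurable (?F \<Otimes>\<^sub>M lborel)"
    unfolding case_prod_beta using measurable_compose[OF X \<beta>_measurable] by measurable
  from lborel.borel_measurable_lebesgue_integral[OF this]
  have [measurable]: "(\<lambda>w. \<integral>u. indicator {0..s} u *\<^sub>R \<beta> (?X u w) \<partial>lborel) \<in> borel_measurable ?F" .
  have "fk s h w = (if alive s w then exp (\<integral>u. indicator {0..s} u *\<^sub>R \<beta> (?X u w) \<partial>lborel) * h (state s w) else 0)" for w
  proof (cases "alive s w")
    case True
    have "(\<integral>u. indicator {0..s} u *\<^sub>R \<beta> (?X u w) \<partial>lborel) = weight s w"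
      unfolding weight_def set_lebesgue_integral_def
    proof (intro bochner_cong refl)
      fix u
      have "alive u w" if "0 \<le> u" "u \<le> s" using True that by (auto simp: alive_def intro: le_less_trans[of _ "ereal s"])
      then show "indicator {0..s} u *\<^sub>R \<beta> (?X u w) = indicator {0..s} u *\<^sub>R \<beta> (state u w)"
        using True by (auto simp: indicator_def state_def)
    qed
    then show ?thesis using True by (simp add: fk_def)
  qed (simp add: fk_def)
  then have "fk s h = (\<lambda>w. if alive s w then exp (\<integral>u. indicator {0..s} u *\<^sub>R \<beta> (?X u w) \<partial>lborel) * h (state s w) else 0)" by auto
  then show ?thesis by (simp only:) measurable
next
  case False
  then have "fk s h = (\<lambda>_. 0)" by (auto simp: fk_def alive_def)
  then show ?thesis by simp
qed

lemma fk_semigroup_measurable: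
  assumes h: "(\<lambda>(s, y). h s y) \<in> borel_measurable (borel \<Otimes>\<^sub>M borel)" and C: "\<And>s y. \<bar>h s y\<bar> \<le> C" and t: "0 \<le> t"
  shows "(\<lambda>(s, x). indicator {0..t} s * FK s (h s) x) \<in> borel_measurable (borel \<Otimes>\<^sub>M borel)"
proof -
  have 1: "(\<lambda>(z, w). indicator {0..t} (fst z) * fk (fst z) (h (fst z)) w) \<in> borel_measurable ((borel \<Otimes>\<^sub>M borel) \<Otimes>\<^sub>M paths)"
  proof -
    have [measurable]: "(\<lambda>q. fk (fst (fst q)) (h (fst (fst q))) (snd q)) \<in> borel_measurable ((borel \<Otimes>\<^sub>M borel) \<Otimes>\<^sub>M paths)"
      using measurable_compose[OF _ fk_joint[OF h], of "\<lambda>q. (fst (fst q), snd q)" "(borel \<Otimes>\<^sub>M borel) \<Otimes>\<^sub>M paths"] by simp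
    show ?thesis unfolding case_prod_beta by measurable
  qed
  have C0: "0 \<le> C" using C[of undefined undefined] by (meson abs_ge_zero order_trans)
  have 2: "\<bar>indicator {0..t} s * fk s (h s) w\<bar> \<le> exp (b0 * t) * C" for s w
  proof (cases "s \<in> {0..t}")
    case True
    then have "\<bar>fk s (h s) w\<bar> \<le> exp (b0 * s) * C" by (intro fk_bound C) auto
    also have "\<dots> \<le> exp (b0 * t) * C" using True b0_nonneg C0 by (intro mult_right_mono) (auto intro: mult_left_mono)
    finally show ?thesis using True by simp
  qed (use C0 in simp)
  have "(\<lambda>z. \<integral>w. indicator {0..t} (fst z) * fk (fst z) (h (fst z)) w \<partial>path_law (snd z)) \<in> borel_measurable (borel \<Otimes>\<^sub>M borel)"
    by (rule kernel_integral_measurable[OF 1 2]) (auto intro: prob_path_law measurable_compose[OF measurable_snd path_law_measurable])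
  then show ?thesis by (simp add: FK_def case_prod_beta)
qed

end

section \<open>The mean equation\<close>

context feynman_kac
begin

lemma integral_path_law:
  fixes f :: "'w \<Rightarrow> real"
  shows "f \<in> borel_measurable paths \<Longrightarrow> (\<integral>w. f w \<partial>path_law x) = (\<integral>w. f w \<partial>law x)"
  unfolding path_law_def by (rule integral_subalgebra2[OF subalgebra_path])

text \<open>The value of a function along the process, extended by \<open>0\<close> to the cemetery.\<close>

definition killed :: "real \<Rightarrow> ('a \<Rightarrow> real) \<Rightarrow> 'w \<Rightarrow> real" where
  "killed s h w = (if alive s w then h (state s w) else 0)"

lemma killed_measurable: "h \<in> borel_measurable borel \<Longrightarrow> killed s h \<in> borel_measurable paths"
proof -
  assume [measurable]: "h \<in> borel_measurable borel"
  note [measurable] = alive_path[of s] state_path[of s]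
  show ?thesis unfolding killed_def[abs_def] by measurable
qed

lemma killed_abs: "(\<And>y. \<bar>h y\<bar> \<le> C) \<Longrightarrow> \<bar>killed s h w\<bar> \<le> C"
proof -
  assume C: "\<And>y. \<bar>h y\<bar> \<le> C"
  then have "0 \<le> C" using abs_ge_zero[of "h undefined"] by (meson order_trans)
  then show "\<bar>killed s h w\<bar> \<le> C" using C by (simp add: killed_def)
qed

lemma killed_joint:
  assumes h: "(\<lambda>(s, y). h s y) \<in> borel_measurable (borel \<Otimes>\<^sub>M borel)"
  shows "(\<lambda>(s, w). killed s (h s) w) \<in> borel_measurable (borel \<Otimes>\<^sub>M paths)"
proof -
  note [measurable] = alive_joint
  have "(\<lambda>z. (fst z, state (fst z) (snd z))) \<in> borel \<Otimes>\<^sub>M paths \<rightarrow>\<^sub>M borel \<Otimes>\<^sub>M borel"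
    using state_joint by (intro measurable_Pair) (auto simp: case_prod_beta)
  from measurable_compose[OF this h]
  have [measurable]: "(\<lambda>z. h (fst z) (state (fst z) (snd z))) \<in> borel_measurable (borel \<Otimes>\<^sub>M paths)" by simp
  show ?thesis unfolding killed_def case_prod_beta by measurable
qed

lemma P_integrable:
  fixes f :: "'a \<Rightarrow> real"
  assumes "0 \<le> r" "f \<in> borel_measurable borel" "\<And>y. \<bar>f y\<bar> \<le> d"
  shows "integrable (P r y) f"
proof -
  interpret subprob_space "P r y" by (rule subprob_P[OF assms(1)])
  show ?thesis using assms by (intro integrable_const_bound[of _ d]) (auto cong: measurable_cong_sets)
qed

lemma P_integral_abs:
  fixes f :: "'a \<Rightarrow> real"
  assumes "0 \<le> r" "f \<in> borel_measurable borel" "\<And>y. \<bar>f y\<bar> \<le> d"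
  shows "\<bar>\<integral>z. f z \<partial>P r y\<bar> \<le> d"
proof -
  interpret subprob_space "P r y" by (rule subprob_P[OF assms(1)])
  have d: "0 \<le> d" using assms(3)[of undefined] by (meson abs_ge_zero order_trans)
  have "\<bar>\<integral>z. f z \<partial>P r y\<bar> \<le> (\<integral>z. \<bar>f z\<bar> \<partial>P r y)" by (rule integral_abs_bound)
  also have "\<dots> \<le> (\<integral>z. d \<partial>P r y)" using P_integrable[OF assms] assms(3) by (intro integral_mono) auto
  also have "\<dots> = d * measure (P r y) (space (P r y))" by simp
  also have "\<dots> \<le> d * 1" using d subprob_measure_le_1 by (intro mult_left_mono) auto
  finally show ?thesis by simp
qed

lemma P_real_measurable:
  fixes f :: "'a \<Rightarrow> real"
  assumes r: "0 \<le> r" and f: "f \<in> borel_measurable borel" "\<And>y. \<bar>f y\<bar> \<le> d"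
  shows "(\<lambda>y. \<integral>z. f z \<partial>P r y) \<in> borel_measurable borel"
proof -
  have *: "(\<lambda>y. \<integral>z. g z \<partial>P r y) \<in> borel_measurable borel" if g: "g \<in> borel_measurable borel" "\<And>z. 0 \<le> g z" for g :: "'a \<Rightarrow> real"
  proof -
    have "(\<integral>z. g z \<partial>P r y) = enn2real (\<integral>\<^sup>+z. ennreal (g z) \<partial>P r y)" for y
      using g r by (intro integral_eq_nn_integral) (auto cong: measurable_cong_sets)
    then show ?thesis using P_integral_measurable[OF r, of "\<lambda>z. ennreal (g z)"] g by simp
  qed
  have d: "0 \<le> f z + d" "0 \<le> d" for z using f(2)[of z] by (auto simp: abs_le_iff)
  have "(\<integral>z. f z \<partial>P r y) = (\<integral>z. f z + d \<partial>P r y) - (\<integral>z. d \<partial>P r y)" for y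
    using P_integrable[OF r f] P_integrable[OF r, of "\<lambda>_. d" d] d by simp
  then show ?thesis using *[of "\<lambda>z. f z + d"] *[of "\<lambda>_. d"] f(1) d by simp
qed

lemma markov_integral_nonneg:
  assumes sr: "0 \<le> s" "0 \<le> r"
    and G: "G \<in> borel_measurable (past s)" "\<And>w. 0 \<le> G w"
    and f: "f \<in> borel_measurable borel" "\<And>y. 0 \<le> f y" "\<And>y. f y \<le> d"
  shows "(\<integral>w. G w * killed (s + r) f w \<partial>path_law x) = (\<integral>w. G w * killed s (\<lambda>y. \<integral>z. f z \<partial>P r y) w \<partial>path_law x)"
proof -
  note [measurable] = natural_measurable_path[OF G(1)] killed_measurable[OF f(1)]
  have fa: "\<bar>f y\<bar> \<le> d" for y using f by (simp add: abs_of_nonneg)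
  note [measurable] = killed_measurable[OF P_real_measurable[OF sr(2) f(1) fa]]
  have Pf: "0 \<le> (\<integral>z. f z \<partial>P r y)" for y using f by (intro bochner_nonneg) auto
  have k: "0 \<le> killed u f w" "0 \<le> killed u (\<lambda>y. \<integral>z. f z \<partial>P r y) w" for u w using f Pf by (auto simp: killed_def)
  have "(\<integral>\<^sup>+w. ennreal (G w * killed (s + r) f w) \<partial>law x) =
      (\<integral>\<^sup>+w. ennreal (G w) * (if alive (s + r) w then ennreal (f (state (s + r) w)) else 0) \<partial>law x)"
    using G(2) f(2) by (intro nn_integral_cong) (auto simp: killed_def ennreal_mult)
  also have "\<dots> = (\<integral>\<^sup>+w. ennreal (G w) * (if alive s w then \<integral>\<^sup>+y. ennreal (f y) \<partial>P r (state s w) else 0) \<partial>law x)"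
    by (rule markov_nn_integral) (use sr G f in auto)
  also have "\<dots> = (\<integral>\<^sup>+w. ennreal (G w * killed s (\<lambda>y. \<integral>z. f z \<partial>P r y) w) \<partial>law x)"
    using G(2) Pf by (intro nn_integral_cong) (auto simp: killed_def ennreal_mult nn_integral_eq_integral[OF P_integrable[OF sr(2) f(1) fa]] f(2))
  finally have eq: "(\<integral>\<^sup>+w. ennreal (G w * killed (s + r) f w) \<partial>path_law x) =
      (\<integral>\<^sup>+w. ennreal (G w * killed s (\<lambda>y. \<integral>z. f z \<partial>P r y) w) \<partial>path_law x)"
    by (simp add: nn_integral_path_law)
  have "(\<integral>w. G w * killed (s + r) f w \<partial>path_law x) = enn2real (\<integral>\<^sup>+w. ennreal (G w * killed (s + r) f w) \<partial>path_law x)"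
    using G(2) k by (intro integral_eq_nn_integral) auto
  moreover have "(\<integral>w. G w * killed s (\<lambda>y. \<integral>z. f z \<partial>P r y) w \<partial>path_law x) =
      enn2real (\<integral>\<^sup>+w. ennreal (G w * killed s (\<lambda>y. \<integral>z. f z \<partial>P r y) w) \<partial>path_law x)"
    using G(2) k by (intro integral_eq_nn_integral) auto
  ultimately show ?thesis using eq by simp
qed

lemma path_integrable:
  assumes "g \<in> borel_measurable paths" "\<And>w. w \<in> space M \<Longrightarrow> \<bar>g w\<bar> \<le> C"
  shows "integrable (path_law x) (g :: 'w \<Rightarrow> real)"
proof -
  interpret prob_space "path_law x" by (rule prob_path_law)
  show ?thesis using assms by (intro integrable_const_bound[of _ C] AE_I2) auto
qed

lemma markov_integral:
  assumes sr: "0 \<le> s" "0 \<le> r"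
    and G: "G \<in> borel_measurable (past s)" "\<And>w. \<bar>G w\<bar> \<le> c"
    and f: "f \<in> borel_measurable borel" "\<And>y. \<bar>f y\<bar> \<le> d"
  shows "(\<integral>w. G w * killed (s + r) f w \<partial>path_law x) = (\<integral>w. G w * killed s (\<lambda>y. \<integral>z. f z \<partial>P r y) w \<partial>path_law x)"
proof -
  have c: "0 \<le> c" "0 \<le> G w + c" for w using G(2)[of w] by (auto simp: abs_le_iff)
  have d: "0 \<le> d" "0 \<le> f y + d" "f y + d \<le> 2 * d" for y using f(2)[of y] by (auto simp: abs_le_iff)
  have [measurable]: "(\<lambda>w. G w + c) \<in> borel_measurable (past s)" using G(1) by simp
  have fd[measurable]: "(\<lambda>y. f y + d) \<in> borel_measurable borel" using f(1) by simp
  have E: "(\<integral>w. G' w * killed (s + r) f' w \<partial>path_law x) = (\<integral>w. G' w * killed s (\<lambda>y. \<integral>z. f' z \<partial>P r y) w \<partial>path_law x)"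
    if "G' \<in> {\<lambda>w. G w + c, \<lambda>_. c}" "f' \<in> {\<lambda>y. f y + d, \<lambda>_. d}" for G' f'
    using that c d by (intro markov_integral_nonneg[OF sr, where d="2 * d"]) auto
  have int: "integrable (path_law x) (\<lambda>w. G' w * killed u g w)"
    if "G' \<in> {\<lambda>w. G w + c, \<lambda>_. c}" "g \<in> borel_measurable borel" "\<And>y. \<bar>g y\<bar> \<le> C" for G' g u C
  proof (rule path_integrable[where C="2 * c * C"])
    have "G' \<in> borel_measurable paths" using that(1) natural_measurable_path[OF G(1)] by auto
    then show "(\<lambda>w. G' w * killed u g w) \<in> borel_measurable paths" using killed_measurable[OF that(2)] by measurable
    have "\<bar>G' w\<bar> \<le> 2 * c" for w using that(1) c G(2)[of w] by (auto simp: abs_le_iff)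
    then show "\<bar>G' w * killed u g w\<bar> \<le> 2 * c * C" for w
      unfolding abs_mult using c by (intro mult_mono killed_abs that(3)) auto
  qed
  have Pd: "(\<integral>z. f z \<partial>P r y) = (\<integral>z. f z + d \<partial>P r y) - (\<integral>z. d \<partial>P r y)" for y
    using P_integrable[OF sr(2) f] P_integrable[OF sr(2), of "\<lambda>_. d" d] d by simp
  have expand: "(\<integral>w. G w * killed u g w \<partial>path_law x) =
      (\<integral>w. (G w + c) * killed u g1 w \<partial>path_law x) - (\<integral>w. (G w + c) * killed u g2 w \<partial>path_law x)
      - (\<integral>w. c * killed u g1 w \<partial>path_law x) + (\<integral>w. c * killed u g2 w \<partial>path_law x)"
    if g: "\<And>y. g y = g1 y - g2 y" "g1 \<in> borel_measurable borel" "\<And>y. \<bar>g1 y\<bar> \<le> C" "g2 \<in> borel_measurable borel" "\<And>y. \<bar>g2 y\<bar> \<le> C" for u g g1 g2 C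
  proof -
    have "G w * killed u g w = (G w + c) * killed u g1 w - (G w + c) * killed u g2 w - c * killed u g1 w + c * killed u g2 w" for w
      by (simp add: killed_def g(1) algebra_simps)
    moreover have "integrable (path_law x) (\<lambda>w. (G w + c) * killed u g1 w)" "integrable (path_law x) (\<lambda>w. (G w + c) * killed u g2 w)"
      "integrable (path_law x) (\<lambda>w. c * killed u g1 w)" "integrable (path_law x) (\<lambda>w. c * killed u g2 w)"
      by (intro int[where C=C] g; simp)+
    ultimately show ?thesis by (simp only: Bochner_Integration.integral_add Bochner_Integration.integral_diff Bochner_Integration.integrable_diff)
  qed
  have fd2: "\<bar>f y + d\<bar> \<le> 2 * d" "\<bar>d\<bar> \<le> 2 * d" for y using d(1) d(2)[of y] d(3)[of y] by auto
  have "(\<integral>w. G w * killed (s + r) f w \<partial>path_law x) =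
      (\<integral>w. (G w + c) * killed (s + r) (\<lambda>y. f y + d) w \<partial>path_law x) - (\<integral>w. (G w + c) * killed (s + r) (\<lambda>_. d) w \<partial>path_law x)
      - (\<integral>w. c * killed (s + r) (\<lambda>y. f y + d) w \<partial>path_law x) + (\<integral>w. c * killed (s + r) (\<lambda>_. d) w \<partial>path_law x)"
    by (rule expand[where C="2 * d"]) (use fd fd2 in auto)
  also have "\<dots> = (\<integral>w. (G w + c) * killed s (\<lambda>y. \<integral>z. f z + d \<partial>P r y) w \<partial>path_law x) - (\<integral>w. (G w + c) * killed s (\<lambda>y. \<integral>z. d \<partial>P r y) w \<partial>path_law x)
      - (\<integral>w. c * killed s (\<lambda>y. \<integral>z. f z + d \<partial>P r y) w \<partial>path_law x) + (\<integral>w. c * killed s (\<lambda>y. \<integral>z. d \<partial>P r y) w \<partial>path_law x)"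
    by (simp only: E insert_iff simp_thms)
  also have "\<dots> = (\<integral>w. G w * killed s (\<lambda>y. \<integral>z. f z \<partial>P r y) w \<partial>path_law x)"
    by (rule expand[where C="2 * d", symmetric])
      (use Pd P_real_measurable[OF sr(2) fd fd2(1)] P_real_measurable[OF sr(2), of "\<lambda>_. d" "2 * d"] P_integral_abs[OF sr(2) fd fd2(1)]
          P_integral_abs[OF sr(2), of "\<lambda>_. d" "2 * d"] fd2 in auto)
  finally show ?thesis .
qed

lemma P_eq_path_law:
  assumes r: "0 \<le> r" and f: "f \<in> borel_measurable borel" "\<And>y. \<bar>f y\<bar> \<le> d"
  shows "(\<integral>z. f z \<partial>P r x) = (\<integral>w. killed r f w \<partial>path_law x)"
proof -
  interpret prob_space "law x" by (rule prob_law)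
  have "(\<integral>w. killed r f w \<partial>path_law x) = (\<integral>w. killed 0 (\<lambda>y. \<integral>z. f z \<partial>P r y) w \<partial>path_law x)"
    using markov_integral[OF order_refl r, of "\<lambda>_. 1" 1 f d x] f by simp
  also have "\<dots> = (\<integral>w. killed 0 (\<lambda>y. \<integral>z. f z \<partial>P r y) w \<partial>law x)"
    by (rule integral_path_law[OF killed_measurable[OF P_real_measurable[OF r f]]])
  also have "\<dots> = (\<integral>w. (\<integral>z. f z \<partial>P r x) \<partial>law x)"
  proof (rule integral_cong_AE)
    show "AE w in law x. killed 0 (\<lambda>y. \<integral>z. f z \<partial>P r y) w = (\<integral>z. f z \<partial>P r x)"
      using normal[of x] by eventually_elim (simp add: alive_def state_def killed_def zero_ereal_def)
    show "killed 0 (\<lambda>y. \<integral>z. f z \<partial>P r y) \<in> borel_measurable (law x)"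
      by (rule path_measurable_law[OF killed_measurable[OF P_real_measurable[OF r f]]])
  qed simp
  finally show ?thesis using prob_space by simp
qed

lemma measurable_restrict_pair:
  assumes "(\<lambda>(x, y). f x y) \<in> borel_measurable (borel \<Otimes>\<^sub>M Y)"
  shows "(\<lambda>(x, y). f x y) \<in> borel_measurable (restrict_space lborel S \<Otimes>\<^sub>M Y)"
proof -
  have "(\<lambda>z. (fst z, snd z)) \<in> restrict_space lborel S \<Otimes>\<^sub>M Y \<rightarrow>\<^sub>M borel \<Otimes>\<^sub>M Y"
    by (intro measurable_Pair measurable_snd measurable_compose[OF measurable_fst]) (simp add: measurable_restrict_space1)
  from measurable_compose[OF this assms] show ?thesis by simp
qed

text \<open>A linear equation driven by the transition semigroup, with zero-order term \<open>\<beta> U\<close> and source \<open>W\<close>, is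
  solved by the Feynman--Kac semigroup.  Time runs backwards: \<open>U s\<close> is the solution at time \<open>s\<close> with
  terminal value \<open>f\<close> at time \<open>t\<close>.\<close>

theorem mean_equation:
  assumes t: "0 \<le> t"
    and f: "f \<in> borel_measurable borel" "\<And>y. \<bar>f y\<bar> \<le> C"
    and U: "(\<lambda>(s, y). U s y) \<in> borel_measurable (borel \<Otimes>\<^sub>M borel)" "\<And>s y. \<bar>U s y\<bar> \<le> C"
    and W: "(\<lambda>(s, y). W s y) \<in> borel_measurable (borel \<Otimes>\<^sub>M borel)" "\<And>s y. \<bar>W s y\<bar> \<le> C"
    and eq: "\<And>s y. 0 \<le> s \<Longrightarrow> s \<le> t \<Longrightarrow>
      U s y = (\<integral>z. f z \<partial>P (t - s) y) + (LINT v:{s..t}|lborel. \<integral>z. (\<beta> z * U v z - W v z) \<partial>P (v - s) y)"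
  shows "U 0 x = FK t f x - (LINT v:{0..t}|lborel. FK v (W v) x)"
proof -
  define J where "J = restrict_space lborel {0..t}"
  have sp: "space J = {0..t}" by (simp add: J_def space_restrict_space)
  have fin: "finite_measure J" by (rule finite_measureI) (simp add: J_def space_restrict_space emeasure_restrict_space emeasure_lborel_Icc_eq)
  have L: "(LINT v:{0..t}|lborel. h v) = (\<integral>v. h v \<partial>J)" for h :: "real \<Rightarrow> real"
    unfolding J_def set_lebesgue_integral_def by (subst integral_restrict_space) auto
  have L': "(LINT v:{s..t}|lborel. h v) = (\<integral>v. indicator {s..} v * h v \<partial>J)" if "0 \<le> s" for h :: "real \<Rightarrow> real" and s
    unfolding L[symmetric] set_lebesgue_integral_def using that
    by (intro bochner_cong) (auto simp: indicator_def)
  have L'': "(LINT v:{0..s}|lborel. h v) = (\<integral>v. indicator {v..} s * h v \<partial>J)" if "s \<le> t" for h :: "real \<Rightarrow> real" and s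
    unfolding L[symmetric] set_lebesgue_integral_def using that
    by (intro bochner_cong) (auto simp: indicator_def)
  have ind: "indicator {s..} v = (if s \<le> v then 1 else 0 :: real)" for s v :: real by (simp add: indicator_def)
  let ?E = "path_law x"
  interpret E: prob_space ?E by (rule prob_path_law)
  interpret J: finite_measure J by (rule fin)
  have C0: "0 \<le> C" using f(2)[of undefined] by (meson abs_ge_zero order_trans)
  define K where "K v z = \<beta> z * U v z - W v z" for v z
  define C1 where "C1 = b0 * C + C"
  have C1: "0 \<le> C1" using C0 b0_nonneg by (simp add: C1_def)
  have Km: "(\<lambda>(v, z). K v z) \<in> borel_measurable (borel \<Otimes>\<^sub>M borel)"
    unfolding K_def[abs_def] using U(1) W(1) unfolding case_prod_beta by measurable
  have Kb: "\<bar>K v z\<bar> \<le> C1" for v z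
  proof -
    have "\<bar>\<beta> z * U v z\<bar> \<le> b0 * C" unfolding abs_mult using \<beta>_bound U(2) b0_nonneg by (intro mult_mono) auto
    then show ?thesis unfolding K_def C1_def by (intro order_trans[OF abs_triangle_ineq4] add_mono W(2))
  qed
  have Ksec: "K v \<in> borel_measurable borel" "U v \<in> borel_measurable borel" "W v \<in> borel_measurable borel" for v
    using measurable_compose[OF measurable_Pair1' Km, of v] measurable_compose[OF measurable_Pair1' U(1), of v]
      measurable_compose[OF measurable_Pair1' W(1), of v] by auto
  let ?G = "\<lambda>s. fk s \<beta>"
  define D where "D = exp (b0 * t) * b0"
  have D0: "0 \<le> D" using b0_nonneg by (simp add: D_def)
  have Gb: "\<bar>?G s w\<bar> \<le> D" if "s \<le> t" for s w
  proof (cases "0 \<le> s")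
    case True
    have "\<bar>?G s w\<bar> \<le> exp (b0 * s) * b0" by (rule fk_bound[OF True \<beta>_bound])
    also have "\<dots> \<le> D" unfolding D_def using that b0_nonneg by (intro mult_right_mono) (auto intro: mult_left_mono)
    finally show ?thesis .
  qed (use D0 in \<open>simp add: fk_neg\<close>)
  have G_joint: "(\<lambda>(s, w). ?G s w) \<in> borel_measurable (borel \<Otimes>\<^sub>M paths)"
    by (rule fk_joint) measurable
  have G_meas: "?G s \<in> borel_measurable paths" for s by (rule fk_measurable) measurable
  have k_joint: "(\<lambda>(v, w). killed v (K v) w) \<in> borel_measurable (borel \<Otimes>\<^sub>M paths)" by (rule killed_joint[OF Km])
  have k_b: "\<bar>killed v (K v) w\<bar> \<le> C1" for v w by (rule killed_abs[OF Kb])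

  text \<open>The exponential weight accumulates: pathwise fundamental theorem.\<close>
  have weight_int: "(\<integral>s. indicator {s..} v * ?G s w \<partial>J) = exp (weight v w) - 1"
    if v: "0 \<le> v" "v \<le> t" and w: "w \<in> space M" "alive v w" for v w
  proof -
    have bm: "(\<lambda>u. \<beta> (state u w)) \<in> borel_measurable borel"
    proof -
      have "(\<lambda>u. (u, w)) \<in> borel \<rightarrow>\<^sub>M borel \<Otimes>\<^sub>M paths" using w(1) by (intro measurable_Pair) auto
      from measurable_compose[OF measurable_compose[OF this state_joint] \<beta>_measurable] show ?thesis by simp
    qed
    have "(\<integral>s. indicator {s..} v * ?G s w \<partial>J) = (LINT s:{0..v}|lborel. ?G s w)" using L''[OF v(2)] by simp
    also have "\<dots> = (LINT s:{0..v}|lborel. \<beta> (state s w) * exp (LINT u:{0..s}|lborel. \<beta> (state u w)))"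
      unfolding set_lebesgue_integral_def
    proof (intro bochner_cong refl)
      fix s
      have "alive s w" if "0 \<le> s" "s \<le> v" using w(2) that by (auto simp: alive_def intro: le_less_trans[of _ "ereal v"])
      then show "indicator {0..v} s *\<^sub>R ?G s w = indicator {0..v} s *\<^sub>R (\<beta> (state s w) * exp (\<integral>u. indicator {0..s} u *\<^sub>R \<beta> (state u w) \<partial>lborel))"
        by (auto simp: indicator_def fk_def weight_def set_lebesgue_integral_def)
    qed
    also have "\<dots> = exp (weight v w) - 1"
      unfolding weight_def by (rule exp_integral_identity[OF bm \<beta>_bound v(1)])
    finally show ?thesis .
  qed

  define Pk where "Pk s v y = (\<integral>w. indicator {s..} v * killed (v - s) (K v) w \<partial>path_law y)" for s v y
  have Pk_eq: "Pk s v y = indicator {s..} v * (\<integral>z. K v z \<partial>P (v - s) y)" for s v y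
    using P_eq_path_law[OF _ Ksec(1)[of v] Kb, of "v - s" y] by (cases "s \<le> v") (auto simp: Pk_def)
  have Pk_b: "\<bar>Pk s v y\<bar> \<le> C1" for s v y
    using P_integral_abs[OF _ Ksec(1)[of v] Kb, of "v - s" y] C1 by (cases "s \<le> v") (auto simp: Pk_eq)
  have Pk_m: "(\<lambda>(v, y). Pk s v y) \<in> borel_measurable (borel \<Otimes>\<^sub>M borel)" for s
  proof -
    have "(\<lambda>(v, z). K (v + s) z) \<in> borel_measurable (borel \<Otimes>\<^sub>M borel)"
      using measurable_compose[OF _ Km, of "\<lambda>q. (fst q + s, snd q)" "borel \<Otimes>\<^sub>M borel"] by (simp add: case_prod_beta)
    from killed_joint[OF this]
    have "(\<lambda>q. killed (fst (fst q) - s) (K (fst (fst q))) (snd q)) \<in> borel_measurable ((borel \<Otimes>\<^sub>M (borel :: 'a measure)) \<Otimes>\<^sub>M paths)"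
      using measurable_compose[of "\<lambda>q. (fst (fst q) - s, snd q)" "(borel \<Otimes>\<^sub>M (borel :: 'a measure)) \<Otimes>\<^sub>M paths" "borel \<Otimes>\<^sub>M paths" "\<lambda>(v, w). killed v (K (v + s)) w" borel]
      by simp
    then have "(\<lambda>(q, w). indicator {s..} (fst q) * killed (fst q - s) (K (fst q)) w) \<in> borel_measurable ((borel \<Otimes>\<^sub>M (borel :: 'a measure)) \<Otimes>\<^sub>M paths)"
      unfolding case_prod_beta by measurable
    then have "(\<lambda>q. \<integral>w. indicator {s..} (fst q) * killed (fst q - s) (K (fst q)) w \<partial>path_law (snd q)) \<in> borel_measurable (borel \<Otimes>\<^sub>M borel)"
    proof (rule kernel_integral_measurable[where C=C1])
      show "\<bar>indicator {s..} (fst q) * killed (fst q - s) (K (fst q)) w\<bar> \<le> C1" for q w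
        using killed_abs[where h="K (fst q)" and s="fst q - s" and w=w and C=C1, OF Kb] C1 by (simp add: indicator_def)
      show "(\<lambda>q. path_law (snd q)) \<in> borel \<Otimes>\<^sub>M borel \<rightarrow>\<^sub>M subprob_algebra paths"
        by (rule measurable_compose[OF measurable_snd path_law_measurable])
    qed (rule prob_path_law)
    then show ?thesis by (simp add: Pk_def case_prod_beta)
  qed

  define A1 where "A1 s = (\<integral>w. indicator {s..} t * (?G s w * killed t f w) \<partial>?E)" for s
  define A2 where "A2 s v = (\<integral>w. indicator {s..} v * (?G s w * killed v (K v) w) \<partial>?E)" for s v
  have step: "(\<integral>w. fk s (\<lambda>y. \<beta> y * U s y) w \<partial>?E) = A1 s + (\<integral>v. A2 s v \<partial>J)" if s: "0 \<le> s" "s \<le> t" for s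
  proof -
    let ?H = "\<lambda>v w. ?G s w * killed s (Pk s v) w"
    have Hm: "(\<lambda>(v, w). ?H v w) \<in> borel_measurable (borel \<Otimes>\<^sub>M paths)"
    proof -
      have [measurable]: "(\<lambda>q. ?G s (snd q)) \<in> borel_measurable (borel \<Otimes>\<^sub>M paths)" by (rule measurable_compose[OF measurable_snd G_meas])
      have [measurable]: "Measurable.pred (borel \<Otimes>\<^sub>M paths) (\<lambda>q. alive s (snd q))" by (rule measurable_compose[OF measurable_snd alive_path])
      have "(\<lambda>q. (fst q, state s (snd q))) \<in> borel \<Otimes>\<^sub>M paths \<rightarrow>\<^sub>M borel \<Otimes>\<^sub>M borel"
        by (intro measurable_Pair measurable_fst measurable_compose[OF measurable_snd state_path])
      from measurable_compose[OF this Pk_m[of s]]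
      have [measurable]: "(\<lambda>q. Pk s (fst q) (state s (snd q))) \<in> borel_measurable (borel \<Otimes>\<^sub>M paths)" by simp
      show ?thesis unfolding killed_def case_prod_beta by measurable
    qed
    have Hm': "(\<lambda>(v, w). ?H v w) \<in> borel_measurable (J \<Otimes>\<^sub>M ?E)"
      using measurable_restrict_pair[OF Hm] by (simp add: J_def cong: measurable_cong_sets)
    have Hb: "\<bar>?H v w\<bar> \<le> D * C1" for v w
      unfolding abs_mult using Gb[OF s(2)] D0 by (intro mult_mono killed_abs Pk_b) auto
    have point: "fk s (\<lambda>y. \<beta> y * U s y) w = ?G s w * killed s (\<lambda>y. \<integral>z. f z \<partial>P (t - s) y) w + (\<integral>v. ?H v w \<partial>J)" for w
    proof (cases "alive s w")
      case True
      have "U s (state s w) = (\<integral>z. f z \<partial>P (t - s) (state s w)) + (\<integral>v. Pk s v (state s w) \<partial>J)"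
        unfolding eq[OF s] L'[OF s(1)] Pk_eq K_def ..
      then show ?thesis using True by (simp add: fk_def killed_def algebra_simps)
    qed (simp add: fk_def killed_def)
    have i1: "integrable ?E (\<lambda>w. ?G s w * killed s (\<lambda>y. \<integral>z. f z \<partial>P (t - s) y) w)"
    proof (rule path_integrable[where C="D * C"])
      show "(\<lambda>w. ?G s w * killed s (\<lambda>y. \<integral>z. f z \<partial>P (t - s) y) w) \<in> borel_measurable paths"
        using s by (intro borel_measurable_times G_meas killed_measurable P_real_measurable[OF _ f]) auto
      show "\<bar>?G s w * killed s (\<lambda>y. \<integral>z. f z \<partial>P (t - s) y) w\<bar> \<le> D * C" for w
        unfolding abs_mult using s D0 Gb[OF s(2)] by (intro mult_mono killed_abs P_integral_abs[OF _ f]) auto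
    qed
    have Hm_swap: "(\<lambda>(w, v). ?H v w) \<in> borel_measurable (?E \<Otimes>\<^sub>M J)"
      using measurable_pair_swap[OF Hm'] by (simp add: case_prod_beta)
    have i2: "integrable ?E (\<lambda>w. \<integral>v. ?H v w \<partial>J)"
      by (rule bounded_Fubini(3)[OF E.finite_measure_axioms fin Hm_swap]) (rule Hb)
    have "(\<integral>w. fk s (\<lambda>y. \<beta> y * U s y) w \<partial>?E) = (\<integral>w. ?G s w * killed s (\<lambda>y. \<integral>z. f z \<partial>P (t - s) y) w \<partial>?E) + (\<integral>w. (\<integral>v. ?H v w \<partial>J) \<partial>?E)"
      unfolding point by (rule Bochner_Integration.integral_add[OF i1 i2])
    also have "(\<integral>w. ?G s w * killed s (\<lambda>y. \<integral>z. f z \<partial>P (t - s) y) w \<partial>?E) = A1 s"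
      unfolding A1_def using markov_integral[OF s(1) _ fk_adapted[OF \<beta>_measurable] Gb[OF s(2)] f, of "t - s" x] s by simp
    also have "(\<integral>w. (\<integral>v. ?H v w \<partial>J) \<partial>?E) = (\<integral>v. (\<integral>w. ?H v w \<partial>?E) \<partial>J)"
      by (rule bounded_Fubini(1)[OF fin E.finite_measure_axioms Hm']) (rule Hb)
    also have "\<dots> = (\<integral>v. A2 s v \<partial>J)"
    proof (intro bochner_cong refl)
      fix v
      show "(\<integral>w. ?H v w \<partial>?E) = A2 s v"
      proof (cases "s \<le> v")
        case True
        have "Pk s v = (\<lambda>y. \<integral>z. K v z \<partial>P (v - s) y)" using True by (auto simp: Pk_eq)
        then show ?thesis unfolding A2_def
          using markov_integral[OF s(1) _ fk_adapted[OF \<beta>_measurable] Gb[OF s(2)] Ksec(1)[of v] Kb, of "v - s" x] True by simp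
      next
        case False
        then have "Pk s v = (\<lambda>_. 0)" by (auto simp: Pk_eq)
        then show ?thesis using False by (simp add: A2_def killed_def)
      qed
    qed
    finally show ?thesis .
  qed

  have swap: "(\<integral>s. (\<integral>w. indicator {s..} v * (?G s w * killed v g w) \<partial>?E) \<partial>J) = FK v g x - (\<integral>w. killed v g w \<partial>?E)"
    and swap_int: "integrable J (\<lambda>s. \<integral>w. indicator {s..} v * (?G s w * killed v g w) \<partial>?E)"
    if v: "v \<in> space J" and g: "g \<in> borel_measurable borel" "\<And>y. \<bar>g y\<bar> \<le> B" for v g B
  proof -
    have v': "0 \<le> v" "v \<le> t" using v by (auto simp: sp)
    have B0: "0 \<le> B" using g(2)[of undefined] by (meson abs_ge_zero order_trans)
    note g_m = killed_measurable[OF g(1), of v] and g_b = killed_abs[of g B, OF g(2)]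
    have "(\<lambda>(s, w). (if s \<le> v then 1 else 0) * (?G s w * killed v g w)) \<in> borel_measurable (borel \<Otimes>\<^sub>M paths)"
      using G_joint measurable_compose[OF measurable_snd g_m] unfolding case_prod_beta by measurable
    from measurable_restrict_pair[OF this]
    have m: "(\<lambda>(s, w). indicator {s..} v * (?G s w * killed v g w)) \<in> borel_measurable (J \<Otimes>\<^sub>M ?E)"
      unfolding ind J_def by (simp only: measurable_cong_sets[OF sets_pair_measure_cong[OF refl sets_path_law] refl])
    have b: "\<bar>indicator {s..} v * (?G s w * killed v g w)\<bar> \<le> D * B" if "s \<in> space J" for s w
    proof -
      have "\<bar>?G s w * killed v g w\<bar> \<le> D * B" unfolding abs_mult using that D0 g_b by (intro mult_mono Gb) (auto simp: sp)
      then show ?thesis using D0 B0 by (simp add: indicator_def)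
    qed
    show "integrable J (\<lambda>s. \<integral>w. indicator {s..} v * (?G s w * killed v g w) \<partial>?E)"
      by (rule bounded_Fubini(3)[OF fin E.finite_measure_axioms m b])
    have "(\<integral>s. (\<integral>w. indicator {s..} v * (?G s w * killed v g w) \<partial>?E) \<partial>J) = (\<integral>w. (\<integral>s. indicator {s..} v * (?G s w * killed v g w) \<partial>J) \<partial>?E)"
      by (rule bounded_Fubini(1)[OF fin E.finite_measure_axioms m b, symmetric])
    also have "\<dots> = (\<integral>w. fk v g w - killed v g w \<partial>?E)"
    proof (intro bochner_cong refl)
      fix w assume w: "w \<in> space ?E"
      have "(\<integral>s. indicator {s..} v * (?G s w * killed v g w) \<partial>J) = (\<integral>s. (indicator {s..} v * ?G s w) * killed v g w \<partial>J)"
        by (simp add: mult.assoc)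
      also have "\<dots> = (\<integral>s. indicator {s..} v * ?G s w \<partial>J) * killed v g w" by simp
      also have "\<dots> = fk v g w - killed v g w"
      proof (cases "alive v w")
        case True
        have "(\<integral>s. indicator {s..} v * ?G s w \<partial>J) = exp (weight v w) - 1" using weight_int[OF v' _ True] w by simp
        then have "(\<integral>s. indicator {s..} v * ?G s w \<partial>J) * killed v g w = (exp (weight v w) - 1) * killed v g w" by (simp only:)
        also have "\<dots> = fk v g w - killed v g w" using True by (simp add: fk_def killed_def algebra_simps)
        finally show ?thesis .
      qed (simp add: fk_def killed_def)
      finally show "(\<integral>s. indicator {s..} v * (?G s w * killed v g w) \<partial>J) = fk v g w - killed v g w" .
    qed
    also have "\<dots> = FK v g x - (\<integral>w. killed v g w \<partial>?E)"
      unfolding FK_def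
      by (rule Bochner_Integration.integral_diff[OF fk_integrable[OF v'(1) g] path_integrable[OF g_m g_b]])
    finally show "(\<integral>s. (\<integral>w. indicator {s..} v * (?G s w * killed v g w) \<partial>?E) \<partial>J) = FK v g x - (\<integral>w. killed v g w \<partial>?E)" .
  qed
  have t_sp: "t \<in> space J" using t by (simp add: sp)
  have A1_sum: "(\<integral>s. A1 s \<partial>J) = FK t f x - (\<integral>w. killed t f w \<partial>?E)"
    and A1_int: "integrable J A1"
    unfolding A1_def[abs_def] by (rule swap[OF t_sp f], rule swap_int[OF t_sp f])
  have A2_swap: "(\<integral>s. A2 s v \<partial>J) = FK v (K v) x - (\<integral>w. killed v (K v) w \<partial>?E)" if "v \<in> space J" for v
    unfolding A2_def by (rule swap[OF that Ksec(1) Kb])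

  have fkW: "integrable J (\<lambda>v. FK v (h v) x)" if h: "(\<lambda>(s, y). h s y) \<in> borel_measurable (borel \<Otimes>\<^sub>M borel)" "\<And>s y. \<bar>h s y\<bar> \<le> B" for h B
  proof -
    have m: "(\<lambda>(s, w). fk s (h s) w) \<in> borel_measurable (J \<Otimes>\<^sub>M ?E)"
      using measurable_restrict_pair[OF fk_joint[OF h(1)]] by (simp add: J_def cong: measurable_cong_sets)
    have B0: "0 \<le> B" using h(2)[of undefined undefined] by (meson abs_ge_zero order_trans)
    have b: "\<bar>fk s (h s) w\<bar> \<le> exp (b0 * t) * B" if "s \<in> space J" for s w
    proof -
      have "\<bar>fk s (h s) w\<bar> \<le> exp (b0 * s) * B" using that by (intro fk_bound h(2)) (auto simp: sp)
      also have "\<dots> \<le> exp (b0 * t) * B" using that B0 b0_nonneg by (intro mult_right_mono) (auto simp: sp intro: mult_left_mono)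
      finally show ?thesis .
    qed
    show ?thesis unfolding FK_def by (rule bounded_Fubini(3)[OF fin E.finite_measure_axioms m b])
  qed

  have killed_int: "integrable J (\<lambda>v. \<integral>w. killed v (K v) w \<partial>?E)"
    by (rule bounded_Fubini(3)[OF fin E.finite_measure_axioms _ k_b])
      (use measurable_restrict_pair[OF k_joint] in \<open>simp add: J_def cong: measurable_cong_sets\<close>)

  have A2_joint: "(\<lambda>(s, v). A2 s v) \<in> borel_measurable (J \<Otimes>\<^sub>M J)"
    and A2_b: "s \<in> space J \<Longrightarrow> \<bar>A2 s v\<bar> \<le> D * C1" for s v
  proof -
    have gm: "(\<lambda>q. ?G (fst (fst q)) (snd q)) \<in> borel_measurable ((borel \<Otimes>\<^sub>M borel) \<Otimes>\<^sub>M paths)"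
      using measurable_compose[OF _ G_joint, of "\<lambda>q. (fst (fst q), snd q)" "(borel \<Otimes>\<^sub>M borel) \<Otimes>\<^sub>M paths"] by simp
    have km: "(\<lambda>q. killed (snd (fst q)) (K (snd (fst q))) (snd q)) \<in> borel_measurable ((borel \<Otimes>\<^sub>M borel) \<Otimes>\<^sub>M paths)"
      using measurable_compose[OF _ k_joint, of "\<lambda>q. (snd (fst q), snd q)" "(borel \<Otimes>\<^sub>M borel) \<Otimes>\<^sub>M paths"] by simp
    have jm: "(\<lambda>(q, w). (if fst q \<le> snd q then 1 else 0) * (?G (fst q) w * killed (snd q) (K (snd q)) w)) \<in> borel_measurable ((borel \<Otimes>\<^sub>M borel) \<Otimes>\<^sub>M ?E)"
    proof -
      note [measurable] = gm km
      have "(\<lambda>(q, w). (if fst q \<le> snd q then 1 else 0) * (?G (fst q) w * killed (snd q) (K (snd q)) w)) \<in> borel_measurable ((borel \<Otimes>\<^sub>M borel) \<Otimes>\<^sub>M paths)"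
        unfolding case_prod_beta by measurable
      then show ?thesis by (simp cong: measurable_cong_sets)
    qed
    have "(\<lambda>q. \<integral>w. (if fst q \<le> snd q then 1 else 0) * (?G (fst q) w * killed (snd q) (K (snd q)) w) \<partial>?E) \<in> borel_measurable (borel \<Otimes>\<^sub>M borel)"
      using jm by (rule E.borel_measurable_lebesgue_integral)
    then have "(\<lambda>(s, v). A2 s v) \<in> borel_measurable (borel \<Otimes>\<^sub>M borel)" unfolding A2_def ind case_prod_beta' .
    moreover have "(\<lambda>q. (fst q, snd q)) \<in> J \<Otimes>\<^sub>M J \<rightarrow>\<^sub>M borel \<Otimes>\<^sub>M borel" unfolding J_def
      by (intro measurable_Pair measurable_compose[OF measurable_fst] measurable_compose[OF measurable_snd]) (simp_all add: measurable_restrict_space1)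
    ultimately show "(\<lambda>(s, v). A2 s v) \<in> borel_measurable (J \<Otimes>\<^sub>M J)" using measurable_compose by fastforce
    have gk: "\<bar>indicator {s..} v * (?G s w * killed v (K v) w)\<bar> \<le> D * C1" if "s \<in> space J" for s v w
    proof -
      have "\<bar>?G s w * killed v (K v) w\<bar> \<le> D * C1" unfolding abs_mult using that D0 k_b by (intro mult_mono Gb) (auto simp: sp)
      then show ?thesis using D0 C1 by (simp add: indicator_def)
    qed
    show "\<bar>A2 s v\<bar> \<le> D * C1" if s: "s \<in> space J"
    proof -
      have "integrable ?E (\<lambda>w. indicator {s..} v * (?G s w * killed v (K v) w))"
        by (rule path_integrable[OF _ gk[OF s]]) (intro borel_measurable_times borel_measurable_const G_meas killed_measurable Ksec)
      then have "\<bar>A2 s v\<bar> \<le> (\<integral>w. D * C1 \<partial>?E)" unfolding A2_def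
        using gk[OF s] by (intro order_trans[OF integral_abs_bound] integral_mono) auto
      then show ?thesis using E.prob_space by simp
    qed
  qed

  text \<open>Both sides of the equation for \<open>U\<close> are tested against the weighted process, and the terms that
    contain \<open>\<beta> U\<close> cancel.\<close>
  have \<beta>U: "(\<lambda>(s, y). \<beta> y * U s y) \<in> borel_measurable (borel \<Otimes>\<^sub>M borel)" "\<bar>\<beta> y * U s y\<bar> \<le> b0 * C" for s y
  proof -
    show "(\<lambda>(s, y). \<beta> y * U s y) \<in> borel_measurable (borel \<Otimes>\<^sub>M borel)" using U(1) unfolding case_prod_beta by measurable
    show "\<bar>\<beta> y * U s y\<bar> \<le> b0 * C" unfolding abs_mult using \<beta>_bound U(2) b0_nonneg by (intro mult_mono) auto
  qed
  let ?I = "\<integral>s. FK s (\<lambda>y. \<beta> y * U s y) x \<partial>J"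
  have A2_int: "integrable J (\<lambda>s. \<integral>v. A2 s v \<partial>J)"
    by (rule bounded_Fubini(3)[OF fin fin A2_joint A2_b])
  have "?I = (\<integral>s. A1 s + (\<integral>v. A2 s v \<partial>J) \<partial>J)"
    by (intro bochner_cong) (auto simp: FK_def sp step)
  also have "\<dots> = (\<integral>s. A1 s \<partial>J) + (\<integral>s. (\<integral>v. A2 s v \<partial>J) \<partial>J)"
    by (rule Bochner_Integration.integral_add[OF A1_int A2_int])
  also have "(\<integral>s. (\<integral>v. A2 s v \<partial>J) \<partial>J) = (\<integral>v. (\<integral>s. A2 s v \<partial>J) \<partial>J)"
    by (rule bounded_Fubini(1)[OF fin fin A2_joint A2_b, symmetric])
  also have "\<dots> = (\<integral>v. FK v (K v) x - (\<integral>w. killed v (K v) w \<partial>?E) \<partial>J)"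
    by (intro bochner_cong refl A2_swap)
  also have "\<dots> = (\<integral>v. FK v (K v) x \<partial>J) - (\<integral>v. (\<integral>w. killed v (K v) w \<partial>?E) \<partial>J)"
    by (rule Bochner_Integration.integral_diff[OF fkW[OF Km Kb] killed_int])
  also have "(\<integral>v. FK v (K v) x \<partial>J) = ?I - (\<integral>v. FK v (W v) x \<partial>J)"
  proof -
    have "FK v (K v) x = FK v (\<lambda>y. \<beta> y * U v y) x - FK v (W v) x" if "v \<in> space J" for v
    proof -
      have fk_eq: "fk v (K v) = (\<lambda>w. fk v (\<lambda>y. \<beta> y * U v y) w - fk v (W v) w)" by (auto simp: fk_def K_def algebra_simps)
      have "(\<lambda>y. \<beta> y * U v y) \<in> borel_measurable borel" using Ksec(2)[of v] by measurable
      then have "integrable ?E (fk v (\<lambda>y. \<beta> y * U v y))"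
        using that by (intro fk_integrable[where C="b0 * C"] \<beta>U(2)) (auto simp: sp)
      moreover have "integrable ?E (fk v (W v))" using that by (intro fk_integrable[OF _ Ksec(3) W(2)]) (auto simp: sp)
      ultimately have "(\<integral>w. fk v (\<lambda>y. \<beta> y * U v y) w - fk v (W v) w \<partial>?E) = FK v (\<lambda>y. \<beta> y * U v y) x - FK v (W v) x"
        unfolding FK_def by (intro Bochner_Integration.integral_diff)
      then show ?thesis unfolding FK_def using fk_eq by simp
    qed
    then have "(\<integral>v. FK v (K v) x \<partial>J) = (\<integral>v. FK v (\<lambda>y. \<beta> y * U v y) x - FK v (W v) x \<partial>J)"
      by (intro bochner_cong refl)
    then show ?thesis using Bochner_Integration.integral_diff[OF fkW[OF \<beta>U] fkW[OF W]] by simp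
  qed
  finally have cancel: "(\<integral>w. killed t f w \<partial>?E) + (\<integral>v. (\<integral>w. killed v (K v) w \<partial>?E) \<partial>J) =
      FK t f x - (\<integral>v. FK v (W v) x \<partial>J)"
    using A1_sum by simp
  have "U 0 x = (\<integral>z. f z \<partial>P t x) + (\<integral>v. (\<integral>z. K v z \<partial>P v x) \<partial>J)"
    using eq[OF order_refl t, of x] unfolding L K_def by simp
  also have "(\<integral>v. (\<integral>z. K v z \<partial>P v x) \<partial>J) = (\<integral>v. (\<integral>w. killed v (K v) w \<partial>?E) \<partial>J)"
    by (intro bochner_cong refl) (auto simp: sp intro!: P_eq_path_law[OF _ Ksec(1) Kb])
  also have "(\<integral>z. f z \<partial>P t x) = (\<integral>w. killed t f w \<partial>?E)" by (rule P_eq_path_law[OF t f])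
  finally show ?thesis using cancel by (simp add: L)
qed

end

section \<open>The nonlinear part of the branching mechanism\<close>

text \<open>The mechanism is \<open>- \<beta> z\<close> plus a nonnegative part, which is of smaller order than \<open>z\<close> at \<open>0\<close> and is
  bounded by a fixed multiple of \<open>z\<close> for \<open>0 \<le> z \<le> 1\<close>.\<close>

definition exp_remainder :: "real \<Rightarrow> real" where
  "exp_remainder v = exp (- v) - 1 + v"

definition nonlinear_part :: "('a \<Rightarrow> real) \<Rightarrow> ('a \<Rightarrow> real measure) \<Rightarrow> 'a \<Rightarrow> real \<Rightarrow> real" where
  "nonlinear_part \<sigma> \<pi> x z = (\<sigma> x)\<^sup>2 * z\<^sup>2 + (\<integral>u. exp_remainder (z * u) \<partial>\<pi> x)"

lemma branching_mechanism_eq: "branching_mechanism \<beta> \<sigma> \<pi> x z = - (\<beta> x * z - nonlinear_part \<sigma> \<pi> x z)"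
  by (simp add: branching_mechanism_def nonlinear_part_def exp_remainder_def)

lemma exp_remainder_nonneg: "0 \<le> exp_remainder v"
  using exp_ge_add_one_self[of "- v"] by (simp add: exp_remainder_def)

lemma exp_remainder_le: "0 \<le> v \<Longrightarrow> exp_remainder v \<le> v" "0 \<le> v \<Longrightarrow> exp_remainder v \<le> v\<^sup>2"
  using exp_taylor_bound[of "- v" 0 0] by (auto simp: exp_remainder_def abs_le_iff)

lemma exp_remainder_scale: "0 \<le> c \<Longrightarrow> c \<le> 1 \<Longrightarrow> exp_remainder (c * v) \<le> c * exp_remainder v"
proof -
  assume c: "0 \<le> c" "c \<le> 1"
  have "(1 - c) * (exp (- (c * v)) * (1 + c * v)) \<le> (1 - c) * 1"
    using c exp_ge_add_one_self[of "c * v"] by (intro mult_left_mono) (auto simp: exp_minus field_simps)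
  moreover have "c * (exp (- (c * v)) * (1 + (c * v - v))) \<le> c * exp (- v)"
    using c mult_left_mono[OF exp_ge_add_one_self[of "c * v - v"], of "exp (- (c * v))"]
    by (intro mult_left_mono) (auto simp: exp_add[symmetric])
  ultimately show ?thesis by (simp add: exp_remainder_def algebra_simps)
qed

lemma exp_remainder_mono: "0 \<le> v \<Longrightarrow> v \<le> w \<Longrightarrow> exp_remainder v \<le> exp_remainder w"
proof -
  assume v: "0 \<le> v" "v \<le> w"
  have "exp (- v) - exp (- w) \<le> exp (- v) * (w - v)" using exp_diff_bounds(2)[of "- v" "- w"] by simp
  also have "\<dots> \<le> 1 * (w - v)" using v by (intro mult_right_mono) auto
  finally show ?thesis by (simp add: exp_remainder_def)
qed

lemma exp_remainder_prod_le:
  assumes "0 \<le> z" "0 < u"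
  shows "exp_remainder (z * u) \<le> max z (z\<^sup>2) * min u (u\<^sup>2)"
proof -
  have 1: "exp_remainder (z * u) \<le> z * u" "exp_remainder (z * u) \<le> z\<^sup>2 * u\<^sup>2"
    using exp_remainder_le[of "z * u"] assms by (auto simp: power_mult_distrib)
  have 2: "z * u \<le> max z (z\<^sup>2) * u" "z\<^sup>2 * u\<^sup>2 \<le> max z (z\<^sup>2) * u\<^sup>2" using assms by (auto intro!: mult_right_mono)
  show ?thesis using 1 2 by (auto simp: min_def)
qed

lemma exp_remainder_measurable [measurable]: "exp_remainder \<in> borel_measurable borel"
  unfolding exp_remainder_def[abs_def] by measurable

locale branching =
  fixes \<sigma> :: "'a::polish_space \<Rightarrow> real" and \<pi> :: "'a \<Rightarrow> real measure"
  assumes \<sigma>: "\<sigma> \<in> bB" and \<pi>: "branching_kernel \<pi>"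
begin

abbreviation \<psi>\<^sub>0 :: "'a \<Rightarrow> real \<Rightarrow> real" where "\<psi>\<^sub>0 \<equiv> nonlinear_part \<sigma> \<pi>"

lemma sets_\<pi>: "sets (\<pi> x) = sets (restrict_space borel {0<..})"
  using \<pi> by (simp add: branching_kernel_def)

lemma space_\<pi>: "space (\<pi> x) = {0<..}"
  using sets_eq_imp_space_eq[OF sets_\<pi>] by (simp add: space_restrict_space)

lemma \<pi>_measurable: "g \<in> borel_measurable borel \<Longrightarrow> g \<in> borel_measurable (\<pi> x)"
  by (subst measurable_cong_sets[OF sets_\<pi> refl]) (rule measurable_restrict_space1)

lemma \<sigma>_measurable [measurable]: "\<sigma> \<in> borel_measurable borel"
  using \<sigma> by (simp add: bB_def)

text \<open>The uniform bound on the integrals of \<open>min u u\<^sup>2\<close>.\<close>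

definition \<pi>_bound :: real where
  "\<pi>_bound = enn2real (SUP x. \<integral>\<^sup>+u. ennreal (min u (u\<^sup>2)) \<partial>\<pi> x)"

lemma \<pi>_nn_bound: "(\<integral>\<^sup>+u. ennreal (min u (u\<^sup>2)) \<partial>\<pi> x) \<le> ennreal \<pi>_bound"
proof -
  have "(SUP x. \<integral>\<^sup>+u. ennreal (min u (u\<^sup>2)) \<partial>\<pi> x) < \<infinity>" using \<pi> by (simp add: branching_kernel_def)
  then have "ennreal \<pi>_bound = (SUP x. \<integral>\<^sup>+u. ennreal (min u (u\<^sup>2)) \<partial>\<pi> x)" by (simp add: \<pi>_bound_def)
  then show ?thesis using SUP_upper[of x UNIV "\<lambda>x. \<integral>\<^sup>+u. ennreal (min u (u\<^sup>2)) \<partial>\<pi> x"] by simp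
qed

lemma \<pi>_bound_nonneg: "0 \<le> \<pi>_bound" by (simp add: \<pi>_bound_def)

lemma min_integrable: "integrable (\<pi> x) (\<lambda>u. min u (u\<^sup>2))"
  and min_integral_le: "(\<integral>u. min u (u\<^sup>2) \<partial>\<pi> x) \<le> \<pi>_bound"
proof -
  have m: "(\<lambda>u::real. min u (u\<^sup>2)) \<in> borel_measurable (\<pi> x)" by (rule \<pi>_measurable) measurable
  have nn: "AE u in \<pi> x. 0 \<le> min u (u\<^sup>2)" by (rule AE_I2) (auto simp: space_\<pi>)
  have "(\<integral>\<^sup>+u. ennreal (norm (min u (u\<^sup>2))) \<partial>\<pi> x) = (\<integral>\<^sup>+u. ennreal (min u (u\<^sup>2)) \<partial>\<pi> x)"
    by (intro nn_integral_cong) (auto simp: space_\<pi> min_def)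
  then show i: "integrable (\<pi> x) (\<lambda>u. min u (u\<^sup>2))"
    using m \<pi>_nn_bound[of x] by (intro integrableI_bounded) (auto intro: le_less_trans)
  have "ennreal (\<integral>u. min u (u\<^sup>2) \<partial>\<pi> x) \<le> ennreal \<pi>_bound"
    using nn_integral_eq_integral[OF i nn] \<pi>_nn_bound[of x] by simp
  then show "(\<integral>u. min u (u\<^sup>2) \<partial>\<pi> x) \<le> \<pi>_bound" using \<pi>_bound_nonneg by simp
qed

lemma remainder_integrable: "0 \<le> z \<Longrightarrow> integrable (\<pi> x) (\<lambda>u. exp_remainder (z * u))"
proof (rule Bochner_Integration.integrable_bound[of _ "\<lambda>u. max z (z\<^sup>2) * min u (u\<^sup>2)"])
  assume z: "0 \<le> z"
  show "integrable (\<pi> x) (\<lambda>u. max z (z\<^sup>2) * min u (u\<^sup>2))" by (intro integrable_mult_right min_integrable)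
  show "(\<lambda>u. exp_remainder (z * u)) \<in> borel_measurable (\<pi> x)" by (rule \<pi>_measurable) measurable
  show "AE u in \<pi> x. norm (exp_remainder (z * u)) \<le> norm (max z (z\<^sup>2) * min u (u\<^sup>2))"
  proof (rule AE_I2)
    fix u assume "u \<in> space (\<pi> x)"
    then have u: "0 < u" by (simp add: space_\<pi>)
    show "norm (exp_remainder (z * u)) \<le> norm (max z (z\<^sup>2) * min u (u\<^sup>2))"
      using exp_remainder_prod_le[OF z u] exp_remainder_nonneg[of "z * u"] by simp
  qed
qed

lemma \<psi>\<^sub>0_nonneg: "0 \<le> \<psi>\<^sub>0 x z"
  unfolding nonlinear_part_def by (intro add_nonneg_nonneg bochner_nonneg exp_remainder_nonneg) auto

lemma \<psi>\<^sub>0_mono: "0 \<le> z \<Longrightarrow> z \<le> w \<Longrightarrow> \<psi>\<^sub>0 x z \<le> \<psi>\<^sub>0 x w"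
  unfolding nonlinear_part_def
  by (intro add_mono mult_left_mono power_mono integral_mono remainder_integrable exp_remainder_mono) (auto simp: space_\<pi> intro: mult_right_mono)

lemma \<psi>\<^sub>0_scale: "0 \<le> c \<Longrightarrow> c \<le> 1 \<Longrightarrow> 0 \<le> z \<Longrightarrow> \<psi>\<^sub>0 x (c * z) \<le> c * \<psi>\<^sub>0 x z"
proof -
  assume c: "0 \<le> c" "c \<le> 1" and z: "0 \<le> z"
  have "c * c \<le> c * 1" using c by (intro mult_left_mono) auto
  then have "(\<sigma> x)\<^sup>2 * (c * z)\<^sup>2 \<le> c * ((\<sigma> x)\<^sup>2 * z\<^sup>2)"
    using mult_right_mono[of "c * c" c "(\<sigma> x)\<^sup>2 * z\<^sup>2"] zero_le_power2[of "\<sigma> x * z"]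
    by (simp add: power2_eq_square mult_ac)
  moreover have "(\<integral>u. exp_remainder (c * z * u) \<partial>\<pi> x) \<le> (\<integral>u. c * exp_remainder (z * u) \<partial>\<pi> x)"
    using c z remainder_integrable[of "c * z" x] remainder_integrable[of z x] exp_remainder_scale[of c]
    by (intro integral_mono) (auto simp: mult.assoc)
  ultimately show ?thesis by (simp add: nonlinear_part_def algebra_simps)
qed

lemma \<sigma>_bound: "\<exists>s. 0 \<le> s \<and> (\<forall>x. (\<sigma> x)\<^sup>2 \<le> s)"
proof -
  obtain s where s: "\<And>x. \<bar>\<sigma> x\<bar> \<le> s" using \<sigma> by (auto simp: bB_def bounded_iff)
  have "(\<sigma> x)\<^sup>2 \<le> s\<^sup>2" for x using s[of x] by (metis abs_ge_zero power2_abs power_mono)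
  then show ?thesis by (intro exI[of _ "s\<^sup>2"]) auto
qed

text \<open>A constant \<open>c\<close> with \<open>\<psi>\<^sub>0 x z \<le> c max z z\<^sup>2\<close>; the choice picks some bound for \<open>\<sigma>\<^sup>2\<close>.\<close>

definition \<psi>_const :: real where
  "\<psi>_const = (SOME s. 0 \<le> s \<and> (\<forall>x. (\<sigma> x)\<^sup>2 \<le> s)) + \<pi>_bound"

lemma \<psi>_const_nonneg: "0 \<le> \<psi>_const"
  using someI_ex[OF \<sigma>_bound] \<pi>_bound_nonneg unfolding \<psi>_const_def by linarith

lemma \<psi>\<^sub>0_le: "0 \<le> z \<Longrightarrow> \<psi>\<^sub>0 x z \<le> \<psi>_const * max z (z\<^sup>2)"
proof -
  assume z: "0 \<le> z"
  let ?s = "SOME s. 0 \<le> s \<and> (\<forall>x. (\<sigma> x)\<^sup>2 \<le> s)"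
  have s: "0 \<le> ?s" "(\<sigma> x)\<^sup>2 \<le> ?s" using someI_ex[OF \<sigma>_bound] by blast+
  have "(\<integral>u. exp_remainder (z * u) \<partial>\<pi> x) \<le> (\<integral>u. max z (z\<^sup>2) * min u (u\<^sup>2) \<partial>\<pi> x)"
    using z by (intro integral_mono remainder_integrable integrable_mult_right min_integrable exp_remainder_prod_le) (auto simp: space_\<pi>)
  also have "\<dots> \<le> max z (z\<^sup>2) * \<pi>_bound"
    using z min_integral_le[of x] by (simp add: mult_left_mono le_max_iff_disj)
  finally have 1: "(\<integral>u. exp_remainder (z * u) \<partial>\<pi> x) \<le> max z (z\<^sup>2) * \<pi>_bound" .
  have 2: "(\<sigma> x)\<^sup>2 * z\<^sup>2 \<le> ?s * max z (z\<^sup>2)" using s by (intro mult_mono) auto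
  show ?thesis using 1 2 by (simp add: nonlinear_part_def \<psi>_const_def algebra_simps)
qed

lemma \<psi>\<^sub>0_le_linear: "0 \<le> z \<Longrightarrow> z \<le> 1 \<Longrightarrow> \<psi>\<^sub>0 x z \<le> \<psi>_const * z"
proof -
  assume z: "0 \<le> z" "z \<le> 1"
  have "z\<^sup>2 \<le> z" using z mult_left_mono[of z 1 z] by (simp add: power2_eq_square)
  then show ?thesis using \<psi>\<^sub>0_le[OF z(1), of x] by (simp add: max_absorb1)
qed

lemma \<psi>\<^sub>0_tendsto:
  assumes z: "\<And>n. 0 \<le> z n" "z \<longlonglongrightarrow> w"
  shows "(\<lambda>n. \<psi>\<^sub>0 x (z n)) \<longlonglongrightarrow> \<psi>\<^sub>0 x w"
proof -
  have w: "0 \<le> w" using LIMSEQ_le_const[OF z(2), of 0] z(1) by auto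
  obtain B where B: "\<And>n. z n \<le> B"
    using convergent_imp_bounded[of z] z(2) unfolding bounded_iff convergent_def
    by (metis abs_le_D1 rangeI real_norm_def)
  have B0: "0 \<le> B" using z(1)[of 0] B[of 0] by simp
  have "(\<lambda>n. \<integral>u. exp_remainder (z n * u) \<partial>\<pi> x) \<longlonglongrightarrow> (\<integral>u. exp_remainder (w * u) \<partial>\<pi> x)"
  proof (rule integral_dominated_convergence[where w="\<lambda>u. exp_remainder (B * u)"])
    show "integrable (\<pi> x) (\<lambda>u. exp_remainder (B * u))" by (rule remainder_integrable[OF B0])
    show "(\<lambda>u. exp_remainder (w * u)) \<in> borel_measurable (\<pi> x)" by (rule \<pi>_measurable) measurable
    show "(\<lambda>u. exp_remainder (z n * u)) \<in> borel_measurable (\<pi> x)" for n by (rule \<pi>_measurable) measurable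
    show "AE u in \<pi> x. (\<lambda>n. exp_remainder (z n * u)) \<longlonglongrightarrow> exp_remainder (w * u)"
      unfolding exp_remainder_def using z(2) by (intro AE_I2 tendsto_intros)
    show "AE u in \<pi> x. norm (exp_remainder (z n * u)) \<le> exp_remainder (B * u)" for n
    proof (rule AE_I2)
      fix u assume "u \<in> space (\<pi> x)"
      then show "norm (exp_remainder (z n * u)) \<le> exp_remainder (B * u)"
        using exp_remainder_nonneg[of "z n * u"] exp_remainder_mono[of "z n * u" "B * u"] z(1)[of n] B[of n]
        by (auto simp: space_\<pi> intro: mult_right_mono)
    qed
  qed
  then show ?thesis unfolding nonlinear_part_def using z(2) by (intro tendsto_intros)
qed

lemma \<psi>\<^sub>0_measurable_section: "0 \<le> z \<Longrightarrow> (\<lambda>x. \<psi>\<^sub>0 x z) \<in> borel_measurable borel"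
proof -
  assume z: "0 \<le> z"
  have "(\<lambda>u. ennreal (exp_remainder (z * u))) \<in> borel_measurable (restrict_space borel {0<..})"
    by (rule measurable_restrict_space1) measurable
  then have "(\<lambda>x. \<integral>\<^sup>+u. ennreal (exp_remainder (z * u)) \<partial>\<pi> x) \<in> borel_measurable borel"
    using \<pi> by (intro kernel_nn_integral_measurable[where S="restrict_space borel {0<..}"]) (auto simp: branching_kernel_def)
  moreover have "(\<integral>u. exp_remainder (z * u) \<partial>\<pi> x) = enn2real (\<integral>\<^sup>+u. ennreal (exp_remainder (z * u)) \<partial>\<pi> x)" for x
  proof (rule integral_eq_nn_integral)
    show "(\<lambda>u. exp_remainder (z * u)) \<in> borel_measurable (\<pi> x)" by (rule \<pi>_measurable) measurable
  qed (simp add: exp_remainder_nonneg)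
  ultimately show ?thesis unfolding nonlinear_part_def by simp
qed

lemma \<psi>\<^sub>0_joint: "(\<lambda>(x, z). \<psi>\<^sub>0 x (max 0 z)) \<in> borel_measurable (borel \<Otimes>\<^sub>M borel)"
proof (rule borel_measurable_LIMSEQ_real)
  fix n
  have "(\<lambda>w. \<psi>\<^sub>0 (fst w) (max 0 (right_approx n (max 0 (snd w))))) \<in> borel_measurable (borel \<Otimes>\<^sub>M borel)"
    by (rule right_approx_compose_measurable[where g="\<lambda>c w. \<psi>\<^sub>0 (fst w) (max 0 c)"])
      (auto intro!: measurable_compose[OF measurable_fst \<psi>\<^sub>0_measurable_section])
  then show "(\<lambda>(x, z). \<psi>\<^sub>0 x (max 0 (right_approx n (max 0 z)))) \<in> borel_measurable (borel \<Otimes>\<^sub>M borel)"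
    by (simp add: case_prod_beta)
next
  fix w :: "'a \<times> real"
  obtain x z where w: "w = (x, z)" by (cases w)
  have "(\<lambda>n. max 0 (right_approx n (max 0 z))) \<longlonglongrightarrow> max 0 (max 0 z)"
    by (intro tendsto_max tendsto_const right_approx_tendsto)
  then have "(\<lambda>n. \<psi>\<^sub>0 x (max 0 (right_approx n (max 0 z)))) \<longlonglongrightarrow> \<psi>\<^sub>0 x (max 0 z)"
    by (intro \<psi>\<^sub>0_tendsto) auto
  then show "(\<lambda>n. case w of (x, z) \<Rightarrow> \<psi>\<^sub>0 x (max 0 (right_approx n (max 0 z)))) \<longlonglongrightarrow> (case w of (x, z) \<Rightarrow> \<psi>\<^sub>0 x (max 0 z))"
    by (simp add: w)
qed

lemma \<psi>\<^sub>0_compose_measurable: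
  assumes g: "g \<in> borel_measurable borel" "\<And>x. 0 \<le> g x"
  shows "(\<lambda>x. \<psi>\<^sub>0 x (g x)) \<in> borel_measurable borel"
proof -
  have "(\<lambda>x. (x, g x)) \<in> borel \<rightarrow>\<^sub>M borel \<Otimes>\<^sub>M borel" using g(1) by measurable
  from measurable_compose[OF this \<psi>\<^sub>0_joint] show ?thesis using g(2) by (simp add: max_absorb2)
qed

lemma \<psi>\<^sub>0_compose_bpB:
  assumes g: "g \<in> bpB"
  shows "(\<lambda>x. \<psi>\<^sub>0 x (g x)) \<in> bpB"
proof -
  obtain B where B: "0 < B" "\<And>x. g x \<le> B" using bpB_boundE[OF g] by metis
  show ?thesis
  proof (rule bpBI[OF \<psi>\<^sub>0_compose_measurable[OF bpB_measurable[OF g] bpB_nonneg[OF g]] \<psi>\<^sub>0_nonneg])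
    fix x
    have "\<psi>\<^sub>0 x (g x) \<le> \<psi>\<^sub>0 x B" by (intro \<psi>\<^sub>0_mono bpB_nonneg[OF g] B)
    also have "\<dots> \<le> \<psi>_const * max B (B\<^sup>2)" using B by (intro \<psi>\<^sub>0_le) auto
    finally show "\<psi>\<^sub>0 x (g x) \<le> \<psi>_const * max B (B\<^sup>2)" .
  qed
qed

text \<open>The nonlinear part is of smaller order at \<open>0\<close>, in mean with respect to any finite measure.\<close>

lemma \<psi>\<^sub>0_small:
  fixes \<nu> :: "'a fin_measure"
  assumes \<phi>: "\<phi> \<in> bpB" and e: "0 < e"
  shows "\<exists>d>0. \<forall>z. 0 \<le> z \<and> z \<le> d \<longrightarrow> (\<integral>x. \<psi>\<^sub>0 x (z * \<phi> x) \<partial>fm_measure \<nu>) \<le> e * z"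
proof -
  define c where "c n = inverse (real (Suc n))" for n
  have c: "0 < c n" "c n \<le> 1" for n by (auto simp: c_def inverse_eq_divide)
  have c0: "c \<longlonglongrightarrow> 0" unfolding c_def[abs_def] by (rule LIMSEQ_inverse_real_of_nat)
  have B: "(\<lambda>x. z * \<phi> x) \<in> bpB" if "0 \<le> z" for z
  proof -
    obtain B where "0 < B" "\<And>x. \<phi> x \<le> B" using bpB_boundE[OF \<phi>] by metis
    then show ?thesis using that bpB_measurable[OF \<phi>] bpB_nonneg[OF \<phi>]
      by (intro bpBI[where B="z * B"]) (auto intro: mult_left_mono)
  qed
  have int: "integrable (fm_measure \<nu>) (\<lambda>x. \<psi>\<^sub>0 x (z * \<phi> x))" if "0 \<le> z" for z
    by (rule integrable_fm_bpB[OF \<psi>\<^sub>0_compose_bpB[OF B[OF that]]])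
  have scale: "\<psi>\<^sub>0 x (c n * \<phi> x) / c n \<le> \<psi>\<^sub>0 x (\<phi> x)" for n x
    using \<psi>\<^sub>0_scale[of "c n" "\<phi> x" x] c[of n] bpB_nonneg[OF \<phi>] by (simp add: divide_le_eq mult.commute)
  have point: "(\<lambda>n. \<psi>\<^sub>0 x (c n * \<phi> x) / c n) \<longlonglongrightarrow> 0" for x
  proof -
    have \<phi>x: "0 \<le> \<phi> x" by (rule bpB_nonneg[OF \<phi>])
    have "(\<lambda>n. \<integral>u. exp_remainder (c n * \<phi> x * u) / c n \<partial>\<pi> x) \<longlonglongrightarrow> (\<integral>u. 0 \<partial>\<pi> x)"
    proof (rule integral_dominated_convergence[where w="\<lambda>u. exp_remainder (\<phi> x * u)"])
      show "integrable (\<pi> x) (\<lambda>u. exp_remainder (\<phi> x * u))" by (rule remainder_integrable[OF \<phi>x])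
      show "(\<lambda>u. exp_remainder (c n * \<phi> x * u) / c n) \<in> borel_measurable (\<pi> x)" for n by (rule \<pi>_measurable) measurable
      show "AE u in \<pi> x. (\<lambda>n. exp_remainder (c n * \<phi> x * u) / c n) \<longlonglongrightarrow> 0"
      proof (rule AE_I2)
        fix u assume "u \<in> space (\<pi> x)"
        then have u: "0 < u" by (simp add: space_\<pi>)
        show "(\<lambda>n. exp_remainder (c n * \<phi> x * u) / c n) \<longlonglongrightarrow> 0"
        proof (rule tendsto_sandwich[of "\<lambda>_. 0"])
          have "(\<lambda>n. c n * (\<phi> x * u)\<^sup>2) \<longlonglongrightarrow> 0 * (\<phi> x * u)\<^sup>2" by (intro tendsto_intros c0)
          then show "(\<lambda>n. c n * (\<phi> x * u)\<^sup>2) \<longlonglongrightarrow> 0" by simp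
          show "eventually (\<lambda>n. exp_remainder (c n * \<phi> x * u) / c n \<le> c n * (\<phi> x * u)\<^sup>2) sequentially"
          proof (intro always_eventually allI)
            fix n
            have "exp_remainder (c n * \<phi> x * u) \<le> (c n * \<phi> x * u)\<^sup>2" using c[of n] \<phi>x u by (intro exp_remainder_le) auto
            then show "exp_remainder (c n * \<phi> x * u) / c n \<le> c n * (\<phi> x * u)\<^sup>2"
              using c(1)[of n] by (simp add: divide_le_eq power2_eq_square mult_ac)
          qed
          show "eventually (\<lambda>n. 0 \<le> exp_remainder (c n * \<phi> x * u) / c n) sequentially"
            using c exp_remainder_nonneg by (auto intro!: always_eventually divide_nonneg_pos)
        qed simp
      qed
      show "AE u in \<pi> x. norm (exp_remainder (c n * \<phi> x * u) / c n) \<le> exp_remainder (\<phi> x * u)" for n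
      proof (rule AE_I2)
        fix u
        have "exp_remainder (c n * \<phi> x * u) / c n \<le> exp_remainder (\<phi> x * u)"
          using exp_remainder_scale[of "c n" "\<phi> x * u"] c[of n] by (simp add: divide_le_eq mult_ac)
        then show "norm (exp_remainder (c n * \<phi> x * u) / c n) \<le> exp_remainder (\<phi> x * u)"
          using exp_remainder_nonneg[of "c n * \<phi> x * u"] c(1)[of n] by simp
      qed
    qed simp
    moreover have "(\<lambda>n. (\<sigma> x)\<^sup>2 * (\<phi> x)\<^sup>2 * c n) \<longlonglongrightarrow> (\<sigma> x)\<^sup>2 * (\<phi> x)\<^sup>2 * 0" by (intro tendsto_intros c0)
    ultimately have "(\<lambda>n. (\<sigma> x)\<^sup>2 * (\<phi> x)\<^sup>2 * c n + (\<integral>u. exp_remainder (c n * \<phi> x * u) / c n \<partial>\<pi> x)) \<longlonglongrightarrow> 0"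
      using tendsto_add by fastforce
    moreover have "(\<sigma> x)\<^sup>2 * (\<phi> x)\<^sup>2 * c n + (\<integral>u. exp_remainder (c n * \<phi> x * u) / c n \<partial>\<pi> x) = \<psi>\<^sub>0 x (c n * \<phi> x) / c n" for n
    proof -
      have "(\<sigma> x)\<^sup>2 * (c n * \<phi> x)\<^sup>2 / c n = (\<sigma> x)\<^sup>2 * (\<phi> x)\<^sup>2 * c n"
        using c(1)[of n] by (simp add: power2_eq_square divide_eq_eq mult_ac)
      then show ?thesis by (simp add: nonlinear_part_def add_divide_distrib)
    qed
    ultimately show ?thesis by simp
  qed
  have "(\<lambda>n. \<integral>x. \<psi>\<^sub>0 x (c n * \<phi> x) / c n \<partial>fm_measure \<nu>) \<longlonglongrightarrow> (\<integral>x. 0 \<partial>fm_measure \<nu>)"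
  proof (rule integral_dominated_convergence[where w="\<lambda>x. \<psi>\<^sub>0 x (1 * \<phi> x)"])
    show "integrable (fm_measure \<nu>) (\<lambda>x. \<psi>\<^sub>0 x (1 * \<phi> x))" by (rule int) simp
    show "(\<lambda>x. \<psi>\<^sub>0 x (c n * \<phi> x) / c n) \<in> borel_measurable (fm_measure \<nu>)" for n
      using bpB_measurable[OF \<psi>\<^sub>0_compose_bpB[OF B[of "c n"]]] c(1)[of n] by (auto intro!: borel_measurable_divide)
    show "AE x in fm_measure \<nu>. norm (\<psi>\<^sub>0 x (c n * \<phi> x) / c n) \<le> \<psi>\<^sub>0 x (1 * \<phi> x)" for n
      using scale[of _ n] \<psi>\<^sub>0_nonneg c(1)[of n] by (intro AE_I2) simp
  qed (use point in auto)
  then have "(\<lambda>n. (\<integral>x. \<psi>\<^sub>0 x (c n * \<phi> x) \<partial>fm_measure \<nu>) / c n) \<longlonglongrightarrow> 0" by simp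
  then have "eventually (\<lambda>n. (\<integral>x. \<psi>\<^sub>0 x (c n * \<phi> x) \<partial>fm_measure \<nu>) / c n < e) sequentially" using e by (rule order_tendstoD)
  then obtain n where n: "(\<integral>x. \<psi>\<^sub>0 x (c n * \<phi> x) \<partial>fm_measure \<nu>) / c n < e" by (auto simp: eventually_sequentially)
  show ?thesis
  proof (intro exI[of _ "c n"] conjI allI impI)
    show "0 < c n" by (rule c)
    fix z assume z: "0 \<le> z \<and> z \<le> c n"
    have "(\<integral>x. \<psi>\<^sub>0 x (z * \<phi> x) \<partial>fm_measure \<nu>) \<le> (\<integral>x. z / c n * \<psi>\<^sub>0 x (c n * \<phi> x) \<partial>fm_measure \<nu>)"
    proof (rule integral_mono)
      show "integrable (fm_measure \<nu>) (\<lambda>x. \<psi>\<^sub>0 x (z * \<phi> x))" using z by (intro int) auto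
      show "integrable (fm_measure \<nu>) (\<lambda>x. z / c n * \<psi>\<^sub>0 x (c n * \<phi> x))" using c(1)[of n] by (intro integrable_mult_right int) auto
      fix x
      have "\<psi>\<^sub>0 x (z / c n * (c n * \<phi> x)) \<le> z / c n * \<psi>\<^sub>0 x (c n * \<phi> x)"
        using z c(1)[of n] bpB_nonneg[OF \<phi>, of x] by (intro \<psi>\<^sub>0_scale) auto
      then show "\<psi>\<^sub>0 x (z * \<phi> x) \<le> z / c n * \<psi>\<^sub>0 x (c n * \<phi> x)" using c(1)[of n] by simp
    qed
    also have "\<dots> = z * ((\<integral>x. \<psi>\<^sub>0 x (c n * \<phi> x) \<partial>fm_measure \<nu>) / c n)" by simp
    also have "\<dots> \<le> z * e" using z n by (intro mult_left_mono) auto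
    finally show "(\<integral>x. \<psi>\<^sub>0 x (z * \<phi> x) \<partial>fm_measure \<nu>) \<le> e * z" by (simp add: mult.commute)
  qed
qed

end

section \<open>The Feynman--Kac semigroup\<close>

context feynman_kac
begin

lemma fk_eq_one: "fk s h w = fk s (\<lambda>_. 1) w * h (state s w)"
  by (simp add: fk_def)

lemma fk_nonneg: "(\<And>y. 0 \<le> h y) \<Longrightarrow> 0 \<le> fk s h w"
  by (simp add: fk_def)

lemma fk_semigroup_nonneg: "(\<And>y. 0 \<le> h y) \<Longrightarrow> 0 \<le> FK s h x"
  unfolding FK_def by (intro bochner_nonneg fk_nonneg)

lemma fk_integrable_bpB: "0 \<le> s \<Longrightarrow> h \<in> bpB \<Longrightarrow> integrable (path_law x) (fk s h)"
  by (metis abs_of_nonneg bpB_boundE bpB_measurable bpB_nonneg fk_integrable)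

lemma fk_semigroup_mono:
  assumes "0 \<le> s" "h \<in> bpB" "k \<in> bpB" "\<And>y. h y \<le> k y"
  shows "FK s h x \<le> FK s k x"
  unfolding FK_def using assms
  by (intro integral_mono fk_integrable_bpB) (auto simp: fk_def)

lemma fk_semigroup_cmult: "FK s (\<lambda>y. c * h y) x = c * FK s h x"
proof -
  have "fk s (\<lambda>y. c * h y) w = c * fk s h w" for w by (simp add: fk_def)
  then show ?thesis by (simp add: FK_def)
qed

lemma fk_semigroup_diff:
  assumes "0 \<le> s" "h \<in> bpB" "k \<in> bpB"
  shows "FK s (\<lambda>y. h y - k y) x = FK s h x - FK s k x"
proof -
  have "fk s (\<lambda>y. h y - k y) w = fk s h w - fk s k w" for w by (simp add: fk_def algebra_simps)
  then show ?thesis using assms by (simp add: FK_def fk_integrable_bpB)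
qed

lemma nn_integral_fk:
  assumes "0 \<le> s" "h \<in> bpB"
  shows "(\<integral>\<^sup>+w. ennreal (fk s h w) \<partial>path_law x) = ennreal (FK s h x)"
  unfolding FK_def using assms
  by (intro nn_integral_eq_integral fk_integrable_bpB) (auto simp: fk_def bpB_nonneg)

lemma fk_semigroup_section_measurable:
  assumes "0 \<le> s" "h \<in> bpB"
  shows "FK s h \<in> borel_measurable borel"
proof -
  have "(\<lambda>x. \<integral>\<^sup>+w. ennreal (fk s h w) \<partial>path_law x) \<in> borel_measurable borel"
    using fk_measurable[OF bpB_measurable[OF assms(2)], of s]
    by (intro nn_integral_measurable_subprob_algebra2[OF _ path_law_measurable]) (auto simp: case_prod_beta intro: measurable_compose[OF measurable_snd])
  then have "(\<lambda>x. enn2real (ennreal (FK s h x))) \<in> borel_measurable borel"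
    unfolding nn_integral_fk[OF assms] by measurable
  then show ?thesis using fk_semigroup_nonneg[of h s] bpB_nonneg[OF assms(2)] by simp
qed

lemma fk_semigroup_bpB:
  assumes "0 \<le> s" "h \<in> bpB"
  shows "FK s h \<in> bpB"
proof -
  obtain B where B: "\<And>y. h y \<le> B" using bpB_boundE[OF assms(2)] by metis
  show ?thesis
  proof (rule bpBI[where B="exp (b0 * s) * B", OF fk_semigroup_section_measurable[OF assms] fk_semigroup_nonneg[OF bpB_nonneg[OF assms(2)]]])
    fix x
    interpret prob_space "path_law x" by (rule prob_path_law)
    have "FK s h x \<le> (\<integral>w. exp (b0 * s) * B \<partial>path_law x)"
      unfolding FK_def
    proof (intro integral_mono fk_integrable_bpB assms)
      fix w
      have "\<bar>fk s h w\<bar> \<le> exp (b0 * s) * B"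
        using assms bpB_nonneg[OF assms(2)] B by (intro fk_bound) auto
      then show "fk s h w \<le> exp (b0 * s) * B" by simp
    qed simp
    then show "FK s h x \<le> exp (b0 * s) * B" using prob_space by simp
  qed
qed

lemma mean_semigroup_eq:
  assumes t: "0 \<le> t" and f: "f \<in> bpB"
  shows "mean_semigroup law \<xi> \<zeta> \<beta> t f x = ennreal (FK t f x)"
proof -
  have "mean_semigroup law \<xi> \<zeta> \<beta> t f x = (\<integral>\<^sup>+w. ennreal (fk t f w) \<partial>law x)"
    unfolding mean_semigroup_def
  proof (rule nn_integral_cong)
    fix w
    show "ennreal (exp (LINT s:{0..t}|lborel. \<beta> (\<xi> s w)) * f (\<xi> t w)) * indicator {w'. ereal t < \<zeta> w'} w = ennreal (fk t f w)"
    proof (cases "ereal t < \<zeta> w")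
      case True
      have st: "state s w = \<xi> s w" if s: "0 \<le> s" "s \<le> t" for s
      proof -
        have "ereal s < \<zeta> w" using True s(2) by (metis ereal_less_eq(3) le_less_trans)
        then show ?thesis using s(1) by (simp add: state_def alive_def)
      qed
      have "(LINT s:{0..t}|lborel. \<beta> (\<xi> s w)) = weight t w"
        unfolding weight_def by (rule set_lebesgue_integral_cong) (auto simp: st)
      then show ?thesis using True t st[of t] by (simp add: fk_def alive_def)
    qed (simp add: fk_def alive_def)
  qed
  also have "\<dots> = (\<integral>\<^sup>+w. ennreal (fk t f w) \<partial>path_law x)"
    using fk_measurable[OF bpB_measurable[OF f]] by (intro nn_integral_path_law[symmetric]) auto
  finally show ?thesis by (simp add: nn_integral_fk[OF assms])
qed

text \<open>An eigenmeasure, tested on indicators, is an eigenmeasure on all bounded functions.\<close>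

lemma fk_eigenmeasure:
  fixes \<nu> :: "'a fin_measure"
  assumes t: "0 \<le> t" and c: "0 \<le> c"
    and eig: "\<And>A. A \<in> sets borel \<Longrightarrow> (\<integral>\<^sup>+x. ennreal (FK t (indicator A) x) \<partial>fm_measure \<nu>) = ennreal c * emeasure (fm_measure \<nu>) A"
    and f: "f \<in> bpB"
  shows "(\<integral>x. FK t f x \<partial>fm_measure \<nu>) = c * (\<integral>x. f x \<partial>fm_measure \<nu>)"
proof -
  let ?B = "fm_measure \<nu> \<bind> path_law"
  let ?N = "distr (density ?B (\<lambda>w. ennreal (fk t (\<lambda>_. 1) w))) borel (state t)"
  have ne: "space (fm_measure \<nu>) \<noteq> {}" by simp
  have K: "path_law \<in> fm_measure \<nu> \<rightarrow>\<^sub>M subprob_algebra paths" by (simp cong: measurable_cong_sets)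
  have sB [measurable_cong]: "sets ?B = sets paths" by (rule sets_bind[OF _ ne]) simp
  have one: "(\<lambda>_. 1::real) \<in> borel_measurable (borel :: 'a measure)" by simp
  note [measurable] = state_path[of t] fk_measurable[OF one, of t]
  have N: "(\<integral>\<^sup>+y. ennreal (g y) \<partial>?N) = (\<integral>\<^sup>+x. ennreal (FK t g x) \<partial>fm_measure \<nu>)" if g: "g \<in> bpB" for g
  proof -
    note [measurable] = bpB_measurable[OF g] fk_measurable[OF bpB_measurable[OF g], of t]
    have "(\<integral>\<^sup>+y. ennreal (g y) \<partial>?N) = (\<integral>\<^sup>+w. ennreal (g (state t w)) \<partial>density ?B (\<lambda>w. ennreal (fk t (\<lambda>_. 1) w)))"
      by (subst nn_integral_distr) auto
    also have "\<dots> = (\<integral>\<^sup>+w. ennreal (fk t (\<lambda>_. 1) w) * ennreal (g (state t w)) \<partial>?B)"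
      by (subst nn_integral_density) auto
    also have "\<dots> = (\<integral>\<^sup>+w. ennreal (fk t g w) \<partial>?B)"
      by (intro nn_integral_cong, subst fk_eq_one[of t g]) (simp add: ennreal_mult bpB_nonneg[OF g] fk_nonneg)
    also have "\<dots> = (\<integral>\<^sup>+x. \<integral>\<^sup>+w. ennreal (fk t g w) \<partial>path_law x \<partial>fm_measure \<nu>)"
      by (subst nn_integral_bind[OF _ K]) auto
    finally show ?thesis by (simp add: nn_integral_fk[OF t g])
  qed
  have "?N = density (fm_measure \<nu>) (\<lambda>_. ennreal c)"
  proof (rule measure_eqI)
    fix A assume "A \<in> sets ?N"
    then have A: "A \<in> sets borel" by simp
    have ind: "(indicator A :: 'a \<Rightarrow> real) \<in> bpB" using A by (intro bpBI[where B=1]) (auto simp: indicator_def)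
    have "emeasure ?N A = (\<integral>\<^sup>+y. ennreal (indicator A y) \<partial>?N)" using A by (simp add: nn_integral_indicator ennreal_indicator)
    also have "\<dots> = ennreal c * emeasure (fm_measure \<nu>) A" by (simp add: N[OF ind] eig[OF A])
    finally show "emeasure ?N A = emeasure (density (fm_measure \<nu>) (\<lambda>_. ennreal c)) A"
      using A by (simp add: emeasure_density_const)
  qed simp
  then have "(\<integral>\<^sup>+x. ennreal (FK t f x) \<partial>fm_measure \<nu>) = (\<integral>\<^sup>+y. ennreal (f y) \<partial>density (fm_measure \<nu>) (\<lambda>_. ennreal c))"
    using N[OF f] by simp
  also have "\<dots> = ennreal c * (\<integral>\<^sup>+y. ennreal (f y) \<partial>fm_measure \<nu>)"
    using bpB_measurable[OF f] by (subst nn_integral_density) (auto simp: nn_integral_cmult)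
  also have "(\<integral>\<^sup>+y. ennreal (f y) \<partial>fm_measure \<nu>) = ennreal (\<integral>y. f y \<partial>fm_measure \<nu>)"
    using integrable_fm_bpB[OF f] bpB_nonneg[OF f] by (intro nn_integral_eq_integral) auto
  finally have "(\<integral>\<^sup>+x. ennreal (FK t f x) \<partial>fm_measure \<nu>) = ennreal (c * (\<integral>y. f y \<partial>fm_measure \<nu>))"
    using c by (simp add: ennreal_mult')
  moreover have "(\<integral>\<^sup>+x. ennreal (FK t f x) \<partial>fm_measure \<nu>) = ennreal (\<integral>x. FK t f x \<partial>fm_measure \<nu>)"
    using integrable_fm_bpB[OF fk_semigroup_bpB[OF t f]] fk_semigroup_nonneg[OF bpB_nonneg[OF f]] by (intro nn_integral_eq_integral) auto
  ultimately show ?thesis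
    using c bpB_nonneg[OF f] fk_semigroup_nonneg[OF bpB_nonneg[OF f]]
    by (simp add: bochner_nonneg)
qed

end

section \<open>Cumulants in mean form\<close>

lemma set_integral_shift:
  fixes F :: "real \<Rightarrow> real"
  shows "(LINT r:{0..t - s}|lborel. F r) = (LINT v:{s..t}|lborel. F (v - s))"
proof -
  have "(LINT r:{0..t - s}|lborel. F r) = (\<integral>v. indicator {0..t - s} (- s + 1 * v) *\<^sub>R F (- s + 1 * v) \<partial>lborel)"
    unfolding set_lebesgue_integral_def
    by (subst lborel_integral_real_affine[where c=1 and t="- s"]) auto
  also have "\<dots> = (LINT v:{s..t}|lborel. F (v - s))"
    unfolding set_lebesgue_integral_def
    by (intro bochner_cong) (auto simp: indicator_def)
  finally show ?thesis .
qed

lemma set_integral_Icc_le: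
  fixes F :: "real \<Rightarrow> real"
  assumes t: "0 \<le> t" and F: "\<And>v. 0 \<le> v \<Longrightarrow> v \<le> t \<Longrightarrow> F v \<le> a" and a: "0 \<le> a"
  shows "(LINT v:{0..t}|lborel. F v) \<le> t * a"
proof (cases "set_integrable lborel {0..t} F")
  case True
  have "(LINT v:{0..t}|lborel. F v) \<le> (LINT v:{0..t}|lborel. a)"
    using F t by (intro set_integral_mono True) (auto simp: set_integrable_def emeasure_lborel_Icc_eq)
  then show ?thesis using t by (simp add: set_lebesgue_integral_def)
next
  case False
  then show ?thesis using t a by (simp add: set_lebesgue_integral_def set_integrable_def not_integrable_integral_eq)
qed

lemma set_integral_nonneg':
  fixes F :: "real \<Rightarrow> real"
  assumes "\<And>v. 0 \<le> v \<Longrightarrow> v \<le> t \<Longrightarrow> 0 \<le> F v"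
  shows "0 \<le> (LINT v:{0..t}|lborel. F v)"
  unfolding set_lebesgue_integral_def using assms
  by (intro bochner_nonneg) (auto simp: indicator_def)

text \<open>The cumulants \<open>V\<close> of a superprocess with spatial motion \<open>\<xi>\<close>.  The mean equation rewrites their defining
  equation as \<open>V\<^sub>t f = T\<^sub>t f - \<integral>\<^sub>0\<^sup>t T\<^sub>v \<psi>\<^sub>0(V\<^sub>t\<^sub>-\<^sub>v f) dv\<close>, with \<open>T\<close> the Feynman--Kac semigroup, so that the linear
  growth is separated from the nonnegative nonlinear loss.\<close>

locale cumulant_process = feynman_kac P M law \<xi> \<zeta> \<beta> b0 + branching \<sigma> \<pi>
  for P :: "real \<Rightarrow> 'a::polish_space \<Rightarrow> 'a measure" and M law \<xi> \<zeta> \<beta> and \<sigma> :: "'a \<Rightarrow> real" and b0 \<pi> +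
  fixes V :: "real \<Rightarrow> ('a \<Rightarrow> real) \<Rightarrow> 'a \<Rightarrow> real"
  assumes cumulant: "\<And>f. f \<in> bpB \<Longrightarrow> cumulant_solution P (branching_mechanism \<beta> \<sigma> \<pi>) f (\<lambda>t. V t f)"
begin

lemma V_measurable: "f \<in> bpB \<Longrightarrow> (\<lambda>(t, x). V t f x) \<in> borel_measurable (restrict_space borel ({0..} \<times> UNIV))"
  using cumulant by (simp add: cumulant_solution_def)

lemma V_nonneg: "f \<in> bpB \<Longrightarrow> 0 \<le> t \<Longrightarrow> 0 \<le> V t f x"
  using cumulant by (simp add: cumulant_solution_def)

lemma V_bounded: "f \<in> bpB \<Longrightarrow> \<exists>C. \<forall>s x. 0 \<le> s \<longrightarrow> s \<le> t \<longrightarrow> V s f x \<le> C"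
proof (cases "0 \<le> t")
  case True
  assume "f \<in> bpB"
  then have "bounded ((\<lambda>(t, x). V t f x) ` ({0..t} \<times> UNIV))"
    using cumulant True unfolding cumulant_solution_def by blast
  then obtain C where "\<And>v. v \<in> (\<lambda>(t, x). V t f x) ` ({0..t} \<times> UNIV) \<Longrightarrow> norm v \<le> C" unfolding bounded_iff by blast
  then have "\<bar>V s f x\<bar> \<le> C" if "0 \<le> s" "s \<le> t" for s x using that by force
  then show ?thesis by (metis abs_le_D1)
qed auto

lemma V_eq: "f \<in> bpB \<Longrightarrow> 0 \<le> t \<Longrightarrow>
    V t f x + (LINT s:{0..t}|lborel. \<integral>y. branching_mechanism \<beta> \<sigma> \<pi> y (V (t - s) f y) \<partial>P s x) = (\<integral>y. f y \<partial>P t x)"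
  using cumulant by (simp add: cumulant_solution_def)

lemma V_joint:
  assumes f: "f \<in> bpB"
  shows "(\<lambda>(s, y). if 0 \<le> s \<and> s \<le> t then V (t - s) f y else 0) \<in> borel_measurable (borel \<Otimes>\<^sub>M borel)"
proof -
  have sets: "{0..} \<times> (UNIV :: 'a set) \<in> sets (borel :: (real \<times> 'a) measure)"
    by (metis borel_closed closed_Times closed_UNIV closed_atLeast)
  have 1: "(\<lambda>z. if z \<in> {0..} \<times> UNIV then (\<lambda>(t, x). V t f x) z else 0) \<in> borel_measurable (borel :: (real \<times> 'a) measure)"
    using V_measurable[OF f] sets by (subst (asm) measurable_restrict_space_iff) auto
  have "(\<lambda>z. (t - fst z, snd z)) \<in> borel \<Otimes>\<^sub>M borel \<rightarrow>\<^sub>M (borel :: (real \<times> 'a) measure)"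
    unfolding borel_prod[symmetric] by measurable
  from measurable_compose[OF this 1]
  have [measurable]: "(\<lambda>z. if 0 \<le> t - fst z then V (t - fst z) f (snd z) else 0) \<in> borel_measurable (borel \<Otimes>\<^sub>M borel)"
    by (simp add: mem_Times_iff cong: if_cong)
  have "(\<lambda>z. if 0 \<le> fst z then (if 0 \<le> t - fst z then V (t - fst z) f (snd z) else 0) else 0) \<in> borel_measurable (borel \<Otimes>\<^sub>M borel)"
    by measurable
  then show ?thesis by (rule measurable_cong[THEN iffD1, rotated]) auto
qed

lemma V_bpB: "f \<in> bpB \<Longrightarrow> 0 \<le> t \<Longrightarrow> V t f \<in> bpB"
proof -
  assume f: "f \<in> bpB" and t: "0 \<le> t"
  obtain C where C: "\<And>s x. 0 \<le> s \<Longrightarrow> s \<le> t \<Longrightarrow> V s f x \<le> C" using V_bounded[OF f] by metis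
  from measurable_compose[OF measurable_Pair1' V_joint[OF f, of t], of 0]
  have "V t f \<in> borel_measurable borel" using t by simp
  then show ?thesis using t C by (intro bpBI[where B=C] V_nonneg[OF f]) auto
qed

lemma V_0: "f \<in> bpB \<Longrightarrow> V 0 f = f"
proof
  fix x assume f: "f \<in> bpB"
  have "(LINT s:{0..0}|lborel. \<integral>y. branching_mechanism \<beta> \<sigma> \<pi> y (V (0 - s) f y) \<partial>P s x) = 0"
  proof -
    have "AE s in lborel. s \<noteq> (0::real)" by (rule AE_lborel_singleton)
    then show ?thesis unfolding set_lebesgue_integral_def
      by (intro integral_eq_zero_AE) (auto elim!: eventually_mono)
  qed
  then show "V 0 f x = f x"
    using V_eq[OF f, of 0 x] bpB_measurable[OF f] by (simp add: P_0 integral_return)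
qed

text \<open>The source term of the mean equation, at time \<open>v\<close> out of a horizon \<open>t\<close>.\<close>

definition source :: "real \<Rightarrow> ('a \<Rightarrow> real) \<Rightarrow> real \<Rightarrow> 'a \<Rightarrow> real" where
  "source t f v y = \<psi>\<^sub>0 y (if 0 \<le> v \<and> v \<le> t then V (t - v) f y else 0)"

lemma source_nonneg: "0 \<le> source t f v y" by (simp add: source_def \<psi>\<^sub>0_nonneg)

lemma source_joint: "f \<in> bpB \<Longrightarrow> (\<lambda>(v, y). source t f v y) \<in> borel_measurable (borel \<Otimes>\<^sub>M borel)"
proof -
  assume f: "f \<in> bpB"
  let ?U = "\<lambda>z. if 0 \<le> fst z \<and> fst z \<le> t then V (t - fst z) f (snd z) else 0"
  have "(\<lambda>z. (snd z, ?U z)) \<in> borel \<Otimes>\<^sub>M borel \<rightarrow>\<^sub>M borel \<Otimes>\<^sub>M borel"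
    using V_joint[OF f, of t] by (intro measurable_Pair) (auto simp: case_prod_beta)
  from measurable_compose[OF this \<psi>\<^sub>0_joint] show ?thesis
    using V_nonneg[OF f] by (simp add: source_def case_prod_beta max_absorb2)
qed

lemma source_bounded: "f \<in> bpB \<Longrightarrow> \<exists>C. \<forall>v y. source t f v y \<le> C"
proof -
  assume f: "f \<in> bpB"
  obtain C0 where C0: "\<And>s x. 0 \<le> s \<Longrightarrow> s \<le> t \<Longrightarrow> V s f x \<le> C0" using V_bounded[OF f] by metis
  define C where "C = max C0 0"
  have "source t f v y \<le> \<psi>_const * max C (C\<^sup>2)" for v y
  proof -
    have "source t f v y \<le> \<psi>\<^sub>0 y C"
      unfolding source_def using V_nonneg[OF f] C0 by (intro \<psi>\<^sub>0_mono) (auto simp: C_def intro: max.coboundedI1)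
    also have "\<dots> \<le> \<psi>_const * max C (C\<^sup>2)" by (rule \<psi>\<^sub>0_le) (simp add: C_def)
    finally show ?thesis .
  qed
  then show ?thesis by blast
qed

lemma source_bpB: "f \<in> bpB \<Longrightarrow> source t f v \<in> bpB"
proof -
  assume f: "f \<in> bpB"
  obtain C where C: "\<And>v y. source t f v y \<le> C" using source_bounded[OF f] by metis
  have "source t f v \<in> borel_measurable borel"
    using measurable_compose[OF measurable_Pair1' source_joint[OF f, of t], of v] by simp
  then show ?thesis by (rule bpBI[OF _ source_nonneg C])
qed

lemma V_mean_equation:
  assumes f: "f \<in> bpB" and t: "0 \<le> t"
  shows "V t f x = FK t f x - (LINT v:{0..t}|lborel. FK v (source t f v) x)"
proof -
  define U where "U s y = (if 0 \<le> s \<and> s \<le> t then V (t - s) f y else 0)" for s y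
  obtain C1 where C1: "\<And>s x. 0 \<le> s \<Longrightarrow> s \<le> t \<Longrightarrow> V s f x \<le> C1" using V_bounded[OF f] by metis
  obtain C2 where C2: "\<And>v y. source t f v y \<le> C2" using source_bounded[OF f] by metis
  obtain C3 where C3: "\<And>y. f y \<le> C3" using bpB_boundE[OF f] by metis
  define C where "C = max (max C1 0) (max C2 C3)"
  have "U 0 x = FK t f x - (LINT v:{0..t}|lborel. FK v (source t f v) x)"
  proof (rule mean_equation[where C=C, OF t bpB_measurable[OF f] _ _ _ source_joint[OF f]])
    show "\<bar>f y\<bar> \<le> C" for y using C3[of y] bpB_nonneg[OF f, of y] by (simp add: C_def)
    show "\<bar>source t f v y\<bar> \<le> C" for v y using C2[of v y] source_nonneg[of t f v y] by (simp add: C_def)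
    show "\<bar>U v y\<bar> \<le> C" for v y using C1[of "t - v" y] V_nonneg[OF f, of "t - v" y]
      by (auto simp: U_def C_def max_def)
    show "(\<lambda>(s, y). U s y) \<in> borel_measurable (borel \<Otimes>\<^sub>M borel)" unfolding U_def by (rule V_joint[OF f])
    fix s y assume s: "0 \<le> s" "s \<le> t"
    have "U s y = (\<integral>z. f z \<partial>P (t - s) y) - (LINT r:{0..t - s}|lborel. \<integral>z. branching_mechanism \<beta> \<sigma> \<pi> z (V (t - s - r) f z) \<partial>P r y)"
      using V_eq[OF f, of "t - s" y] s by (simp add: U_def)
    also have "(LINT r:{0..t - s}|lborel. \<integral>z. branching_mechanism \<beta> \<sigma> \<pi> z (V (t - s - r) f z) \<partial>P r y)
        = (LINT v:{s..t}|lborel. \<integral>z. branching_mechanism \<beta> \<sigma> \<pi> z (V (t - v) f z) \<partial>P (v - s) y)"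
      by (subst set_integral_shift) simp
    also have "\<dots> = (LINT v:{s..t}|lborel. - (\<integral>z. (\<beta> z * U v z - source t f v z) \<partial>P (v - s) y))"
      using s by (intro set_lebesgue_integral_cong)
        (auto simp: U_def source_def branching_mechanism_eq simp flip: Bochner_Integration.integral_minus)
    also have "\<dots> = - (LINT v:{s..t}|lborel. \<integral>z. (\<beta> z * U v z - source t f v z) \<partial>P (v - s) y)"
      by (simp add: set_lebesgue_integral_def)
    finally show "U s y = (\<integral>z. f z \<partial>P (t - s) y) + (LINT v:{s..t}|lborel. \<integral>z. (\<beta> z * U v z - source t f v z) \<partial>P (v - s) y)"
      by simp
  qed
  then show ?thesis using t by (simp add: U_def)
qed

lemma V_le_fk: "f \<in> bpB \<Longrightarrow> 0 \<le> t \<Longrightarrow> V t f x \<le> FK t f x"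
  using V_mean_equation[of f t x] set_integral_nonneg'[of t "\<lambda>v. FK v (source t f v) x"] fk_semigroup_nonneg[OF source_nonneg]
  by simp

text \<open>Integrating the mean equation against a measure.\<close>

lemma V_mean_integrated:
  assumes f: "f \<in> bpB" and t: "0 \<le> t"
  shows "(\<integral>x. V t f x \<partial>fm_measure \<nu>) = (\<integral>x. FK t f x \<partial>fm_measure \<nu>)
     - (LINT v:{0..t}|lborel. \<integral>x. FK v (source t f v) x \<partial>fm_measure \<nu>)"
proof -
  define J where "J = restrict_space lborel {0..t}"
  have sp: "space J = {0..t}" by (simp add: J_def space_restrict_space)
  have fin: "finite_measure J" by (rule finite_measureI) (simp add: J_def space_restrict_space emeasure_restrict_space emeasure_lborel_Icc_eq)
  have L: "(LINT v:{0..t}|lborel. h v) = (\<integral>v. indicator {0..t} v * h v \<partial>J)" for h :: "real \<Rightarrow> real"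
  proof -
    have "(\<integral>v. indicator {0..t} v * h v \<partial>J) = (\<integral>v. indicator {0..t} v *\<^sub>R (indicator {0..t} v * h v) \<partial>lborel)"
      unfolding J_def by (subst integral_restrict_space) auto
    also have "\<dots> = (LINT v:{0..t}|lborel. h v)"
      unfolding set_lebesgue_integral_def by (intro bochner_cong) (auto simp: indicator_def)
    finally show ?thesis by simp
  qed
  obtain C where C: "\<And>v y. source t f v y \<le> C" using source_bounded[OF f] by metis
  have C': "\<bar>source t f v y\<bar> \<le> C" for v y using C[of v y] source_nonneg[of t f v y] by simp
  have C0: "0 \<le> C" using C'[of undefined undefined] abs_ge_zero by (meson order_trans)
  let ?k = "\<lambda>v x. indicator {0..t} v * FK v (source t f v) x"
  have joint: "(\<lambda>(v, x). ?k v x) \<in> borel_measurable (J \<Otimes>\<^sub>M fm_measure \<nu>)"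
  proof -
    have "(\<lambda>(v, x). ?k v x) \<in> borel_measurable (J \<Otimes>\<^sub>M borel)"
      unfolding J_def by (rule measurable_restrict_pair[OF fk_semigroup_measurable[OF source_joint[OF f] C' t]])
    then show ?thesis by (subst measurable_cong_sets[OF sets_pair_measure_cong[OF refl sets_fm_measure] refl])
  qed
  have bound: "\<bar>?k v x\<bar> \<le> exp (b0 * t) * C" if "v \<in> space J" for v x
  proof -
    have v: "0 \<le> v" "v \<le> t" using that by (auto simp: sp)
    interpret prob_space "path_law x" by (rule prob_path_law)
    have "FK v (source t f v) x \<le> (\<integral>w. exp (b0 * t) * C \<partial>path_law x)"
      unfolding FK_def
    proof (intro integral_mono fk_integrable_bpB v(1) source_bpB[OF f])
      fix w
      have "\<bar>fk v (source t f v) w\<bar> \<le> exp (b0 * v) * C" by (rule fk_bound[OF v(1) C'])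
      also have "\<dots> \<le> exp (b0 * t) * C" using v b0_nonneg C0 by (intro mult_right_mono) (auto intro: mult_left_mono)
      finally show "fk v (source t f v) w \<le> exp (b0 * t) * C" by simp
    qed simp
    then show ?thesis using v prob_space fk_semigroup_nonneg[of "source t f v" v x, OF source_nonneg] by simp
  qed
  note F = bounded_Fubini[OF fin finite_fm_measure joint bound]
  have int: "integrable (fm_measure \<nu>) (\<lambda>x. LINT v:{0..t}|lborel. FK v (source t f v) x)"
  proof -
    have "(\<lambda>x. LINT v:{0..t}|lborel. FK v (source t f v) x) = (\<lambda>x. FK t f x - V t f x)"
      using V_mean_equation[OF f t] by auto
    then show ?thesis using integrable_fm_bpB[OF fk_semigroup_bpB[OF t f]] integrable_fm_bpB[OF V_bpB[OF f t]] by simp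
  qed
  have "(\<integral>x. V t f x \<partial>fm_measure \<nu>) = (\<integral>x. FK t f x - (LINT v:{0..t}|lborel. FK v (source t f v) x) \<partial>fm_measure \<nu>)"
    by (simp only: V_mean_equation[OF f t])
  also have "\<dots> = (\<integral>x. FK t f x \<partial>fm_measure \<nu>) - (\<integral>x. (LINT v:{0..t}|lborel. FK v (source t f v) x) \<partial>fm_measure \<nu>)"
    by (rule Bochner_Integration.integral_diff[OF integrable_fm_bpB[OF fk_semigroup_bpB[OF t f]] int])
  also have "(\<integral>x. (LINT v:{0..t}|lborel. FK v (source t f v) x) \<partial>fm_measure \<nu>)
      = (LINT v:{0..t}|lborel. \<integral>x. FK v (source t f v) x \<partial>fm_measure \<nu>)"
    unfolding L using F(1) by simp
  finally show ?thesis .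
qed

end

section \<open>Cumulants and the principal eigenfunction\<close>

text \<open>The function \<open>\<phi>\<close> and the measure \<open>\<nu>\<close> are the principal eigenelements of the Feynman--Kac semigroup, and
  \<open>h\<close> bounds the relative error in its ergodic approximation.  Integration against \<open>\<nu>\<close> is written \<open>mean\<close>.\<close>

locale ergodic_cumulants = cumulant_process +
  fixes \<phi> :: "'a \<Rightarrow> real" and \<nu> :: "'a fin_measure" and lam :: real and h :: "real \<Rightarrow> real"
  assumes \<phi>: "\<phi> \<in> bpB" and \<phi>_pos: "0 < \<phi> x"
    and \<nu>_prob: "prob_space (fm_measure \<nu>)"
    and \<nu>_\<phi>: "(\<integral>x. \<phi> x \<partial>fm_measure \<nu>) = 1"
    and fk_\<phi>: "0 \<le> t \<Longrightarrow> FK t \<phi> x = exp (lam * t) * \<phi> x"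
    and fk_\<nu>: "0 \<le> t \<Longrightarrow> f \<in> bpB \<Longrightarrow>
      (\<integral>x. FK t f x \<partial>fm_measure \<nu>) = exp (lam * t) * (\<integral>x. f x \<partial>fm_measure \<nu>)"
    and fk_h: "0 < t \<Longrightarrow> f \<in> bpB \<Longrightarrow>
      \<bar>FK t f x - exp (lam * t) * \<phi> x * (\<integral>x. f x \<partial>fm_measure \<nu>)\<bar>
        \<le> exp (lam * t) * \<phi> x * (\<integral>x. f x \<partial>fm_measure \<nu>) * h t"
    and h_nonneg: "0 < t \<Longrightarrow> 0 \<le> h t"
    and lam_neg: "lam < 0"
begin

abbreviation mean :: "('a \<Rightarrow> real) \<Rightarrow> real" where "mean f \<equiv> \<integral>x. f x \<partial>fm_measure \<nu>"

lemma mean_nonneg: "f \<in> bpB \<Longrightarrow> 0 \<le> mean f"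
  by (intro bochner_nonneg bpB_nonneg)

lemma mean_mono: "f \<in> bpB \<Longrightarrow> g \<in> bpB \<Longrightarrow> (\<And>x. f x \<le> g x) \<Longrightarrow> mean f \<le> mean g"
  by (intro integral_mono integrable_fm_bpB)

lemma bpB_cmult: "f \<in> bpB \<Longrightarrow> 0 \<le> c \<Longrightarrow> (\<lambda>x. c * f x) \<in> (bpB :: ('a \<Rightarrow> real) set)"
proof -
  assume f: "f \<in> bpB" and c: "0 \<le> c"
  obtain B where "\<And>x. f x \<le> B" using bpB_boundE[OF f] by metis
  then show ?thesis using f c bpB_nonneg[OF f] by (intro bpBI[where B="c * B"]) (auto intro: mult_left_mono)
qed

lemma exp_lam_le: "0 \<le> t \<Longrightarrow> exp (lam * t) \<le> 1"
  using lam_neg by (simp add: mult_nonpos_nonneg)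

text \<open>Multiples of the eigenfunction are supersolutions.\<close>

lemma fk_le_eigenfunction:
  assumes g: "g \<in> bpB" "\<And>y. g y \<le> c * \<phi> y" and c: "0 \<le> c" and t: "0 \<le> t"
  shows "FK t g x \<le> c * \<phi> x"
proof -
  have "FK t g x \<le> FK t (\<lambda>y. c * \<phi> y) x"
    by (rule fk_semigroup_mono[OF t g(1) bpB_cmult[OF \<phi> c] g(2)])
  also have "\<dots> = exp (lam * t) * (c * \<phi> x)" by (simp add: fk_semigroup_cmult fk_\<phi>[OF t])
  also have "\<dots> \<le> 1 * (c * \<phi> x)" using exp_lam_le[OF t] c \<phi>_pos[of x] by (intro mult_right_mono) auto
  finally show ?thesis by simp
qed

lemma V_le_eigenfunction:
  assumes g: "g \<in> bpB" "\<And>y. g y \<le> c * \<phi> y" and c: "0 \<le> c" and t: "0 \<le> t"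
  shows "V t g x \<le> c * \<phi> x"
  using V_le_fk[OF g(1) t, of x] fk_le_eigenfunction[OF g c t, of x] by (rule order_trans)

text \<open>The constant \<open>C\<close> in \<open>T\<^sub>t g \<le> C \<nu>(g) \<phi>\<close>.\<close>

definition upper_const :: "real \<Rightarrow> real" where
  "upper_const t = exp (lam * t) * (1 + h t)"

lemma upper_const_pos: "0 < t \<Longrightarrow> 0 < upper_const t"
  using h_nonneg[of t] by (simp add: upper_const_def add_pos_nonneg)

lemma fk_upper: "0 < t \<Longrightarrow> g \<in> bpB \<Longrightarrow> FK t g x \<le> upper_const t * mean g * \<phi> x"
  using fk_h[of t g x] by (simp add: upper_const_def abs_le_iff algebra_simps)

lemma V_upper: "0 < t \<Longrightarrow> g \<in> bpB \<Longrightarrow> V t g x \<le> upper_const t * mean g * \<phi> x"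
  using V_le_fk[of g t x] fk_upper[of t g x] by linarith

lemma mean_V_le: "0 \<le> t \<Longrightarrow> g \<in> bpB \<Longrightarrow> mean (V t g) \<le> exp (lam * t) * mean g"
  using mean_mono[OF V_bpB[of g t] fk_semigroup_bpB[of t g] V_le_fk[of g t]] fk_\<nu>[of t g] by simp

lemma mean_V_le': "0 \<le> t \<Longrightarrow> g \<in> bpB \<Longrightarrow> mean (V t g) \<le> mean g"
  using mean_V_le[of t g] mult_right_mono[OF exp_lam_le[of t] mean_nonneg[of g]] by simp

text \<open>The mean lost by the nonlinearity is at most the time times a bound on the mean rate of loss.\<close>

lemma mean_V_ge:
  assumes g: "g \<in> bpB" and s: "0 \<le> s" and a: "0 \<le> a"
    and le: "\<And>u. 0 \<le> u \<Longrightarrow> u \<le> s \<Longrightarrow> mean (\<lambda>y. \<psi>\<^sub>0 y (V u g y)) \<le> a"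
  shows "exp (lam * s) * mean g - mean (V s g) \<le> s * a"
proof -
  have "(LINT v:{0..s}|lborel. mean (FK v (source s g v))) \<le> s * a"
  proof (rule set_integral_Icc_le[OF s _ a])
    fix v assume v: "0 \<le> v" "v \<le> s"
    have src: "source s g v = (\<lambda>y. \<psi>\<^sub>0 y (V (s - v) g y))" using v by (auto simp: source_def)
    have "mean (FK v (source s g v)) = exp (lam * v) * mean (source s g v)"
      by (rule fk_\<nu>[OF v(1) source_bpB[OF g]])
    also have "\<dots> \<le> 1 * mean (source s g v)"
      by (rule mult_right_mono[OF exp_lam_le[OF v(1)] mean_nonneg[OF source_bpB[OF g]]])
    also have "\<dots> \<le> a" using le[of "s - v"] v by (simp add: src)
    finally show "mean (FK v (source s g v)) \<le> a" .
  qed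
  then show ?thesis using V_mean_integrated[OF g s, of \<nu>] fk_\<nu>[OF s g] by simp
qed

text \<open>A lower bound after two time steps: the first, of length \<open>s\<close>, makes the linear semigroup
  ergodic, and the second, of length \<open>d\<close>, regularises the accumulated nonlinear loss.\<close>

lemma V_lower:
  assumes g: "g \<in> bpB" and s: "0 < s" and hs: "h s \<le> 1" and d: "0 < d"
    and le: "\<And>u y. 0 \<le> u \<Longrightarrow> u \<le> d \<Longrightarrow> V u (V s g) y \<le> 1"
  shows "((1 - h s) * exp (lam * (s + d)) * mean g
      - upper_const d * (exp (lam * s) * mean g - mean (V s g))
      - \<psi>_const * d * upper_const s * mean g) * \<phi> x \<le> V d (V s g) x"
proof -
  let ?k = "V s g"
  let ?c = "upper_const s * mean g"
  have s0: "0 \<le> s" and d0: "0 \<le> d" using s d by auto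
  have k: "?k \<in> bpB" by (rule V_bpB[OF g s0])
  have c: "0 \<le> ?c" using upper_const_pos[OF s] mean_nonneg[OF g] by simp
  define D where "D x = FK s g x - ?k x" for x
  have T: "FK s g \<in> bpB" by (rule fk_semigroup_bpB[OF s0 g])
  obtain B where B: "\<And>x. FK s g x \<le> B" using bpB_boundE[OF T] by metis
  have D: "D \<in> bpB"
  proof (rule bpBI[where B=B])
    show "D \<in> borel_measurable borel" using bpB_measurable[OF T] bpB_measurable[OF k] unfolding D_def[abs_def] by simp
    fix x
    show "0 \<le> D x" using V_le_fk[OF g s0, of x] by (simp add: D_def)
    show "D x \<le> B" using B[of x] bpB_nonneg[OF k, of x] by (simp add: D_def)
  qed
  have mD: "mean D = exp (lam * s) * mean g - mean ?k"
    unfolding D_def using fk_\<nu>[OF s0 g] by (simp add: integrable_fm_bpB[OF T] integrable_fm_bpB[OF k])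
  have 1: "FK d ?k x = FK d (FK s g) x - FK d D x"
    using fk_semigroup_diff[OF d0 T k, of x] by (simp add: D_def[abs_def])
  have 2: "FK d D x \<le> upper_const d * mean D * \<phi> x" by (rule fk_upper[OF d D])
  have 3: "(1 - h s) * exp (lam * (s + d)) * mean g * \<phi> x \<le> FK d (FK s g) x"
  proof -
    let ?b = "(1 - h s) * exp (lam * s) * mean g"
    have b: "0 \<le> ?b" using hs mean_nonneg[OF g] by simp
    have "?b * \<phi> y \<le> FK s g y" for y
      using fk_h[OF s g, of y] by (simp add: abs_le_iff algebra_simps)
    then have "FK d (\<lambda>y. ?b * \<phi> y) x \<le> FK d (FK s g) x"
      by (intro fk_semigroup_mono d0 T bpB_cmult \<phi> b)
    then show ?thesis unfolding fk_semigroup_cmult fk_\<phi>[OF d0] distrib_left exp_add by (simp only: mult_ac)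
  qed
  have 4: "(LINT v:{0..d}|lborel. FK v (source d ?k v) x) \<le> d * (\<psi>_const * ?c * \<phi> x)"
  proof (rule set_integral_Icc_le[OF d0])
    show c': "0 \<le> \<psi>_const * ?c * \<phi> x" using c \<psi>_const_nonneg \<phi>_pos[of x] by simp
    fix v assume v: "0 \<le> v" "v \<le> d"
    have "source d ?k v y \<le> \<psi>_const * ?c * \<phi> y" for y
    proof -
      have "source d ?k v y = \<psi>\<^sub>0 y (V (d - v) ?k y)" using v by (simp add: source_def)
      also have "\<dots> \<le> \<psi>_const * V (d - v) ?k y" using v by (intro \<psi>\<^sub>0_le_linear V_nonneg[OF k] le) auto
      also have "\<dots> \<le> \<psi>_const * (?c * \<phi> y)"
        using v by (intro mult_left_mono V_le_eigenfunction[OF k _ c] V_upper[OF s g] \<psi>_const_nonneg) auto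
      finally show ?thesis by (simp add: mult.assoc)
    qed
    then show "FK v (source d ?k v) x \<le> \<psi>_const * ?c * \<phi> x"
      using c \<psi>_const_nonneg by (intro fk_le_eigenfunction[OF source_bpB[OF k]] v) auto
  qed
  show ?thesis using 1 2 3 4 V_mean_equation[OF k d0, of x] by (simp add: mD algebra_simps)
qed

end

section \<open>Uniform asymptotics of the cumulants\<close>

text \<open>The additional properties hold because \<open>V\<close> is the family of cumulants of a Markov process that is
  extinct at every positive time with positive probability when started from \<open>\<nu>\<close>.\<close>

locale extinguishing_cumulants = ergodic_cumulants +
  assumes h_limit: "(h \<longlongrightarrow> 0) at_top"
    and flow: "f \<in> bpB \<Longrightarrow> 0 \<le> s \<Longrightarrow> 0 \<le> t \<Longrightarrow> V (s + t) f = V s (V t f)"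
    and V_mono: "f \<in> bpB \<Longrightarrow> g \<in> bpB \<Longrightarrow> 0 \<le> t \<Longrightarrow> (\<And>x. f x \<le> g x) \<Longrightarrow> V t f x \<le> V t g x"
    and V_concave: "f \<in> bpB \<Longrightarrow> 0 \<le> t \<Longrightarrow> 0 \<le> c \<Longrightarrow> c \<le> 1 \<Longrightarrow> c * V t f x \<le> V t (\<lambda>x. c * f x) x"
    and V_continuous: "(\<And>n. k n \<in> bpB) \<Longrightarrow> f \<in> bpB \<Longrightarrow> (\<And>n x. k n x \<le> f x) \<Longrightarrow>
      (\<And>x. (\<lambda>n. k n x) \<longlonglongrightarrow> f x) \<Longrightarrow> 0 \<le> t \<Longrightarrow> (\<lambda>n. V t (k n) x) \<longlonglongrightarrow> V t f x"
    and extinction_bound: "0 < t \<Longrightarrow> \<exists>K. \<forall>f\<in>bpB. mean (V t f) \<le> K"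
begin

text \<open>After a positive time the cumulants are bounded by a multiple of \<open>\<phi>\<close>, whatever the initial
  function, and this multiple tends to \<open>0\<close>.\<close>

lemma V_uniform_bound:
  assumes "0 < t"
  obtains C where "0 < C" "\<And>f x. f \<in> bpB \<Longrightarrow> V t f x \<le> C * \<phi> x"
proof -
  obtain K where K: "\<And>f. f \<in> bpB \<Longrightarrow> mean (V (t / 2) f) \<le> K" using extinction_bound[of "t / 2"] assms by auto
  have K0: "0 \<le> K" using K[OF \<phi>] mean_nonneg[OF V_bpB[OF \<phi>, of "t / 2"]] assms by simp
  have u: "0 < upper_const (t / 2)" using assms by (intro upper_const_pos) simp
  show ?thesis
  proof
    show "0 < upper_const (t / 2) * (K + 1)" using u K0 by simp
    fix f :: "'a \<Rightarrow> real" and x assume f: "f \<in> bpB"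
    have "V t f x = V (t / 2) (V (t / 2) f) x" using flow[OF f, of "t / 2" "t / 2"] assms by simp
    also have "\<dots> \<le> upper_const (t / 2) * mean (V (t / 2) f) * \<phi> x"
      using assms by (intro V_upper V_bpB f) auto
    also have "\<dots> \<le> upper_const (t / 2) * (K + 1) * \<phi> x"
      using u K[OF f] \<phi>_pos[of x] by (intro mult_right_mono mult_left_mono) auto
    finally show "V t f x \<le> upper_const (t / 2) * (K + 1) * \<phi> x" .
  qed
qed

lemma eventually_mean_small:
  assumes e: "0 < e"
  shows "\<forall>\<^sub>F t in at_top. \<forall>f\<in>bpB. mean (V t f) \<le> e"
proof -
  obtain K where K: "\<And>f. f \<in> bpB \<Longrightarrow> mean (V 1 f) \<le> K" using extinction_bound[of 1] by auto
  have "filterlim (\<lambda>t. lam * (t - 1)) at_bot at_top" using lam_neg by real_asymp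
  from filterlim_compose[OF exp_at_bot this] have "((\<lambda>t. exp (lam * (t - 1)) * K) \<longlongrightarrow> 0 * K) at_top"
    by (intro tendsto_intros)
  then have "\<forall>\<^sub>F t in at_top. exp (lam * (t - 1)) * K < e" using e by (intro order_tendstoD) auto
  with eventually_ge_at_top[of 1] show ?thesis
  proof eventually_elim
    case (elim t)
    show ?case
    proof
      fix f :: "'a \<Rightarrow> real" assume f: "f \<in> bpB"
      have "mean (V t f) = mean (V (t - 1) (V 1 f))" using flow[OF f, of "t - 1" 1] elim by simp
      also have "\<dots> \<le> exp (lam * (t - 1)) * mean (V 1 f)" using elim f by (intro mean_V_le V_bpB) auto
      also have "\<dots> \<le> exp (lam * (t - 1)) * K" using K[OF f] by simp
      finally show "mean (V t f) \<le> e" using elim by simp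
    qed
  qed
qed

lemma V_le_eventually:
  assumes e: "0 < e" and d: "0 < d"
  shows "\<forall>\<^sub>F t in at_top. \<forall>f\<in>bpB. mean (V t f) \<le> e \<and> (\<forall>u\<ge>d. \<forall>x. V u (V t f) x \<le> e * \<phi> x)"
proof -
  have "\<forall>\<^sub>F t in at_top. \<forall>f\<in>bpB. mean (V t f) \<le> e / upper_const d"
    using e upper_const_pos[OF d] by (intro eventually_mean_small) simp
  with eventually_mean_small[OF e] eventually_ge_at_top[of 0] show ?thesis
  proof eventually_elim
    case (elim t)
    show ?case
    proof (intro ballI conjI allI impI)
      fix f :: "'a \<Rightarrow> real" and u x assume f: "f \<in> bpB" and u: "d \<le> u"
      have k: "V t f \<in> bpB" using f elim by (intro V_bpB) auto
      have "V d (V t f) y \<le> e * \<phi> y" for y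
      proof -
        have "V d (V t f) y \<le> upper_const d * mean (V t f) * \<phi> y" by (rule V_upper[OF d k])
        also have "\<dots> \<le> upper_const d * (e / upper_const d) * \<phi> y"
          using elim f upper_const_pos[OF d] \<phi>_pos[of y] by (intro mult_right_mono mult_left_mono) auto
        finally show ?thesis using upper_const_pos[OF d] by simp
      qed
      moreover have "V u (V t f) = V (u - d) (V d (V t f))" using flow[OF k, of "u - d" d] u d by simp
      moreover have "V d (V t f) \<in> bpB" using d by (intro V_bpB k) auto
      ultimately show "V u (V t f) x \<le> e * \<phi> x"
        using V_le_eigenfunction[of "V d (V t f)" e "u - d" x] u e by simp
    qed (use elim in auto)
  qed
qed

text \<open>From a large time on, the cumulants stay below \<open>1\<close>, where the nonlinearity is bounded linearly.\<close>

lemma V_le_one_eventually: "\<forall>\<^sub>F t in at_top. \<forall>f\<in>bpB. \<forall>u\<ge>0. \<forall>x. V u (V t f) x \<le> 1"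
proof -
  obtain B where B: "0 < B" "\<And>x. \<phi> x \<le> B" using bpB_boundE[OF \<phi>] by metis
  have "\<forall>\<^sub>F t in at_top. \<forall>f\<in>bpB. mean (V t f) \<le> 1 / B \<and> (\<forall>u\<ge>1. \<forall>x. V u (V t f) x \<le> 1 / B * \<phi> x)"
    using B by (intro V_le_eventually) auto
  then obtain t0 where t0: "\<And>t f u x. t0 \<le> t \<Longrightarrow> f \<in> bpB \<Longrightarrow> 1 \<le> u \<Longrightarrow> V u (V t f) x \<le> 1 / B * \<phi> x"
    unfolding eventually_at_top_linorder by blast
  show ?thesis unfolding eventually_at_top_linorder
  proof (intro exI allI ballI impI)
    fix t :: real and f :: "'a \<Rightarrow> real" and u :: real and x assume t: "max t0 0 + 1 \<le> t" and f: "f \<in> bpB" and u: "0 \<le> u"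
    have "V u (V t f) = V (u + 1) (V (t - 1) f)"
      using flow[OF f, of u t] flow[OF f, of "u + 1" "t - 1"] u t by (simp add: algebra_simps)
    then have "V u (V t f) x \<le> 1 / B * \<phi> x" using t0[of "t - 1" f "u + 1" x] t f u by simp
    also have "\<dots> \<le> 1 / B * B" using B by (intro mult_left_mono) auto
    finally show "V u (V t f) x \<le> 1" using B by simp
  qed
qed

text \<open>In a short time, the same for all functions whose cumulants stay below \<open>1\<close>, the mean loses at most
  half of its value.\<close>

lemma mean_V_half:
  obtains d where "0 < d" "d \<le> 1"
    "\<And>g. g \<in> bpB \<Longrightarrow> (\<And>u x. 0 \<le> u \<Longrightarrow> V u g x \<le> 1) \<Longrightarrow> mean g / 2 \<le> mean (V d g)"
proof -
  define d where "d = 1 / (2 * (\<bar>lam\<bar> + \<psi>_const) + 1)"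
  have pos: "0 < 2 * (\<bar>lam\<bar> + \<psi>_const) + 1" using \<psi>_const_nonneg by (simp add: add_nonneg_pos)
  have d: "0 < d" "d \<le> 1" using pos \<psi>_const_nonneg by (auto simp: d_def)
  have "d * (2 * (\<bar>lam\<bar> + \<psi>_const) + 1) = 1" using pos by (simp add: d_def)
  then have "1 / 2 \<le> 1 + lam * d - d * \<psi>_const" using d lam_neg by (simp add: algebra_simps)
  also have "\<dots> \<le> exp (lam * d) - d * \<psi>_const" using exp_ge_add_one_self[of "lam * d"] by simp
  finally have e: "1 / 2 \<le> exp (lam * d) - d * \<psi>_const" .
  show ?thesis
  proof (rule that[OF d])
    fix g :: "'a \<Rightarrow> real" assume g: "g \<in> bpB" and le: "\<And>u x. 0 \<le> u \<Longrightarrow> V u g x \<le> 1"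
    have "exp (lam * d) * mean g - mean (V d g) \<le> d * (\<psi>_const * mean g)"
    proof (rule mean_V_ge[OF g])
      fix u assume u: "0 \<le> u" "u \<le> d"
      have Vu: "V u g \<in> bpB" by (rule V_bpB[OF g u(1)])
      have "mean (\<lambda>y. \<psi>\<^sub>0 y (V u g y)) \<le> mean (\<lambda>y. \<psi>_const * V u g y)"
        using le[OF u(1)] by (intro mean_mono \<psi>\<^sub>0_compose_bpB bpB_cmult Vu \<psi>_const_nonneg \<psi>\<^sub>0_le_linear bpB_nonneg) auto
      also have "\<dots> \<le> \<psi>_const * mean g"
        using mult_left_mono[OF mean_V_le'[OF u(1) g] \<psi>_const_nonneg] by simp
      finally show "mean (\<lambda>y. \<psi>\<^sub>0 y (V u g y)) \<le> \<psi>_const * mean g" .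
    qed (use d mean_nonneg[OF g] \<psi>_const_nonneg in auto)
    moreover have "1 / 2 * mean g \<le> (exp (lam * d) - d * \<psi>_const) * mean g"
      by (rule mult_right_mono[OF e mean_nonneg[OF g]])
    ultimately show "mean g / 2 \<le> mean (V d g)" by (simp add: algebra_simps)
  qed
qed

text \<open>At large times the nonlinear loss is negligible, so the mean decays asymptotically at rate \<open>lam\<close>.\<close>

lemma mean_decay:
  assumes e: "0 < e" and s: "0 \<le> s"
  shows "\<forall>\<^sub>F t in at_top. \<forall>f\<in>bpB. exp (lam * s) * mean (V t f) - mean (V s (V t f)) \<le> e * mean (V t f)"
proof -
  obtain d where d: "0 < d" "d \<le> 1"
    "\<And>g. g \<in> bpB \<Longrightarrow> (\<And>u x. 0 \<le> u \<Longrightarrow> V u g x \<le> 1) \<Longrightarrow> mean g / 2 \<le> mean (V d g)"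
    using mean_V_half by metis
  define c where "c = upper_const d"
  have c: "0 < c" using upper_const_pos[OF d(1)] by (simp add: c_def)
  define e' where "e' = e / (2 * (s + 1) * c)"
  have e': "0 < e'" using e s c by (simp add: e'_def)
  obtain z where z: "0 < z" "\<And>w. 0 \<le> w \<Longrightarrow> w \<le> z \<Longrightarrow> mean (\<lambda>x. \<psi>\<^sub>0 x (w * \<phi> x)) \<le> e' * w"
    using \<psi>\<^sub>0_small[OF \<phi> e'] by blast
  have "0 < z / c" using z c by simp
  from eventually_conj[OF V_le_one_eventually eventually_mean_small[OF this]]
  obtain t0 where t0: "\<And>t f u x. t0 \<le> t \<Longrightarrow> f \<in> bpB \<Longrightarrow> 0 \<le> u \<Longrightarrow> V u (V t f) x \<le> 1"
    "\<And>t f. t0 \<le> t \<Longrightarrow> f \<in> bpB \<Longrightarrow> mean (V t f) \<le> z / c"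
    unfolding eventually_at_top_linorder by blast
  show ?thesis unfolding eventually_at_top_linorder
  proof (intro exI allI ballI impI)
    fix t and f :: "'a \<Rightarrow> real" assume t: "max t0 0 + 1 \<le> t" and f: "f \<in> bpB"
    define k where "k = V (t - d) f"
    have td: "0 \<le> t - d" "t0 \<le> t - d" using t d by auto
    have k: "k \<in> bpB" unfolding k_def by (rule V_bpB[OF f td(1)])
    have Vt: "V t f = V d k" using flow[OF f, of d "t - d"] d td by (simp add: k_def)
    define w where "w = c * mean k"
    have w: "0 \<le> w" "w \<le> z"
      using c mean_nonneg[OF k] t0(2)[OF td(2) f] by (auto simp: w_def k_def le_divide_eq mult.commute)
    have half: "mean k \<le> 2 * mean (V t f)"
      using d(3)[OF k] t0(1)[OF td(2) f] by (simp add: Vt k_def)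
    have up: "V d k y \<le> w * \<phi> y" for y using V_upper[OF d(1) k, of y] by (simp add: w_def c_def)
    have Vd: "V d k \<in> bpB" using d by (intro V_bpB k) auto
    have "exp (lam * s) * mean (V t f) - mean (V s (V t f)) \<le> s * (e' * w)"
      unfolding Vt
    proof (rule mean_V_ge[OF Vd s])
      fix u assume u: "0 \<le> u" "u \<le> s"
      have "mean (\<lambda>y. \<psi>\<^sub>0 y (V u (V d k) y)) \<le> mean (\<lambda>y. \<psi>\<^sub>0 y (w * \<phi> y))"
        by (intro mean_mono \<psi>\<^sub>0_compose_bpB bpB_cmult \<phi> w V_bpB Vd u \<psi>\<^sub>0_mono V_nonneg V_le_eigenfunction up)
      also have "\<dots> \<le> e' * w" by (rule z(2)[OF w])
      finally show "mean (\<lambda>y. \<psi>\<^sub>0 y (V u (V d k) y)) \<le> e' * w" .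
    qed (use e' w in simp)
    also have "\<dots> \<le> (s + 1) * (e' * (c * (2 * mean (V t f))))"
      unfolding w_def using s e' c half mean_nonneg[OF k] by (intro mult_mono mult_left_mono) auto
    also have "\<dots> = (e' * (2 * (s + 1) * c)) * mean (V t f)" by (simp only: mult_ac)
    also have "e' * (2 * (s + 1) * c) = e" using s c by (simp add: e'_def)
    finally show "exp (lam * s) * mean (V t f) - mean (V s (V t f)) \<le> e * mean (V t f)" .
  qed
qed

text \<open>For large times the cumulants align with the eigenfunction, uniformly in the initial function.\<close>

lemma V_upper_asymp:
  assumes e: "0 < e"
  shows "\<forall>\<^sub>F t in at_top. \<forall>f\<in>bpB. \<forall>x. V t f x \<le> (1 + e) * mean (V t f) * \<phi> x"
proof -
  have "\<forall>\<^sub>F s in at_top. h s < e / 4" using h_limit e by (intro order_tendstoD) auto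
  with eventually_gt_at_top[of 0] have "\<forall>\<^sub>F s in at_top. 0 < s \<and> h s < e / 4" by (rule eventually_conj)
  then obtain s where s: "0 < s" "h s < e / 4" by (auto simp: eventually_at_top_linorder)
  define m where "m = e / (2 * (1 + e))"
  have m: "0 < m" "m < 1" "(1 - m) * (1 + e) \<ge> 1 + e / 4" using e by (auto simp: m_def field_simps)
  have "0 < m * exp (lam * s)" using m by simp
  from eventually_conj[OF mean_decay[OF this less_imp_le[OF s(1)]] eventually_ge_at_top[of 0]]
  obtain t0 where t0: "\<And>t f. t0 \<le> t \<Longrightarrow> f \<in> bpB \<Longrightarrow>
      exp (lam * s) * mean (V t f) - mean (V s (V t f)) \<le> m * exp (lam * s) * mean (V t f)" "\<And>t. t0 \<le> t \<Longrightarrow> 0 \<le> t"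
    unfolding eventually_at_top_linorder by blast
  show ?thesis unfolding eventually_at_top_linorder
  proof (intro exI allI ballI impI)
    fix t and f :: "'a \<Rightarrow> real" and x assume t: "t0 + s \<le> t" and f: "f \<in> bpB"
    define k where "k = V (t - s) f"
    have ts: "t0 \<le> t - s" "0 \<le> t - s" using t t0(2)[of "t - s"] by auto
    have k: "k \<in> bpB" unfolding k_def by (rule V_bpB[OF f ts(2)])
    have Vt: "V t f = V s k" using flow[OF f, of s "t - s"] s ts by (simp add: k_def)
    have "V t f x \<le> exp (lam * s) * (1 + h s) * mean k * \<phi> x"
      unfolding Vt using V_upper[OF s(1) k, of x] by (simp add: upper_const_def)
    also have "\<dots> \<le> exp (lam * s) * ((1 - m) * (1 + e)) * mean k * \<phi> x"
      using s m mean_nonneg[OF k] \<phi>_pos[of x] by (intro mult_right_mono mult_left_mono) auto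
    also have "\<dots> = (1 + e) * ((1 - m) * (exp (lam * s) * mean k)) * \<phi> x" by simp
    also have "\<dots> \<le> (1 + e) * mean (V t f) * \<phi> x"
      using t0(1)[OF ts(1) f] e \<phi>_pos[of x]
      by (intro mult_right_mono mult_left_mono) (auto simp: Vt k_def algebra_simps)
    finally show "V t f x \<le> (1 + e) * mean (V t f) * \<phi> x" .
  qed
qed

lemma V_lower_asymp:
  assumes e: "0 < e"
  shows "\<forall>\<^sub>F t in at_top. \<forall>f\<in>bpB. \<forall>x. (1 - e) * mean (V t f) * \<phi> x \<le> V t f x"
proof -
  have "\<forall>\<^sub>F s in at_top. h s < min 1 (e / 4)" using h_limit e by (intro order_tendstoD) auto
  with eventually_gt_at_top[of 0] have "\<forall>\<^sub>F s in at_top. 0 < s \<and> h s < min 1 (e / 4)" by (rule eventually_conj)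
  then obtain s where s: "0 < s" "h s < 1" "h s < e / 4" by (auto simp: eventually_at_top_linorder)
  \<comment> \<open>the regularising step is short, so that its own nonlinear loss is small\<close>
  define q where "q = 8 * (\<psi>_const + 1) * exp \<bar>lam\<bar>"
  have q: "0 < q" using \<psi>_const_nonneg by (simp add: q_def)
  define d where "d = min 1 (e / q)"
  have d: "0 < d" "d \<le> 1" "d \<le> e / q" using e q by (auto simp: d_def)
  define E where "E = exp (lam * (s + d))"
  define m where "m = e / 4 * E / upper_const d"
  have m: "0 < m" using e upper_const_pos[OF d(1)] by (simp add: m_def E_def)
  have dq: "\<psi>_const * d * upper_const s \<le> e / 4 * E"
  proof -
    have "upper_const s \<le> exp (lam * s) * 2" using s by (simp add: upper_const_def)
    moreover have "exp (lam * s) \<le> exp \<bar>lam\<bar> * E"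
    proof -
      have "lam * s \<le> \<bar>lam\<bar> + lam * (s + d)" using d lam_neg mult_left_mono[of d 1 "- lam"] by (simp add: algebra_simps)
      then show ?thesis by (simp add: E_def exp_add[symmetric])
    qed
    ultimately have u: "upper_const s \<le> 2 * exp \<bar>lam\<bar> * E" by linarith
    have "\<psi>_const * d * upper_const s \<le> (\<psi>_const + 1) * (e / q) * (2 * exp \<bar>lam\<bar> * E)"
      using d \<psi>_const_nonneg u upper_const_pos[OF s(1)] e q by (intro mult_mono) auto
    also have "\<dots> = e / 4 * E" using \<psi>_const_nonneg by (simp add: q_def field_simps add_nonneg_eq_0_iff)
    finally show ?thesis .
  qed
  from eventually_conj[OF eventually_conj[OF mean_decay[OF m less_imp_le[OF s(1)]] V_le_one_eventually] eventually_ge_at_top[of 0]]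
  obtain t0 where t0: "\<And>t f. t0 \<le> t \<Longrightarrow> f \<in> bpB \<Longrightarrow>
      exp (lam * s) * mean (V t f) - mean (V s (V t f)) \<le> m * mean (V t f)" "\<And>t. t0 \<le> t \<Longrightarrow> 0 \<le> t"
      "\<And>t f u x. t0 \<le> t \<Longrightarrow> f \<in> bpB \<Longrightarrow> 0 \<le> u \<Longrightarrow> V u (V t f) x \<le> 1"
    unfolding eventually_at_top_linorder by blast
  show ?thesis unfolding eventually_at_top_linorder
  proof (intro exI allI ballI impI)
    fix t and f :: "'a \<Rightarrow> real" and x assume t: "t0 + s + d \<le> t" and f: "f \<in> bpB"
    define k where "k = V (t - s - d) f"
    have ts: "t0 \<le> t - s - d" "0 \<le> t - s - d" using t t0(2)[of "t - s - d"] by auto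
    have k: "k \<in> bpB" unfolding k_def by (rule V_bpB[OF f ts(2)])
    have Vt: "V t f = V d (V s k)" and Vt': "V t f = V (s + d) k"
      using flow[OF f, of "s + d" "t - s - d"] flow[OF k, of d s] s d ts by (auto simp: k_def add.commute algebra_simps)
    have mk: "0 \<le> mean k" by (rule mean_nonneg[OF k])
    show "(1 - e) * mean (V t f) * \<phi> x \<le> V t f x"
    proof (cases "e \<le> 1")
      case True
      have "mean (V t f) \<le> E * mean k" unfolding Vt' E_def using s d by (intro mean_V_le k) auto
      then have "(1 - e) * mean (V t f) \<le> (1 - e) * (E * mean k)" using True by (intro mult_left_mono) auto
      also have "\<dots> = E * mean k - e / 4 * E * mean k - e / 4 * E * mean k - e / 4 * E * mean k - e / 4 * E * mean k"
        by (simp add: algebra_simps)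
      also have "\<dots> \<le> (1 - h s) * E * mean k - upper_const d * (exp (lam * s) * mean k - mean (V s k)) - \<psi>_const * d * upper_const s * mean k"
      proof -
        have E: "0 < E" by (simp add: E_def)
        have "h s * E * mean k \<le> e / 4 * E * mean k" using s E mk by (intro mult_right_mono) auto
        moreover have "upper_const d * (exp (lam * s) * mean k - mean (V s k)) \<le> upper_const d * (m * mean k)"
          using t0(1)[OF ts(1) f] upper_const_pos[OF d(1)] by (intro mult_left_mono) (auto simp: k_def)
        moreover have "upper_const d * (m * mean k) = e / 4 * E * mean k"
          using upper_const_pos[OF d(1)] by (simp add: m_def)
        moreover have "\<psi>_const * d * upper_const s * mean k \<le> e / 4 * E * mean k" by (rule mult_right_mono[OF dq mk])
        moreover have "0 \<le> e / 4 * E * mean k" using e E mk by simp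
        moreover have "(1 - h s) * E * mean k = E * mean k - h s * E * mean k" by (simp add: algebra_simps)
        ultimately show ?thesis by linarith
      qed
      finally have *: "(1 - e) * mean (V t f) \<le> \<dots>" .
      have "(1 - e) * mean (V t f) * \<phi> x \<le> ((1 - h s) * E * mean k - upper_const d * (exp (lam * s) * mean k - mean (V s k)) - \<psi>_const * d * upper_const s * mean k) * \<phi> x"
        using \<phi>_pos[of x] by (intro mult_right_mono[OF *]) auto
      also have "\<dots> \<le> V d (V s k) x" unfolding E_def
      proof (rule V_lower[OF k s(1) less_imp_le[OF s(2)] d(1)])
        fix u y assume u: "0 \<le> u" "u \<le> d"
        have "V u (V s k) = V (u + s) k" using flow[OF k, of u s] u s by simp
        then show "V u (V s k) y \<le> 1" using t0(3)[OF ts(1) f, of "u + s" y] u s by (simp add: k_def)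
      qed
      finally show ?thesis by (simp add: Vt)
    next
      case False
      have "0 \<le> t" using ts(2) s d by simp
      then have "0 \<le> mean (V t f)" "0 \<le> V t f x" using f by (auto intro: mean_nonneg V_bpB V_nonneg)
      then show ?thesis using False \<phi>_pos[of x] mult_nonpos_nonneg[of "1 - e" "mean (V t f) * \<phi> x"]
        by (simp add: mult.assoc)
    qed
  qed
qed

end

section \<open>Two limit lemmas\<close>

text \<open>A bounded nonnegative function converges if, late enough, it never drops by more than a small fraction:
  two cluster points would have to be arbitrarily close.\<close>

lemma almost_increasing_tendsto:
  fixes R :: "real \<Rightarrow> real"
  assumes R: "\<forall>\<^sub>F t in at_top. 0 \<le> R t \<and> R t \<le> 1"
    and inc: "\<And>e. 0 < e \<Longrightarrow> \<forall>\<^sub>F t in at_top. \<forall>s\<ge>0. (1 - e) * R t \<le> R (t + s)"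
  shows "\<exists>L. (R \<longlongrightarrow> L) at_top"
proof -
  have "eventually (\<lambda>x. x \<in> {0..1}) (filtermap R at_top)" using R by (simp add: eventually_filtermap)
  then obtain L where L: "inf (nhds L) (filtermap R at_top) \<noteq> bot"
    using compact_Icc[of "0::real" 1] unfolding compact_filter by (metis filtermap_bot_iff trivial_limit_at_top_linorder)
  have freq: "\<exists>t\<ge>T. \<bar>R t - L\<bar> < e" if e: "0 < e" for T e
  proof (rule ccontr)
    assume c: "\<not> (\<exists>t\<ge>T. \<bar>R t - L\<bar> < e)"
    have "eventually (\<lambda>x. \<bar>x - L\<bar> < e) (nhds L)" using e by (auto simp: eventually_nhds_metric dist_real_def)
    moreover have "eventually (\<lambda>x. \<not> \<bar>x - L\<bar> < e) (filtermap R at_top)"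
      unfolding eventually_filtermap eventually_at_top_linorder using c by blast
    ultimately have "eventually (\<lambda>_. False) (inf (nhds L) (filtermap R at_top))"
      unfolding eventually_inf by blast
    then show False using L by (simp add: trivial_limit_def)
  qed
  have "\<forall>\<^sub>F t in at_top. \<bar>R t - L\<bar> \<le> 2 * e" if e: "0 < e" for e
  proof -
    from eventually_conj[OF R inc[OF e]]
    obtain t0 where t0: "\<And>t. t0 \<le> t \<Longrightarrow> 0 \<le> R t \<and> R t \<le> 1" "\<And>t s. t0 \<le> t \<Longrightarrow> 0 \<le> s \<Longrightarrow> (1 - e) * R t \<le> R (t + s)"
      unfolding eventually_at_top_linorder by blast
    have step: "R t - e \<le> R u" if "t0 \<le> t" "t \<le> u" for t u
    proof -
      have "e * R t \<le> e * 1" using t0(1)[OF that(1)] e by (intro mult_left_mono) auto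
      then show ?thesis using t0(2)[OF that(1), of "u - t"] that(2) by (simp add: algebra_simps)
    qed
    obtain t1 where t1: "t0 \<le> t1" "\<bar>R t1 - L\<bar> < e" using freq[OF e] by blast
    have "\<bar>R u - L\<bar> \<le> 2 * e" if u: "t1 \<le> u" for u
    proof -
      obtain w where w: "u \<le> w" "\<bar>R w - L\<bar> < e" using freq[OF e] by blast
      show ?thesis using step[OF t1(1) u] step[of u w] t1 u w unfolding abs_le_iff abs_less_iff by linarith
    qed
    then show ?thesis unfolding eventually_at_top_linorder by blast
  qed
  then have "(R \<longlongrightarrow> L) at_top"
  proof (intro tendstoI)
    fix e :: real assume e: "0 < e"
    assume "\<And>e. 0 < e \<Longrightarrow> \<forall>\<^sub>F t in at_top. \<bar>R t - L\<bar> \<le> 2 * e"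
    from this[of "e / 3"] e show "\<forall>\<^sub>F t in at_top. dist (R t) L < e"
      by (auto simp: dist_real_def elim!: eventually_mono)
  qed
  then show ?thesis by blast
qed

lemma one_minus_exp_ratio_tendsto:
  fixes a m :: "real \<Rightarrow> real"
  assumes a: "\<forall>\<^sub>F t in F. 0 \<le> a t" and m: "\<forall>\<^sub>F t in F. 0 < m t" "(m \<longlongrightarrow> 0) F"
    and c: "((\<lambda>t. a t / m t) \<longlongrightarrow> c) F"
  shows "((\<lambda>t. (1 - exp (- a t)) / m t) \<longlongrightarrow> c) F"
proof -
  have "((\<lambda>t. exp_remainder (a t) / m t) \<longlongrightarrow> 0) F"
  proof (rule tendsto_sandwich[of "\<lambda>_. 0"])
    have "((\<lambda>t. (a t / m t)\<^sup>2 * m t) \<longlongrightarrow> c\<^sup>2 * 0) F" by (intro tendsto_intros c m)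
    then show "((\<lambda>t. (a t / m t)\<^sup>2 * m t) \<longlongrightarrow> 0) F" by simp
    show "\<forall>\<^sub>F t in F. 0 \<le> exp_remainder (a t) / m t" using m(1)
      by eventually_elim (simp add: exp_remainder_nonneg)
    show "\<forall>\<^sub>F t in F. exp_remainder (a t) / m t \<le> (a t / m t)\<^sup>2 * m t" using a m(1)
    proof eventually_elim
      case (elim t)
      have "exp_remainder (a t) / m t \<le> (a t)\<^sup>2 / m t" using elim by (intro divide_right_mono exp_remainder_le) auto
      also have "\<dots> = (a t / m t)\<^sup>2 * m t" using elim by (simp add: power2_eq_square)
      finally show ?case .
    qed
  qed simp
  from tendsto_diff[OF c this] show ?thesis
    by (simp add: exp_remainder_def diff_divide_distrib[symmetric] algebra_simps)
qed

section \<open>The maximal cumulant\<close>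

context extinguishing_cumulants
begin

text \<open>The limit of the cumulants of larger and larger constants, finite at positive times: the extinction
  probability from \<open>\<mu>\<close> up to time \<open>t\<close> is the exponential of \<open>- \<mu>(ext t)\<close>.\<close>

definition ext :: "real \<Rightarrow> 'a \<Rightarrow> real" where
  "ext t x = (SUP n. V t (\<lambda>_. real n) x)"

lemma const_bpB: "0 \<le> c \<Longrightarrow> (\<lambda>_. c) \<in> (bpB :: ('a \<Rightarrow> real) set)"
  by (intro bpBI[where B=c]) auto

lemma V_const_mono: "0 \<le> t \<Longrightarrow> m \<le> n \<Longrightarrow> V t (\<lambda>_. real m) x \<le> V t (\<lambda>_. real n) x"
  by (intro V_mono const_bpB) auto

lemma V_const_bdd: "0 < t \<Longrightarrow> bdd_above (range (\<lambda>n. V t (\<lambda>_. real n) x))"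
proof -
  assume "0 < t"
  then obtain C where "\<And>f x. f \<in> bpB \<Longrightarrow> V t f x \<le> C * \<phi> x" using V_uniform_bound by metis
  from this[OF const_bpB] show ?thesis by (intro bdd_aboveI[of _ "C * \<phi> x"]) auto
qed

lemma V_const_tendsto: "0 < t \<Longrightarrow> (\<lambda>n. V t (\<lambda>_. real n) x) \<longlonglongrightarrow> ext t x"
  unfolding ext_def by (intro LIMSEQ_incseq_SUP V_const_bdd) (auto intro!: incseq_SucI V_const_mono)

lemma V_const_le_ext: "0 < t \<Longrightarrow> V t (\<lambda>_. real n) x \<le> ext t x"
  unfolding ext_def by (intro cSUP_upper V_const_bdd) auto

lemma ext_bpB: "0 < t \<Longrightarrow> ext t \<in> bpB"
proof -
  assume t: "0 < t"
  then obtain C where C: "0 < C" "\<And>f x. f \<in> bpB \<Longrightarrow> V t f x \<le> C * \<phi> x" using V_uniform_bound by metis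
  obtain B where B: "\<And>x. \<phi> x \<le> B" using bpB_boundE[OF \<phi>] by metis
  show ?thesis
  proof (rule bpBI[where B="C * B"])
    have "V t (\<lambda>_. real n) \<in> borel_measurable borel" for n using t by (intro bpB_measurable V_bpB const_bpB) auto
    then show "ext t \<in> borel_measurable borel" by (rule borel_measurable_LIMSEQ_real[OF V_const_tendsto[OF t], rotated])
    fix x
    have "0 \<le> V t (\<lambda>_. real 0) x" using t by (intro V_nonneg const_bpB) auto
    then show "0 \<le> ext t x" using V_const_le_ext[OF t, of 0 x] by linarith
    have "V t (\<lambda>_. real n) x \<le> C * B" for n
    proof -
      have "V t (\<lambda>_. real n) x \<le> C * \<phi> x" by (intro C const_bpB) auto
      also have "\<dots> \<le> C * B" using C B by (intro mult_left_mono) auto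
      finally show ?thesis .
    qed
    then show "ext t x \<le> C * B" by (intro LIMSEQ_le_const2[OF V_const_tendsto[OF t]]) auto
  qed
qed

lemma V_le_ext: "0 < t \<Longrightarrow> f \<in> bpB \<Longrightarrow> V t f x \<le> ext t x"
proof -
  assume t: "0 < t" and f: "f \<in> bpB"
  obtain B where B: "\<And>x. f x \<le> B" using bpB_boundE[OF f] by metis
  obtain n where n: "B \<le> real n" using real_arch_simple by blast
  have "f y \<le> real n" for y using B[of y] n by linarith
  then have "V t f x \<le> V t (\<lambda>_. real n) x" using t f by (intro V_mono const_bpB) auto
  also have "\<dots> \<le> ext t x" by (rule V_const_le_ext[OF t])
  finally show ?thesis .
qed

lemma ext_flow: "0 < t \<Longrightarrow> 0 \<le> s \<Longrightarrow> V s (ext t) = ext (s + t)"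
proof
  fix x assume t: "0 < t" and s: "0 \<le> s"
  have "(\<lambda>n. V s (V t (\<lambda>_. real n)) x) \<longlonglongrightarrow> V s (ext t) x"
    using t s by (intro V_continuous V_bpB const_bpB ext_bpB V_const_le_ext V_const_tendsto) auto
  moreover have "V s (V t (\<lambda>_. real n)) = V (s + t) (\<lambda>_. real n)" for n
    using t s by (intro flow[symmetric] const_bpB) auto
  ultimately have "(\<lambda>n. V (s + t) (\<lambda>_. real n) x) \<longlonglongrightarrow> V s (ext t) x" by simp
  then show "V s (ext t) x = ext (s + t) x" using V_const_tendsto[of "s + t" x] t s by (intro LIMSEQ_unique) auto
qed

text \<open>Since \<open>ext t\<close> is the cumulant of \<open>ext 1\<close> at time \<open>t - 1\<close>, uniform asymptotics apply to it.\<close>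

lemma eventually_extI:
  assumes "\<forall>\<^sub>F t in at_top. \<forall>f\<in>bpB. Q (V t f)"
  shows "\<forall>\<^sub>F t in at_top. Q (ext t)"
proof -
  obtain t0 where t0: "\<And>t f. t0 \<le> t \<Longrightarrow> f \<in> bpB \<Longrightarrow> Q (V t f)" using assms unfolding eventually_at_top_linorder by blast
  have "Q (ext t)" if "max t0 0 + 1 \<le> t" for t
    using t0[of "t - 1" "ext 1"] ext_bpB[of 1] ext_flow[of 1 "t - 1"] that by simp
  then show ?thesis unfolding eventually_at_top_linorder by blast
qed

text \<open>A small multiple of \<open>\<phi>\<close> has cumulants below \<open>1\<close> at all times, so each of finitely many short steps at
  most halves the mean.\<close>

lemma mean_V_pos:
  assumes t: "0 \<le> t"
  shows "\<exists>f\<in>bpB. 0 < mean (V t f)"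
proof -
  obtain d where d: "0 < d" "d \<le> 1"
    "\<And>g. g \<in> bpB \<Longrightarrow> (\<And>u x. 0 \<le> u \<Longrightarrow> V u g x \<le> 1) \<Longrightarrow> mean g / 2 \<le> mean (V d g)"
    using mean_V_half by metis
  obtain B where B: "0 < B" "\<And>x. \<phi> x \<le> B" using bpB_boundE[OF \<phi>] by metis
  let ?f = "\<lambda>x. 1 / B * \<phi> x"
  have f: "?f \<in> bpB" using B by (intro bpB_cmult \<phi>) auto
  have le: "V u ?f x \<le> 1" if "0 \<le> u" for u x
  proof -
    have "V u ?f x \<le> 1 / B * \<phi> x" using B that by (intro V_le_eigenfunction f) auto
    also have "\<dots> \<le> 1 / B * B" using B by (intro mult_left_mono) auto
    finally show ?thesis using B by simp
  qed
  have pos: "0 < mean (V (real n * d) ?f)" for n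
  proof (induction n)
    case 0
    show ?case using V_0[OF f] \<nu>_\<phi> B by simp
  next
    case (Suc n)
    let ?g = "V (real n * d) ?f"
    have g: "?g \<in> bpB" using d by (intro V_bpB f) auto
    have "V u ?g x \<le> 1" if "0 \<le> u" for u x
      using le[of "u + real n * d" x] flow[OF f, of u "real n * d"] that d by simp
    then have "mean ?g / 2 \<le> mean (V d ?g)" by (intro d g)
    moreover have "V d ?g = V (real (Suc n) * d) ?f" using flow[OF f, of d "real n * d"] d by (simp add: algebra_simps)
    ultimately show ?case using Suc by simp
  qed
  obtain n where n: "t / d \<le> real n" using real_arch_simple by blast
  then have n: "t \<le> real n * d" using d by (simp add: divide_le_eq)
  have "V (real n * d) ?f = V (real n * d - t) (V t ?f)" using flow[OF f, of "real n * d - t" t] n t by simp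
  then have "mean (V (real n * d) ?f) \<le> mean (V t ?f)"
    using mean_V_le'[of "real n * d - t" "V t ?f"] V_bpB[OF f t] n by simp
  then show ?thesis using pos[of n] f by (intro bexI[of _ ?f]) auto
qed

lemma mean_ext_pos: "0 < t \<Longrightarrow> 0 < mean (ext t)"
proof -
  assume t: "0 < t"
  then obtain f where f: "f \<in> bpB" "0 < mean (V t f)" using mean_V_pos[of t] by auto
  have "mean (V t f) \<le> mean (ext t)" using t f by (intro mean_mono V_bpB ext_bpB V_le_ext) auto
  then show ?thesis using f(2) by simp
qed

lemma mean_ext_tendsto: "((\<lambda>t. mean (ext t)) \<longlongrightarrow> 0) at_top"
proof (rule tendstoI)
  fix e :: real assume e: "0 < e"
  have "\<forall>\<^sub>F t in at_top. mean (ext t) \<le> e / 2" using e by (intro eventually_extI eventually_mean_small) simp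
  with eventually_gt_at_top[of 0] show "\<forall>\<^sub>F t in at_top. dist (mean (ext t)) 0 < e"
    by eventually_elim (use e mean_ext_pos in \<open>force simp: dist_real_def\<close>)
qed

lemma mean_ext_ratio:
  assumes r: "0 \<le> r"
  shows "((\<lambda>t. mean (ext (t + r)) / mean (ext t)) \<longlongrightarrow> exp (lam * r)) at_top"
proof (rule tendstoI)
  fix e :: real assume e: "0 < e"
  have "\<forall>\<^sub>F t in at_top. exp (lam * r) * mean (ext t) - mean (V r (ext t)) \<le> e / 2 * mean (ext t)"
    using e r by (intro eventually_extI mean_decay) auto
  with eventually_gt_at_top[of 0]
  show "\<forall>\<^sub>F t in at_top. dist (mean (ext (t + r)) / mean (ext t)) (exp (lam * r)) < e"
  proof eventually_elim
    case (elim t)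
    have m: "0 < mean (ext t)" using elim(1) by (rule mean_ext_pos)
    have V: "V r (ext t) = ext (t + r)" using ext_flow[of t r] elim r by (simp add: add.commute)
    have "mean (ext (t + r)) \<le> exp (lam * r) * mean (ext t)"
      using mean_V_le[OF r ext_bpB[OF elim(1)]] by (simp add: V)
    then have "mean (ext (t + r)) / mean (ext t) \<le> exp (lam * r)" using m by (simp add: divide_le_eq)
    moreover have "exp (lam * r) - e / 2 \<le> mean (ext (t + r)) / mean (ext t)"
      using elim(2) m by (simp add: V le_divide_eq algebra_simps)
    ultimately show ?case using e by (simp add: dist_real_def abs_less_iff)
  qed
qed

section \<open>The limiting ratio of cumulants\<close>

definition ratio :: "real \<Rightarrow> ('a \<Rightarrow> real) \<Rightarrow> real" where
  "ratio t f = mean (V t f) / mean (ext t)"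

lemma ratio_bounds: "0 < t \<Longrightarrow> f \<in> bpB \<Longrightarrow> 0 \<le> ratio t f" "0 < t \<Longrightarrow> f \<in> bpB \<Longrightarrow> ratio t f \<le> 1"
proof -
  assume t: "0 < t" and f: "f \<in> bpB"
  have m: "0 < mean (ext t)" by (rule mean_ext_pos[OF t])
  have "mean (V t f) \<le> mean (ext t)" using t f by (intro mean_mono V_bpB ext_bpB V_le_ext) auto
  then show "ratio t f \<le> 1" using m by (simp add: ratio_def)
  have "0 \<le> mean (V t f)" using t f by (intro mean_nonneg V_bpB) auto
  then show "0 \<le> ratio t f" using m by (simp add: ratio_def)
qed

text \<open>Since both cumulants align with \<open>\<phi>\<close>, their ratio is nearly constant in space; concavity then
  makes the ratio almost nondecreasing in time.\<close>

lemma ratio_almost_increasing: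
  assumes f: "f \<in> bpB" and e: "0 < e"
  shows "\<forall>\<^sub>F t in at_top. \<forall>s\<ge>0. (1 - e) * ratio t f \<le> ratio (t + s) f"
proof -
  define d where "d = min 1 (e / 2)"
  have d: "0 < d" "d \<le> 1" "2 * d \<le> e" using e by (auto simp: d_def)
  have "\<forall>\<^sub>F t in at_top. \<forall>x. ext t x \<le> (1 + d) * mean (ext t) * \<phi> x"
    using d by (intro eventually_extI V_upper_asymp) auto
  moreover have "\<forall>\<^sub>F t in at_top. \<forall>x. (1 - d) * mean (V t f) * \<phi> x \<le> V t f x"
    using V_lower_asymp[OF d(1)] f by (auto elim!: eventually_mono)
  ultimately show ?thesis using eventually_gt_at_top[of 0]
  proof eventually_elim
    case (elim t)
    have m: "0 < mean (ext t)" by (rule mean_ext_pos[OF elim(3)])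
    have R: "0 \<le> ratio t f" "ratio t f \<le> 1" using ratio_bounds[OF elim(3) f] by auto
    define c where "c = (1 - d) / (1 + d) * ratio t f"
    have q: "0 \<le> (1 - d) / (1 + d)" "(1 - d) / (1 + d) \<le> 1" "1 - e \<le> (1 - d) / (1 + d)"
    proof -
      have "(1 - e) * (1 + d) \<le> (1 - 2 * d) * (1 + d)" using d by (intro mult_right_mono) auto
      also have "\<dots> \<le> 1 - d" using d by (simp add: algebra_simps)
      finally show "1 - e \<le> (1 - d) / (1 + d)" using d by (simp add: le_divide_eq)
    qed (use d in auto)
    have c: "0 \<le> c" "c \<le> 1" using q R mult_le_one[of "(1 - d) / (1 + d)" "ratio t f"] mult_nonneg_nonneg[OF q(1) R(1)] by (auto simp: c_def)
    have Vt: "V t f \<in> bpB" and E: "ext t \<in> bpB" using elim(3) f by (auto intro: V_bpB ext_bpB)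
    have le: "c * ext t x \<le> V t f x" for x
    proof -
      have "c * ext t x \<le> c * ((1 + d) * mean (ext t) * \<phi> x)" using elim c by (intro mult_left_mono) auto
      also have "\<dots> = (1 - d) * mean (V t f) * \<phi> x"
        using m d by (simp add: c_def ratio_def)
      also have "\<dots> \<le> V t f x" using elim by blast
      finally show ?thesis .
    qed
    show ?case
    proof (intro allI impI)
      fix s :: real assume s: "0 \<le> s"
      have ts: "0 < t + s" using elim(3) s by simp
      have "c * ext (t + s) x \<le> V (t + s) f x" for x
      proof -
        have "c * ext (t + s) x = c * V s (ext t) x" using ext_flow[OF elim(3) s] by (simp add: add.commute)
        also have "\<dots> \<le> V s (\<lambda>x. c * ext t x) x" by (rule V_concave[OF E s c])
        also have "\<dots> \<le> V s (V t f) x" by (rule V_mono[OF bpB_cmult[OF E c(1)] Vt s le])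
        also have "V s (V t f) = V (t + s) f" using flow[OF f s, of t] elim(3) by (simp add: add.commute)
        finally show ?thesis .
      qed
      then have "mean (\<lambda>x. c * ext (t + s) x) \<le> mean (V (t + s) f)"
        using ts f c by (intro mean_mono bpB_cmult ext_bpB V_bpB) auto
      then have "c \<le> ratio (t + s) f" using mean_ext_pos[OF ts] by (simp add: ratio_def le_divide_eq)
      moreover have "(1 - e) * ratio t f \<le> c" unfolding c_def using q R by (intro mult_right_mono) auto
      ultimately show "(1 - e) * ratio t f \<le> ratio (t + s) f" by linarith
    qed
  qed
qed

text \<open>The limit of the ratios, which exists for every \<open>f \<in> bpB\<close>.\<close>

definition G :: "('a \<Rightarrow> real) \<Rightarrow> real" where
  "G f = Lim at_top (\<lambda>t. ratio t f)"

lemma G_tendsto: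
  assumes f: "f \<in> bpB"
  shows "((\<lambda>t. ratio t f) \<longlongrightarrow> G f) at_top"
proof -
  have "\<forall>\<^sub>F t in at_top. 0 \<le> ratio t f \<and> ratio t f \<le> 1"
    using eventually_gt_at_top[of 0] by eventually_elim (use ratio_bounds f in auto)
  then obtain L where "((\<lambda>t. ratio t f) \<longlongrightarrow> L) at_top"
    using almost_increasing_tendsto[of "\<lambda>t. ratio t f"] ratio_almost_increasing[OF f] by blast
  then show ?thesis unfolding G_def using tendsto_Lim[OF trivial_limit_at_top_linorder] by metis
qed

lemma G_mono:
  assumes "f \<in> bpB" "g \<in> bpB" "\<And>x. f x \<le> g x"
  shows "G f \<le> G g"
proof (rule tendsto_le[OF _ G_tendsto[OF assms(2)] G_tendsto[OF assms(1)]])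
  show "\<forall>\<^sub>F t in at_top. ratio t f \<le> ratio t g" using eventually_gt_at_top[of 0]
  proof eventually_elim
    case (elim t)
    have "mean (V t f) \<le> mean (V t g)" using elim assms by (intro mean_mono V_bpB V_mono) auto
    then show ?case unfolding ratio_def using mean_ext_pos[OF elim] by (intro divide_right_mono) auto
  qed
qed simp

lemma G_ext:
  assumes r: "0 < r"
  shows "G (ext r) = exp (lam * r)"
proof -
  have "((\<lambda>t. ratio t (ext r)) \<longlongrightarrow> exp (lam * r)) at_top"
    by (rule Lim_transform_eventually[OF mean_ext_ratio[OF less_imp_le[OF r]]],
        rule eventually_mono[OF eventually_ge_at_top[of 0]]) (simp add: ratio_def ext_flow[OF r])
  then show ?thesis using G_tendsto[OF ext_bpB[OF r]] by (intro tendsto_unique) auto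
qed

text \<open>If \<open>f\<close> is small in mean, then after unit time its cumulant is below the maximal cumulant
  at a large time.\<close>

lemma G_small:
  assumes e: "0 < e"
  shows "\<exists>d>0. \<forall>f\<in>bpB. mean f < d \<longrightarrow> G f < e"
proof -
  have "filterlim (\<lambda>s. lam * (s - 1)) at_bot at_top" using lam_neg by real_asymp
  from filterlim_compose[OF exp_at_bot this] have "\<forall>\<^sub>F s in at_top. exp (lam * (s - 1)) < e"
    using e by (rule order_tendstoD)
  moreover have "\<forall>\<^sub>F s in at_top. \<forall>x. (1 - 1 / 2) * mean (ext s) * \<phi> x \<le> ext s x"
    by (rule eventually_extI[OF V_lower_asymp]) simp
  ultimately have "\<forall>\<^sub>F s in at_top. 1 < s \<and> exp (lam * (s - 1)) < e \<and> (\<forall>x. mean (ext s) / 2 * \<phi> x \<le> ext s x)"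
    using eventually_gt_at_top[of 1] by eventually_elim auto
  then obtain s where s: "1 < s" "exp (lam * (s - 1)) < e" "\<And>x. mean (ext s) / 2 * \<phi> x \<le> ext s x"
    unfolding eventually_at_top_linorder by blast
  define d where "d = mean (ext s) / 2 / upper_const 1"
  have d: "0 < d" using mean_ext_pos[of s] s upper_const_pos[of 1] by (simp add: d_def)
  have "G f < e" if f: "f \<in> bpB" and less: "mean f < d" for f
  proof -
    have le: "V 1 f x \<le> ext s x" for x
    proof -
      have "V 1 f x \<le> upper_const 1 * mean f * \<phi> x" by (rule V_upper[OF _ f]) simp
      also have "\<dots> \<le> upper_const 1 * d * \<phi> x"
        using less \<phi>_pos[of x] upper_const_pos[of 1] by (intro mult_right_mono mult_left_mono) auto
      also have "\<dots> = mean (ext s) / 2 * \<phi> x" using upper_const_pos[of 1] by (simp add: d_def)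
      also have "\<dots> \<le> ext s x" by (rule s)
      finally show ?thesis .
    qed
    have "G f \<le> exp (lam * (s - 1))"
    proof (rule tendsto_le[OF _ mean_ext_ratio G_tendsto[OF f]])
      show "\<forall>\<^sub>F t in at_top. ratio t f \<le> mean (ext (t + (s - 1))) / mean (ext t)" using eventually_ge_at_top[of 1]
      proof eventually_elim
        case (elim t)
        have V1: "V 1 f \<in> bpB" by (intro V_bpB f) simp
        have es: "ext s \<in> bpB" using s by (intro ext_bpB) simp
        have "V t f = V (t - 1) (V 1 f)" using flow[OF f, of "t - 1" 1] elim by simp
        moreover have "V (t - 1) (ext s) = ext (t + (s - 1))" using ext_flow[of s "t - 1"] elim s by (simp add: algebra_simps)
        moreover have "mean (V (t - 1) (V 1 f)) \<le> mean (V (t - 1) (ext s))"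
          using elim by (intro mean_mono V_bpB V_mono V1 es le) auto
        ultimately show ?case unfolding ratio_def using mean_ext_pos[of t] elim by (intro divide_right_mono) auto
      qed
    qed (use s in auto)
    then show ?thesis using s by simp
  qed
  then show ?thesis using d by blast
qed

lemma integral_\<phi>_pos: "\<mu> \<noteq> 0 \<Longrightarrow> 0 < (\<integral>x. \<phi> x \<partial>fm_measure \<mu>)"
proof -
  assume \<mu>: "\<mu> \<noteq> 0"
  interpret finite_measure "fm_measure \<mu>" by simp
  have nn: "0 \<le> (\<integral>x. \<phi> x \<partial>fm_measure \<mu>)" by (intro bochner_nonneg bpB_nonneg[OF \<phi>])
  have "(\<integral>x. \<phi> x \<partial>fm_measure \<mu>) \<noteq> 0"
  proof
    assume "(\<integral>x. \<phi> x \<partial>fm_measure \<mu>) = 0"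
    then have "AE x in fm_measure \<mu>. \<phi> x = 0"
      using integral_nonneg_eq_0_iff_AE[OF integrable_fm_bpB[OF \<phi>]] bpB_nonneg[OF \<phi>] by auto
    then have "AE x in fm_measure \<mu>. False" using \<phi>_pos by (auto elim!: eventually_mono simp: less_le)
    then have "emeasure (fm_measure \<mu>) UNIV = 0" by (simp add: AE_iff_measurable[where N=UNIV])
    then show False using \<mu> zero_fin_measure_iff[of \<mu>] by (simp add: measure_def)
  qed
  then show ?thesis using nn by simp
qed

text \<open>Functions that align with \<open>\<phi>\<close> have asymptotically proportional integrals against all measures, which
  is why the limit law does not depend on the initial measure.\<close>

lemma aligned_integral_tendsto:
  assumes bp: "\<forall>\<^sub>F t in at_top. F t \<in> bpB"
    and up: "\<And>e. 0 < e \<Longrightarrow> \<forall>\<^sub>F t in at_top. \<forall>x. F t x \<le> (1 + e) * mean (F t) * \<phi> x"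
    and low: "\<And>e. 0 < e \<Longrightarrow> \<forall>\<^sub>F t in at_top. \<forall>x. (1 - e) * mean (F t) * \<phi> x \<le> F t x"
    and lim: "((\<lambda>t. mean (F t) / mean (ext t)) \<longlongrightarrow> c) at_top"
  shows "((\<lambda>t. (\<integral>x. F t x \<partial>fm_measure \<mu>) / mean (ext t)) \<longlongrightarrow> c * (\<integral>x. \<phi> x \<partial>fm_measure \<mu>)) at_top"
proof -
  define p where "p = (\<integral>x. \<phi> x \<partial>fm_measure \<mu>)"
  have p: "0 \<le> p" unfolding p_def by (intro bochner_nonneg bpB_nonneg[OF \<phi>])
  let ?q = "\<lambda>t. mean (F t) / mean (ext t)"
  have int: "integrable (fm_measure \<mu>) (\<lambda>x. a * \<phi> x)" for a
    by (intro integrable_mult_right integrable_fm_bpB \<phi>)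
  have "((\<lambda>t. (\<integral>x. F t x \<partial>fm_measure \<mu>) / mean (ext t) - ?q t * p) \<longlongrightarrow> 0) at_top"
  proof (rule tendstoI)
    fix e :: real assume e: "0 < e"
    define d where "d = e / (2 * (\<bar>c\<bar> + 1) * (p + 1))"
    have d: "0 < d" using e p by (simp add: d_def add_nonneg_pos)
    have "\<forall>\<^sub>F t in at_top. ?q t < \<bar>c\<bar> + 1" using lim by (rule order_tendstoD) simp
    with bp up[OF d] low[OF d] eventually_gt_at_top[of 0]
    show "\<forall>\<^sub>F t in at_top. dist ((\<integral>x. F t x \<partial>fm_measure \<mu>) / mean (ext t) - ?q t * p) 0 < e"
    proof eventually_elim
      case (elim t)
      have m: "0 < mean (ext t)" using elim by (intro mean_ext_pos)
      have "(\<integral>x. F t x \<partial>fm_measure \<mu>) \<le> (\<integral>x. (1 + d) * mean (F t) * \<phi> x \<partial>fm_measure \<mu>)"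
        using elim by (intro integral_mono integrable_fm_bpB int) auto
      then have 1: "(\<integral>x. F t x \<partial>fm_measure \<mu>) \<le> (1 + d) * mean (F t) * p" by (simp add: p_def)
      have "(\<integral>x. (1 - d) * mean (F t) * \<phi> x \<partial>fm_measure \<mu>) \<le> (\<integral>x. F t x \<partial>fm_measure \<mu>)"
        using elim by (intro integral_mono integrable_fm_bpB int) auto
      then have 2: "(1 - d) * mean (F t) * p \<le> (\<integral>x. F t x \<partial>fm_measure \<mu>)" by (simp add: p_def)
      have "\<bar>(\<integral>x. F t x \<partial>fm_measure \<mu>) - mean (F t) * p\<bar> \<le> d * (mean (F t) * p)"
        using 1 2 by (simp add: abs_le_iff algebra_simps)
      then have "\<bar>(\<integral>x. F t x \<partial>fm_measure \<mu>) - mean (F t) * p\<bar> / mean (ext t) \<le> d * (mean (F t) * p) / mean (ext t)"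
        using m by (intro divide_right_mono) auto
      moreover have "(\<integral>x. F t x \<partial>fm_measure \<mu>) / mean (ext t) - ?q t * p = ((\<integral>x. F t x \<partial>fm_measure \<mu>) - mean (F t) * p) / mean (ext t)"
        by (simp add: diff_divide_distrib)
      ultimately have "\<bar>(\<integral>x. F t x \<partial>fm_measure \<mu>) / mean (ext t) - ?q t * p\<bar> \<le> d * (?q t * p)"
        using m by (simp add: abs_divide)
      also have "\<dots> \<le> d * ((\<bar>c\<bar> + 1) * (p + 1))"
        using d p elim by (intro mult_left_mono mult_mono) auto
      also have "\<dots> = d * (2 * (\<bar>c\<bar> + 1) * (p + 1)) / 2" by (simp add: algebra_simps)
      also have "d * (2 * (\<bar>c\<bar> + 1) * (p + 1)) = e"
      proof -
        have "2 * (\<bar>c\<bar> + 1) * (p + 1) \<noteq> 0" using p by (simp add: add_nonneg_eq_0_iff)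
        then show ?thesis by (simp add: d_def)
      qed
      finally show ?case using e by (simp add: dist_real_def)
    qed
  qed
  from tendsto_add[OF this tendsto_mult_right[OF lim, of p]] show ?thesis by (simp add: p_def)
qed

lemma V_integral_tendsto:
  assumes f: "f \<in> bpB"
  shows "((\<lambda>t. (\<integral>x. V t f x \<partial>fm_measure \<mu>) / mean (ext t)) \<longlongrightarrow> G f * (\<integral>x. \<phi> x \<partial>fm_measure \<mu>)) at_top"
proof (rule aligned_integral_tendsto)
  show "\<forall>\<^sub>F t in at_top. V t f \<in> bpB" using eventually_ge_at_top[of 0] by eventually_elim (rule V_bpB[OF f])
  show "((\<lambda>t. mean (V t f) / mean (ext t)) \<longlongrightarrow> G f) at_top" using G_tendsto[OF f] by (simp add: ratio_def)
  fix e :: real assume e: "0 < e"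
  show "\<forall>\<^sub>F t in at_top. \<forall>x. V t f x \<le> (1 + e) * mean (V t f) * \<phi> x"
    using V_upper_asymp[OF e] by eventually_elim (use f in blast)
  show "\<forall>\<^sub>F t in at_top. \<forall>x. (1 - e) * mean (V t f) * \<phi> x \<le> V t f x"
    using V_lower_asymp[OF e] by eventually_elim (use f in blast)
qed

lemma ext_integral_tendsto:
  assumes r: "0 \<le> r"
  shows "((\<lambda>t. (\<integral>x. ext (t + r) x \<partial>fm_measure \<mu>) / mean (ext t)) \<longlongrightarrow> exp (lam * r) * (\<integral>x. \<phi> x \<partial>fm_measure \<mu>)) at_top"
proof (rule aligned_integral_tendsto)
  have shift: "filterlim (\<lambda>t. t + r) at_top at_top" by real_asymp
  show "\<forall>\<^sub>F t in at_top. ext (t + r) \<in> bpB"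
    using eventually_gt_at_top[of 0] by eventually_elim (rule ext_bpB, use r in simp)
  show "((\<lambda>t. mean (ext (t + r)) / mean (ext t)) \<longlongrightarrow> exp (lam * r)) at_top" by (rule mean_ext_ratio[OF r])
  fix e :: real assume e: "0 < e"
  have "\<forall>\<^sub>F t in at_top. \<forall>x. ext t x \<le> (1 + e) * mean (ext t) * \<phi> x" by (rule eventually_extI[OF V_upper_asymp[OF e]])
  from eventually_compose_filterlim[OF this shift]
  show "\<forall>\<^sub>F t in at_top. \<forall>x. ext (t + r) x \<le> (1 + e) * mean (ext (t + r)) * \<phi> x" .
  have "\<forall>\<^sub>F t in at_top. \<forall>x. (1 - e) * mean (ext t) * \<phi> x \<le> ext t x" by (rule eventually_extI[OF V_lower_asymp[OF e]])
  from eventually_compose_filterlim[OF this shift]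
  show "\<forall>\<^sub>F t in at_top. \<forall>x. (1 - e) * mean (ext (t + r)) * \<phi> x \<le> ext (t + r) x" .
qed

section \<open>Limit of the conditional Laplace functionals\<close>

text \<open>The exponent of \<open>f\<close> at time \<open>t\<close> on the event of extinction by time \<open>t + r\<close>.  The case \<open>r = 0\<close> is
  separate because extinction in no time corresponds to an infinite test function.\<close>

definition killed_cumulant :: "real \<Rightarrow> real \<Rightarrow> ('a \<Rightarrow> real) \<Rightarrow> 'a \<Rightarrow> real" where
  "killed_cumulant r t f = (if r = 0 then ext t else V t (\<lambda>x. f x + ext r x))"

text \<open>The Laplace functional of the limit law.\<close>

definition limit_laplace :: "real \<Rightarrow> ('a \<Rightarrow> real) \<Rightarrow> real" where
  "limit_laplace r f = exp (- (lam * r)) * ((if r = 0 then 1 else G (\<lambda>x. f x + ext r x)) - G f)"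

lemma add_ext_bpB: "f \<in> bpB \<Longrightarrow> 0 < r \<Longrightarrow> (\<lambda>x. f x + ext r x) \<in> bpB"
proof -
  assume f: "f \<in> bpB" and r: "0 < r"
  note E = ext_bpB[OF r]
  obtain B1 where "\<And>x. f x \<le> B1" using bpB_boundE[OF f] by metis
  moreover obtain B2 where "\<And>x. ext r x \<le> B2" using bpB_boundE[OF E] by metis
  ultimately show ?thesis using bpB_measurable[OF f] bpB_measurable[OF E] bpB_nonneg[OF f] bpB_nonneg[OF E]
    by (intro bpBI[where B="B1 + B2"]) (auto intro: add_mono)
qed

lemma killed_cumulant_nonneg: "f \<in> bpB \<Longrightarrow> 0 \<le> r \<Longrightarrow> 0 < t \<Longrightarrow> 0 \<le> killed_cumulant r t f x"
  using bpB_nonneg[OF ext_bpB[of t]] V_nonneg[OF add_ext_bpB[of f r], of t] by (auto simp: killed_cumulant_def)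

lemma conditional_limit:
  assumes \<mu>: "\<mu> \<noteq> 0" and f: "f \<in> bpB" and r: "0 \<le> r"
  shows "((\<lambda>t. (laplace (V t f) \<mu> - laplace (killed_cumulant r t f) \<mu>)
        / (1 - laplace (ext (t + r)) \<mu>)) \<longlongrightarrow> limit_laplace r f) at_top"
proof -
  let ?m = "\<lambda>t. mean (ext t)"
  define p where "p = (\<integral>x. \<phi> x \<partial>fm_measure \<mu>)"
  have p: "0 < p" unfolding p_def by (rule integral_\<phi>_pos[OF \<mu>])
  have pos: "\<forall>\<^sub>F t in at_top. 0 < ?m t" using eventually_gt_at_top[of 0] by eventually_elim (rule mean_ext_pos)
  note E = one_minus_exp_ratio_tendsto[OF _ pos mean_ext_tendsto]
  have 1: "((\<lambda>t. (1 - laplace (V t f) \<mu>) / ?m t) \<longlongrightarrow> G f * p) at_top"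
    unfolding p_def laplace_def
    by (intro E V_integral_tendsto f eventually_mono[OF eventually_ge_at_top[of 0]] bochner_nonneg V_nonneg)
  define g where "g = (if r = 0 then 1 else G (\<lambda>x. f x + ext r x))"
  have "((\<lambda>t. (\<integral>x. killed_cumulant r t f x \<partial>fm_measure \<mu>) / ?m t) \<longlongrightarrow> g * p) at_top"
  proof (cases "r = 0")
    case True
    then show ?thesis using ext_integral_tendsto[of 0 \<mu>] by (simp add: killed_cumulant_def g_def p_def)
  next
    case False
    then show ?thesis using V_integral_tendsto[OF add_ext_bpB[OF f], of r \<mu>] r by (simp add: killed_cumulant_def g_def p_def)
  qed
  then have 2: "((\<lambda>t. (1 - laplace (killed_cumulant r t f) \<mu>) / ?m t) \<longlongrightarrow> g * p) at_top"
    unfolding laplace_def by (intro E eventually_mono[OF eventually_gt_at_top[of 0]] bochner_nonneg killed_cumulant_nonneg f r)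
  have 3: "((\<lambda>t. (1 - laplace (ext (t + r)) \<mu>) / ?m t) \<longlongrightarrow> exp (lam * r) * p) at_top"
    unfolding p_def laplace_def
  proof (intro E ext_integral_tendsto r)
    show "\<forall>\<^sub>F t in at_top. 0 \<le> (\<integral>x. ext (t + r) x \<partial>fm_measure \<mu>)"
      using eventually_gt_at_top[of 0]
    proof eventually_elim
      case (elim t)
      then have "ext (t + r) \<in> bpB" using r by (intro ext_bpB) simp
      then show ?case by (intro bochner_nonneg bpB_nonneg)
    qed
  qed
  have 4: "((\<lambda>t. ((1 - laplace (killed_cumulant r t f) \<mu>) / ?m t - (1 - laplace (V t f) \<mu>) / ?m t)
      / ((1 - laplace (ext (t + r)) \<mu>) / ?m t)) \<longlongrightarrow> (g * p - G f * p) / (exp (lam * r) * p)) at_top"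
    using p by (intro tendsto_intros 1 2 3) simp
  have 5: "(g * p - G f * p) / (exp (lam * r) * p) = limit_laplace r f"
    using p by (simp add: limit_laplace_def g_def exp_minus divide_inverse left_diff_distrib[symmetric])
  show ?thesis
  proof (rule Lim_transform_eventually[OF 4[unfolded 5]])
    show "\<forall>\<^sub>F t in at_top. ((1 - laplace (killed_cumulant r t f) \<mu>) / ?m t - (1 - laplace (V t f) \<mu>) / ?m t)
      / ((1 - laplace (ext (t + r)) \<mu>) / ?m t)
      = (laplace (V t f) \<mu> - laplace (killed_cumulant r t f) \<mu>)
        / (1 - laplace (ext (t + r)) \<mu>)"
      using pos by eventually_elim (simp add: diff_divide_distrib[symmetric])
  qed
qed

lemma ext_integral_pos:
  assumes \<mu>: "\<mu> \<noteq> 0"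
  shows "\<forall>\<^sub>F t in at_top. 0 < (\<integral>x. ext t x \<partial>fm_measure \<mu>)"
proof -
  have "((\<lambda>t. (\<integral>x. ext t x \<partial>fm_measure \<mu>) / mean (ext t)) \<longlongrightarrow> (\<integral>x. \<phi> x \<partial>fm_measure \<mu>)) at_top"
    using ext_integral_tendsto[of 0 \<mu>] by simp
  from order_tendstoD(1)[OF this integral_\<phi>_pos[OF \<mu>]] eventually_gt_at_top[of 0] show ?thesis
    by eventually_elim (use mean_ext_pos in \<open>auto simp: zero_less_divide_iff dest: less_asym\<close>)
qed

lemma limit_laplace_small:
  assumes r: "0 \<le> r" and e: "0 < e"
  shows "\<exists>d>0. \<forall>f\<in>bpB. mean f < d \<longrightarrow> 1 - limit_laplace r f < e"
proof -
  obtain d where d: "0 < d" "\<And>f. f \<in> bpB \<Longrightarrow> mean f < d \<Longrightarrow> G f < exp (lam * r) * e"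
    using G_small[of "exp (lam * r) * e"] e by auto
  have "1 - limit_laplace r f < e" if f: "f \<in> bpB" and less: "mean f < d" for f
  proof -
    have "exp (lam * r) \<le> (if r = 0 then 1 else G (\<lambda>x. f x + ext r x))"
    proof (cases "r = 0")
      case False
      then have r': "0 < r" using r by simp
      have "G (ext r) \<le> G (\<lambda>x. f x + ext r x)"
        using bpB_nonneg[OF f] by (intro G_mono ext_bpB add_ext_bpB f r') auto
      then show ?thesis using False by (simp add: G_ext[OF r'])
    qed simp
    then have "exp (- (lam * r)) * (exp (lam * r) - exp (lam * r) * e) < limit_laplace r f"
      unfolding limit_laplace_def using d(2)[OF f less] by (intro mult_strict_left_mono) auto
    moreover have "exp (- (lam * r)) * (exp (lam * r) - exp (lam * r) * e) = (exp (- (lam * r)) * exp (lam * r)) * (1 - e)"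
      by (simp only: algebra_simps)
    moreover have "exp (- (lam * r)) * exp (lam * r) = 1" by (simp flip: exp_add)
    ultimately show ?thesis by simp
  qed
  then show ?thesis using d(1) by blast
qed

end

section \<open>The superprocess\<close>

lemma laplace_pos: "0 < laplace f \<eta>"
  by (simp add: laplace_def)

lemma laplace_nonneg [simp]: "0 \<le> laplace f \<eta>"
  by (simp add: laplace_def)

lemma laplace_le_one: "f \<in> bpB \<Longrightarrow> laplace f \<eta> \<le> 1"
  by (simp add: laplace_def bochner_nonneg bpB_nonneg)

lemma laplace_measurable: "f \<in> bpB \<Longrightarrow> laplace f \<in> borel_measurable (borel :: 'a::metric_space fin_measure measure)"
  unfolding laplace_def[abs_def] using fm_integral_measurable[of f] by measurable

lemma laplace_zero [simp]: "laplace f 0 = 1"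
  by (simp add: laplace_def integral_null_measure)

lemma laplace_add: "f \<in> bpB \<Longrightarrow> g \<in> bpB \<Longrightarrow> laplace (\<lambda>x. f x + g x) \<eta> = laplace f \<eta> * laplace g \<eta>"
  by (simp add: laplace_def integrable_fm_bpB exp_add[symmetric])

text \<open>The point mass at \<open>x\<close>; the cumulants at \<open>x\<close> are recovered by starting the superprocess from it.\<close>

definition dirac :: "'a::topological_space \<Rightarrow> 'a fin_measure" where
  "dirac x = Fin_Measure (return borel x)"

lemma laplace_dirac: "f \<in> bpB \<Longrightarrow> laplace f (dirac x) = exp (- f x)"
proof -
  assume f: "f \<in> bpB"
  interpret prob_space "return borel x" by (rule prob_space_return) simp
  have "fm_measure (dirac x) = return borel x" unfolding dirac_def
    by (rule fm_measure_Fin_Measure) (simp_all add: finite_measure_axioms)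
  then show ?thesis using bpB_measurable[OF f] by (simp add: laplace_def integral_return)
qed

locale polish_superprocess = superprocess Q Pr V
  for Q :: "real \<Rightarrow> 'a::polish_space fin_measure \<Rightarrow> 'a fin_measure measure"
    and Pr :: "'a fin_measure \<Rightarrow> (real \<Rightarrow> 'a fin_measure) measure"
    and V :: "real \<Rightarrow> ('a \<Rightarrow> real) \<Rightarrow> 'a \<Rightarrow> real" +
  assumes V_bpB: "f \<in> bpB \<Longrightarrow> 0 \<le> t \<Longrightarrow> V t f \<in> bpB"
begin

lemma alive_iff: "alive t w \<longleftrightarrow> 0 \<le> t"
  by (simp add: alive_def)

lemma state_eq: "0 \<le> t \<Longrightarrow> state t w = w t"
  by (simp add: state_def alive_iff)

lemma coordinate_measurable: "0 \<le> t \<Longrightarrow> (\<lambda>w. w t) \<in> Pr \<mu> \<rightarrow>\<^sub>M borel"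
proof -
  assume "0 \<le> t"
  then have "state t = (\<lambda>w. w t)" by (auto simp: state_eq)
  then show ?thesis using path_measurable_law[OF state_path[of t], of \<mu>] by simp
qed

lemma nn_integral_coordinate:
  assumes t: "0 \<le> t" and f: "f \<in> borel_measurable borel"
  shows "(\<integral>\<^sup>+w. f (w t) \<partial>Pr \<mu>) = (\<integral>\<^sup>+\<eta>. f \<eta> \<partial>Q t \<mu>)"
  using law_state_nn_integral[OF t f, of \<mu>] t by (simp add: alive_iff state_eq)

lemma nn_integral_two_coordinates:
  assumes t: "0 \<le> t" "0 \<le> s" and f: "f \<in> borel_measurable borel" "g \<in> borel_measurable borel"
  shows "(\<integral>\<^sup>+w. f (w t) * g (w (t + s)) \<partial>Pr \<mu>) = (\<integral>\<^sup>+\<eta>. f \<eta> * (\<integral>\<^sup>+\<zeta>. g \<zeta> \<partial>Q s \<eta>) \<partial>Q t \<mu>)"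
proof -
  have "(\<lambda>w. f (state t w)) \<in> borel_measurable (natural_filtration path_space (\<lambda>t w. w t) (\<lambda>_. \<infinity>) t)"
    by (rule measurable_compose[OF state_natural[OF order_refl] f(1)])
  from markov_nn_integral[OF t(2,1) this f(2), of \<mu>]
  have "(\<integral>\<^sup>+w. f (w t) * g (w (t + s)) \<partial>Pr \<mu>) = (\<integral>\<^sup>+w. f (w t) * (\<integral>\<^sup>+\<zeta>. g \<zeta> \<partial>Q s (w t)) \<partial>Pr \<mu>)"
    using t by (simp add: alive_iff state_eq)
  also have "\<dots> = (\<integral>\<^sup>+\<eta>. f \<eta> * (\<integral>\<^sup>+\<zeta>. g \<zeta> \<partial>Q s \<eta>) \<partial>Q t \<mu>)"
    using f P_integral_measurable[OF t(2) f(2)] by (intro nn_integral_coordinate[OF t(1)]) auto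
  finally show ?thesis .
qed

lemma prob_Q:
  assumes t: "0 \<le> t"
  shows "prob_space (Q t \<mu>)"
proof -
  interpret prob_space "Pr \<mu>" by (rule prob_law)
  have "emeasure (Q t \<mu>) (space (Q t \<mu>)) = 1"
    using nn_integral_coordinate[OF t, of "\<lambda>_. 1" \<mu>] emeasure_space_1 by simp
  then show ?thesis by (rule prob_spaceI)
qed

lemma laplace_Q_measurable: "0 \<le> t \<Longrightarrow> f \<in> bpB \<Longrightarrow> laplace f \<in> borel_measurable (Q t \<mu>)"
  using laplace_measurable[of f] sets_P[of t \<mu>] by (simp cong: measurable_cong_sets)

lemma laplace_integrable: "0 \<le> t \<Longrightarrow> f \<in> bpB \<Longrightarrow> integrable (Q t \<mu>) (laplace f)"
proof -
  assume t: "0 \<le> t" and f: "f \<in> bpB"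
  interpret prob_space "Q t \<mu>" by (rule prob_Q[OF t])
  show ?thesis using laplace_le_one[OF f]
    by (intro integrable_const_bound[of _ 1] laplace_Q_measurable t f) auto
qed

lemma laplace_transition: "0 \<le> t \<Longrightarrow> f \<in> bpB \<Longrightarrow> (\<integral>\<eta>. laplace f \<eta> \<partial>Q t \<mu>) = laplace (V t f) \<mu>"
  using Laplace_functional[of t f \<mu>] by (simp add: laplace_def)

lemma nn_laplace_transition: "0 \<le> t \<Longrightarrow> f \<in> bpB \<Longrightarrow> (\<integral>\<^sup>+\<eta>. ennreal (laplace f \<eta>) \<partial>Q t \<mu>) = ennreal (laplace (V t f) \<mu>)"
  by (subst nn_integral_eq_integral[OF laplace_integrable]) (auto simp: laplace_transition)

lemma laplace_transition_dirac: "0 \<le> t \<Longrightarrow> f \<in> bpB \<Longrightarrow> (\<integral>\<eta>. laplace f \<eta> \<partial>Q t (dirac x)) = exp (- V t f x)"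
  by (simp add: laplace_transition laplace_dirac V_bpB)

lemma V_flow:
  assumes f: "f \<in> bpB" and s: "0 \<le> s" and t: "0 \<le> t"
  shows "V (s + t) f = V s (V t f)"
proof
  fix x
  have "ennreal (laplace (V (s + t) f) (dirac x)) = (\<integral>\<^sup>+\<eta>. ennreal (laplace f \<eta>) \<partial>Q (s + t) (dirac x))"
    using s t f by (simp add: nn_laplace_transition)
  also have "Q (s + t) (dirac x) = Q s (dirac x) \<bind> Q t"
    using semigroup s t by (simp add: transition_semigroup_def)
  also have "(\<integral>\<^sup>+\<eta>. ennreal (laplace f \<eta>) \<partial>(Q s (dirac x) \<bind> Q t)) = (\<integral>\<^sup>+\<eta>. \<integral>\<^sup>+\<zeta>. ennreal (laplace f \<zeta>) \<partial>Q t \<eta> \<partial>Q s (dirac x))"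
    using laplace_measurable[OF f] P_measurable[OF t] sets_P[OF s]
    by (intro nn_integral_bind) (auto cong: measurable_cong_sets)
  also have "\<dots> = ennreal (laplace (V s (V t f)) (dirac x))"
    using s t f by (simp add: nn_laplace_transition V_bpB)
  finally show "V (s + t) f x = V s (V t f) x" using s t f by (simp add: laplace_dirac V_bpB)
qed

lemma V_mono:
  assumes f: "f \<in> bpB" "g \<in> bpB" and t: "0 \<le> t" and le: "\<And>x. f x \<le> g x"
  shows "V t f x \<le> V t g x"
proof -
  have "(\<integral>\<eta>. laplace g \<eta> \<partial>Q t (dirac x)) \<le> (\<integral>\<eta>. laplace f \<eta> \<partial>Q t (dirac x))"
    using f le by (intro integral_mono laplace_integrable t) (auto simp: laplace_def intro!: integral_mono integrable_fm_bpB)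
  then show ?thesis using t f by (simp add: laplace_transition_dirac)
qed

text \<open>Concavity under scaling is Jensen's inequality for the power with exponent \<open>c\<close>.\<close>

lemma V_concave:
  assumes f: "f \<in> bpB" "(\<lambda>x. c * f x) \<in> bpB" and t: "0 \<le> t" and c: "0 \<le> c" "c \<le> 1"
  shows "c * V t f x \<le> V t (\<lambda>x. c * f x) x"
proof -
  let ?v = "V t f x" and ?Q = "Q t (dirac x)"
  interpret prob_space ?Q by (rule prob_Q[OF t])
  have "laplace (\<lambda>x. c * f x) \<eta> \<le> exp (- (c * ?v)) * ((1 - c) + c * (exp ?v * laplace f \<eta>))" for \<eta>
  proof -
    let ?u = "\<integral>x. f x \<partial>fm_measure \<eta>"
    have "exp (- (c * (?u - ?v))) \<le> (1 - c) + c * exp (- (?u - ?v))"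
      using exp_remainder_scale[OF c, of "?u - ?v"] by (simp add: exp_remainder_def algebra_simps)
    then have "exp (- (c * ?v)) * exp (- (c * (?u - ?v))) \<le> exp (- (c * ?v)) * ((1 - c) + c * exp (- (?u - ?v)))"
      by (rule mult_left_mono) simp
    then show ?thesis by (simp add: laplace_def exp_add[symmetric] algebra_simps)
  qed
  then have "(\<integral>\<eta>. laplace (\<lambda>x. c * f x) \<eta> \<partial>?Q) \<le> (\<integral>\<eta>. exp (- (c * ?v)) * ((1 - c) + c * (exp ?v * laplace f \<eta>)) \<partial>?Q)"
    using laplace_integrable[OF t f(1)] by (intro integral_mono laplace_integrable t f(2)) auto
  also have "\<dots> = exp (- (c * ?v)) * ((1 - c) + c * (exp ?v * exp (- ?v)))"
    using laplace_integrable[OF t f(1), of "dirac x"] prob_space by (simp add: laplace_transition_dirac[OF t f(1)])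
  also have "\<dots> = exp (- (c * ?v))" by (simp flip: exp_add)
  finally show ?thesis using t f by (simp add: laplace_transition_dirac)
qed

lemma V_continuous:
  assumes k: "\<And>n. k n \<in> bpB" "f \<in> bpB" "\<And>n x. k n x \<le> f x" "\<And>x. (\<lambda>n. k n x) \<longlonglongrightarrow> f x" and t: "0 \<le> t"
  shows "(\<lambda>n. V t (k n) x) \<longlonglongrightarrow> V t f x"
proof -
  interpret prob_space "Q t (dirac x)" by (rule prob_Q[OF t])
  have "(\<lambda>n. \<integral>x. k n x \<partial>fm_measure \<eta>) \<longlonglongrightarrow> (\<integral>x. f x \<partial>fm_measure \<eta>)" for \<eta> :: "'a fin_measure"
    using k by (intro integral_dominated_convergence[where w=f]) (auto intro: bpB_measurable integrable_fm_bpB simp: bpB_nonneg)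
  then have lim: "(\<lambda>n. laplace (k n) \<eta>) \<longlonglongrightarrow> laplace f \<eta>" for \<eta>
    unfolding laplace_def by (intro tendsto_intros)
  have "(\<lambda>n. \<integral>\<eta>. laplace (k n) \<eta> \<partial>Q t (dirac x)) \<longlonglongrightarrow> (\<integral>\<eta>. laplace f \<eta> \<partial>Q t (dirac x))"
    using k by (intro integral_dominated_convergence[where w="\<lambda>_. 1"]) (auto intro: laplace_Q_measurable t lim laplace_le_one)
  then have "(\<lambda>n. exp (- V t (k n) x)) \<longlonglongrightarrow> exp (- V t f x)" using k t by (simp add: laplace_transition_dirac)
  then have "(\<lambda>n. ln (exp (- V t (k n) x))) \<longlonglongrightarrow> ln (exp (- V t f x))" by (rule tendsto_ln) simp
  then show ?thesis by (simp add: tendsto_minus_cancel_left)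
qed

lemma indicator_zero_Q: "0 \<le> t \<Longrightarrow> (indicator {0} :: 'a fin_measure \<Rightarrow> real) \<in> borel_measurable (Q t \<mu>)"
  by (simp cong: measurable_cong_sets)

lemma measure_coordinate_zero:
  assumes t: "0 \<le> t"
  shows "measure (Pr \<mu>) {w \<in> space path_space. w t = 0} = measure (Q t \<mu>) {0}"
proof -
  have eq: "{w \<in> space path_space. w t = 0} = (\<lambda>w. w t) -` {0} \<inter> space (Pr \<mu>)" by auto
  then have A: "{w \<in> space path_space. w t = 0} \<in> sets (Pr \<mu>)"
    using measurable_sets[OF coordinate_measurable[OF t], of "{0}" \<mu>] by simp
  have "emeasure (Pr \<mu>) {w \<in> space path_space. w t = 0} = (\<integral>\<^sup>+w. indicator {w \<in> space path_space. w t = 0} w \<partial>Pr \<mu>)"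
    using A by simp
  also have "\<dots> = (\<integral>\<^sup>+w. indicator {0} (w t) \<partial>Pr \<mu>)" by (intro nn_integral_cong) (auto simp: indicator_def)
  also have "\<dots> = (\<integral>\<^sup>+\<eta>. indicator {0} \<eta> \<partial>Q t \<mu>)" by (rule nn_integral_coordinate[OF t]) simp
  also have "\<dots> = emeasure (Q t \<mu>) {0}" using t by simp
  finally show ?thesis by (simp add: measure_def)
qed

lemma extinction_bound:
  assumes t: "0 \<le> t" and pos: "0 < measure (Pr \<mu>) {w \<in> space path_space. w t = 0}" and f: "f \<in> bpB"
  shows "(\<integral>x. V t f x \<partial>fm_measure \<mu>) \<le> - ln (measure (Pr \<mu>) {w \<in> space path_space. w t = 0})"
proof -
  interpret prob_space "Q t \<mu>" by (rule prob_Q[OF t])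
  have p: "0 < measure (Q t \<mu>) {0}" using pos by (simp add: measure_coordinate_zero[OF t])
  have "measure (Q t \<mu>) {0} = (\<integral>\<eta>. indicator {0} \<eta> \<partial>Q t \<mu>)" using t by simp
  also have "\<dots> \<le> (\<integral>\<eta>. laplace f \<eta> \<partial>Q t \<mu>)"
  proof (intro integral_mono laplace_integrable t f)
    show "integrable (Q t \<mu>) (indicator {0} :: _ \<Rightarrow> real)"
      using indicator_zero_Q[OF t] by (intro integrable_const_bound[of _ 1]) auto
  qed (auto simp: indicator_def)
  also have "\<dots> = laplace (V t f) \<mu>" by (rule laplace_transition[OF t f])
  finally have "ln (measure (Q t \<mu>) {0}) \<le> ln (laplace (V t f) \<mu>)" using p by (subst ln_le_cancel_iff) (auto simp: laplace_pos)
  then show ?thesis by (simp only: measure_coordinate_zero[OF t] laplace_def ln_exp)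
qed

text \<open>The increasing limit of the cumulants of large constants is the extinction exponent.\<close>

lemma extinction_probability:
  assumes t: "0 < t" and e: "e \<in> bpB" "\<And>n x. V t (\<lambda>_. real n) x \<le> e x" "\<And>x. (\<lambda>n. V t (\<lambda>_. real n) x) \<longlonglongrightarrow> e x"
  shows "emeasure (Q t \<mu>) {0} = ennreal (laplace e \<mu>)"
proof -
  have t0: "0 \<le> t" using t by simp
  interpret prob_space "Q t \<mu>" by (rule prob_Q[OF t0])
  have b: "(\<lambda>_. real n) \<in> (bpB :: ('a \<Rightarrow> real) set)" for n by (intro bpBI[where B="real n"]) auto
  have "(\<lambda>n. \<integral>x. V t (\<lambda>_. real n) x \<partial>fm_measure \<mu>) \<longlonglongrightarrow> (\<integral>x. e x \<partial>fm_measure \<mu>)"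
    using e V_bpB[OF b t0]
    by (intro integral_dominated_convergence[where w=e]) (auto intro: bpB_measurable integrable_fm_bpB simp: bpB_nonneg)
  then have "(\<lambda>n. laplace (V t (\<lambda>_. real n)) \<mu>) \<longlonglongrightarrow> laplace e \<mu>" unfolding laplace_def by (intro tendsto_intros)
  moreover have "(\<lambda>n. \<integral>\<eta>. laplace (\<lambda>_. real n) \<eta> \<partial>Q t \<mu>) \<longlonglongrightarrow> (\<integral>\<eta>. indicator {0} \<eta> \<partial>Q t \<mu>)"
  proof (rule integral_dominated_convergence[where w="\<lambda>_. 1"])
    show "AE \<eta> in Q t \<mu>. (\<lambda>n. laplace (\<lambda>_. real n) \<eta>) \<longlonglongrightarrow> indicator {0} \<eta>"
    proof (rule AE_I2)
      fix \<eta> :: "'a fin_measure"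
      show "(\<lambda>n. laplace (\<lambda>_. real n) \<eta>) \<longlonglongrightarrow> indicator {0} \<eta>"
      proof (cases "\<eta> = 0")
        case False
        define m where "m = measure (fm_measure \<eta>) UNIV"
        have m: "0 < m" using False zero_fin_measure_iff[of \<eta>] measure_nonneg[of "fm_measure \<eta>" UNIV] by (simp add: m_def less_le)
        have eq: "laplace (\<lambda>_. real n) \<eta> = exp (- m) ^ n" for n
          by (simp add: laplace_def m_def exp_of_nat_mult[symmetric] mult.commute)
        have "(\<lambda>n. exp (- m) ^ n) \<longlonglongrightarrow> 0" using m by (intro LIMSEQ_realpow_zero) auto
        then show ?thesis using False by (simp add: eq)
      qed simp
    qed
    show "AE \<eta> in Q t \<mu>. norm (laplace (\<lambda>_. real n) \<eta>) \<le> 1" for n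
      using laplace_le_one[OF b[of n]] by simp
  qed (use t0 in \<open>auto intro: laplace_Q_measurable b indicator_zero_Q \<close>)
  ultimately have "(\<integral>\<eta>. indicator {0} \<eta> \<partial>Q t \<mu>) = laplace e \<mu>"
    by (simp only: laplace_transition[OF t0 b]) (rule LIMSEQ_unique)
  then show ?thesis using t0 by (simp add: emeasure_eq_measure)
qed

text \<open>The Markov property at time \<open>t\<close> expresses the Laplace functional of the conditional law by cumulants.
  Here \<open>e t\<close> is the extinction exponent.\<close>

lemma conditional_laplace:
  assumes t: "0 < t" and r: "0 \<le> r" and f: "f \<in> bpB"
    and e: "\<And>t. 0 < t \<Longrightarrow> e t \<in> bpB" "\<And>t n x. 0 < t \<Longrightarrow> V t (\<lambda>_. real n) x \<le> e t x"
      "\<And>t x. 0 < t \<Longrightarrow> (\<lambda>n. V t (\<lambda>_. real n) x) \<longlonglongrightarrow> e t x"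
    and pos: "0 < (\<integral>x. e (t + r) x \<partial>fm_measure \<mu>)"
    and add: "0 < r \<Longrightarrow> (\<lambda>x. f x + e r x) \<in> bpB"
  shows "prob_space (conditional_law Pr \<mu> t r)" "sets (conditional_law Pr \<mu> t r) = sets borel"
    and "(\<integral>\<eta>. laplace f \<eta> \<partial>conditional_law Pr \<mu> t r)
      = (laplace (V t f) \<mu> - laplace (if r = 0 then e t else V t (\<lambda>x. f x + e r x)) \<mu>) / (1 - laplace (e (t + r)) \<mu>)"
proof -
  interpret prob_space "Pr \<mu>" by (rule prob_law)
  have t0: "0 \<le> t" and tr: "0 \<le> t + r" "0 < t + r" using t r by auto
  define A :: "(real \<Rightarrow> 'a fin_measure) set" where "A = {w \<in> space path_space. w (t + r) \<noteq> 0}"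
  note [measurable] = coordinate_measurable[OF t0, of \<mu>] coordinate_measurable[OF tr(1), of \<mu>] laplace_measurable[OF f]
  have A: "A \<in> sets (Pr \<mu>)"
  proof -
    have "A = (\<lambda>w. w (t + r)) -` (- {0}) \<inter> space (Pr \<mu>)" by (auto simp: A_def)
    also have "\<dots> \<in> sets (Pr \<mu>)" by (rule measurable_sets[OF coordinate_measurable[OF tr(1)]]) (auto intro: borel_comp)
    finally show ?thesis .
  qed
  define a where "a = 1 - laplace (e (t + r)) \<mu>"
  have a: "0 < a" using pos by (simp add: a_def laplace_def)
  have mA: "measure (Pr \<mu>) A = a"
  proof -
    have "measure (Pr \<mu>) (space (Pr \<mu>) - A) = 1 - measure (Pr \<mu>) A" by (rule prob_compl[OF A])
    moreover have "space (Pr \<mu>) - A = {w \<in> space path_space. w (t + r) = 0}" by (auto simp: A_def)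
    moreover have "measure (Q (t + r) \<mu>) {0} = laplace (e (t + r)) \<mu>"
      using extinction_probability[OF tr(2) e(1)[OF tr(2)] e(2)[OF tr(2)] e(3)[OF tr(2)], of \<mu>]
      by (simp add: measure_def)
    ultimately show ?thesis by (simp add: measure_coordinate_zero[OF tr(1)] a_def)
  qed
  have eA: "emeasure (Pr \<mu>) A = ennreal a" by (simp add: emeasure_eq_measure mA)
  let ?U = "uniform_measure (Pr \<mu>) A"
  have CL: "conditional_law Pr \<mu> t r = distr ?U borel (\<lambda>w. w t)"
    by (simp add: conditional_law_def A_def)
  have U: "prob_space ?U" using a by (intro prob_space_uniform_measure) (auto simp: eA)
  have cm: "(\<lambda>w. w t) \<in> ?U \<rightarrow>\<^sub>M borel" by (simp cong: measurable_cong_sets)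
  show "prob_space (conditional_law Pr \<mu> t r)"
    unfolding CL by (rule prob_space.prob_space_distr[OF U cm])
  show "sets (conditional_law Pr \<mu> t r) = sets borel" by (simp add: CL)
  define k where "k = laplace (if r = 0 then e t else V t (\<lambda>x. f x + e r x)) \<mu>"
  have k0: "0 \<le> k" by (simp add: k_def)
  have zero: "(\<integral>\<^sup>+w. ennreal (laplace f (w t)) * indicator {0} (w (t + r)) \<partial>Pr \<mu>) = ennreal k"
  proof -
    have "(\<integral>\<^sup>+w. ennreal (laplace f (w t)) * indicator {0} (w (t + r)) \<partial>Pr \<mu>)
        = (\<integral>\<^sup>+\<eta>. ennreal (laplace f \<eta>) * (\<integral>\<^sup>+\<zeta>. indicator {0} \<zeta> \<partial>Q r \<eta>) \<partial>Q t \<mu>)"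
      by (rule nn_integral_two_coordinates[OF t0 r]) auto
    also have "\<dots> = (\<integral>\<^sup>+\<eta>. ennreal (laplace f \<eta>) * emeasure (Q r \<eta>) {0} \<partial>Q t \<mu>)" using r by simp
    also have "\<dots> = ennreal k"
    proof (cases "r = 0")
      case True
      have "(\<integral>\<^sup>+\<eta>. ennreal (laplace f \<eta>) * emeasure (Q r \<eta>) {0} \<partial>Q t \<mu>) = (\<integral>\<^sup>+\<eta>. indicator {0} \<eta> \<partial>Q t \<mu>)"
        by (intro nn_integral_cong) (auto simp: True P_0 indicator_def)
      also have "\<dots> = emeasure (Q t \<mu>) {0}" using t0 by simp
      finally show ?thesis using extinction_probability[OF t e(1)[OF t] e(2)[OF t] e(3)[OF t], of \<mu>] True by (simp add: k_def)
    next
      case False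
      then have r': "0 < r" using r by simp
      have "(\<integral>\<^sup>+\<eta>. ennreal (laplace f \<eta>) * emeasure (Q r \<eta>) {0} \<partial>Q t \<mu>) = (\<integral>\<^sup>+\<eta>. ennreal (laplace (\<lambda>x. f x + e r x) \<eta>) \<partial>Q t \<mu>)"
        by (intro nn_integral_cong)
          (simp add: extinction_probability[OF r' e(1)[OF r'] e(2)[OF r'] e(3)[OF r']] laplace_add[OF f e(1)[OF r']] ennreal_mult)
      then show ?thesis using nn_laplace_transition[OF t0 add[OF r'], of \<mu>] False by (simp add: k_def)
    qed
    finally show ?thesis .
  qed
  let ?n = "\<integral>\<^sup>+w. ennreal (laplace f (w t)) * indicator A w \<partial>Pr \<mu>"
  have "(\<integral>\<^sup>+w. ennreal (laplace f (w t)) \<partial>Pr \<mu>)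
      = (\<integral>\<^sup>+w. ennreal (laplace f (w t)) * indicator A w + ennreal (laplace f (w t)) * indicator {0} (w (t + r)) \<partial>Pr \<mu>)"
    by (intro nn_integral_cong) (auto simp: indicator_def A_def)
  also have "\<dots> = ?n + (\<integral>\<^sup>+w. ennreal (laplace f (w t)) * indicator {0} (w (t + r)) \<partial>Pr \<mu>)"
    using A by (intro nn_integral_add) auto
  also have "(\<integral>\<^sup>+w. ennreal (laplace f (w t)) \<partial>Pr \<mu>) = ennreal (laplace (V t f) \<mu>)"
    using nn_integral_coordinate[OF t0, of "\<lambda>\<eta>. ennreal (laplace f \<eta>)" \<mu>] nn_laplace_transition[OF t0 f, of \<mu>] by simp
  finally have sum: "ennreal (laplace (V t f) \<mu>) = ?n + ennreal k" by (simp only: zero)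
  have n: "?n = ennreal (laplace (V t f) \<mu> - k)"
  proof -
    have "?n = ennreal (laplace (V t f) \<mu>) - ennreal k" by (simp add: sum)
    then show ?thesis using k0 by (simp add: ennreal_minus)
  qed
  have k: "k \<le> laplace (V t f) \<mu>"
  proof -
    have "ennreal k \<le> ennreal (laplace (V t f) \<mu>)" unfolding sum by simp
    then show ?thesis by simp
  qed
  have "(\<integral>\<^sup>+\<eta>. ennreal (laplace f \<eta>) \<partial>conditional_law Pr \<mu> t r) = (\<integral>\<^sup>+w. ennreal (laplace f (w t)) \<partial>?U)"
    unfolding CL by (rule nn_integral_distr[OF cm]) simp
  also have "\<dots> = ?n / emeasure (Pr \<mu>) A"
    using A by (subst nn_integral_uniform_measure) auto
  also have "\<dots> = ennreal ((laplace (V t f) \<mu> - k) / a)" using a k by (simp only: n eA) (simp add: divide_ennreal)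
  finally have nn: "(\<integral>\<^sup>+\<eta>. ennreal (laplace f \<eta>) \<partial>conditional_law Pr \<mu> t r) = ennreal ((laplace (V t f) \<mu> - k) / a)" .
  have "(\<integral>\<eta>. laplace f \<eta> \<partial>conditional_law Pr \<mu> t r) = enn2real (\<integral>\<^sup>+\<eta>. ennreal (laplace f \<eta>) \<partial>conditional_law Pr \<mu> t r)"
    by (intro integral_eq_nn_integral) (auto simp: CL)
  also have "\<dots> = (laplace (V t f) \<mu> - k) / a" using a k by (simp add: nn)
  finally show "(\<integral>\<eta>. laplace f \<eta> \<partial>conditional_law Pr \<mu> t r)
      = (laplace (V t f) \<mu> - laplace (if r = 0 then e t else V t (\<lambda>x. f x + e r x)) \<mu>) / (1 - laplace (e (t + r)) \<mu>)"
    by (simp only: a_def k_def)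
qed

end

theorem theorem1p1:
  fixes P :: "real \<Rightarrow> 'e::polish_space \<Rightarrow> 'e measure"
    and M :: "'w measure"
    and law :: "'e \<Rightarrow> 'w measure"
    and \<xi> :: "real \<Rightarrow> 'w \<Rightarrow> 'e"
    and \<zeta> :: "'w \<Rightarrow> ereal"
    and \<beta> \<sigma> \<phi> :: "'e \<Rightarrow> real"
    and \<pi> :: "'e \<Rightarrow> real measure"
    and V :: "real \<Rightarrow> ('e \<Rightarrow> real) \<Rightarrow> 'e \<Rightarrow> real"
    and Q :: "real \<Rightarrow> 'e fin_measure \<Rightarrow> 'e fin_measure measure"
    and Pr :: "'e fin_measure \<Rightarrow> (real \<Rightarrow> 'e fin_measure) measure"
    and lam :: real
    and \<nu> :: "'e fin_measure"
    and H :: "real \<Rightarrow> ('e \<Rightarrow> real) \<Rightarrow> 'e \<Rightarrow> real"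
  defines "T \<equiv> mean_semigroup law \<xi> \<zeta> \<beta>"
  assumes right_process: "borel_right_process P M law \<xi> \<zeta>"
    and branching: "\<beta> \<in> bB" "\<sigma> \<in> bB" "branching_kernel \<pi>"
    and cumulant: "\<And>f. f \<in> bpB \<Longrightarrow>
          cumulant_solution P (branching_mechanism \<beta> \<sigma> \<pi>) f (\<lambda>t. V t f)"
    and X: "superprocess Q Pr V"
    and phi: "\<phi> \<in> bB" "\<And>x. 0 < \<phi> x"
    and nu: "prob_space (fm_measure \<nu>)"
      "\<And>U. open U \<Longrightarrow> U \<noteq> {} \<Longrightarrow> 0 < emeasure (fm_measure \<nu>) U"
    and nu_phi: "(\<integral>x. \<phi> x \<partial>fm_measure \<nu>) = 1"
    and eigenfunction: "\<And>t x. 0 \<le> t \<Longrightarrow> T t \<phi> x = ennreal (exp (lam * t) * \<phi> x)"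
    and eigenmeasure: "\<And>t A. 0 \<le> t \<Longrightarrow> A \<in> sets borel \<Longrightarrow>
          (\<integral>\<^sup>+x. T t (indicator A) x \<partial>fm_measure \<nu>)
            = ennreal (exp (lam * t)) * emeasure (fm_measure \<nu>) A"
    and H_eq: "\<And>t x f. 0 < t \<Longrightarrow> f \<in> L1_plus (fm_measure \<nu>) \<Longrightarrow>
          T t f x < \<infinity> \<and>
          enn2real (T t f x)
            = exp (lam * t) * \<phi> x * (\<integral>y. f y \<partial>fm_measure \<nu>) * (1 + H t f x)"
    and H_bounded: "\<And>t. 0 < t \<Longrightarrow>
          bdd_above ((\<lambda>(x, f). \<bar>H t f x\<bar>) ` (UNIV \<times> L1_plus (fm_measure \<nu>)))"
    and H_limit:
          "((\<lambda>t. SUP (x, f) \<in> UNIV \<times> L1_plus (fm_measure \<nu>). \<bar>H t f x\<bar>) \<longlongrightarrow> 0) at_top"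
    and subcritical: "lam < 0"
    and extinction: "\<And>t. 0 < t \<Longrightarrow> 0 < measure (Pr \<nu>) {w \<in> space (Pr \<nu>). w t = 0}"
  shows "\<forall>r\<ge>0. \<exists>Q_inf :: 'e fin_measure measure.
           prob_space Q_inf \<and> sets Q_inf = sets borel \<and>
           (\<forall>\<mu>. \<mu> \<noteq> 0 \<longrightarrow>
              converges_weakly (\<lambda>t. conditional_law Pr \<mu> t r) Q_inf at_top)"
proof -
  obtain b0 where b0: "\<And>x. \<bar>\<beta> x\<bar> \<le> b0" using branching(1) by (auto simp: bB_def bounded_iff)
  interpret C: cumulant_process P M law \<xi> \<zeta> \<beta> \<sigma> b0 \<pi> V
  proof (intro cumulant_process.intro feynman_kac.intro polish_right_process.intro feynman_kac_axioms.intro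
      branching.intro cumulant_process_axioms.intro)
    show "\<beta> \<in> borel_measurable borel" using branching(1) by (simp add: bB_def)
  qed (fact right_process branching b0 cumulant)+
  interpret X: polish_superprocess Q Pr V
    by (intro polish_superprocess.intro polish_superprocess_axioms.intro X C.V_bpB)
  define h where "h t = (SUP (x, f) \<in> UNIV \<times> L1_plus (fm_measure \<nu>). \<bar>H t f x\<bar>)" for t
  have \<phi>: "\<phi> \<in> bpB" using phi by (auto simp: bpB_def intro: less_imp_le)
  have L1: "f \<in> L1_plus (fm_measure \<nu>)" if "f \<in> bpB" for f
    using integrable_fm_bpB[OF that, of \<nu>] bpB_nonneg[OF that] bpB_measurable[OF that]
    by (auto simp: L1_plus_def nn_integral_eq_integral)
  have H_le: "\<bar>H t f x\<bar> \<le> h t" if "0 < t" "f \<in> bpB" for t f x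
    unfolding h_def using cSUP_upper[OF _ H_bounded[OF that(1)], of "(x, f)"] L1[OF that(2)] by simp
  have fk: "C.FK t f x = exp (lam * t) * \<phi> x * (\<integral>y. f y \<partial>fm_measure \<nu>) * (1 + H t f x)"
    if "0 < t" "f \<in> bpB" for t f x
    using H_eq[OF that(1) L1[OF that(2)], of x] C.mean_semigroup_eq[of t f x] C.fk_semigroup_nonneg[of f t x]
      bpB_nonneg[OF that(2)] that unfolding T_def by simp
  interpret A: extinguishing_cumulants P M law \<xi> \<zeta> \<beta> \<sigma> b0 \<pi> V \<phi> \<nu> lam h
  proof (intro extinguishing_cumulants.intro ergodic_cumulants.intro ergodic_cumulants_axioms.intro
      extinguishing_cumulants_axioms.intro)
    show "cumulant_process P M law \<xi> \<zeta> \<beta> \<sigma> b0 \<pi> V" by (rule C.cumulant_process_axioms)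
    show "C.FK t \<phi> x = exp (lam * t) * \<phi> x" if "0 \<le> t" for t x
      using eigenfunction[OF that, of x] C.mean_semigroup_eq[OF that \<phi>, of x]
        C.fk_semigroup_nonneg[of \<phi> t x] bpB_nonneg[OF \<phi>] unfolding T_def by simp
    show "(\<integral>x. C.FK t f x \<partial>fm_measure \<nu>) = exp (lam * t) * (\<integral>x. f x \<partial>fm_measure \<nu>)"
      if t: "0 \<le> t" and f: "f \<in> bpB" for t f
    proof (rule C.fk_eigenmeasure[OF t _ _ f])
      fix A :: "'e set" assume A: "A \<in> sets borel"
      have "(indicator A :: 'e \<Rightarrow> real) \<in> bpB" using A by (intro bpBI[where B=1]) (auto simp: indicator_def)
      then show "(\<integral>\<^sup>+x. ennreal (C.FK t (indicator A) x) \<partial>fm_measure \<nu>) = ennreal (exp (lam * t)) * emeasure (fm_measure \<nu>) A"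
        using eigenmeasure[OF t A] C.mean_semigroup_eq[OF t] unfolding T_def by simp
    qed simp
    show "\<bar>C.FK t f x - exp (lam * t) * \<phi> x * (\<integral>x. f x \<partial>fm_measure \<nu>)\<bar>
        \<le> exp (lam * t) * \<phi> x * (\<integral>x. f x \<partial>fm_measure \<nu>) * h t" if t: "0 < t" and f: "f \<in> bpB" for t f x
    proof -
      define c where "c = exp (lam * t) * \<phi> x * (\<integral>x. f x \<partial>fm_measure \<nu>)"
      have c: "0 \<le> c" using bpB_nonneg[OF \<phi>] bpB_nonneg[OF f] by (simp add: c_def bochner_nonneg)
      have "C.FK t f x - c = c * H t f x" by (simp add: fk[OF t f] c_def distrib_left)
      then have "\<bar>C.FK t f x - c\<bar> \<le> c * h t"
        using mult_left_mono[OF H_le[OF t f, of x] c] c by (simp add: abs_mult)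
      then show ?thesis by (simp add: c_def)
    qed
    show "0 \<le> h t" if "0 < t" for t using H_le[OF that \<phi>, of undefined] by linarith
    show "(h \<longlongrightarrow> 0) at_top" using H_limit by (simp add: h_def[abs_def])
    show "\<exists>K. \<forall>f\<in>bpB. (\<integral>x. V t f x \<partial>fm_measure \<nu>) \<le> K" if "0 < t" for t
      using X.extinction_bound[of t \<nu>] extinction[OF that] that by auto
    show "c * V t f x \<le> V t (\<lambda>x. c * f x) x" if f: "f \<in> bpB" and t: "0 \<le> t" and c: "0 \<le> c" "c \<le> 1" for f t c x
    proof (rule X.V_concave[OF f _ t c])
      obtain B where "\<And>x. f x \<le> B" using bpB_boundE[OF f] by metis
      then show "(\<lambda>x. c * f x) \<in> bpB" using c bpB_nonneg[OF f] bpB_measurable[OF f]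
        by (intro bpBI[where B="c * B"]) (auto intro: mult_left_mono)
    qed
  qed (fact \<phi> phi(2) nu(1) nu_phi subcritical X.V_flow X.V_mono X.V_continuous)+
  have \<nu>0: "\<nu> \<noteq> 0"
  proof
    assume "\<nu> = 0"
    then show False using prob_space.emeasure_space_1[OF nu(1)] by simp
  qed
  show ?thesis
  proof (intro allI impI)
    fix r :: real assume r: "0 \<le> r"
    have cond: "prob_space (conditional_law Pr \<mu> t r)" "sets (conditional_law Pr \<mu> t r) = sets borel"
      "f \<in> bpB \<Longrightarrow> (\<integral>\<eta>. laplace f \<eta> \<partial>conditional_law Pr \<mu> t r)
        = (laplace (V t f) \<mu> - laplace (A.killed_cumulant r t f) \<mu>)
          / (1 - laplace (A.ext (t + r)) \<mu>)"
      if t: "0 < t" and pos: "0 < (\<integral>x. A.ext (t + r) x \<partial>fm_measure \<mu>)" for \<mu> t f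
    proof -
      note L = X.conditional_laplace[OF t r _ A.ext_bpB A.V_const_le_ext A.V_const_tendsto pos A.add_ext_bpB]
      show "prob_space (conditional_law Pr \<mu> t r)" "sets (conditional_law Pr \<mu> t r) = sets borel"
        by (rule L(1,2)[OF A.const_bpB[OF order_refl] _ _ _ A.const_bpB[OF order_refl]]; assumption)+
      show "(\<integral>\<eta>. laplace f \<eta> \<partial>conditional_law Pr \<mu> t r)
        = (laplace (V t f) \<mu> - laplace (A.killed_cumulant r t f) \<mu>)
          / (1 - laplace (A.ext (t + r)) \<mu>)" if f: "f \<in> bpB"
        using L(3)[OF f _ _ _ f] by (simp add: A.killed_cumulant_def)
    qed
    have shift: "filterlim (\<lambda>t. t + r) at_top at_top" by real_asymp
    have pos: "\<forall>\<^sub>F t in at_top. 0 < t \<and> 0 < (\<integral>x. A.ext (t + r) x \<partial>fm_measure \<mu>)" if "\<mu> \<noteq> 0" for \<mu>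
      using eventually_compose_filterlim[OF A.ext_integral_pos[OF that] shift] eventually_gt_at_top[of 0]
      by eventually_elim simp
    have lim: "((\<lambda>t. \<integral>\<eta>. laplace f \<eta> \<partial>conditional_law Pr \<mu> t r) \<longlongrightarrow> A.limit_laplace r f) at_top"
      if "\<mu> \<noteq> 0" "f \<in> bpB" for \<mu> f
      by (rule Lim_transform_eventually[OF A.conditional_limit[OF that r]])
        (use pos[OF that(1)] in \<open>eventually_elim; simp add: cond(3) that(2)\<close>)
    have \<nu>_pos: "0 < (\<integral>x. A.ext (real (Suc n) + r) x \<partial>fm_measure \<nu>)" for n
      using r by (intro A.mean_ext_pos) simp
    have seq: "filterlim (\<lambda>n. real (Suc n)) at_top sequentially"
      by (rule filterlim_compose[OF filterlim_real_sequentially filterlim_Suc])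
    obtain Q_inf :: "'e fin_measure measure" where Q_inf: "prob_space Q_inf" "sets Q_inf = sets borel"
      "\<And>N :: real \<Rightarrow> 'e fin_measure measure.
        eventually (\<lambda>t. prob_space (N t) \<and> sets (N t) = sets borel) at_top \<Longrightarrow>
        (\<And>f. f \<in> bpB \<Longrightarrow> ((\<lambda>t. \<integral>\<eta>. laplace f \<eta> \<partial>N t) \<longlongrightarrow> A.limit_laplace r f) at_top) \<Longrightarrow>
        converges_weakly N Q_inf at_top"
    proof (rule fm_laplace_weak_convergence[of \<nu> "A.limit_laplace r" "\<lambda>n. conditional_law Pr \<nu> (real (Suc n)) r"])
      show "\<exists>d>0. \<forall>f\<in>bpB. (\<forall>x. f x \<le> 1) \<longrightarrow> (\<integral>x. f x \<partial>fm_measure \<nu>) < d \<longrightarrow> 1 - A.limit_laplace r f < e" if "0 < e" for e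
        using A.limit_laplace_small[OF r that] by blast
      show "prob_space (conditional_law Pr \<nu> (real (Suc n)) r)" "sets (conditional_law Pr \<nu> (real (Suc n)) r) = sets borel" for n
        using cond(1,2)[OF _ \<nu>_pos] by simp_all
      show "(\<lambda>n. \<integral>\<eta>. laplace f \<eta> \<partial>conditional_law Pr \<nu> (real (Suc n)) r) \<longlonglongrightarrow> A.limit_laplace r f"
        if "f \<in> bpB" for f
        by (rule filterlim_compose[OF lim[OF \<nu>0 that] seq])
    next
      fix Q' :: "'e fin_measure measure"
      assume "prob_space Q'" "sets Q' = sets borel"
        and "\<And>N :: real \<Rightarrow> 'e fin_measure measure.
          eventually (\<lambda>t. prob_space (N t) \<and> sets (N t) = sets borel) at_top \<Longrightarrow>
          (\<And>f. f \<in> bpB \<Longrightarrow> ((\<lambda>t. \<integral>\<eta>. laplace f \<eta> \<partial>N t) \<longlongrightarrow> A.limit_laplace r f) at_top) \<Longrightarrow>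
          converges_weakly N Q' at_top"
      then show thesis by (rule that)
    qed
    show "\<exists>Q_inf :: 'e fin_measure measure. prob_space Q_inf \<and> sets Q_inf = sets borel \<and>
      (\<forall>\<mu>. \<mu> \<noteq> 0 \<longrightarrow> converges_weakly (\<lambda>t. conditional_law Pr \<mu> t r) Q_inf at_top)"
    proof (intro exI[of _ Q_inf] conjI allI impI Q_inf)
      fix \<mu> :: "'e fin_measure" assume \<mu>: "\<mu> \<noteq> 0"
      show "\<forall>\<^sub>F t in at_top. prob_space (conditional_law Pr \<mu> t r) \<and> sets (conditional_law Pr \<mu> t r) = sets borel"
        using pos[OF \<mu>] by eventually_elim (use cond in auto)
      show "((\<lambda>t. \<integral>\<eta>. laplace f \<eta> \<partial>conditional_law Pr \<mu> t r) \<longlongrightarrow> A.limit_laplace r f) at_top"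
        if "f \<in> bpB" for f by (rule lim[OF \<mu> that])
    qed
  qed
qed

end
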